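(* Let $E$ be a compact Polish space, $\alpha$ a probability measure on $E$, and $\Phi:E\times E\to\mathbb{R}$ a bounded measurable pair interaction potential. Let $(w_i)_{i\in\mathbb{N}}$ be weights in $E'=(0,\infty)$ such that: (i) there is a random variable $W$ with values in $(0,\infty)$ and law $P$ such that $\frac1N\sum_{i=1}^N\delta_{w_i}$ converges weakly to $P$ as $N\to\infty$; and (ii) the weights have strongly finite mean, i.e. for some $\varepsilon>0$, $\sup_{N\in\mathbb{N}}\frac1N\sum_{i=1}^N w_i^{1+\varepsilon}<\infty$. Then $$\lim_{N\to\infty}\frac1N\log\int\alpha^{\otimes N}(d\sigma)\exp\Bigl(N\bigl(L_N^{(\sigma,w)}\otimes L_N^{(\sigma,w)}\bigr)(U)\Bigr)=\sup_{\nu\in\mathcal{M}_1(E\times E'):\ \nu(dw)=P(dw)}\Bigl(\nu\otimes\nu(U)-\int P(dw)\,S(\nu^w\mid\alpha)\Bigr)<\infty,$$ where $U(\sigma,\sigma',w,w')=\frac{ww'}{2\,\mathbb{E}[W]}e^{\Phi(\sigma,\sigma')}$.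
   Context: $L_N^{(\sigma,w)}=\frac1N\sum_{i=1}^N\delta_{(\sigma_i,w_i)}$ and $(L_N^{(\sigma,w)}\otimes L_N^{(\sigma,w)})(U)=\frac1{N^2}\sum_{i,j=1}^N U(\sigma_i,\sigma_j,w_i,w_j)$. $\mathcal{M}_1(X)$ denotes the set of Borel probability measures on $X$. For $\nu\in\mathcal{M}_1(E\times E')$, $\nu(dw)$ denotes its marginal on the weight space $E'$, and $\nu^w$ denotes the conditional distribution of $\sigma$ given weight $w$ under $\nu$. $\nu\otimes\nu(U)=\int\int U(\sigma,\sigma',w,w')\,\nu(d\sigma,dw)\,\nu(d\sigma',dw')$. $S(\rho\mid\alpha)=\int\rho(d\sigma)\log\frac{d\rho}{d\alpha}(\sigma)$ is the relative entropy ($+\infty$ if $\rho$ is not absolutely continuous with respect to $\alpha$). *)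

theory Defs
  imports "HOL-Probability.Probability"
begin

text \<open>The weight space \<open>E' = (0,\<infinity>)\<close> with its Borel sets.\<close>

definition weight_space :: "real measure" where
  "weight_space = restrict_space borel {0<..}"

text \<open>\<open>empirical X N x\<close> is \<open>N\<^sup>-\<^sup>1 \<Sum>\<^bsub>i=1..N\<^esub> \<delta>\<^bsub>x i\<^esub>\<close> as a measure on \<open>X\<close>, written
  as the image of the uniform distribution on \<open>{1..N}\<close>.\<close>

definition empirical :: "'c measure \<Rightarrow> nat \<Rightarrow> (nat \<Rightarrow> 'c) \<Rightarrow> 'c measure" where
  "empirical X N x = distr (uniform_count_measure {1..N}) X x"

text \<open>Weak convergence against bounded continuous test functions on the subspace \<open>S\<close>. The
  library's \<open>weak_conv_m\<close> goes through distribution functions of measures on the whole real line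
  and is not meaningful for measures on \<^const>\<open>weight_space\<close>.\<close>

definition weakly_converges_on ::
    "'c::topological_space set \<Rightarrow> (nat \<Rightarrow> 'c measure) \<Rightarrow> 'c measure \<Rightarrow> bool" where
  "weakly_converges_on S \<mu> P \<longleftrightarrow>
     (\<forall>f :: 'c \<Rightarrow> real. continuous_on S f \<longrightarrow> bounded (f ` S) \<longrightarrow>
        (\<lambda>N. integral\<^sup>L (\<mu> N) f) \<longlonglongrightarrow> integral\<^sup>L P f)"

definition pair_functional ::
    "('a \<times> real) measure \<Rightarrow> ('a \<Rightarrow> 'a \<Rightarrow> real \<Rightarrow> real \<Rightarrow> real) \<Rightarrow> real" where
  "pair_functional \<nu> U = (\<integral>x. (\<integral>y. U (fst x) (fst y) (snd x) (snd y) \<partial>\<nu>) \<partial>\<nu>)"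

definition empirical_pair ::
    "nat \<Rightarrow> (nat \<Rightarrow> 'a::topological_space) \<Rightarrow> (nat \<Rightarrow> real) \<Rightarrow> ('a \<times> real) measure" where
  "empirical_pair N \<sigma> w = empirical (borel \<Otimes>\<^sub>M weight_space) N (\<lambda>i. (\<sigma> i, w i))"

definition interaction ::
    "('a \<Rightarrow> 'a \<Rightarrow> real) \<Rightarrow> real \<Rightarrow> 'a \<Rightarrow> 'a \<Rightarrow> real \<Rightarrow> real \<Rightarrow> real" where
  "interaction \<Phi> m \<sigma> \<sigma>' w w' = w * w' / (2 * m) * exp (\<Phi> \<sigma> \<sigma>')"

definition is_cond_spin ::
    "('a::topological_space \<times> real) measure \<Rightarrow> (real \<Rightarrow> 'a measure) \<Rightarrow> bool" where
  "is_cond_spin \<nu> K \<longleftrightarrow>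
     K \<in> weight_space \<rightarrow>\<^sub>M prob_algebra borel \<and>
     (\<forall>A \<in> sets borel. \<forall>B \<in> sets weight_space.
        emeasure \<nu> (A \<times> B) = (\<integral>\<^sup>+w\<in>B. emeasure (K w) A \<partial>(distr \<nu> weight_space snd)))"

text \<open>\<open>cond_spin \<nu> w\<close> is \<open>\<nu>\<^sup>w\<close>. For probability measures with Polish spin space a regular
  conditional distribution exists, and any two versions agree for almost every weight, so the
  choice of version does not affect integrals against the weight marginal.\<close>

definition cond_spin :: "('a::topological_space \<times> real) measure \<Rightarrow> real \<Rightarrow> 'a measure" where
  "cond_spin \<nu> = (SOME K. is_cond_spin \<nu> K)"

text \<open>For \<open>\<rho> \<lless> \<alpha>\<close> the negative part of \<open>log (d\<rho>/d\<alpha>)\<close> is always \<open>\<rho>\<close>-integrable, so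
  failure of integrability means that the integral is \<open>+\<infinity>\<close>; \<^const>\<open>KL_divergence\<close>, being
  real-valued, would give \<open>0\<close> in that case. Note the argument order of \<^const>\<open>KL_divergence\<close>:
  the reference measure comes first.\<close>

definition relative_entropy :: "'a measure \<Rightarrow> 'a measure \<Rightarrow> ereal" where
  "relative_entropy \<rho> \<alpha> =
     (if absolutely_continuous \<alpha> \<rho> \<and> integrable \<rho> (entropy_density (exp 1) \<alpha> \<rho>)
      then ereal (KL_divergence (exp 1) \<alpha> \<rho>) else \<infinity>)"

text \<open>The entropy integral is that of a nonnegative function, with value in \<open>[0,\<infinity>]\<close>;
  \<^const>\<open>e2ennreal\<close> loses nothing because relative entropies of probability measures are
  nonnegative.\<close>

definition rate_value ::
    "'a::topological_space measure \<Rightarrow> real measure \<Rightarrow> ('a \<Rightarrow> 'a \<Rightarrow> real \<Rightarrow> real \<Rightarrow> real)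
      \<Rightarrow> ('a \<times> real) measure \<Rightarrow> ereal" where
  "rate_value \<alpha> P U \<nu> =
     ereal (pair_functional \<nu> U) -
     enn2ereal (\<integral>\<^sup>+w. e2ennreal (relative_entropy (cond_spin \<nu> w) \<alpha>) \<partial>P)"

lemma pair_functional_empirical_pair:
  fixes U :: "'a::topological_space \<Rightarrow> 'a \<Rightarrow> real \<Rightarrow> real \<Rightarrow> real"
  assumes w: "\<And>i. i \<ge> 1 \<Longrightarrow> w i > 0"
    and U: "(\<lambda>((s, w), (s', w')). U s s' w w') \<in> borel_measurable
              ((borel \<Otimes>\<^sub>M weight_space) \<Otimes>\<^sub>M (borel \<Otimes>\<^sub>M weight_space))"
  shows "pair_functional (empirical_pair N \<sigma> w) U
           = (\<Sum>i=1..N. \<Sum>j=1..N. U (\<sigma> i) (\<sigma> j) (w i) (w j)) / (real N)\<^sup>2"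
proof -
  let ?X = "borel \<Otimes>\<^sub>M weight_space :: ('a \<times> real) measure"
  let ?p = "\<lambda>i. (\<sigma> i, w i)"
  have p: "?p i \<in> space ?X" if "i \<in> {1..N}" for i
    using w[of i] that by (auto simp: space_pair_measure weight_space_def space_restrict_space)
  then have pm: "?p \<in> uniform_count_measure {1..N} \<rightarrow>\<^sub>M ?X"
    by (auto simp: measurable_def space_uniform_count_measure sets_uniform_count_measure)
  have V: "(\<lambda>(x, y). U (fst x) (fst y) (snd x) (snd y)) \<in> borel_measurable (?X \<Otimes>\<^sub>M ?X)"
    using U by (simp add: case_prod_beta')
  have E: "integral\<^sup>L (empirical ?X N ?p) f = (\<Sum>i=1..N. f (?p i)) / real N"
    if "f \<in> borel_measurable ?X" for f :: "_ \<Rightarrow> real"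
    unfolding empirical_def
    by (subst integral_distr[OF pm that]) (simp add: integral_uniform_count_measure)
  have in1: "(\<integral>y. U (fst x) (fst y) (snd x) (snd y) \<partial>empirical ?X N ?p)
      = (\<Sum>j=1..N. U (fst x) (\<sigma> j) (snd x) (w j)) / real N" if "x \<in> space ?X" for x
    using measurable_compose[OF measurable_Pair1'[OF that] V] by (subst E) auto
  have m2: "(\<lambda>x. U (fst x) (\<sigma> j) (snd x) (w j)) \<in> borel_measurable ?X" if "j \<in> {1..N}" for j
    using measurable_compose[OF measurable_Pair2'[OF p[OF that]] V] by simp
  have "pair_functional (empirical_pair N \<sigma> w) U
      = (\<integral>x. (\<Sum>j=1..N. U (fst x) (\<sigma> j) (snd x) (w j)) / real N \<partial>empirical ?X N ?p)"
    unfolding pair_functional_def empirical_pair_def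
    by (rule Bochner_Integration.integral_cong[OF refl], rule in1) (simp add: empirical_def)
  also have "\<dots> = (\<Sum>i=1..N. (\<Sum>j=1..N. U (\<sigma> i) (\<sigma> j) (w i) (w j)) / real N) / real N"
    using m2 by (subst E) auto
  finally show ?thesis
    by (simp add: sum_divide_distrib power2_eq_square)
qed

end

theory Submission
  imports Defs
begin

text \<open>The integral is bounded from below by the Gibbs variational principle, with product trial
  densities whose factors depend only on a bin of the weight. The factors are close in total
  variation to the kernels of a given \<open>\<nu>\<close> with finite entropy, and by the Donsker--Varadhan bound
  they cost no more entropy than \<open>\<nu>\<close>. For the upper bound, \<open>exp \<Phi>\<close> is replaced by its conditional
  expectation on a finite grid, which is exponentially good because the difference is small in
  \<open>L\<^sup>1(\<alpha> \<otimes> \<alpha>)\<close> and bounded. The grid energy depends only on the counts of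
  (bin, cell) pairs. There are polynomially many such types, and the density that is constant on
  the cells with the proportions of a type defines an admissible measure whose energy and
  entropy match the contribution of that type.\<close>

section \<open>Conditional distributions on Polish spaces\<close>

text \<open>The potential is only measurable and the weights are unbounded, so the energy is not a
  weakly continuous functional of the empirical measure, and Sanov's theorem with Varadhan's lemma
  does not apply to it directly. The moment bound gives uniform integrability, which allows all
  weights to be rounded down to finitely many values at an arbitrarily small cost per site; after
  that only the limiting bin frequencies matter. On the spin side a grid function need not be
  uniformly close to \<open>G\<close>, so the error may be of order \<open>N\<close> on some
  configurations, and the probability of these has to be beaten down exponentially. Averaging over
  cells, rather than any other approximation in mean, gives cell-constant densities exactly the same
  energy under \<open>G\<close> and under its grid version, so a type and its admissible measure are
  compared without a further error. The functional is defined through one chosen version of the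
  conditional law: its existence gives the entropy inequality for general \<open>\<nu>\<close>, and
  almost sure uniqueness allows the entropy to be evaluated for explicit densities.\<close>

lemma ternary_expansion:
  fixes b :: "nat \<Rightarrow> bool"
  defines "s \<equiv> \<lambda>b. \<Sum>n. of_bool (b n) * (2 / 3 ^ Suc n) :: real"
  shows summable_ternary: "summable (\<lambda>n. of_bool (b n) * (2 / 3 ^ Suc n) :: real)"
    and ternary_step: "s b = of_bool (b 0) * (2 / 3) + s (\<lambda>n. b (Suc n)) / 3"
    and ternary_bounds: "0 \<le> s b" "s b \<le> 1"
proof -
  have g: "summable (\<lambda>n. 2 / 3 ^ Suc n :: real)"
    using summable_mult[OF summable_geometric[of "1/3::real"], of "2/3"] by (simp add: power_one_over)
  show S: "summable (\<lambda>n. of_bool (b n) * (2 / 3 ^ Suc n) :: real)" for b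
    by (rule summable_comparison_test'[OF g, of 0]) simp
  show "s b = of_bool (b 0) * (2 / 3) + s (\<lambda>n. b (Suc n)) / 3"
    unfolding s_def using suminf_split_head[OF S[of b]] suminf_divide[OF S[of "\<lambda>n. b (Suc n)"], of 3]
    by (simp add: mult_ac)
  show "0 \<le> s b"
    unfolding s_def by (rule suminf_nonneg[OF S]) simp
  have "s b \<le> (\<Sum>n. 2 / 3 ^ Suc n)"
    unfolding s_def by (rule suminf_le[OF _ S g]) simp
  also have "\<dots> = 1"
    using suminf_mult[OF summable_geometric[of "1/3::real"], of "2/3"] suminf_geometric[of "1/3::real"]
    by (simp add: power_one_over)
  finally show "s b \<le> 1" .
qed

text \<open>The shift on the Cantor set: each step drops the leading digit. Expansions with digits 0
  and 2 lie in [0, 1/3] or [2/3, 1] according to that digit, so the test against 1/2 reads it off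
  without the ambiguity of binary expansions, and every step is a Borel function.\<close>

primrec ternary_rem :: "nat \<Rightarrow> real \<Rightarrow> real" where
  "ternary_rem 0 x = x"
| "ternary_rem (Suc n) x = 3 * ternary_rem n x - (if ternary_rem n x > 1/2 then 2 else 0)"

lemma measurable_ternary_rem [measurable]: "ternary_rem n \<in> borel_measurable borel"
  by (induction n) auto

lemma ternary_rem_expansion:
  "ternary_rem n (\<Sum>n. of_bool (b n) * (2 / 3 ^ Suc n)) = (\<Sum>k. of_bool (b (k + n)) * (2 / 3 ^ Suc k))"
proof (induction n)
  case (Suc n)
  define r where "r = ternary_rem n (\<Sum>n. of_bool (b n) * (2 / 3 ^ Suc n))"
  have "r = of_bool (b n) * (2 / 3) + (\<Sum>k. of_bool (b (Suc k + n)) * (2 / 3 ^ Suc k)) / 3"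
    unfolding r_def Suc.IH using ternary_step[of "\<lambda>k. b (k + n)"] by simp
  moreover note ternary_bounds[of "\<lambda>k. b (Suc k + n)"]
  ultimately have "3 * r - (if r > 1/2 then 2 else 0) = (\<Sum>k. of_bool (b (Suc k + n)) * (2 / 3 ^ Suc k))"
    by (cases "b n") auto
  then show ?case by (simp add: r_def)
qed simp

lemma ternary_rem_gt_half:
  "ternary_rem n (\<Sum>n. of_bool (b n) * (2 / 3 ^ Suc n)) > 1 / 2 \<longleftrightarrow> b n"
  unfolding ternary_rem_expansion
  using ternary_step[of "\<lambda>k. b (k + n)"] ternary_bounds[of "\<lambda>k. b (Suc k + n)"]
  by auto

text \<open>Code \<open>x\<close> by the truth values of \<open>dist x (d j) < 2\<^bsup>-i\<^esup>\<close> for a dense sequence \<open>d\<close>; the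
  point is recovered as a limit of the \<open>d j\<close> selected by the code.\<close>

lemma polish_borel_retract_of_real:
  obtains s :: "'a::polish_space \<Rightarrow> real" and g :: "real \<Rightarrow> 'a"
  where "s \<in> borel_measurable borel" "g \<in> borel_measurable borel" "\<And>x. g (s x) = x"
    "\<And>x. 0 \<le> s x" "\<And>x. s x \<le> 1"
proof -
  obtain D :: "'a set" where D: "countable D" "\<And>X. open X \<Longrightarrow> X \<noteq> {} \<Longrightarrow> \<exists>d\<in>D. d \<in> X"
    using countable_dense_exists by metis
  define d where "d = from_nat_into D"
  have "D \<noteq> {}" using D(2)[of UNIV] by auto
  then have dd: "\<exists>j. dist x (d j) < e" if "e > 0" for x e
    using D(2)[of "ball x e"] that D(1) unfolding d_def
    by (metis centre_in_ball empty_iff from_nat_into_surj mem_ball open_ball)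
  define b where "b x n = (case prod_decode n of (i, j) \<Rightarrow> dist x (d j) < 1 / 2 ^ i)" for x n
  define s where "s x = (\<Sum>n. of_bool (b x n) * (2 / 3 ^ Suc n) :: real)" for x
  define f where "f i r = d (LEAST j. ternary_rem (prod_encode (i, j)) r > 1 / 2)" for i r
  \<comment> \<open>Off the range of \<open>s\<close> the selected points need not converge; the
    default \<open>d 0\<close> makes \<open>g\<close> total, and the set of \<open>r\<close> with a
    Cauchy sequence is measurable.\<close>
  define g where "g r = (if Cauchy (\<lambda>i. f i r) then lim (\<lambda>i. f i r) else d 0)" for r
  have [measurable]: "Measurable.pred borel (\<lambda>x. b x n)" for n
    unfolding b_def by (cases "prod_decode n") simp
  have s: "s \<in> borel_measurable borel"
    unfolding s_def by measurable
  have fm [measurable]: "f i \<in> borel_measurable borel" for i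
    unfolding f_def by measurable
  have [measurable]: "Measurable.pred borel (\<lambda>r. Cauchy (\<lambda>i. f i r))"
    using sets_Collect_Cauchy[of f borel, OF fm] by simp
  have g: "g \<in> borel_measurable borel"
  proof (rule borel_measurable_LIMSEQ_metric)
    show "(\<lambda>r. if Cauchy (\<lambda>i. f i r) then f i r else d 0) \<in> borel_measurable borel" for i
      by measurable
    show "(\<lambda>i. if Cauchy (\<lambda>i. f i r) then f i r else d 0) \<longlonglongrightarrow> g r" for r
      unfolding g_def using Cauchy_convergent_iff convergent_LIMSEQ_iff by auto
  qed
  have "g (s x) = x" for x
  proof -
    have bit: "ternary_rem (prod_encode (i, j)) (s x) > 1 / 2 \<longleftrightarrow> dist x (d j) < 1 / 2 ^ i" for i j
      unfolding s_def ternary_rem_gt_half by (simp add: b_def)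
    have fx: "dist x (f i (s x)) < 1 / 2 ^ i" for i
      unfolding f_def bit by (rule LeastI_ex) (use dd[of "1/2^i" x] in auto)
    have "(\<lambda>i. f i (s x)) \<longlonglongrightarrow> x"
    proof (rule metric_LIMSEQ_I)
      fix e :: real assume "e > 0"
      then obtain n where n: "(1/2)^n < e"
        using real_arch_pow_inv[of e "1/2"] by auto
      have "dist (f i (s x)) x < e" if "i \<ge> n" for i
      proof -
        have "dist (f i (s x)) x < (1/2)^i"
          using fx[of i] by (simp add: dist_commute power_one_over)
        also have "\<dots> \<le> (1/2)^n" using that by (intro power_decreasing) auto
        finally show ?thesis using n by simp
      qed
      then show "\<exists>no. \<forall>i\<ge>no. dist (f i (s x)) x < e" by blast
    qed
    then show ?thesis
      unfolding g_def using LIMSEQ_imp_Cauchy limI by auto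
  qed
  with s g show thesis
    by (rule that) (auto simp only: s_def intro: ternary_bounds)
qed

section \<open>Disintegration over the weight\<close>

text \<open>Tested on the set where \<open>g < f\<close>; the finite integral of \<open>g\<close> is
  what permits subtraction in \<open>ennreal\<close>.\<close>

lemma AE_le_if_set_nn_integral_le:
  fixes f g :: "'c \<Rightarrow> ennreal"
  assumes [measurable]: "f \<in> borel_measurable M" "g \<in> borel_measurable M"
    and fin: "(\<integral>\<^sup>+x. g x \<partial>M) \<noteq> \<infinity>"
    and le: "\<And>B. B \<in> sets M \<Longrightarrow> (\<integral>\<^sup>+x\<in>B. f x \<partial>M) \<le> (\<integral>\<^sup>+x\<in>B. g x \<partial>M)"
  shows "AE x in M. f x \<le> g x"
proof -
  define B where "B = {x \<in> space M. g x < f x}"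
  have [measurable]: "B \<in> sets M" unfolding B_def by measurable
  have finB: "(\<integral>\<^sup>+x\<in>B. g x \<partial>M) \<noteq> \<infinity>"
  proof -
    have "(\<integral>\<^sup>+x\<in>B. g x \<partial>M) \<le> (\<integral>\<^sup>+x. g x \<partial>M)"
      by (rule nn_integral_mono) (auto simp: indicator_def)
    then show ?thesis using fin by (auto simp: top_unique)
  qed
  have "(\<integral>\<^sup>+x. f x * indicator B x - g x * indicator B x \<partial>M) =
      (\<integral>\<^sup>+x\<in>B. f x \<partial>M) - (\<integral>\<^sup>+x\<in>B. g x \<partial>M)"
    by (rule nn_integral_diff) (use finB in \<open>auto simp: B_def indicator_def\<close>)
  also have "\<dots> = 0"
    using le[of B] finB by (simp add: diff_eq_0_iff_ennreal top.not_eq_extremum)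
  finally have "AE x in M. f x * indicator B x - g x * indicator B x = 0"
    by (subst (asm) nn_integral_0_iff_AE) auto
  moreover have "AE x in M. g x \<noteq> \<infinity>"
    using fin by (intro nn_integral_PInf_AE) auto
  moreover note AE_space[of M]
  ultimately show ?thesis
  proof eventually_elim
    case (elim x)
    then show ?case
      by (cases "x \<in> B") (auto simp: diff_eq_0_iff_ennreal B_def indicator_def not_less
          top.not_eq_extremum)
  qed
qed

text \<open>The conditional distribution function is the infimum over rational \<open>q > x\<close> of arbitrary
  Radon--Nikodym versions of \<open>\<nu>(fst \<le> q | w)\<close>; the infimum is monotone and right-continuous
  for every \<open>w\<close>, without discarding a null set.\<close>

lemma real_disintegration:
  fixes \<nu> :: "(real \<times> 'w) measure" and N :: "'w measure"
  assumes "prob_space \<nu>" and sets_nu [measurable_cong]: "sets \<nu> = sets (borel \<Otimes>\<^sub>M N)"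
    and unit: "AE z in \<nu>. 0 \<le> fst z \<and> fst z \<le> 1"
  obtains \<kappa> where "\<kappa> \<in> N \<rightarrow>\<^sub>M prob_algebra borel"
    "\<And>A B. A \<in> sets borel \<Longrightarrow> B \<in> sets N \<Longrightarrow>
       emeasure \<nu> (A \<times> B) = (\<integral>\<^sup>+w\<in>B. emeasure (\<kappa> w) A \<partial>(distr \<nu> N snd))"
proof -
  interpret \<nu>: prob_space \<nu> by fact
  define P where "P = distr \<nu> N snd"
  interpret P: prob_space P unfolding P_def by (rule \<nu>.prob_space_distr) measurable
  have sets_P [measurable_cong, simp]: "sets P = sets N" by (simp add: P_def)
  have space_P [simp]: "space P = space N" by (simp add: P_def)
  have space_nu: "space \<nu> = UNIV \<times> space N"
    using sets_eq_imp_space_eq[OF sets_nu] by (simp add: space_pair_measure)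
  have rect [measurable]: "A \<times> B \<in> sets \<nu>" if "A \<in> sets borel" "B \<in> sets N" for A B
    using that by (simp add: sets_nu)
  have P_eq: "emeasure P B = emeasure \<nu> (UNIV \<times> B)" if "B \<in> sets N" for B
    using that sets.sets_into_space[OF that] unfolding P_def
    by (subst emeasure_distr) (auto simp: space_nu intro!: arg_cong[where f="emeasure \<nu>"])
  \<comment> \<open>The measure sending \<open>B\<close> to \<open>\<nu>({..x} \<times> B)\<close>.
    It is dominated by the weight marginal, so it has a density with respect to it.\<close>
  define \<nu>x where "\<nu>x x = distr (density \<nu> (indicator ({..x} \<times> space N))) N snd" for x :: real
  have nux: "emeasure (\<nu>x x) B = emeasure \<nu> ({..x} \<times> B)" if B [measurable]: "B \<in> sets N" for x B
  proof -
    have "snd -` B \<inter> space \<nu> \<in> sets \<nu>"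
      by measurable
    then show ?thesis
      unfolding \<nu>x_def using sets.sets_into_space[OF B]
      apply (subst emeasure_distr)
        apply measurable
      apply (subst emeasure_density)
        apply (auto simp: nn_integral_indicator[symmetric] simp del: nn_integral_indicator simp: space_nu
          intro!: nn_integral_cong split: split_indicator)
      done
  qed
  have sets_nux: "sets (\<nu>x x) = sets N" for x by (simp add: \<nu>x_def)
  have ac: "absolutely_continuous P (\<nu>x x)" for x
    unfolding absolutely_continuous_def
  proof
    fix B assume "B \<in> null_sets P"
    then have B: "B \<in> sets N" "emeasure \<nu> (UNIV \<times> B) = 0" by (auto simp: null_sets_def P_eq)
    have "emeasure \<nu> ({..x} \<times> B) \<le> emeasure \<nu> (UNIV \<times> B)"
      using B by (intro emeasure_mono) auto
    then show "B \<in> null_sets (\<nu>x x)"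
      using B by (simp add: null_sets_def nux sets_nux)
  qed
  define f where "f x = RN_deriv P (\<nu>x x)" for x
  have [measurable]: "f x \<in> borel_measurable N" for x
    unfolding f_def using borel_measurable_RN_deriv[of P] by (simp cong: measurable_cong_sets)
  have f: "(\<integral>\<^sup>+w\<in>B. f x w \<partial>P) = emeasure \<nu> ({..x} \<times> B)" if [measurable]: "B \<in> sets N" for x B
    using P.density_RN_deriv[OF ac, of x] sets_nux
    by (simp add: f_def nux[symmetric] emeasure_density[symmetric])
  have f_mono: "AE w in P. f x w \<le> f y w" if "x \<le> y" for x y
  proof (rule AE_le_if_set_nn_integral_le)
    show "(\<integral>\<^sup>+x. f y x \<partial>P) \<noteq> \<infinity>"
      using f[of "space N" y] by (simp cong: nn_integral_cong_simp)
    show "(\<integral>\<^sup>+w\<in>B. f x w \<partial>P) \<le> (\<integral>\<^sup>+w\<in>B. f y w \<partial>P)" if "B \<in> sets P" for B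
      using that \<open>x \<le> y\<close> by (auto simp: f intro!: emeasure_mono)
  qed measurable
  have f_le1: "AE w in P. f x w \<le> 1" for x
  proof (rule AE_le_if_set_nn_integral_le)
    show "(\<integral>\<^sup>+w\<in>B. f x w \<partial>P) \<le> (\<integral>\<^sup>+w\<in>B. 1 \<partial>P)" if "B \<in> sets P" for B
      using that by (auto simp: f P_eq intro!: emeasure_mono)
  qed (auto simp: P.emeasure_space_1)
  \<comment> \<open>Truncation at 1 changes \<open>f\<close> only on a null set and makes it real
    for every \<open>w\<close>, so that the infima below are taken over bounded sets of
    reals.\<close>
  define h where "h x w = enn2real (min 1 (f x w))" for x w
  have h_meas: "h x \<in> borel_measurable N" for x unfolding h_def by measurable
  have h01: "0 \<le> h x w" "h x w \<le> 1" for x w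
    by (auto simp: h_def intro!: enn2real_leI)
  have ennh: "ennreal (h x w) = min 1 (f x w)" for x w
    unfolding h_def by (rule ennreal_enn2real) (auto simp: min_less_iff_disj)
  have neQ: "{q \<in> \<rat>. x < q} \<noteq> {}" for x :: real
    using Rats_no_top_le[of "x + 1"] by force
  have ctblQ: "countable {q \<in> \<rat>. x < q}" for x :: real
    by (rule countable_subset[OF _ countable_rat]) auto
  have bdd: "bdd_below ((\<lambda>q. h q w) ` {q \<in> \<rat>. x < q})" for x w
    using h01 by (auto intro!: bdd_belowI2)
  \<comment> \<open>The values 0 and 1 outside [0, 1) match the support of the first coordinate and
    give the correct limits at both infinities for every \<open>w\<close>, not just almost every
    one.\<close>
  define F where "F w x = (if x < 0 then 0 else if 1 \<le> x then 1 else INF q\<in>{q\<in>\<rat>. x < q}. h q w)" for w x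
  have F_le: "F w x \<le> h q w" if "q \<in> \<rat>" "x < q" "x < 1" for w x q
    using that h01 by (auto simp: F_def intro!: cINF_lower bdd)
  have F01: "0 \<le> F w x" "F w x \<le> 1" for w x
  proof -
    obtain q where "q \<in> {q \<in> \<rat>. x < q}" using neQ[of x] by auto
    then show "F w x \<le> 1" using F_le[of q x w] h01(2)[of q w] by (cases "x < 1") (auto simp: F_def)
    show "0 \<le> F w x" using neQ h01 by (auto simp: F_def intro!: cINF_greatest)
  qed
  have F_mono: "F w x \<le> F w y" if "x \<le> y" for w x y
  proof (cases "0 \<le> x \<and> y < 1")
    case True
    then have "(INF q\<in>{q\<in>\<rat>. x < q}. h q w) \<le> (INF q\<in>{q\<in>\<rat>. y < q}. h q w)"
      using that neQ bdd by (intro cINF_superset_mono) auto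
    then show ?thesis using True that by (simp add: F_def)
  next
    case False
    then consider "x < 0" | "1 \<le> y" by linarith
    then show ?thesis
    proof cases
      case 1
      then have "F w x = 0" by (simp add: F_def)
      then show ?thesis using F01(1)[of w y] by simp
    next
      case 2
      then have "F w y = 1" by (simp add: F_def)
      then show ?thesis using F01(2)[of w x] by simp
    qed
  qed
  have F_rc: "continuous (at_right a) (F w)" for w a
  proof -
    have "\<exists>d>0. F w (a + d) - F w a < e" if "e > 0" for e
    proof -
      consider "a < 0" | "1 \<le> a" | "0 \<le> a" "a < 1" by linarith
      then show ?thesis
      proof cases
        case 1
        then have "F w (a + (-a/2)) = F w a" by (simp add: F_def)
        then show ?thesis using 1 \<open>e > 0\<close> by (intro exI[of _ "-a/2"]) auto
      next
        case 2
        then show ?thesis using \<open>e > 0\<close> by (intro exI[of _ 1]) (simp add: F_def)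
      next
        case 3
        then have "(INF q\<in>{q\<in>\<rat>. a < q}. h q w) < F w a + e"
          using \<open>e > 0\<close> by (simp add: F_def)
        then obtain q where q: "q \<in> \<rat>" "a < q" "h q w < F w a + e"
          using cINF_less_iff[OF neQ bdd] by auto
        define d where "d = (min q 1 - a) / 2"
        have "d > 0" "a + d < q" "a + d < 1"
          using 3 q by (auto simp: d_def min_def field_simps)
        then show ?thesis using F_le[of q "a + d" w] q by (intro exI[of _ d]) auto
      qed
    qed
    then show ?thesis using F_mono by (subst continuous_at_right_real_increasing) auto
  qed
  have F_bot: "(F w \<longlongrightarrow> 0) at_bot" for w
    by (rule tendsto_eventually) (auto simp: F_def intro!: eventually_at_bot_linorderI[of "-1"])
  have F_top: "(F w \<longlongrightarrow> 1) at_top" for w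
    by (rule tendsto_eventually) (auto simp: F_def intro!: eventually_at_top_linorderI[of "1"])
  have F_meas [measurable]: "(\<lambda>w. F w x) \<in> borel_measurable N" for x
  proof -
    have "(\<lambda>w. INF q\<in>{q\<in>\<rat>. x < q}. h q w) \<in> borel_measurable N"
      by (rule borel_measurable_cINF[OF ctblQ h_meas bdd])
    moreover consider "x < 0" | "1 \<le> x" | "0 \<le> x" "x < 1" by linarith
    ultimately show ?thesis by cases (simp_all add: F_def)
  qed
  define \<kappa> where "\<kappa> w = interval_measure (F w)" for w
  have \<kappa>_Iic: "emeasure (\<kappa> w) {..x} = F w x" for w x
    unfolding \<kappa>_def using F_mono F_rc F_bot by (intro emeasure_interval_measure_Iic) auto
  have \<kappa>_prob: "prob_space (\<kappa> w)" for w
    using real_distribution_interval_measure[of "F w"] F_mono F_rc F_bot F_top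
    by (auto simp: \<kappa>_def real_distribution_def)
  have gen: "sets (borel :: real measure) = sigma_sets UNIV (range atMost)"
    by (subst borel_eq_atMost) (simp add: sets_measure_of)
  have stab: "Int_stable (range atMost :: real set set)"
    by (auto simp: Int_stable_def Int_atMost)
  have \<kappa>: "\<kappa> \<in> N \<rightarrow>\<^sub>M prob_algebra borel"
  proof (rule measurable_prob_algebra_generated[OF gen stab])
    show "(\<lambda>w. emeasure (\<kappa> w) A) \<in> borel_measurable N" if "A \<in> range atMost" for A
      using that by (auto simp: \<kappa>_Iic)
    show "sets (\<kappa> w) = sets borel" for w by (simp add: \<kappa>_def)
  qed (simp_all add: \<kappa>_prob)
  have Iic: "emeasure \<nu> ({..x} \<times> B) = (\<integral>\<^sup>+w\<in>B. F w x \<partial>P)" if B [measurable]: "B \<in> sets N" for x B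
  proof -
    consider "x < 0" | "1 \<le> x" | "0 \<le> x" "x < 1" by linarith
    then show ?thesis
    proof cases
      case 1
      have "emeasure \<nu> ({..x} \<times> B) = emeasure \<nu> {}"
        using unit 1 by (intro emeasure_eq_AE) (auto elim: eventually_mono)
      then show ?thesis using 1 by (simp add: F_def)
    next
      case 2
      have "emeasure \<nu> ({..x} \<times> B) = emeasure \<nu> (UNIV \<times> B)"
        using unit 2 by (intro emeasure_eq_AE) (auto elim: eventually_mono)
      then show ?thesis using 2 by (simp add: F_def P_eq[symmetric])
    next
      case 3
      show ?thesis
      proof (rule antisym)
        \<comment> \<open>Only countably many \<open>q\<close> occur, so one null set serves the
          comparison with all of them, and \<open>f x\<close> lies below the infimum.\<close>
        have "AE w in P. \<forall>q\<in>{q\<in>\<rat>. x < q}. f x w \<le> f q w"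
          using f_mono by (subst AE_ball_countable[OF ctblQ]) auto
        with f_le1[of x] have "AE w in P. f x w \<le> ennreal (F w x)"
        proof eventually_elim
          case (elim w)
          have "h x w \<le> F w x"
            using 3 neQ elim by (auto simp: F_def h_def intro!: cINF_greatest enn2real_mono
                intro: min.coboundedI2 simp: min_less_iff_disj)
          moreover have "f x w = ennreal (h x w)" using elim by (simp add: ennh min_def)
          ultimately show ?case by (simp add: ennreal_leI)
        qed
        then show "emeasure \<nu> ({..x} \<times> B) \<le> (\<integral>\<^sup>+w\<in>B. F w x \<partial>P)"
          unfolding f[OF B, symmetric]
          by (intro nn_integral_mono_AE) (auto split: split_indicator elim!: eventually_mono)
      next
        \<comment> \<open>Rational points squeezed between \<open>x + 1/(n+2)\<close> and
          \<open>x + 1/(n+1)\<close> decrease to \<open>x\<close> automatically; continuity of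
          \<open>\<nu>\<close> from above along them gives the reverse inequality.\<close>
        obtain q where q: "\<And>n. q n \<in> \<rat>" "\<And>n. x < q n" "decseq q" "q \<longlonglongrightarrow> x"
        proof -
          have "\<exists>q\<in>\<rat>. x + 1 / real (Suc (Suc n)) < q \<and> q < x + 1 / real (Suc n)" for n
            by (rule Rats_dense_in_real) (simp add: frac_less2)
          then obtain q where q: "\<And>n. q n \<in> \<rat>" "\<And>n. x + 1 / real (Suc (Suc n)) < q n"
            "\<And>n. q n < x + 1 / real (Suc n)" by metis
          show thesis
          proof (rule that[of q])
            show "x < q n" for n using q(2)[of n] by (smt (verit) divide_pos_pos of_nat_0_less_iff zero_less_Suc)
            show "decseq q" using q(2,3) by (intro decseq_SucI) (meson less_eq_real_def less_trans)
            show "q \<longlonglongrightarrow> x"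
            proof (rule tendsto_sandwich[where f="\<lambda>_. x" and h="\<lambda>n. x + 1 / real (Suc n)"])
              show "\<forall>\<^sub>F n in sequentially. x \<le> q n"
                using \<open>\<And>n. x < q n\<close> by (simp add: less_imp_le)
              show "\<forall>\<^sub>F n in sequentially. q n \<le> x + 1 / real (Suc n)"
                using q(3) by (simp add: less_imp_le)
              show "(\<lambda>n. x + 1 / real (Suc n)) \<longlonglongrightarrow> x"
                using tendsto_add[OF tendsto_const[of x] LIMSEQ_inverse_real_of_nat]
                by (simp add: inverse_eq_divide)
            qed simp
          qed (rule q(1))
        qed
        have "(\<lambda>n. emeasure \<nu> ({..q n} \<times> B)) \<longlonglongrightarrow> emeasure \<nu> (\<Inter>n. {..q n} \<times> B)"
          using q(3) by (intro Lim_emeasure_decseq) (auto simp: decseq_def intro: order_trans)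
        also have "(\<Inter>n. {..q n} \<times> B) = {..x} \<times> B"
          using less_imp_le[OF q(2)] LIMSEQ_le_const[OF q(4)] by (auto intro: order_trans)
        finally show "(\<integral>\<^sup>+w\<in>B. F w x \<partial>P) \<le> emeasure \<nu> ({..x} \<times> B)"
        proof (rule Lim_bounded2[where N=0], intro allI impI)
          fix n
          have "ennreal (F w x) \<le> f (q n) w" for w
          proof -
            have "ennreal (F w x) \<le> ennreal (h (q n) w)" using F_le[OF q(1,2) 3(2)] by (intro ennreal_leI)
            also have "\<dots> \<le> f (q n) w" by (simp add: ennh)
            finally show ?thesis .
          qed
          then show "(\<integral>\<^sup>+w\<in>B. F w x \<partial>P) \<le> emeasure \<nu> ({..q n} \<times> B)"
            unfolding f[OF B, symmetric] by (intro nn_integral_mono mult_right_mono) auto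
        qed
      qed
    qed
  qed
  show thesis
  proof (rule that[OF \<kappa>])
    fix A :: "real set" and B
    assume A: "A \<in> sets borel" and B [measurable]: "B \<in> sets N"
    \<comment> \<open>For fixed \<open>B\<close> both sides of the claim are finite measures in
      \<open>A\<close>, so agreement on the half lines suffices.\<close>
    define \<mu>1 where "\<mu>1 = distr (density \<nu> (indicator (UNIV \<times> B))) borel fst"
    define \<mu>2 where "\<mu>2 = density P (indicator B) \<bind> \<kappa>"
    have \<kappa>': "\<kappa> \<in> density P (indicator B) \<rightarrow>\<^sub>M subprob_algebra borel"
      using measurable_prob_algebraD[OF \<kappa>] by (simp cong: measurable_cong_sets)
    have ne: "space (density P (indicator B)) \<noteq> {}"
      using P.not_empty by simp
    have \<mu>1: "emeasure \<mu>1 A = emeasure \<nu> (A \<times> B)" if [measurable]: "A \<in> sets borel" for A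
    proof -
      have "fst -` A \<inter> space \<nu> \<in> sets \<nu>"
        by measurable
      then show ?thesis
        unfolding \<mu>1_def using sets.sets_into_space[OF B]
        apply (subst emeasure_distr)
          apply measurable
        apply (subst emeasure_density)
          apply (auto simp: nn_integral_indicator[symmetric] simp del: nn_integral_indicator simp: space_nu
            intro!: nn_integral_cong split: split_indicator)
        done
    qed
    have \<mu>2: "emeasure \<mu>2 A = (\<integral>\<^sup>+w\<in>B. emeasure (\<kappa> w) A \<partial>P)" if [measurable]: "A \<in> sets borel" for A
    proof -
      have [measurable]: "(\<lambda>w. emeasure (\<kappa> w) A) \<in> borel_measurable N"
        using measurable_emeasure_kernel[OF measurable_prob_algebraD[OF \<kappa>] that] .
      have "emeasure \<mu>2 A = (\<integral>\<^sup>+w. emeasure (\<kappa> w) A \<partial>density P (indicator B))"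
        unfolding \<mu>2_def by (rule emeasure_bind[OF ne \<kappa>' that])
      also have "\<dots> = (\<integral>\<^sup>+w. indicator B w * emeasure (\<kappa> w) A \<partial>P)"
        by (rule nn_integral_density) (auto simp: borel_measurable_indicator)
      finally show ?thesis by (simp add: mult.commute)
    qed
    have "\<mu>1 = \<mu>2"
    proof (rule measure_eqI_generator_eq[OF stab, where \<Omega>=UNIV and A="\<lambda>n. {..real n}"])
      show "sets \<mu>1 = sigma_sets UNIV (range atMost)" by (simp add: \<mu>1_def gen)
      show "sets \<mu>2 = sigma_sets UNIV (range atMost)"
        unfolding \<mu>2_def gen[symmetric] by (rule sets_bind[OF _ ne]) (simp add: \<kappa>_def)
      show "emeasure \<mu>1 X = emeasure \<mu>2 X" if "X \<in> range atMost" for X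
        using that by (auto simp: \<mu>1 \<mu>2 \<kappa>_Iic Iic)
      show "(\<Union>i. {..real i}) = UNIV" using real_nat_ceiling_ge by auto
      show "emeasure \<mu>1 {..real i} \<noteq> \<infinity>" for i by (simp add: \<mu>1)
    qed auto
    then show "emeasure \<nu> (A \<times> B) = (\<integral>\<^sup>+w\<in>B. emeasure (\<kappa> w) A \<partial>(distr \<nu> N snd))"
      using \<mu>1[OF A] \<mu>2[OF A] by (simp add: P_def)
  qed
qed

text \<open>The spin is coded by a real number, disintegrated on the line, and the kernel is pushed
  back with \<open>g\<close>. Since \<open>g\<close> inverts \<open>s\<close> on the left, the
  rectangle over the preimage of \<open>A\<close> under \<open>g\<close> has the mass of
  \<open>A \<times> B\<close>.\<close>

lemma is_cond_spin_exists:
  fixes \<nu> :: "('a::polish_space \<times> real) measure"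
  assumes \<nu>: "\<nu> \<in> space (prob_algebra (borel \<Otimes>\<^sub>M weight_space))"
  shows "\<exists>K. is_cond_spin \<nu> K"
proof -
  obtain s :: "'a \<Rightarrow> real" and g :: "real \<Rightarrow> 'a"
    where s [measurable]: "s \<in> borel_measurable borel" and g [measurable]: "g \<in> borel_measurable borel"
      and gs: "\<And>x. g (s x) = x" and s01: "\<And>x. 0 \<le> s x" "\<And>x. s x \<le> 1"
    using polish_borel_retract_of_real by blast
  interpret \<nu>: prob_space \<nu> using \<nu> by (simp add: space_prob_algebra)
  have [measurable_cong]: "sets \<nu> = sets (borel \<Otimes>\<^sub>M weight_space)"
    using \<nu> by (simp add: space_prob_algebra)
  then have space_\<nu>: "space \<nu> = UNIV \<times> space weight_space"
    using sets_eq_imp_space_eq by (fastforce simp: space_pair_measure)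
  define \<nu>' where "\<nu>' = distr \<nu> (borel \<Otimes>\<^sub>M weight_space) (\<lambda>z. (s (fst z), snd z))"
  have "AE z in \<nu>'. 0 \<le> fst z \<and> fst z \<le> 1"
    unfolding \<nu>'_def by (subst AE_distr_iff) (use s01 in auto)
  moreover have "prob_space \<nu>'"
    unfolding \<nu>'_def by (rule \<nu>.prob_space_distr) measurable
  moreover have "sets \<nu>' = sets (borel \<Otimes>\<^sub>M weight_space)" by (simp add: \<nu>'_def)
  ultimately obtain \<kappa> where \<kappa>: "\<kappa> \<in> weight_space \<rightarrow>\<^sub>M prob_algebra borel"
    "\<And>A B. A \<in> sets borel \<Longrightarrow> B \<in> sets weight_space \<Longrightarrow>
       emeasure \<nu>' (A \<times> B) = (\<integral>\<^sup>+w\<in>B. emeasure (\<kappa> w) A \<partial>(distr \<nu>' weight_space snd))"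
    using real_disintegration by blast
  have marg: "distr \<nu>' weight_space snd = distr \<nu> weight_space snd"
    unfolding \<nu>'_def by (subst distr_distr) (auto simp: comp_def)
  have "is_cond_spin \<nu> (\<lambda>w. distr (\<kappa> w) borel g)"
    unfolding is_cond_spin_def
  proof (intro conjI ballI)
    show "(\<lambda>w. distr (\<kappa> w) borel g) \<in> weight_space \<rightarrow>\<^sub>M prob_algebra borel"
      using \<kappa>(1) by (rule measurable_compose[OF _ measurable_distr_prob_space[OF g]])
    fix A :: "'a set" and B :: "real set"
    assume [measurable]: "A \<in> sets borel" "B \<in> sets weight_space"
    have B: "B \<subseteq> space weight_space" using sets.sets_into_space[OF \<open>B \<in> sets weight_space\<close>] .
    have gA [measurable]: "g -` A \<in> sets borel" using measurable_sets[OF g, of A] by simp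
    have "emeasure \<nu> (A \<times> B) = emeasure \<nu>' ((g -` A) \<times> B)"
      unfolding \<nu>'_def using B
      by (subst emeasure_distr) (auto simp: gs space_\<nu> intro!: arg_cong[where f="emeasure \<nu>"])
    also have "\<dots> = (\<integral>\<^sup>+w\<in>B. emeasure (\<kappa> w) (g -` A) \<partial>(distr \<nu>' weight_space snd))"
      by (rule \<kappa>(2)) auto
    also have "\<dots> = (\<integral>\<^sup>+w\<in>B. emeasure (distr (\<kappa> w) borel g) A \<partial>(distr \<nu> weight_space snd))"
      unfolding marg
    proof (rule nn_integral_cong)
      fix w assume "w \<in> space (distr \<nu> weight_space snd)"
      then have sets: "sets (\<kappa> w) = sets borel"
        using measurable_space[OF \<kappa>(1), of w] by (simp add: space_prob_algebra)
      then have "space (\<kappa> w) = UNIV" using sets_eq_imp_space_eq by fastforce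
      then show "emeasure (\<kappa> w) (g -` A) * indicator B w =
          emeasure (distr (\<kappa> w) borel g) A * indicator B w"
        using g by (subst emeasure_distr) (auto simp: measurable_cong_sets[OF sets])
    qed
    finally show "emeasure \<nu> (A \<times> B) =
      (\<integral>\<^sup>+w\<in>B. emeasure (distr (\<kappa> w) borel g) A \<partial>(distr \<nu> weight_space snd))" .
  qed
  then show ?thesis by blast
qed

lemma is_cond_spin_cond_spin:
  fixes \<nu> :: "('a::polish_space \<times> real) measure"
  assumes "\<nu> \<in> space (prob_algebra (borel \<Otimes>\<^sub>M weight_space))"
  shows "is_cond_spin \<nu> (cond_spin \<nu>)"
  unfolding cond_spin_def using is_cond_spin_exists[OF assms] by (rule someI_ex)

section \<open>Almost sure uniqueness of the conditional law\<close>

lemma countable_Int_stable_generator: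
  obtains G :: "'a::second_countable_topology set set"
  where "countable G" "Int_stable G" "sets (borel :: 'a measure) = sigma_sets UNIV G" "UNIV \<in> G"
proof -
  obtain B :: "'a set set" where B: "countable B" "topological_basis B"
    using ex_countable_basis by auto
  define G where "G = (\<lambda>F. \<Inter>F) ` {F. F \<subseteq> B \<and> finite F}"
  have "countable G"
    unfolding G_def using countable_Collect_finite_subset[OF B(1)] by (simp add: conj_commute)
  moreover have "Int_stable G"
    unfolding Int_stable_def G_def
  proof safe
    fix F F' assume "F \<subseteq> B" "finite F" "F' \<subseteq> B" "finite F'"
    then show "\<Inter>F \<inter> \<Inter>F' \<in> Inter ` {F. F \<subseteq> B \<and> finite F}"
      by (intro image_eqI[of _ _ "F \<union> F'"]) auto
  qed
  moreover have "sets (borel :: 'a measure) = sigma_sets UNIV G"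
  proof
    have sB: "sets (borel :: 'a measure) = sigma_sets UNIV B"
      using borel_eq_countable_basis[OF B] by (metis sets_measure_of top_greatest Pow_UNIV)
    have "B \<subseteq> G" unfolding G_def by (auto intro!: image_eqI[of _ _ "{_}"])
    then show "sets (borel :: 'a measure) \<subseteq> sigma_sets UNIV G"
      unfolding sB by (rule sigma_sets_mono')
    have "G \<subseteq> sets borel"
      unfolding G_def using B topological_basis_open[OF B(2)]
      by (auto intro!: borel_open open_Inter)
    then show "sigma_sets UNIV G \<subseteq> sets (borel :: 'a measure)"
      using sets.sigma_sets_subset[of G borel] by simp
  qed
  moreover have "UNIV \<in> G" unfolding G_def by (intro image_eqI[of _ _ "{}"]) auto
  ultimately show thesis by (rule that)
qed

text \<open>On a countable generator closed under intersections the equality of the kernels is a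
  countable family of almost sure statements, hence holds outside a single null set of weights, and
  there the measures agree.\<close>

lemma is_cond_spin_unique:
  fixes \<nu> :: "('a::polish_space \<times> real) measure"
  assumes \<nu>: "\<nu> \<in> space (prob_algebra (borel \<Otimes>\<^sub>M weight_space))"
    and K: "is_cond_spin \<nu> K" and K': "is_cond_spin \<nu> K'"
  shows "AE w in distr \<nu> weight_space snd. K w = K' w"
proof -
  define P where "P = distr \<nu> weight_space snd"
  interpret \<nu>: prob_space \<nu> using \<nu> by (simp add: space_prob_algebra)
  have [measurable_cong]: "sets \<nu> = sets (borel \<Otimes>\<^sub>M weight_space)"
    using \<nu> by (simp add: space_prob_algebra)
  interpret P: prob_space P unfolding P_def by (rule \<nu>.prob_space_distr) measurable
  have [measurable_cong, simp]: "sets P = sets weight_space" by (simp add: P_def)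
  have Km: "K \<in> weight_space \<rightarrow>\<^sub>M prob_algebra borel" "K' \<in> weight_space \<rightarrow>\<^sub>M prob_algebra borel"
    using K K' by (auto simp: is_cond_spin_def)
  have eK [measurable]: "(\<lambda>w. emeasure (K w) A) \<in> borel_measurable weight_space"
    "(\<lambda>w. emeasure (K' w) A) \<in> borel_measurable weight_space" if "A \<in> sets borel" for A
    using that by (auto intro!: measurable_emeasure_kernel measurable_prob_algebraD Km)
  have pr: "prob_space (K w)" "sets (K w) = sets borel" "prob_space (K' w)" "sets (K' w) = sets borel"
    if "w \<in> space weight_space" for w
    using measurable_space[OF Km(1) that] measurable_space[OF Km(2) that]
    by (auto simp: space_prob_algebra)
  obtain G :: "'a set set" where G: "countable G" "Int_stable G"
      "sets (borel :: 'a measure) = sigma_sets UNIV G" "UNIV \<in> G"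
    by (rule countable_Int_stable_generator)
  have "AE w in P. emeasure (K w) A = emeasure (K' w) A" if "A \<in> G" for A
  proof -
    have A: "A \<in> sets borel" using that G by auto
    have int: "(\<integral>\<^sup>+w\<in>B. emeasure (K w) A \<partial>P) = (\<integral>\<^sup>+w\<in>B. emeasure (K' w) A \<partial>P)"
      if "B \<in> sets P" for B
      using that A K K' by (simp add: is_cond_spin_def P_def[symmetric])
    have fin: "(\<integral>\<^sup>+w. emeasure (K w) A \<partial>P) \<noteq> \<infinity>" "(\<integral>\<^sup>+w. emeasure (K' w) A \<partial>P) \<noteq> \<infinity>"
    proof -
      have "(\<integral>\<^sup>+w. emeasure (K w) A \<partial>P) \<le> (\<integral>\<^sup>+w. 1 \<partial>P)" "(\<integral>\<^sup>+w. emeasure (K' w) A \<partial>P) \<le> (\<integral>\<^sup>+w. 1 \<partial>P)"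
        by (rule nn_integral_mono, simp add: P_def prob_space.emeasure_le_1 pr)+
      then show "(\<integral>\<^sup>+w. emeasure (K w) A \<partial>P) \<noteq> \<infinity>" "(\<integral>\<^sup>+w. emeasure (K' w) A \<partial>P) \<noteq> \<infinity>"
        by (auto simp: P.emeasure_space_1 top_unique)
    qed
    have "AE w in P. emeasure (K w) A \<le> emeasure (K' w) A"
      "AE w in P. emeasure (K' w) A \<le> emeasure (K w) A"
      using A fin int by (auto intro!: AE_le_if_set_nn_integral_le)
    then show ?thesis by eventually_elim auto
  qed
  then have "AE w in P. \<forall>A\<in>G. emeasure (K w) A = emeasure (K' w) A"
    using G(1) by (simp add: AE_ball_countable)
  with AE_space have "AE w in P. K w = K' w"
  proof eventually_elim
    case (elim w)
    then have w: "w \<in> space weight_space" by (simp add: P_def)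
    interpret Kw: prob_space "K w" using pr(1)[OF w] .
    show ?case
      by (rule measure_eqI_generator_eq[OF G(2), where \<Omega>=UNIV and A="\<lambda>_. UNIV"])
        (use G(3,4) elim(2) pr[OF w] in auto)
  qed
  then show ?thesis unfolding P_def .
qed

section \<open>Entropy inequalities\<close>

text \<open>A bounded density has integrable \<open>f ln f\<close>, so
  \<open>relative_entropy\<close> takes its finite branch. This evaluates the entropy of explicitly
  constructed measures.\<close>

lemma (in prob_space) relative_entropy_density_bounded:
  fixes f :: "'a \<Rightarrow> real"
  assumes [measurable]: "f \<in> borel_measurable M" and f: "\<And>x. 0 \<le> f x" "\<And>x. f x \<le> C"
  shows "relative_entropy (density M f) M = ereal (\<integral>x. f x * ln (f x) \<partial>M)"
    and "integrable M (\<lambda>x. f x * ln (f x))"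
proof -
  \<comment> \<open>\<open>t ln t\<close> lies between \<open>-1\<close> and the larger of
    \<open>0\<close> and \<open>C ln C\<close>; the bound chosen is generous because only
    integrability matters.\<close>
  have bd: "\<bar>t * ln t\<bar> \<le> 1 + \<bar>C * ln C\<bar> + C\<^sup>2" if "0 \<le> t" "t \<le> C" for t :: real
  proof (cases "t = 0")
    case False
    then have t: "t > 0" "C > 0" using that by auto
    have "t * ln t \<le> C * ln C \<or> t * ln t \<le> 0"
    proof (cases "t \<ge> 1")
      case True
      then have "t * ln t \<le> C * ln C" using that by (intro mult_mono) auto
      then show ?thesis ..
    next
      case False
      then show ?thesis using t by (auto simp: mult_le_0_iff)
    qed
    moreover have "t * ln t \<ge> - 1"
    proof -
      have "ln (1 / t) \<le> 1 / t - 1" using t by (intro ln_le_minus_one) auto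
      then have "t * ln (1 / t) \<le> t * (1 / t - 1)" using t by (intro mult_left_mono) auto
      then show ?thesis using t by (simp add: ln_div algebra_simps)
    qed
    ultimately show ?thesis by (smt (verit) zero_le_power2)
  qed simp
  show int: "integrable M (\<lambda>x. f x * ln (f x))"
    using bd f by (intro integrable_const_bound[where B="1 + \<bar>C * ln C\<bar> + C\<^sup>2"]) auto
  have eq: "AE x in M. RN_deriv M (density M f) x = f x"
    by (rule density_unique) (auto intro: density_RN_deriv_density)
  have "integrable (density M f) (entropy_density (exp 1) M (density M f)) \<longleftrightarrow>
      integrable M (\<lambda>x. f x * ln (f x))"
  proof -
    have "AE x in M. f x * entropy_density (exp 1) M (density M f) x = f x * ln (f x)"
      using eq by eventually_elim (simp add: entropy_density_def f log_ln)
    then have "integrable M (\<lambda>x. f x * entropy_density (exp 1) M (density M f) x) \<longleftrightarrow>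
        integrable M (\<lambda>x. f x * ln (f x))"
      by (intro integrable_cong_AE) (auto simp: entropy_density_def)
    then show ?thesis
      using f by (subst integrable_real_density) (auto simp: entropy_density_def)
  qed
  then show "relative_entropy (density M f) M = ereal (\<integral>x. f x * ln (f x) \<partial>M)"
    using int f by (simp add: relative_entropy_def absolutely_continuousI_density KL_density log_ln)
qed

text \<open>The Donsker--Varadhan bound for the test function \<open>ln h\<close>, normalised so that the
  logarithmic moment vanishes; pointwise it is \<open>f ln f \<ge> f ln h + f - h\<close>.\<close>

lemma (in prob_space) relative_entropy_ge:
  fixes h :: "'a \<Rightarrow> real"
  assumes [measurable]: "h \<in> borel_measurable M"
    and h: "\<And>x. lo \<le> h x" "\<And>x. h x \<le> hi" "0 < lo" and h1: "(\<integral>x. h x \<partial>M) = 1"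
    and \<rho>: "prob_space \<rho>" and sets_\<rho> [measurable_cong]: "sets \<rho> = sets M"
  shows "ennreal (\<integral>x. ln (h x) \<partial>\<rho>) \<le> e2ennreal (relative_entropy \<rho> M)"
proof (cases "absolutely_continuous M \<rho> \<and> integrable \<rho> (entropy_density (exp 1) M \<rho>)")
  case False
  then show ?thesis unfolding relative_entropy_def if_not_P[OF False] by simp
next
  case True
  interpret \<rho>: prob_space \<rho> by fact
  define f where "f x = enn2real (RN_deriv M \<rho> x)" for x
  have [measurable]: "f \<in> borel_measurable M" unfolding f_def by measurable
  have f0: "0 \<le> f x" for x by (simp add: f_def)
  have "AE x in M. RN_deriv M \<rho> x \<noteq> \<infinity>"
    using True sets_\<rho> by (intro RN_deriv_finite) (auto simp: \<rho>.sigma_finite_measure_axioms)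
  then have "AE x in M. RN_deriv M \<rho> x = ennreal (f x)"
    by eventually_elim (auto simp: f_def top.not_eq_extremum)
  then have "density M (RN_deriv M \<rho>) = density M f"
    by (intro density_cong) auto
  then have \<rho>_f: "\<rho> = density M f"
    using density_RN_deriv[of \<rho>] True sets_\<rho> by simp
  have KL: "KL_divergence (exp 1) M \<rho> = (\<integral>x. f x * ln (f x) \<partial>M)"
    unfolding \<rho>_f using f0 by (subst KL_density) (auto simp: log_ln)
  have eq: "AE x in M. RN_deriv M \<rho> x = f x"
    using \<open>AE x in M. RN_deriv M \<rho> x = ennreal (f x)\<close> .
  have int1: "integrable M (\<lambda>x. f x * ln (f x))"
  proof -
    have "integrable (density M f) (entropy_density (exp 1) M \<rho>)"
      using True \<rho>_f by simp
    then have "integrable M (\<lambda>x. f x * entropy_density (exp 1) M \<rho> x)"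
      using f0 by (subst (asm) integrable_real_density) (auto simp: entropy_density_def)
    moreover have "AE x in M. f x * entropy_density (exp 1) M \<rho> x = f x * ln (f x)"
      using eq by eventually_elim (simp add: entropy_density_def f0 log_ln)
    ultimately show ?thesis
      by (subst (asm) integrable_cong_AE) (auto simp: entropy_density_def)
  qed
  have bln: "\<bar>ln (h x)\<bar> \<le> \<bar>ln lo\<bar> + \<bar>ln hi\<bar>" for x
  proof -
    have "ln lo \<le> ln (h x)" "ln (h x) \<le> ln hi"
      using h(1,2)[of x] h(3) by (auto intro!: ln_mono)
    then show ?thesis by auto
  qed
  have "integrable \<rho> (\<lambda>x. ln (h x))"
    using bln by (intro \<rho>.integrable_const_bound[where B="\<bar>ln lo\<bar> + \<bar>ln hi\<bar>"]) auto
  then have int2: "integrable M (\<lambda>x. f x * ln (h x))"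
    using f0 by (subst (asm) \<rho>_f) (simp add: integrable_real_density)
  have "integrable \<rho> (\<lambda>x. 1 :: real)" by simp
  then have int3: "integrable M f"
    using f0 by (subst (asm) \<rho>_f) (simp add: integrable_real_density)
  have int4: "integrable M h"
  proof (rule integrable_const_bound[where B=hi])
    have "\<bar>h x\<bar> \<le> hi" for x using h(1,2)[of x] h(3) by auto
    then show "AE x in M. norm (h x) \<le> hi" by simp
  qed simp
  have f1: "(\<integral>x. f x \<partial>M) = 1"
  proof -
    have "1 = (\<integral>x. (1::real) \<partial>\<rho>)" by (simp add: \<rho>.prob_space)
    also have "\<dots> = (\<integral>x. f x * 1 \<partial>M)"
      using f0 by (subst \<rho>_f, subst integral_real_density) auto
    finally show ?thesis by simp
  qed
  have pw: "f x * ln (h x) + f x - h x \<le> f x * ln (f x)" for x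
  proof (cases "f x = 0")
    case True then show ?thesis using h(1)[of x] h(3) by simp
  next
    case False
    then have fx: "f x > 0" "h x > 0" using f0[of x] h(1)[of x] h(3) by auto
    have "ln (h x / f x) \<le> h x / f x - 1" using fx by (intro ln_le_minus_one) auto
    then have "f x * ln (h x / f x) \<le> f x * (h x / f x - 1)" using fx by (intro mult_left_mono) auto
    then show ?thesis using fx by (simp add: ln_div algebra_simps)
  qed
  have "(\<integral>x. ln (h x) \<partial>\<rho>) = (\<integral>x. f x * ln (h x) \<partial>M)"
    using f0 by (subst \<rho>_f, subst integral_real_density) auto
  also have "\<dots> = (\<integral>x. f x * ln (h x) + f x - h x \<partial>M)"
    using int2 int3 int4 f1 h1 by simp
  also have "\<dots> \<le> (\<integral>x. f x * ln (f x) \<partial>M)"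
    using int1 int2 int3 int4 pw by (intro integral_mono) auto
  finally show ?thesis
    using True KL by (simp add: relative_entropy_def e2ennreal_ereal ennreal_leI)
qed

text \<open>With \<open>h0 = min f L + e\<close> where \<open>e = \<integral> (f - L)\<^sup>+\<close>, the mass cut off above \<open>L\<close> is spread
  evenly, so that \<open>\<integral> (h0 - f) ln h \<le> 0\<close> for every increasing function \<open>h \<ge> 0\<close> of \<open>h0\<close> whose
  maximum is at least \<open>1\<close>. Mixing in a little of the constant \<open>1\<close> bounds \<open>h\<close> away from zero.\<close>

lemma (in prob_space) bounded_density_approx:
  fixes f :: "'a \<Rightarrow> real"
  assumes int_f [measurable]: "integrable M f" and f0: "\<And>x. 0 \<le> f x" and f1: "(\<integral>x. f x \<partial>M) = 1"
    and "\<delta> > 0"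
  obtains h lo hi where "h \<in> borel_measurable M" "0 < lo" "\<And>x. lo \<le> h x" "\<And>x. h x \<le> hi"
    "(\<integral>x. h x \<partial>M) = 1" "(\<integral>x. \<bar>h x - f x\<bar> \<partial>M) \<le> \<delta>"
    "(\<integral>x. h x * ln (h x) \<partial>M) \<le> (\<integral>x. f x * ln (h x) \<partial>M)"
proof -
  have [measurable]: "f \<in> borel_measurable M" using int_f by simp
  have "(\<lambda>n. \<integral>x. f x - min (f x) (real n) \<partial>M) \<longlonglongrightarrow> (\<integral>x. 0 \<partial>M)"
  proof (rule integral_dominated_convergence[where w=f])
    show "AE x in M. (\<lambda>n. f x - min (f x) (real n)) \<longlonglongrightarrow> 0"
    proof (rule AE_I2, rule tendsto_eventually)
      fix x
      show "\<forall>\<^sub>F n in sequentially. f x - min (f x) (real n) = 0"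
        using eventually_ge_at_top[of "nat \<lceil>f x\<rceil>"] by eventually_elim (simp add: min_def nat_ceiling_le_eq)
    qed
    show "AE x in M. norm (f x - min (f x) (real n)) \<le> f x" for n
      using f0 by (auto simp: min_def)
  qed (use int_f in auto)
  then have "\<forall>\<^sub>F n in sequentially. (\<integral>x. f x - min (f x) (real n) \<partial>M) < \<delta> / 4"
    using \<open>\<delta> > 0\<close> by (intro order_tendstoD) auto
  then obtain n where n: "n \<ge> 1" "(\<integral>x. f x - min (f x) (real n) \<partial>M) < \<delta> / 4"
    using eventually_ge_at_top[of 1] by (metis (mono_tags, lifting) eventually_at_top_linorder nle_le order_trans)
  define L where "L = real n"
  define g where "g x = f x - min (f x) L" for x
  define e where "e = (\<integral>x. g x \<partial>M)"
  have L: "L \<ge> 1" using n by (simp add: L_def)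
  have g: "0 \<le> g x" "g x \<le> f x" for x using f0[of x] L by (auto simp: g_def)
  have [measurable]: "g \<in> borel_measurable M" unfolding g_def by measurable
  have int_g: "integrable M g"
    using g by (intro Bochner_Integration.integrable_bound[OF int_f]) (auto simp: f0)
  have e: "0 \<le> e" "e < \<delta> / 4" using g n by (auto simp: e_def g_def L_def)
  \<comment> \<open>The final distance is at most \<open>2 \<theta> + 2 e\<close>, and each of
    \<open>\<theta>\<close> and \<open>e\<close> takes a quarter of \<open>\<delta>\<close>.\<close>
  define \<theta> where "\<theta> = min (1/2) (\<delta> / 4)"
  have \<theta>: "0 < \<theta>" "\<theta> < 1" "\<theta> \<le> \<delta> / 4" using \<open>\<delta> > 0\<close> by (auto simp: \<theta>_def)
  define h0 where "h0 x = min (f x) L + e" for x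
  define h where "h x = (1 - \<theta>) * h0 x + \<theta>" for x
  define hi where "hi = (1 - \<theta>) * (L + e) + \<theta>"
  have h0_eq: "h0 x = f x - g x + e" for x by (simp add: h0_def g_def)
  have int_h0: "integrable M h0" unfolding h0_eq[abs_def] using int_f int_g by auto
  have int_h: "integrable M h" unfolding h_def[abs_def] using int_h0 by auto
  have h0_1: "(\<integral>x. h0 x \<partial>M) = 1"
    unfolding h0_eq using int_f int_g by (simp add: f1 e_def prob_space)
  have h_1: "(\<integral>x. h x \<partial>M) = 1"
    unfolding h_def using int_h0 by (simp add: h0_1 prob_space)
  have h0_nn: "0 \<le> h0 x" for x using f0[of x] L e by (auto simp: h0_def)
  have lo: "\<theta> \<le> h x" for x using h0_nn[of x] \<theta> by (auto simp: h_def)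
  have hi: "h x \<le> hi" for x using \<theta> by (auto simp: h_def hi_def h0_def intro!: mult_left_mono)
  have hm [measurable]: "h \<in> borel_measurable M" using int_h by simp
  have bln: "\<bar>ln (h x)\<bar> \<le> \<bar>ln \<theta>\<bar> + \<bar>ln hi\<bar>" for x
  proof -
    have "ln \<theta> \<le> ln (h x)" "ln (h x) \<le> ln hi"
      using lo[of x] hi[of x] \<theta> by (auto intro!: ln_mono)
    then show ?thesis by auto
  qed
  have intln: "integrable M (\<lambda>x. u x * ln (h x))" if "integrable M u" for u :: "'a \<Rightarrow> real"
  proof (rule Bochner_Integration.integrable_bound)
    show "integrable M (\<lambda>x. (\<bar>ln \<theta>\<bar> + \<bar>ln hi\<bar>) * u x)" using that by simp
    show "AE x in M. norm (u x * ln (h x)) \<le> norm ((\<bar>ln \<theta>\<bar> + \<bar>ln hi\<bar>) * u x)"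
    proof (rule AE_I2)
      fix x
      have "\<bar>ln (h x)\<bar> * \<bar>u x\<bar> \<le> (\<bar>ln \<theta>\<bar> + \<bar>ln hi\<bar>) * \<bar>u x\<bar>"
        by (rule mult_right_mono[OF bln]) simp
      then show "norm (u x * ln (h x)) \<le> norm ((\<bar>ln \<theta>\<bar> + \<bar>ln hi\<bar>) * u x)"
        by (simp add: abs_mult mult.commute)
    qed
  qed (use that in auto)
  \<comment> \<open>Split \<open>h - f\<close> as \<open>\<theta> (1 - h0) + (e - g)\<close>. The
    first term has the sign opposite to \<open>ln h\<close>, because
    \<open>h - 1 = (1 - \<theta>) (h0 - 1)\<close>. In the second, \<open>ln h\<close> may be
    replaced by the constant \<open>ln hi\<close>: where \<open>f \<le> L\<close> the factor is
    \<open>e \<ge> 0\<close>, and where \<open>f > L\<close> one has \<open>h = hi\<close>. Finally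
    \<open>e - g\<close> integrates to zero.\<close>
  have pw: "h x * ln (h x) - f x * ln (h x) \<le> ln hi * (e - g x)" for x
  proof -
    have 1: "\<theta> * ((1 - h0 x) * ln (h x)) \<le> 0"
    proof -
      have "(1 - h0 x) * ln (h x) \<le> 0"
      proof (cases "h0 x \<ge> 1")
        case True
        then have "(1 - \<theta>) * 1 \<le> (1 - \<theta>) * h0 x" using \<theta> by (intro mult_left_mono) auto
        then have "h x \<ge> 1" by (simp add: h_def)
        then show ?thesis using True by (auto simp: mult_le_0_iff)
      next
        case False
        then have "(1 - \<theta>) * h0 x \<le> (1 - \<theta>) * 1" using \<theta> by (intro mult_left_mono) auto
        then have "h x \<le> 1" by (simp add: h_def)
        then show ?thesis using False lo[of x] \<theta> by (auto simp: mult_le_0_iff)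
      qed
      then show ?thesis using \<theta> by (simp add: mult_le_0_iff)
    qed
    have 2: "(e - g x) * ln (h x) \<le> (e - g x) * ln hi"
    proof (cases "f x \<le> L")
      case True
      then have "g x = 0" by (simp add: g_def)
      moreover have "ln (h x) \<le> ln hi" using hi[of x] lo[of x] \<theta> by (intro ln_mono) auto
      ultimately show ?thesis using e by (simp add: mult_left_mono)
    next
      case False
      then have "h x = hi" by (simp add: h_def h0_def hi_def)
      then show ?thesis by simp
    qed
    have "h x - f x = \<theta> * (1 - h0 x) + (e - g x)"
      by (simp add: h_def h0_eq algebra_simps)
    then have "(h x - f x) * ln (h x) = (\<theta> * (1 - h0 x) + (e - g x)) * ln (h x)"
      by (simp only:)
    also have "\<dots> = \<theta> * ((1 - h0 x) * ln (h x)) + (e - g x) * ln (h x)"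
      by (simp only: distrib_right mult.assoc)
    finally have "(h x - f x) * ln (h x) = \<theta> * ((1 - h0 x) * ln (h x)) + (e - g x) * ln (h x)" .
    with 1 2 show ?thesis by (simp add: algebra_simps)
  qed
  have "(\<integral>x. h x * ln (h x) - f x * ln (h x) \<partial>M) \<le> (\<integral>x. ln hi * (e - g x) \<partial>M)"
    using pw intln[OF int_h] intln[OF int_f] int_g by (intro integral_mono) auto
  also have "\<dots> = 0" using int_g by (simp add: e_def prob_space)
  finally have ent: "(\<integral>x. h x * ln (h x) \<partial>M) \<le> (\<integral>x. f x * ln (h x) \<partial>M)"
    using intln[OF int_h] intln[OF int_f] by simp
  have "(\<integral>x. \<bar>h x - f x\<bar> \<partial>M) \<le> (\<integral>x. \<theta> * (1 + h0 x) + (e + g x) \<partial>M)"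
  proof (rule integral_mono)
    fix x
    have "h x - f x = \<theta> * (1 - h0 x) + (e - g x)"
      by (simp add: h_def h0_eq algebra_simps)
    moreover have "\<bar>\<theta> * (1 - h0 x)\<bar> \<le> \<theta> * (1 + h0 x)"
      using \<theta> h0_nn[of x] by (auto simp: abs_mult intro!: mult_left_mono)
    ultimately show "\<bar>h x - f x\<bar> \<le> \<theta> * (1 + h0 x) + (e + g x)"
      using e g[of x] by linarith
  qed (use int_h int_f int_h0 int_g in auto)
  also have "\<dots> = 2 * \<theta> + 2 * e"
    using int_h0 int_g by (simp add: h0_1 prob_space e_def)
  also have "\<dots> \<le> \<delta>" using \<theta> e by simp
  finally show thesis
    using that[OF hm \<theta>(1) lo hi h_1 _ ent] by simp
qed

section \<open>Weight sequences\<close>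

lemma space_weight_space [simp]: "space weight_space = {0<..}"
  by (simp add: weight_space_def space_restrict_space)

lemma measurable_weight_spaceI [measurable (raw)]:
  "f \<in> borel \<rightarrow>\<^sub>M N \<Longrightarrow> f \<in> weight_space \<rightarrow>\<^sub>M N"
  unfolding weight_space_def by (rule measurable_restrict_space1)

lemma integral_empirical_weights:
  fixes f :: "real \<Rightarrow> real"
  assumes w: "\<And>i. i \<ge> 1 \<Longrightarrow> w i > 0" and f: "f \<in> borel_measurable weight_space"
  shows "integral\<^sup>L (empirical weight_space N w) f = (\<Sum>i=1..N. f (w i)) / real N"
proof -
  have "w \<in> uniform_count_measure {1..N} \<rightarrow>\<^sub>M weight_space"
    using w by (auto simp: measurable_def space_uniform_count_measure sets_uniform_count_measure)
  then show ?thesis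
    unfolding empirical_def using f by (subst integral_distr) (auto simp: integral_uniform_count_measure)
qed

locale weight_sequence =
  fixes w :: "nat \<Rightarrow> real" and P :: "real measure"
  assumes w_pos: "\<And>i. i \<ge> 1 \<Longrightarrow> w i > 0"
    and P_prob: "prob_space P" and sets_P [measurable_cong, simp]: "sets P = sets weight_space"
    and w_conv: "weakly_converges_on {0<..} (\<lambda>N. empirical weight_space N w) P"
    and w_moment: "\<exists>\<epsilon>>0. bdd_above ((\<lambda>N::nat. (\<Sum>i=1..N. w i powr (1 + \<epsilon>)) / real N) ` {1..})"
begin

sublocale P: prob_space P by (rule P_prob)

lemma space_P [simp]: "space P = {0<..}"
  using sets_eq_imp_space_eq[OF sets_P] by simp

lemma measure_P_UNIV [simp]: "measure P {0<..} = 1"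
  using P.prob_space by simp

lemma weak_limit:
  fixes f :: "real \<Rightarrow> real"
  assumes "continuous_on {0<..} f" "bounded (f ` {0<..})" "f \<in> borel_measurable borel"
  shows "(\<lambda>N. (\<Sum>i=1..N. f (w i)) / real N) \<longlonglongrightarrow> integral\<^sup>L P f"
proof -
  have "(\<lambda>N. integral\<^sup>L (empirical weight_space N w) f) \<longlonglongrightarrow> integral\<^sup>L P f"
    using w_conv assms unfolding weakly_converges_on_def by blast
  then show ?thesis
    using assms(3) by (subst (asm) integral_empirical_weights[OF w_pos]) auto
qed

text \<open>Uniform integrability from the moment bound: on \<open>w > R\<close> one has
  \<open>w \<le> w powr (1 + \<epsilon>) * R powr (-\<epsilon>)\<close>, for all \<open>N\<close> at
  once.\<close>

lemma uniform_tails: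
  obtains C where "\<And>N. N \<ge> 1 \<Longrightarrow> (\<Sum>i=1..N. w i) / real N \<le> C"
    "\<And>e. e > 0 \<Longrightarrow> \<exists>R0. \<forall>R\<ge>R0. \<forall>N\<ge>1. (\<Sum>i=1..N. if w i > R then w i else 0) / real N \<le> e"
proof -
  obtain \<epsilon> K where \<epsilon>: "\<epsilon> > 0" and K: "\<And>N. N \<ge> 1 \<Longrightarrow> (\<Sum>i=1..N. w i powr (1 + \<epsilon>)) / real N \<le> K"
    using w_moment unfolding bdd_above_def by (auto simp: Ball_def)
  have tail: "(\<Sum>i=1..N. if w i > R then w i else 0) / real N \<le> K * R powr (-\<epsilon>)"
    if "R > 0" "N \<ge> 1" for R N
  proof -
    have "(\<Sum>i=1..N. if w i > R then w i else 0) \<le> (\<Sum>i=1..N. w i powr (1 + \<epsilon>) * R powr (-\<epsilon>))"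
    proof (rule sum_mono)
      fix i assume "i \<in> {1..N}"
      then have wi: "w i > 0" using w_pos by auto
      show "(if w i > R then w i else 0) \<le> w i powr (1 + \<epsilon>) * R powr (-\<epsilon>)"
      proof (cases "w i > R")
        case True
        have "R powr \<epsilon> \<le> w i powr \<epsilon>" using True \<epsilon> that by (intro powr_mono2) auto
        then have "w i * 1 \<le> w i * (w i powr \<epsilon> * R powr (-\<epsilon>))"
          using wi that by (intro mult_left_mono) (auto simp: powr_minus field_simps)
        then show ?thesis using True wi by (simp add: powr_add mult_ac)
      qed simp
    qed
    also have "\<dots> = (\<Sum>i=1..N. w i powr (1 + \<epsilon>)) * R powr (-\<epsilon>)" by (simp add: sum_distrib_right)
    finally have "(\<Sum>i=1..N. if w i > R then w i else 0) / real N \<le>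
        (\<Sum>i=1..N. w i powr (1 + \<epsilon>)) * R powr (-\<epsilon>) / real N"
      by (rule divide_right_mono) simp
    also have "\<dots> = ((\<Sum>i=1..N. w i powr (1 + \<epsilon>)) / real N) * R powr (-\<epsilon>)" by simp
    also have "\<dots> \<le> K * R powr (-\<epsilon>)"
      using K[OF that(2)] by (intro mult_right_mono) auto
    finally show ?thesis .
  qed
  have lim: "((\<lambda>R. K * R powr (-\<epsilon>)) \<longlongrightarrow> 0) at_top"
    using tendsto_mult_right_zero[OF tendsto_neg_powr[OF _ filterlim_ident, of "-\<epsilon>"], of K] \<epsilon> by simp
  \<comment> \<open>Weights up to 1 contribute at most 1 to the average, and the rest is the tail at
    \<open>R = 1\<close>, at most \<open>K\<close>.\<close>
  show thesis
  proof (rule that[of "1 + K"])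
    fix N :: nat assume N: "N \<ge> 1"
    have "(\<Sum>i=1..N. w i) \<le> (\<Sum>i=1..N. 1 + (if w i > 1 then w i else 0))"
      by (intro sum_mono) auto
    also have "\<dots> = real N + (\<Sum>i=1..N. if w i > 1 then w i else 0)" by (simp add: sum.distrib)
    finally have "(\<Sum>i=1..N. w i) / real N \<le> (real N + (\<Sum>i=1..N. if w i > 1 then w i else 0)) / real N"
      by (rule divide_right_mono) simp
    also have "\<dots> = 1 + (\<Sum>i=1..N. if w i > 1 then w i else 0) / real N"
      using N by (simp add: add_divide_distrib)
    also have "\<dots> \<le> 1 + K" using tail[of 1 N] N by simp
    finally show "(\<Sum>i=1..N. w i) / real N \<le> 1 + K" .
  next
    fix e :: real assume "e > 0"
    then have "\<forall>\<^sub>F R in at_top. K * R powr (-\<epsilon>) < e" using order_tendstoD(2)[OF lim] by simp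
    with eventually_gt_at_top[of 0] have "\<forall>\<^sub>F R in at_top. 0 < R \<and> K * R powr (-\<epsilon>) < e"
      by eventually_elim simp
    then obtain R0 where "\<And>R. R \<ge> R0 \<Longrightarrow> 0 < R \<and> K * R powr (-\<epsilon>) < e"
      unfolding eventually_at_top_linorder by blast
    then show "\<exists>R0. \<forall>R\<ge>R0. \<forall>N\<ge>1. (\<Sum>i=1..N. if w i > R then w i else 0) / real N \<le> e"
      using tail by (meson less_imp_le order_trans)
  qed
qed

text \<open>The truncations \<open>min x n\<close> are bounded continuous test functions, so the
  bound on the averages passes to their integrals under \<open>P\<close>; monotone convergence
  removes the truncation.\<close>

lemma integrable_weight: "integrable P (\<lambda>x. x)"
proof -
  obtain C where C: "\<And>N. N \<ge> 1 \<Longrightarrow> (\<Sum>i=1..N. w i) / real N \<le> C" by (rule uniform_tails) blast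
  have le: "(\<integral>x. min x (real n) \<partial>P) \<le> C" for n
  proof (rule LIMSEQ_le_const2[OF weak_limit])
    show "continuous_on {0<..} (\<lambda>x. min x (real n))" by (intro continuous_intros)
    show "bounded ((\<lambda>x. min x (real n)) ` {0<..})"
      by (intro boundedI[where B="real n"]) auto
    show "\<exists>M. \<forall>N\<ge>M. (\<Sum>i=1..N. min (w i) (real n)) / real N \<le> C"
    proof (intro exI[of _ 1] allI impI)
      fix N :: nat assume "1 \<le> N"
      have "(\<Sum>i=1..N. min (w i) (real n)) / real N \<le> (\<Sum>i=1..N. w i) / real N"
        by (intro divide_right_mono sum_mono) auto
      also have "\<dots> \<le> C" by (rule C) fact
      finally show "(\<Sum>i=1..N. min (w i) (real n)) / real N \<le> C" .
    qed
  qed simp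
  have int: "integrable P (\<lambda>x. min x (real n))" for n
    by (rule P.integrable_const_bound[where B="real n"]) (auto intro!: AE_I2)
  have "(\<integral>\<^sup>+x. ennreal x \<partial>P) = (\<integral>\<^sup>+x. (SUP n. ennreal (min x (real n))) \<partial>P)"
  proof (rule nn_integral_cong)
    fix x
    obtain n where n: "x \<le> real n" using real_arch_simple by blast
    show "ennreal x = (SUP n. ennreal (min x (real n)))"
    proof (rule antisym)
      have "ennreal x = ennreal (min x (real n))" using n by simp
      also have "\<dots> \<le> (SUP n. ennreal (min x (real n)))" by (rule SUP_upper) simp
      finally show "ennreal x \<le> (SUP n. ennreal (min x (real n)))" .
    qed (auto intro!: SUP_least ennreal_leI)
  qed
  also have "\<dots> = (SUP n. \<integral>\<^sup>+x. ennreal (min x (real n)) \<partial>P)"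
  proof (rule nn_integral_monotone_convergence_SUP)
    show "incseq (\<lambda>n x. ennreal (min x (real n)))"
      by (intro incseq_SucI le_funI ennreal_leI) auto
  qed measurable
  also have "\<dots> = (SUP n. ennreal (\<integral>x. min x (real n) \<partial>P))"
    by (intro SUP_cong refl nn_integral_eq_integral int AE_I2) auto
  also have "\<dots> \<le> ennreal C" by (intro SUP_least ennreal_leI le)
  finally have "(\<integral>\<^sup>+x. ennreal x \<partial>P) < \<infinity>" by (rule le_less_trans) simp
  moreover have "(\<integral>\<^sup>+x. ennreal (norm x) \<partial>P) = (\<integral>\<^sup>+x. ennreal x \<partial>P)"
    by (intro nn_integral_cong) auto
  ultimately show ?thesis by (simp add: integrable_iff_bounded)
qed

text \<open>The indicator of a half line is not a continuous test function. After pushing the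
  measures to the whole line, weak convergence becomes convergence of distribution functions at
  continuity points, and \<open>b\<close> is one because it carries no atom.\<close>

lemma frequency_atMost:
  assumes "measure P {x \<in> space P. x = b} = 0"
  shows "(\<lambda>N. (\<Sum>i=1..N. indicator {..b} (w i)) / real N :: real) \<longlonglongrightarrow> measure P {x \<in> space P. x \<le> b}"
proof -
  define Q where "Q = distr P borel (\<lambda>x. x)"
  \<comment> \<open>The index is shifted by one because the empirical measure for
    \<open>N = 0\<close> is not a probability measure.\<close>
  define QN where "QN N = distr (empirical weight_space (Suc N) w) borel (\<lambda>x. x)" for N
  have idm: "(\<lambda>x. x) \<in> weight_space \<rightarrow>\<^sub>M borel" by measurable
  have emp: "prob_space (empirical weight_space (Suc N) w)" for N
    unfolding empirical_def
  proof (rule prob_space.prob_space_distr)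
    show "prob_space (uniform_count_measure {1..Suc N})" by (rule prob_space_uniform_count_measure) auto
    show "w \<in> uniform_count_measure {1..Suc N} \<rightarrow>\<^sub>M weight_space"
      using w_pos by (auto simp: measurable_def space_uniform_count_measure sets_uniform_count_measure)
  qed
  have idm': "(\<lambda>x. x) \<in> empirical weight_space (Suc N) w \<rightarrow>\<^sub>M borel" for N
    using idm by (simp add: empirical_def)
  have "real_distribution Q"
    unfolding Q_def real_distribution_def real_distribution_axioms_def
    by (auto intro!: P.prob_space_distr)
  moreover have "real_distribution (QN N)" for N
    unfolding QN_def real_distribution_def real_distribution_axioms_def
    by (auto intro!: prob_space.prob_space_distr[OF emp] idm')
  ultimately interpret Q: real_distribution Q + QN: real_distribution "QN N" for N .
  have sumQ: "integral\<^sup>L (QN N) f = (\<Sum>i=1..Suc N. f (w i)) / real (Suc N)"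
    if [measurable]: "f \<in> borel_measurable borel" for f :: "real \<Rightarrow> real" and N
    unfolding QN_def by (subst integral_distr[OF idm']) (auto simp: integral_empirical_weights[OF w_pos] simp del: of_nat_Suc)
  have "weak_conv_m QN Q"
  proof (rule integral_bdd_continuous_conv_imp_weak_conv)
    fix f :: "real \<Rightarrow> real" assume f: "\<And>x. isCont f x" "\<And>x. \<bar>f x\<bar> \<le> 1"
    have [measurable]: "f \<in> borel_measurable borel"
      using f by (intro borel_measurable_continuous_onI) (simp add: continuous_at_imp_continuous_on)
    have "(\<lambda>N. (\<Sum>i=1..N. f (w i)) / real N) \<longlonglongrightarrow> integral\<^sup>L P f"
      using f by (intro weak_limit boundedI[where B=1]) (auto simp: continuous_at_imp_continuous_on)
    from LIMSEQ_Suc[OF this] show "(\<lambda>n. integral\<^sup>L (QN n) f) \<longlonglongrightarrow> integral\<^sup>L Q f"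
      unfolding Q_def by (subst integral_distr) (auto simp: sumQ)
  qed (fact Q.real_distribution_axioms QN.real_distribution_axioms)+
  moreover have "isCont (cdf Q) b"
  proof -
    have "(\<lambda>x. x) -` {b} \<inter> space P = {x \<in> space P. x = b}" by auto
    then have "measure Q {b} = 0"
      using assms unfolding Q_def by (subst measure_distr) auto
    then show ?thesis by (simp add: Q.isCont_cdf)
  qed
  ultimately have "(\<lambda>N. cdf (QN N) b) \<longlonglongrightarrow> cdf Q b"
    by (auto simp: weak_conv_m_def weak_conv_def)
  moreover have "cdf (QN N) b = (\<Sum>i=1..Suc N. indicator {..b} (w i)) / real (Suc N)" for N
  proof -
    have "cdf (QN N) b = (\<integral>x. indicator {..b} x \<partial>QN N)" by (simp add: cdf_def)
    also have "\<dots> = (\<Sum>i=1..Suc N. indicator {..b} (w i)) / real (Suc N)"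
      by (rule sumQ) measurable
    finally show ?thesis .
  qed
  moreover have "cdf Q b = measure P {x \<in> space P. x \<le> b}"
  proof -
    have "(\<lambda>x. x) -` {..b} \<inter> space P = {x \<in> space P. x \<le> b}" by auto
    then show ?thesis unfolding cdf_def Q_def by (subst measure_distr) auto
  qed
  ultimately show ?thesis
    by (subst filterlim_sequentially_Suc[symmetric]) (simp del: of_nat_Suc)
qed

text \<open>Bin \<open>j \<ge> 1\<close> is \<open>((j - 1) t, j t]\<close> with representative \<open>(j - 1) t\<close>; the label \<open>0\<close>
  collects all weights above \<open>J t\<close>, whose representative is \<open>0\<close>. The mesh \<open>t\<close> is chosen so
  that no multiple of it is an atom of \<open>P\<close>.\<close>

lemma weight_bins:
  assumes "\<eta> > 0"
  obtains k :: "real \<Rightarrow> nat" and r :: "nat \<Rightarrow> real" and K :: nat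
  where "k \<in> borel \<rightarrow>\<^sub>M count_space UNIV" "\<And>x. k x < K" "\<And>j. 0 \<le> r j" "\<And>x. x > 0 \<Longrightarrow> r (k x) \<le> x"
    "(\<integral>x. x - r (k x) \<partial>P) \<le> \<eta>"
    "\<And>N. N \<ge> 1 \<Longrightarrow> (\<Sum>i=1..N. w i - r (k (w i))) / real N \<le> \<eta>"
    "\<And>j. (\<lambda>N. (\<Sum>i=1..N. indicator {j} (k (w i))) / real N :: real) \<longlonglongrightarrow> measure P {x \<in> space P. k x = j}"
proof -
  obtain R1 where R1: "\<And>R N. R \<ge> R1 \<Longrightarrow> N \<ge> 1 \<Longrightarrow> (\<Sum>i=1..N. if w i > R then w i else 0) / real N \<le> \<eta> / 2"
    using uniform_tails assms by (metis half_gt_zero)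
  have "(\<lambda>n. \<integral>x. (if x > real n then x else 0) \<partial>P) \<longlonglongrightarrow> (\<integral>x. 0 \<partial>P)"
  proof (rule integral_dominated_convergence[where w="\<lambda>x. \<bar>x\<bar>"])
    show "AE x in P. (\<lambda>n. if x > real n then x else 0) \<longlonglongrightarrow> 0"
    proof (rule AE_I2, rule tendsto_eventually)
      fix x :: real
      show "\<forall>\<^sub>F n in sequentially. (if x > real n then x else 0) = 0"
        using eventually_ge_at_top[of "nat \<lceil>x\<rceil>"] by eventually_elim (simp add: nat_ceiling_le_eq)
    qed
    show "integrable P (\<lambda>x. \<bar>x\<bar>)" by (rule integrable_abs[OF integrable_weight])
    show "(\<lambda>x. if real n < x then x else 0) \<in> borel_measurable P" for n by measurable
    show "AE x in P. norm (if real n < x then x else 0) \<le> \<bar>x\<bar>" for n by simp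
  qed simp
  then have "\<forall>\<^sub>F n in sequentially. (\<integral>x. (if x > real n then x else 0) \<partial>P) < \<eta> / 2"
    using assms by (intro order_tendstoD) auto
  then obtain n0 where n0: "\<And>n. n \<ge> n0 \<Longrightarrow> (\<integral>x. (if x > real n then x else 0) \<partial>P) < \<eta> / 2"
    unfolding eventually_sequentially by blast
  define Q where "Q = distr P borel (\<lambda>x. x)"
  interpret Q: prob_space Q unfolding Q_def by (rule P.prob_space_distr) measurable
  define S where "S = {x. measure Q {x} \<noteq> 0}"
  \<comment> \<open>A mesh \<open>t\<close> is forbidden if some multiple \<open>j t\<close> with
    \<open>j \<ge> 1\<close> is an atom, that is, if \<open>t = x / j\<close> for an atom
    \<open>x\<close>. Only countably many values are excluded, so the interval below
    \<open>\<eta> / 2\<close> contains a good one.\<close>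
  have "countable (\<Union>j\<in>{1::nat..}. (\<lambda>x. x / real j) ` S)"
    using Q.countable_support unfolding S_def by (intro countable_UN countable_image) auto
  moreover have "uncountable {0<..<\<eta> / 2}" using assms by (simp add: uncountable_open_interval)
  ultimately have "\<not> {0<..<\<eta> / 2} \<subseteq> (\<Union>j\<in>{1::nat..}. (\<lambda>x. x / real j) ` S)"
    by (meson countable_subset)
  then obtain t where t: "0 < t" "t < \<eta> / 2" and t': "t \<notin> (\<Union>j\<in>{1::nat..}. (\<lambda>x. x / real j) ` S)"
    by (auto simp only: subset_iff greaterThanLessThan_iff)
  have tS: "t \<noteq> x / real j" if "j \<ge> 1" "x \<in> S" for x j
    using t' that by blast
  have atom: "measure P {x \<in> space P. x = real j * t} = 0" for j :: nat
  proof (cases "j = 0")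
    case True
    then have "{x \<in> space P. x = real j * t} = {}" by auto
    then show ?thesis by (simp only: measure_empty)
  next
    case False
    then have "real j * t \<notin> S" using tS[of j "real j * t"] by auto
    moreover have "measure Q {y} = measure P {x \<in> space P. x = y}" for y
      unfolding Q_def by (subst measure_distr) (auto intro!: arg_cong[where f="measure P"])
    ultimately show ?thesis by (simp only: S_def mem_Collect_eq not_not)
  qed
  note freq = frequency_atMost[OF atom]
  \<comment> \<open>The cutoff \<open>J t\<close> must pass two thresholds: \<open>R1\<close>
    controls the tails of the averages over the sequence, \<open>n0\<close> the tail under
    \<open>P\<close>.\<close>
  obtain J :: nat where J: "real J * t \<ge> R1" "real J * t \<ge> real n0"
  proof -
    obtain J where "max R1 (real n0) / t \<le> real J" using real_arch_simple by blast
    then have "max R1 (real n0) \<le> real J * t" using t by (simp add: divide_le_eq)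
    then show thesis using that[of J] by auto
  qed
  define k where "k x = (if 0 < x \<and> x \<le> real J * t then nat \<lceil>x / t\<rceil> else 0)" for x
  \<comment> \<open>Truncated subtraction gives \<open>r 0 = 0\<close>, the value wanted for the
    overflow label.\<close>
  define r where "r j = real (j - 1) * t" for j :: nat
  have k_iff: "k x = j \<longleftrightarrow> real (j - 1) * t < x \<and> x \<le> real j * t" if "1 \<le> j" "j \<le> J" "x > 0" for x j
  proof -
    have le: "nat \<lceil>x / t\<rceil> \<le> m \<longleftrightarrow> x \<le> real m * t" for m
      using t by (simp add: nat_ceiling_le_eq divide_le_eq)
    have "nat \<lceil>x / t\<rceil> = j \<longleftrightarrow> nat \<lceil>x / t\<rceil> \<le> j \<and> \<not> nat \<lceil>x / t\<rceil> \<le> j - 1"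
      using that(1) by linarith
    also have "\<dots> \<longleftrightarrow> real (j - 1) * t < x \<and> x \<le> real j * t" unfolding le not_le by blast
    finally have 1: "nat \<lceil>x / t\<rceil> = j \<longleftrightarrow> real (j - 1) * t < x \<and> x \<le> real j * t" .
    have "real j * t \<le> real J * t" using that t by (intro mult_right_mono) auto
    then show ?thesis using 1 that by (auto simp: k_def)
  qed
  have k_pos: "1 \<le> k x" "k x \<le> J" if "0 < x" "x \<le> real J * t" for x
  proof -
    have "\<not> nat \<lceil>x / t\<rceil> \<le> 0" using that t by (simp add: divide_le_eq)
    then have "1 \<le> nat \<lceil>x / t\<rceil>" by linarith
    then show "1 \<le> k x" using that by (auto simp: k_def)
    show "k x \<le> J" using that t by (auto simp: k_def nat_ceiling_le_eq divide_le_eq)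
  qed
  have k0: "k x = 0 \<longleftrightarrow> x > real J * t" if "x > 0" for x
  proof (cases "x \<le> real J * t")
    case True
    then show ?thesis using k_pos(1)[of x] that by simp
  next
    case False
    then show ?thesis by (simp add: k_def)
  qed
  have kJ: "k x < Suc J" for x
  proof (cases "0 < x \<and> x \<le> real J * t")
    case True
    then show ?thesis using k_pos(2)[of x] by simp
  next
    case False
    then show ?thesis by (auto simp: k_def)
  qed
  have r0: "0 \<le> r j" for j using t by (simp add: r_def)
  have low: "r (k x) \<le> x" and diff: "x - r (k x) \<le> t + (if x > real J * t then x else 0)" if "x > 0" for x
  proof -
    have "r (k x) \<le> x \<and> x - r (k x) \<le> t + (if x > real J * t then x else 0)"
    proof (cases "x \<le> real J * t")
      case True
      have "real (k x - 1) * t < x \<and> x \<le> real (k x) * t"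
        using k_iff[of "k x" x] k_pos[OF that True] that by blast
      moreover have "real (k x) * t = r (k x) + t"
      proof -
        have "real (k x) = real (k x - 1) + 1" using k_pos(1)[OF that True] by linarith
        then show ?thesis by (simp only: r_def distrib_right mult_1)
      qed
      moreover have "(if x > real J * t then x else 0) = 0" using True by simp
      ultimately show ?thesis unfolding r_def by linarith
    next
      case False
      then show ?thesis using that t by (simp add: r_def k_def)
    qed
    then show "r (k x) \<le> x" "x - r (k x) \<le> t + (if x > real J * t then x else 0)" by auto
  qed
  have km: "k \<in> borel \<rightarrow>\<^sub>M count_space UNIV" unfolding k_def by measurable
  have tailP: "(\<integral>x. (if x > real J * t then x else 0) \<partial>P) \<le> \<eta> / 2"
  proof -
    have int: "integrable P (\<lambda>x. if x > c then x else 0)" for c :: real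
      by (rule Bochner_Integration.integrable_bound[OF integrable_weight]) auto
    have "(\<integral>x. (if x > real J * t then x else 0) \<partial>P) \<le> (\<integral>x. (if x > real n0 then x else 0) \<partial>P)"
      using J(2) by (intro integral_mono int) auto
    then show ?thesis using n0[of n0] by simp
  qed
  show thesis
  proof (rule that[OF km kJ r0 low])
    have rk: "integrable P (\<lambda>x. r (k x))"
    proof (rule Bochner_Integration.integrable_bound[OF integrable_weight])
      show "AE x in P. norm (r (k x)) \<le> norm x" using low r0 by (intro AE_I2) auto
      show "(\<lambda>x. r (k x)) \<in> borel_measurable P"
        unfolding measurable_cong_sets[OF sets_P refl]
        by (rule measurable_weight_spaceI[OF measurable_compose[OF km]]) simp
    qed
    have int: "integrable P (\<lambda>x. if x > c then x else 0)" for c :: real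
      by (rule Bochner_Integration.integrable_bound[OF integrable_weight]) auto
    have "(\<integral>x. x - r (k x) \<partial>P) \<le> (\<integral>x. t + (if x > real J * t then x else 0) \<partial>P)"
      using diff integrable_weight rk int by (intro integral_mono) auto
    also have "\<dots> \<le> \<eta>" using int tailP t by (simp add: P.prob_space)
    finally show "(\<integral>x. x - r (k x) \<partial>P) \<le> \<eta>" .
  next
    fix N :: nat assume N: "N \<ge> 1"
    have "(\<Sum>i=1..N. w i - r (k (w i))) \<le> (\<Sum>i=1..N. t + (if w i > real J * t then w i else 0))"
      using diff w_pos by (intro sum_mono) auto
    also have "\<dots> = real N * t + (\<Sum>i=1..N. if w i > real J * t then w i else 0)" by (simp add: sum.distrib)
    finally have "(\<Sum>i=1..N. w i - r (k (w i))) / real N \<le>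
        (real N * t + (\<Sum>i=1..N. if w i > real J * t then w i else 0)) / real N"
      by (rule divide_right_mono) simp
    also have "\<dots> = t + (\<Sum>i=1..N. if w i > real J * t then w i else 0) / real N"
      using N by (simp add: add_divide_distrib)
    also have "\<dots> \<le> \<eta>" using R1[OF J(1) N] t by linarith
    finally show "(\<Sum>i=1..N. w i - r (k (w i))) / real N \<le> \<eta>" .
  next
    fix j :: nat
    have meas: "{x \<in> space P. x \<le> b} \<in> sets P" for b by measurable
    consider "j = 0" | "1 \<le> j" "j \<le> J" | "J < j" by linarith
    then show "(\<lambda>N. (\<Sum>i=1..N. indicator {j} (k (w i))) / real N :: real) \<longlonglongrightarrow> measure P {x \<in> space P. k x = j}"
    proof cases
      case 1
      have lim: "(\<lambda>N. 1 - (\<Sum>i=1..N. indicator {..real J * t} (w i)) / real N) \<longlonglongrightarrow>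
          1 - measure P {x \<in> space P. x \<le> real J * t}"
        by (intro tendsto_intros freq)
      have compl: "1 - measure P {x \<in> space P. x \<le> real J * t} = measure P {x \<in> space P. k x = j}"
      proof -
        have "{x \<in> space P. k x = j} = space P - {x \<in> space P. x \<le> real J * t}"
          using k0 1 by auto
        then show ?thesis by (simp only: P.prob_compl[OF meas])
      qed
      have "\<forall>\<^sub>F N in sequentially. 1 - (\<Sum>i=1..N. indicator {..real J * t} (w i)) / real N
          = (\<Sum>i=1..N. indicator {j} (k (w i))) / real N"
        using eventually_ge_at_top[of 1]
      proof eventually_elim
        case (elim N)
        have "(\<Sum>i=1..N. indicator {j} (k (w i)) :: real) = (\<Sum>i=1..N. 1 - indicator {..real J * t} (w i))"
          using k0 w_pos 1 by (intro sum.cong) (auto split: split_indicator)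
        then show ?case using elim by (simp add: sum_subtractf diff_divide_distrib)
      qed
      from Lim_transform_eventually[OF lim this] show ?thesis unfolding compl .
    next
      case 2
      define s where "s = real (j - 1) * t"
      have kj: "k x = j \<longleftrightarrow> s < x \<and> x \<le> real j * t" if "x > 0" for x
        unfolding s_def by (rule k_iff[OF 2 that])
      have mono: "s \<le> real j * t" unfolding s_def using t by (intro mult_right_mono) auto
      have freq_s: "(\<lambda>N. (\<Sum>i=1..N. indicator {..s} (w i)) / real N :: real) \<longlonglongrightarrow> measure P {x \<in> space P. x \<le> s}"
        unfolding s_def by (rule freq)
      have "(\<lambda>N. (\<Sum>i=1..N. indicator {..real j * t} (w i)) / real N -
          (\<Sum>i=1..N. indicator {..s} (w i)) / real N :: real) \<longlonglongrightarrow>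
          measure P {x \<in> space P. x \<le> real j * t} - measure P {x \<in> space P. x \<le> s}"
        by (intro tendsto_diff freq freq_s)
      also have "measure P {x \<in> space P. x \<le> real j * t} - measure P {x \<in> space P. x \<le> s}
          = measure P {x \<in> space P. k x = j}"
      proof -
        have "{x \<in> space P. k x = j} = {x \<in> space P. x \<le> real j * t} - {x \<in> space P. x \<le> s}"
        proof (rule set_eqI)
          fix x
          show "x \<in> {x \<in> space P. k x = j} \<longleftrightarrow>
              x \<in> {x \<in> space P. x \<le> real j * t} - {x \<in> space P. x \<le> s}"
            by (cases "x > 0") (simp_all add: kj not_le conj_commute)
        qed
        moreover have "{x \<in> space P. x \<le> s} \<subseteq> {x \<in> space P. x \<le> real j * t}"
          using mono by auto
        ultimately show ?thesis by (simp only: P.finite_measure_Diff[OF meas meas])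
      qed
      also have "(\<lambda>N. (\<Sum>i=1..N. indicator {..real j * t} (w i)) / real N -
          (\<Sum>i=1..N. indicator {..s} (w i)) / real N :: real) =
          (\<lambda>N. (\<Sum>i=1..N. indicator {j} (k (w i))) / real N)"
      proof
        fix N
        have "(\<Sum>i=1..N. indicator {j} (k (w i)) :: real) =
            (\<Sum>i=1..N. indicator {..real j * t} (w i) - indicator {..s} (w i))"
        proof (rule sum.cong)
          fix i assume "i \<in> {1..N}"
          then have "w i > 0" using w_pos by simp
          from kj[OF this] show "(indicator {j} (k (w i)) :: real) = indicator {..real j * t} (w i) - indicator {..s} (w i)"
            using mono by (simp add: indicator_def)
        qed simp
        then show "(\<Sum>i=1..N. indicator {..real j * t} (w i)) / real N -
          (\<Sum>i=1..N. indicator {..s} (w i)) / real N =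
          (\<Sum>i=1..N. indicator {j} (k (w i))) / real N"
          by (simp add: sum_subtractf diff_divide_distrib)
      qed
      finally show ?thesis .
    next
      case 3
      then have "k x \<noteq> j" for x using kJ[of x] by auto
      then show ?thesis by simp
    qed
  qed
qed

end

section \<open>Exponential approximation and grids\<close>

lemma exp_avg_le:
  fixes f :: "nat \<Rightarrow> real"
  assumes "N \<ge> 1"
  shows "exp ((\<Sum>j=1..N. f j) / real N) \<le> (\<Sum>j=1..N. exp (f j)) / real N"
proof -
  have "exp (\<Sum>j\<in>{1..N}. (1 / real N) *\<^sub>R f j) \<le> (\<Sum>j\<in>{1..N}. (1 / real N) * exp (f j))"
    using assms convex_on_exp[of 1] by (intro convex_on_sum[where C=UNIV]) auto
  then show ?thesis by (simp add: sum_divide_distrib)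
qed

lemma (in prob_space) product_nn_integral_prod_const:
  assumes [measurable]: "f \<in> borel_measurable M" and "finite I"
  shows "(\<integral>\<^sup>+x. (\<Prod>i\<in>I. f (x i)) \<partial>(\<Pi>\<^sub>M i\<in>I. M)) = (\<integral>\<^sup>+x. f x \<partial>M) ^ card I"
proof -
  interpret product_sigma_finite "\<lambda>_. M"
    by (simp add: product_sigma_finite_def sigma_finite_measure_axioms)
  show ?thesis using assms by (subst product_nn_integral_prod) auto
qed

text \<open>Points \<open>y\<close> with \<open>\<integral> D(x, y) dx > \<eta>\<close> are rare, and for them \<open>D\<close> is replaced by its upper
  bound \<open>b\<close>. For the others, Jensen's inequality in \<open>j\<close> fixes \<open>\<sigma> j = y\<close>, and the remaining
  factors are independent.\<close>

lemma (in prob_space) exp_pair_sum_bound: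
  fixes D :: "'a \<Rightarrow> 'a \<Rightarrow> real"
  assumes Dm [measurable]: "(\<lambda>(x, y). D x y) \<in> borel_measurable (M \<Otimes>\<^sub>M M)"
    and D: "\<And>x y. 0 \<le> D x y" "\<And>x y. D x y \<le> b"
    and small: "(\<integral>y. (\<integral>x. D x y \<partial>M) \<partial>M) \<le> \<eta>\<^sup>2" and "0 < \<eta>" and t: "0 \<le> t" and N: "N \<ge> 1"
  shows "(\<integral>\<^sup>+\<sigma>. exp (t / real N * (\<Sum>i=1..N. \<Sum>j=1..N. D (\<sigma> i) (\<sigma> j))) \<partial>(\<Pi>\<^sub>M i\<in>{1..N}. M))
    \<le> exp (2 * t * b) * exp (real N * \<eta> * (1 + 2 * t) * exp (2 * t * b))"
proof -
  let ?PM = "\<Pi>\<^sub>M i\<in>{1..N}. M"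
  interpret pair: pair_prob_space M M ..
  interpret PS: product_sigma_finite "\<lambda>_. M"
    by (simp add: product_sigma_finite_def sigma_finite_measure_axioms)
  interpret PP: prob_space ?PM by (rule prob_space_PiM) (rule prob_space_axioms)
  have b0: "0 \<le> b" using D order_trans by blast
  have tb: "0 \<le> 2 * t * b" using t b0 by simp
  define d where "d y = (\<integral>x. D x y \<partial>M)" for y
  have [measurable]: "d \<in> borel_measurable M" unfolding d_def by measurable
  have Dm1 [measurable]: "(\<lambda>x. D x y) \<in> borel_measurable M" if "y \<in> space M" for y
    using measurable_compose[OF measurable_Pair2'[OF that] Dm] by simp
  have intD: "integrable M (\<lambda>x. D x y)" if "y \<in> space M" for y
    using D that by (intro integrable_const_bound[where B=b]) auto
  have d0: "0 \<le> d y" for y unfolding d_def using D by simp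
  have intd: "integrable M d"
  proof (rule integrable_const_bound[where B=b])
    have "d y \<le> b" if "y \<in> space M" for y
      unfolding d_def using integral_mono[OF intD[OF that], of "\<lambda>_. b"] D by (simp add: prob_space)
    then show "AE y in M. norm (d y) \<le> b" using d0 by auto
  qed measurable
  define G where "G = {y \<in> space M. d y > \<eta>}"
  have [measurable]: "G \<in> sets M" unfolding G_def by measurable
  \<comment> \<open>Markov's inequality: the mean of \<open>d\<close> is at most the square of
    \<open>\<eta>\<close>, which leaves one factor \<open>\<eta>\<close>.\<close>
  have PG: "prob G \<le> \<eta>"
  proof -
    have "\<eta> * prob G = (\<integral>y. \<eta> * indicator G y \<partial>M)" by simp
    also have "\<dots> \<le> (\<integral>y. d y \<partial>M)"
    proof (rule integral_mono[OF _ intd])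
      show "integrable M (\<lambda>y. \<eta> * indicator G y)"
        by (intro integrable_mult_right integrable_real_indicator) (auto simp: emeasure_eq_measure)
      show "\<eta> * indicator G y \<le> d y" if "y \<in> space M" for y
        using d0[of y] by (auto simp: G_def split: split_indicator)
    qed
    also have "\<dots> \<le> \<eta> * \<eta>" using small by (simp add: d_def power2_eq_square)
    finally show ?thesis using \<open>0 < \<eta>\<close> by simp
  qed
  \<comment> \<open>\<open>u\<close> carries the second coordinates in \<open>G\<close>,
    \<open>v\<close> the remaining ones. The exponents are doubled because the two contributions are
    separated below by the inequality of arithmetic and geometric means.\<close>
  define u where "u y = exp (2 * t * b * indicator G y)" for y :: 'a
  define v where "v y x = exp (2 * t * (D x y * indicator (- G) y))" for x y
  have um [measurable]: "u \<in> borel_measurable M" unfolding u_def by measurable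
  have vm [measurable]: "(\<lambda>(x, y). v y x) \<in> borel_measurable (M \<Otimes>\<^sub>M M)"
    unfolding v_def by measurable
  have vm1 [measurable]: "v y \<in> borel_measurable M" if "y \<in> space M" for y
    using measurable_compose[OF measurable_Pair2'[OF that] vm] by simp
  have v0: "0 \<le> v y x" for x y by (simp add: v_def)
  have int_u: "(\<integral>\<^sup>+y. u y \<partial>M) \<le> exp (\<eta> * exp (2 * t * b))"
  proof -
    have "(\<integral>\<^sup>+y. u y \<partial>M) \<le> (\<integral>\<^sup>+y. ennreal 1 + ennreal (exp (2 * t * b)) * indicator G y \<partial>M)"
      by (intro nn_integral_mono) (auto simp: u_def split: split_indicator)
    also have "\<dots> = ennreal 1 + ennreal (exp (2 * t * b)) * emeasure M G"
      by (subst nn_integral_add) (auto simp: nn_integral_cmult_indicator emeasure_space_1)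
    also have "\<dots> = ennreal (1 + exp (2 * t * b) * prob G)"
      by (subst ennreal_plus) (auto simp: emeasure_eq_measure ennreal_mult')
    also have "\<dots> \<le> ennreal (1 + \<eta> * exp (2 * t * b))"
      using PG by (intro ennreal_leI) (simp add: mult.commute)
    also have "\<dots> \<le> ennreal (exp (\<eta> * exp (2 * t * b)))"
      by (intro ennreal_leI) (rule exp_ge_add_one_self)
    finally show ?thesis .
  qed
  have int_v: "(\<integral>\<^sup>+x. v y x \<partial>M) \<le> exp (\<eta> * (2 * t) * exp (2 * t * b))" if y: "y \<in> space M" for y
  proof (cases "y \<in> G")
    case True
    then have "(\<integral>\<^sup>+x. v y x \<partial>M) = 1" by (simp add: v_def emeasure_space_1)
    then show ?thesis using \<open>0 < \<eta>\<close> t by simp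
  next
    case False
    then have dy: "d y \<le> \<eta>" using y by (auto simp: G_def)
    \<comment> \<open>From \<open>exp s \<le> 1 + s * exp s\<close>, so the exponential moment is
      controlled by the first moment \<open>d y\<close>, small because \<open>y\<close> lies outside
      \<open>G\<close>.\<close>
    have "v y x \<le> 1 + 2 * t * exp (2 * t * b) * D x y" for x
    proof -
      define s where "s = 2 * t * D x y"
      have s: "0 \<le> s" "s \<le> 2 * t * b" using D t by (auto simp: s_def intro!: mult_left_mono)
      have "1 - s \<le> exp (- s)" using exp_ge_add_one_self[of "-s"] by simp
      then have "exp s * (1 - s) \<le> 1"
        using mult_left_mono[of "1 - s" "exp (-s)" "exp s"] by (simp flip: exp_add)
      then have "exp s \<le> 1 + s * exp s" by (simp add: algebra_simps)
      also have "\<dots> \<le> 1 + s * exp (2 * t * b)" using s by (simp add: mult_left_mono)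
      finally show ?thesis using False by (simp add: v_def s_def mult_ac)
    qed
    then have "(\<integral>\<^sup>+x. v y x \<partial>M) \<le> (\<integral>\<^sup>+x. ennreal (1 + 2 * t * exp (2 * t * b) * D x y) \<partial>M)"
      by (intro nn_integral_mono ennreal_leI)
    also have "\<dots> = ennreal (\<integral>x. 1 + 2 * t * exp (2 * t * b) * D x y \<partial>M)"
      using intD[OF y] D t by (intro nn_integral_eq_integral) auto
    also have "(\<integral>x. 1 + 2 * t * exp (2 * t * b) * D x y \<partial>M) = 1 + 2 * t * exp (2 * t * b) * d y"
      using intD[OF y] by (simp add: d_def prob_space)
    also have "ennreal \<dots> \<le> ennreal (1 + \<eta> * (2 * t) * exp (2 * t * b))"
      using dy t mult_left_mono[OF dy, of "2 * t * exp (2 * t * b)"] by (intro ennreal_leI) (simp add: mult_ac)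
    also have "\<dots> \<le> exp (\<eta> * (2 * t) * exp (2 * t * b))"
      by (intro ennreal_leI) (rule exp_ge_add_one_self)
    finally show ?thesis .
  qed
  define R where "R = exp (2 * t * b) * exp (real N * \<eta> * (1 + 2 * t) * exp (2 * t * b))"
  have [measurable]: "(\<lambda>\<sigma>. D (\<sigma> i) (\<sigma> j)) \<in> borel_measurable ?PM"
    "(\<lambda>\<sigma>. v (\<sigma> j) (\<sigma> i)) \<in> borel_measurable ?PM" if "i \<in> {1..N}" "j \<in> {1..N}" for i j
  proof -
    have "(\<lambda>\<sigma>. (\<sigma> i, \<sigma> j)) \<in> ?PM \<rightarrow>\<^sub>M M \<Otimes>\<^sub>M M" using that by measurable
    from measurable_compose[OF this Dm] measurable_compose[OF this vm]
    show "(\<lambda>\<sigma>. D (\<sigma> i) (\<sigma> j)) \<in> borel_measurable ?PM"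
      "(\<lambda>\<sigma>. v (\<sigma> j) (\<sigma> i)) \<in> borel_measurable ?PM" by simp_all
  qed
  define T where "T j \<sigma> = exp (2 * t * (\<Sum>i=1..N. D (\<sigma> i) (\<sigma> j) * indicator (- G) (\<sigma> j)))" for j \<sigma>
  have [measurable]: "(\<lambda>\<sigma>. indicator (- G) (\<sigma> j) :: real) \<in> borel_measurable ?PM" if "j \<in> {1..N}" for j
  proof -
    have "indicator (- G) \<in> borel_measurable M" by measurable
    from measurable_compose[OF measurable_component_singleton[OF that] this] show ?thesis .
  qed
  have [measurable]: "T j \<in> borel_measurable ?PM" if "j \<in> {1..N}" for j
    unfolding T_def using that by measurable
  have int_T: "(\<integral>\<^sup>+\<sigma>. T j \<sigma> \<partial>?PM) \<le> R" if j: "j \<in> {1..N}" for j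
  proof -
    \<comment> \<open>The index \<open>j\<close> is split off: the pair \<open>(j, j)\<close> costs
      at most the factor \<open>exp (2 * t * b)\<close>, and once the spin at \<open>j\<close> is
      frozen the other factors are independent.\<close>
    define J where "J = {1..N} - {j}"
    have J: "finite J" "j \<notin> J" "insert j J = {1..N}" "card J = N - 1"
      using j by (auto simp: J_def)
    have le: "T j \<sigma> \<le> exp (2 * t * b) * (\<Prod>i\<in>J. v (\<sigma> j) (\<sigma> i))" for \<sigma>
    proof -
      have "T j \<sigma> = (\<Prod>i\<in>insert j J. v (\<sigma> j) (\<sigma> i))"
        unfolding T_def J(3) v_def by (simp only: sum_distrib_left exp_sum finite_atLeastAtMost)
      also have "\<dots> = v (\<sigma> j) (\<sigma> j) * (\<Prod>i\<in>J. v (\<sigma> j) (\<sigma> i))"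
        by (rule prod.insert[OF J(1,2)])
      also have "\<dots> \<le> exp (2 * t * b) * (\<Prod>i\<in>J. v (\<sigma> j) (\<sigma> i))"
      proof (rule mult_right_mono)
        have "2 * t * (D (\<sigma> j) (\<sigma> j) * indicator (- G) (\<sigma> j)) \<le> 2 * t * b"
          using D t b0 by (intro mult_left_mono) (auto split: split_indicator)
        then show "v (\<sigma> j) (\<sigma> j) \<le> exp (2 * t * b)" unfolding v_def by simp
      qed (simp add: prod_nonneg v0)
      finally show ?thesis .
    qed
    have "(\<integral>\<^sup>+\<sigma>. T j \<sigma> \<partial>?PM) \<le> (\<integral>\<^sup>+\<sigma>. ennreal (exp (2 * t * b)) * (\<Prod>i\<in>J. ennreal (v (\<sigma> j) (\<sigma> i))) \<partial>?PM)"
      using le by (intro nn_integral_mono)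
        (simp add: prod_ennreal v0 prod_nonneg ennreal_leI flip: ennreal_mult')
    also have "\<dots> = ennreal (exp (2 * t * b)) * (\<integral>\<^sup>+\<sigma>. (\<Prod>i\<in>J. ennreal (v (\<sigma> j) (\<sigma> i))) \<partial>?PM)"
      using j J_def by (intro nn_integral_cmult) measurable
    also have "(\<integral>\<^sup>+\<sigma>. (\<Prod>i\<in>J. ennreal (v (\<sigma> j) (\<sigma> i))) \<partial>?PM) =
        (\<integral>\<^sup>+y. (\<integral>\<^sup>+\<sigma>. (\<Prod>i\<in>J. ennreal (v ((\<sigma>(j := y)) j) ((\<sigma>(j := y)) i))) \<partial>(\<Pi>\<^sub>M i\<in>J. M)) \<partial>M)"
      unfolding J(3)[symmetric] using j J_def J(3)
      by (intro PS.product_nn_integral_insert_rev J) (simp, measurable)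
    also have "\<dots> = (\<integral>\<^sup>+y. (\<integral>\<^sup>+\<sigma>. (\<Prod>i\<in>J. ennreal (v y (\<sigma> i))) \<partial>(\<Pi>\<^sub>M i\<in>J. M)) \<partial>M)"
      using J(2) by (intro nn_integral_cong prod.cong refl) (auto intro!: prod.cong)
    also have "\<dots> = (\<integral>\<^sup>+y. (\<integral>\<^sup>+x. v y x \<partial>M) ^ card J \<partial>M)"
      using J by (intro nn_integral_cong product_nn_integral_prod_const) auto
    also have "\<dots> \<le> (\<integral>\<^sup>+y. ennreal (exp (\<eta> * (2 * t) * exp (2 * t * b))) ^ card J \<partial>M)"
      using int_v by (intro nn_integral_mono power_mono) auto
    also have "\<dots> = ennreal (exp (\<eta> * (2 * t) * exp (2 * t * b)) ^ (N - 1))"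
      by (simp add: emeasure_space_1 J ennreal_power)
    also have "\<dots> \<le> ennreal (exp (real N * \<eta> * (1 + 2 * t) * exp (2 * t * b)))"
    proof (intro ennreal_leI)
      have "real (N - 1) * (\<eta> * (2 * t) * exp (2 * t * b)) \<le> real N * (\<eta> * (1 + 2 * t) * exp (2 * t * b))"
        using \<open>0 < \<eta>\<close> t N by (intro mult_mono mult_right_mono mult_left_mono) auto
      then show "exp (\<eta> * (2 * t) * exp (2 * t * b)) ^ (N - 1) \<le> exp (real N * \<eta> * (1 + 2 * t) * exp (2 * t * b))"
        by (simp flip: exp_of_nat_mult add: mult_ac)
    qed
    finally show ?thesis
      by (simp add: R_def ennreal_mult' mult_left_mono)
  qed
  have int_U: "(\<integral>\<^sup>+\<sigma>. (\<Prod>j=1..N. ennreal (u (\<sigma> j))) \<partial>?PM) \<le> R"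
  proof -
    have "(\<integral>\<^sup>+\<sigma>. (\<Prod>j=1..N. ennreal (u (\<sigma> j))) \<partial>?PM) = (\<integral>\<^sup>+y. u y \<partial>M) ^ N"
      by (subst product_nn_integral_prod_const) auto
    also have "\<dots> \<le> ennreal (exp (\<eta> * exp (2 * t * b))) ^ N"
      by (rule power_mono[OF int_u]) simp
    also have "\<dots> = ennreal (exp (\<eta> * exp (2 * t * b)) ^ N)"
      by (simp add: ennreal_power)
    also have "\<dots> \<le> R"
    proof (intro ennreal_leI)
      have "real N * (\<eta> * exp (2 * t * b)) \<le> real N * (\<eta> * (1 + 2 * t) * exp (2 * t * b))"
        using \<open>0 < \<eta>\<close> t N by (intro mult_mono mult_right_mono mult_left_mono) auto
      then have "real N * (\<eta> * exp (2 * t * b)) \<le> 2 * t * b + real N * \<eta> * (1 + 2 * t) * exp (2 * t * b)"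
        using tb by (simp add: mult_ac)
      then show "exp (\<eta> * exp (2 * t * b)) ^ N \<le> R"
        by (simp add: R_def flip: exp_of_nat_mult exp_add)
    qed
    finally show ?thesis .
  qed
  have pw: "exp (t / real N * (\<Sum>i=1..N. \<Sum>j=1..N. D (\<sigma> i) (\<sigma> j)))
      \<le> 1 / 2 * (\<Sum>j=1..N. 1 / real N * T j \<sigma>) + 1 / 2 * (\<Prod>j=1..N. u (\<sigma> j))" for \<sigma>
  proof -
    \<comment> \<open>The exponent is at most \<open>(A + B) / 2\<close>. In \<open>exp A\<close>
      the average over \<open>j\<close> is pulled out by convexity, giving the mean of the
      \<open>T j\<close>; \<open>exp B\<close> factorizes over the vertices.\<close>
    define A where "A = (\<Sum>j=1..N. 2 * t * (\<Sum>i=1..N. D (\<sigma> i) (\<sigma> j) * indicator (- G) (\<sigma> j))) / real N"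
    define B where "B = (\<Sum>j=1..N. 2 * t * b * indicator G (\<sigma> j))"
    have "(\<Sum>i=1..N. \<Sum>j=1..N. D (\<sigma> i) (\<sigma> j)) = (\<Sum>j=1..N. \<Sum>i=1..N. D (\<sigma> i) (\<sigma> j))"
      by (rule sum.swap)
    also have "\<dots> \<le> (\<Sum>j=1..N. (\<Sum>i=1..N. D (\<sigma> i) (\<sigma> j) * indicator (- G) (\<sigma> j)) + real N * b * indicator G (\<sigma> j))"
    proof (rule sum_mono)
      fix j
      have "(\<Sum>i=1..N. D (\<sigma> i) (\<sigma> j)) \<le> (\<Sum>i=1..N. D (\<sigma> i) (\<sigma> j) * indicator (- G) (\<sigma> j) + b * indicator G (\<sigma> j))"
        using D by (intro sum_mono) (auto split: split_indicator)
      then show "(\<Sum>i=1..N. D (\<sigma> i) (\<sigma> j)) \<le> (\<Sum>i=1..N. D (\<sigma> i) (\<sigma> j) * indicator (- G) (\<sigma> j)) + real N * b * indicator G (\<sigma> j)"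
        by (simp add: sum.distrib)
    qed
    finally have "t / real N * (\<Sum>i=1..N. \<Sum>j=1..N. D (\<sigma> i) (\<sigma> j)) \<le>
        t / real N * (\<Sum>j=1..N. (\<Sum>i=1..N. D (\<sigma> i) (\<sigma> j) * indicator (- G) (\<sigma> j)) + real N * b * indicator G (\<sigma> j))"
      using t by (intro mult_left_mono) auto
    also have "\<dots> = (A + B) / 2"
      using N by (simp add: A_def B_def sum.distrib sum_distrib_left sum_divide_distrib field_simps)
    finally have "exp (t / real N * (\<Sum>i=1..N. \<Sum>j=1..N. D (\<sigma> i) (\<sigma> j))) \<le> exp (A / 2) * exp (B / 2)"
      by (simp add: add_divide_distrib flip: exp_add)
    also have "\<dots> \<le> 1 / 2 * exp A + 1 / 2 * exp B"
    proof -
      have "exp A = (exp (A / 2))\<^sup>2" "exp B = (exp (B / 2))\<^sup>2"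
        by (simp_all add: power2_eq_square flip: exp_add)
      then show ?thesis using sum_squares_bound[of "exp (A / 2)" "exp (B / 2)"] by linarith
    qed
    also have "exp A \<le> (\<Sum>j=1..N. 1 / real N * T j \<sigma>)"
      unfolding A_def T_def using exp_avg_le[OF N] by (simp add: sum_divide_distrib)
    also have "exp B = (\<Prod>j=1..N. u (\<sigma> j))" by (simp only: B_def u_def exp_sum finite_atLeastAtMost)
    finally show ?thesis by simp
  qed
  have T0: "0 \<le> T j \<sigma>" for j \<sigma> by (simp add: T_def)
  have u0: "0 \<le> u y" for y by (simp add: u_def)
  have "(\<integral>\<^sup>+\<sigma>. exp (t / real N * (\<Sum>i=1..N. \<Sum>j=1..N. D (\<sigma> i) (\<sigma> j))) \<partial>?PM)
      \<le> (\<integral>\<^sup>+\<sigma>. ennreal (1/2) * (\<Sum>j=1..N. ennreal (1 / real N) * ennreal (T j \<sigma>))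
            + ennreal (1/2) * (\<Prod>j=1..N. ennreal (u (\<sigma> j))) \<partial>?PM)"
  proof (rule nn_integral_mono)
    fix \<sigma>
    have "ennreal (1/2) * (\<Sum>j=1..N. ennreal (1 / real N) * ennreal (T j \<sigma>))
            + ennreal (1/2) * (\<Prod>j=1..N. ennreal (u (\<sigma> j)))
      = ennreal (1 / 2 * (\<Sum>j=1..N. 1 / real N * T j \<sigma>) + 1 / 2 * (\<Prod>j=1..N. u (\<sigma> j)))"
    proof -
      have "(\<Sum>j=1..N. ennreal (1 / real N) * ennreal (T j \<sigma>)) = ennreal (\<Sum>j=1..N. 1 / real N * T j \<sigma>)"
        by (subst sum_ennreal[symmetric]) (simp_all add: T0 ennreal_mult del: times_divide_eq_left)
      moreover have "(\<Prod>j=1..N. ennreal (u (\<sigma> j))) = ennreal (\<Prod>j=1..N. u (\<sigma> j))"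
        by (intro prod_ennreal u0)
      moreover have "0 \<le> (\<Sum>j=1..N. 1 / real N * T j \<sigma>)" "0 \<le> (\<Prod>j=1..N. u (\<sigma> j))"
        by (simp_all add: T0 u0 sum_nonneg prod_nonneg)
      ultimately show ?thesis
        by (simp only: ennreal_plus ennreal_mult mult_nonneg_nonneg zero_le_divide_1_iff zero_le_numeral)
    qed
    then show "ennreal (exp (t / real N * (\<Sum>i=1..N. \<Sum>j=1..N. D (\<sigma> i) (\<sigma> j)))) \<le>
        ennreal (1/2) * (\<Sum>j=1..N. ennreal (1 / real N) * ennreal (T j \<sigma>))
            + ennreal (1/2) * (\<Prod>j=1..N. ennreal (u (\<sigma> j)))"
      using pw[of \<sigma>] by (simp only: ennreal_leI)
  qed
  also have "\<dots> = ennreal (1/2) * (\<Sum>j=1..N. ennreal (1 / real N) * (\<integral>\<^sup>+\<sigma>. T j \<sigma> \<partial>?PM))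
      + ennreal (1/2) * (\<integral>\<^sup>+\<sigma>. (\<Prod>j=1..N. ennreal (u (\<sigma> j))) \<partial>?PM)"
  proof -
    have "(\<integral>\<^sup>+\<sigma>. (\<Sum>j=1..N. ennreal (1 / real N) * ennreal (T j \<sigma>)) \<partial>?PM) =
        (\<Sum>j=1..N. \<integral>\<^sup>+\<sigma>. ennreal (1 / real N) * ennreal (T j \<sigma>) \<partial>?PM)"
      by (rule nn_integral_sum) measurable
    also have "\<dots> = (\<Sum>j=1..N. ennreal (1 / real N) * (\<integral>\<^sup>+\<sigma>. T j \<sigma> \<partial>?PM))"
      by (intro sum.cong refl nn_integral_cmult) measurable
    finally have X: "(\<integral>\<^sup>+\<sigma>. (\<Sum>j=1..N. ennreal (1 / real N) * ennreal (T j \<sigma>)) \<partial>?PM) =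
        (\<Sum>j=1..N. ennreal (1 / real N) * (\<integral>\<^sup>+\<sigma>. T j \<sigma> \<partial>?PM))" .
    have mX: "(\<lambda>\<sigma>. \<Sum>j=1..N. ennreal (1 / real N) * ennreal (T j \<sigma>)) \<in> borel_measurable ?PM"
      by (rule borel_measurable_sum) measurable
    have mY: "(\<lambda>\<sigma>. \<Prod>j=1..N. ennreal (u (\<sigma> j))) \<in> borel_measurable ?PM"
      by (rule borel_measurable_prod_ennreal) measurable
    show ?thesis
      unfolding X[symmetric] nn_integral_cmult[OF mX, symmetric] nn_integral_cmult[OF mY, symmetric]
      by (intro nn_integral_add borel_measurable_times_ennreal mX mY borel_measurable_const)
  qed
  also have "\<dots> \<le> ennreal (1/2) * (\<Sum>j=1..N. ennreal (1 / real N) * ennreal R) + ennreal (1/2) * ennreal R"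
    using int_T int_U by (intro add_mono mult_left_mono sum_mono) auto
  also have "\<dots> = ennreal R"
  proof -
    have "R \<ge> 0" by (simp add: R_def)
    then have "ennreal (1/2) * ennreal R + ennreal (1/2) * ennreal R = ennreal (1/2 * R + 1/2 * R)"
      by (simp only: ennreal_plus ennreal_mult mult_nonneg_nonneg zero_le_divide_1_iff zero_le_numeral)
    moreover have "(\<Sum>j=1..N. ennreal (1 / real N) * ennreal R) = ennreal R"
      using N \<open>R \<ge> 0\<close> by (simp add: ennreal_of_nat_eq_real_of_nat flip: ennreal_mult')
    ultimately show ?thesis by simp
  qed
  finally show ?thesis by (simp add: R_def)
qed

section \<open>Approximation in mean by grid functions\<close>

text \<open>A single labelling serves both coordinates, so that the grid comes from one partition of
  the spin space and pair energies depend only on how many spins carry each label.\<close>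

definition grid_approximable :: "'c measure \<Rightarrow> ('c \<times> 'c \<Rightarrow> real) \<Rightarrow> bool" where
  "grid_approximable M f \<longleftrightarrow> (\<forall>e>0. \<exists>a (A::nat) (c :: nat \<Rightarrow> nat \<Rightarrow> real).
     a \<in> M \<rightarrow>\<^sub>M count_space UNIV \<and> (\<forall>x. a x < A) \<and>
     (\<integral>z. \<bar>f z - c (a (fst z)) (a (snd z))\<bar> \<partial>(M \<Otimes>\<^sub>M M)) < e)"

lemma measurable_grid [measurable (raw)]:
  fixes a b :: "'d \<Rightarrow> nat"
  assumes [measurable]: "a \<in> N \<rightarrow>\<^sub>M count_space UNIV" "b \<in> N \<rightarrow>\<^sub>M count_space UNIV"
  shows "(\<lambda>z. c (a z) (b z) :: real) \<in> borel_measurable N"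
proof -
  have "(\<lambda>z. c k (b z)) \<in> borel_measurable N" for k
    using measurable_compose[OF assms(2) measurable_count_space] by simp
  then show ?thesis by (rule measurable_compose_countable'[OF _ assms(1)]) auto
qed

lemma (in prob_space) integrable_grid:
  assumes [measurable]: "a \<in> M \<rightarrow>\<^sub>M count_space UNIV" and A: "\<And>x. a x < (A :: nat)"
  shows "integrable (M \<Otimes>\<^sub>M M) (\<lambda>z. c (a (fst z)) (a (snd z)) :: real)"
proof -
  interpret pair: pair_prob_space M M ..
  have fin: "finite ((\<lambda>(k, l). \<bar>c k l\<bar>) ` ({..<A} \<times> {..<A}))" by auto
  have "\<bar>c (a x) (a y)\<bar> \<le> Max ((\<lambda>(k, l). \<bar>c k l\<bar>) ` ({..<A} \<times> {..<A}))" for x y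
    using A by (intro Max_ge[OF fin]) auto
  then show ?thesis
    by (intro pair.P.integrable_const_bound[where B="Max ((\<lambda>(k, l). \<bar>c k l\<bar>) ` ({..<A} \<times> {..<A}))"])
      auto
qed

context prob_space begin

lemma grid_approximable_limit:
  assumes "integrable (M \<Otimes>\<^sub>M M) f"
    and "\<And>e. e > 0 \<Longrightarrow> \<exists>g. grid_approximable M g \<and> integrable (M \<Otimes>\<^sub>M M) g \<and>
      (\<integral>z. \<bar>f z - g z\<bar> \<partial>(M \<Otimes>\<^sub>M M)) < e"
  shows "grid_approximable M f"
  unfolding grid_approximable_def
proof (intro allI impI)
  fix e :: real assume "e > 0"
  then obtain g where g: "grid_approximable M g" "integrable (M \<Otimes>\<^sub>M M) g"
    "(\<integral>z. \<bar>f z - g z\<bar> \<partial>(M \<Otimes>\<^sub>M M)) < e / 2" using assms(2)[of "e / 2"] by auto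
  from g(1) \<open>e > 0\<close> obtain a and A :: nat and c :: "nat \<Rightarrow> nat \<Rightarrow> real" where
    a [measurable]: "a \<in> M \<rightarrow>\<^sub>M count_space UNIV" and A: "\<And>x. a x < A"
    and c: "(\<integral>z. \<bar>g z - c (a (fst z)) (a (snd z))\<bar> \<partial>(M \<Otimes>\<^sub>M M)) < e / 2"
    unfolding grid_approximable_def by (meson half_gt_zero)
  have int: "integrable (M \<Otimes>\<^sub>M M) (\<lambda>z. c (a (fst z)) (a (snd z)))"
    using a A by (rule integrable_grid)
  have "(\<integral>z. \<bar>f z - c (a (fst z)) (a (snd z))\<bar> \<partial>(M \<Otimes>\<^sub>M M))
      \<le> (\<integral>z. \<bar>f z - g z\<bar> + \<bar>g z - c (a (fst z)) (a (snd z))\<bar> \<partial>(M \<Otimes>\<^sub>M M))"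
    using assms(1) g(2) int by (intro integral_mono) auto
  also have "\<dots> < e" using assms(1) g(2,3) int c by simp
  finally show "\<exists>a (A::nat) (c :: nat \<Rightarrow> nat \<Rightarrow> real).
     a \<in> M \<rightarrow>\<^sub>M count_space UNIV \<and> (\<forall>x. a x < A) \<and>
     (\<integral>z. \<bar>f z - c (a (fst z)) (a (snd z))\<bar> \<partial>(M \<Otimes>\<^sub>M M)) < e"
    using a A by blast
qed

lemma grid_approximable_add:
  assumes "grid_approximable M f" "grid_approximable M g"
    "integrable (M \<Otimes>\<^sub>M M) f" "integrable (M \<Otimes>\<^sub>M M) g"
  shows "grid_approximable M (\<lambda>z. f z + g z)"
  unfolding grid_approximable_def
proof (intro allI impI)
  fix e :: real assume "e > 0"
  from assms(1) \<open>e > 0\<close> obtain a and A :: nat and c :: "nat \<Rightarrow> nat \<Rightarrow> real" where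
    a [measurable]: "a \<in> M \<rightarrow>\<^sub>M count_space UNIV" and A: "\<And>x. a x < A"
    and c: "(\<integral>z. \<bar>f z - c (a (fst z)) (a (snd z))\<bar> \<partial>(M \<Otimes>\<^sub>M M)) < e / 2"
    unfolding grid_approximable_def by (meson half_gt_zero)
  from assms(2) \<open>e > 0\<close> obtain b and B :: nat and d :: "nat \<Rightarrow> nat \<Rightarrow> real" where
    b [measurable]: "b \<in> M \<rightarrow>\<^sub>M count_space UNIV" and B: "\<And>x. b x < B"
    and d: "(\<integral>z. \<bar>g z - d (b (fst z)) (b (snd z))\<bar> \<partial>(M \<Otimes>\<^sub>M M)) < e / 2"
    unfolding grid_approximable_def by (meson half_gt_zero)
  \<comment> \<open>Common refinement of the two partitions: the pair of labels is coded as one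
    number and decoded by \<open>div\<close> and \<open>mod\<close>.\<close>
  define h where "h x = a x * B + b x" for x
  define k where "k i j = c (i div B) (j div B) + d (i mod B) (j mod B)" for i j
  have h: "h \<in> M \<rightarrow>\<^sub>M count_space UNIV" unfolding h_def by measurable
  have hB: "h x < A * B" for x
  proof -
    have "h x < (a x + 1) * B" using B[of x] by (simp add: h_def)
    also have "\<dots> \<le> A * B" using A[of x] by (intro mult_right_mono) auto
    finally show ?thesis .
  qed
  have hk: "k (h x) (h y) = c (a x) (a y) + d (b x) (b y)" for x y
    using B[of x] B[of y] by (simp add: k_def h_def)
  have int: "integrable (M \<Otimes>\<^sub>M M) (\<lambda>z. c (a (fst z)) (a (snd z)))"
    "integrable (M \<Otimes>\<^sub>M M) (\<lambda>z. d (b (fst z)) (b (snd z)))"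
    by (rule integrable_grid[OF a A] integrable_grid[OF b B])+
  have "(\<integral>z. \<bar>f z + g z - k (h (fst z)) (h (snd z))\<bar> \<partial>(M \<Otimes>\<^sub>M M))
      \<le> (\<integral>z. \<bar>f z - c (a (fst z)) (a (snd z))\<bar> + \<bar>g z - d (b (fst z)) (b (snd z))\<bar> \<partial>(M \<Otimes>\<^sub>M M))"
    unfolding hk using assms(3,4) int by (intro integral_mono) auto
  also have "\<dots> < e" using assms(3,4) int c d by simp
  finally show "\<exists>a (A::nat) (c :: nat \<Rightarrow> nat \<Rightarrow> real).
     a \<in> M \<rightarrow>\<^sub>M count_space UNIV \<and> (\<forall>x. a x < A) \<and>
     (\<integral>z. \<bar>f z + g z - c (a (fst z)) (a (snd z))\<bar> \<partial>(M \<Otimes>\<^sub>M M)) < e"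
    using h hB by blast
qed

lemma grid_approximable_cmult:
  assumes "grid_approximable M f"
  shows "grid_approximable M (\<lambda>z. r * f z)"
  unfolding grid_approximable_def
proof (intro allI impI)
  fix e :: real assume "e > 0"
  then have "e / (\<bar>r\<bar> + 1) > 0" by simp
  with assms obtain a and A :: nat and c :: "nat \<Rightarrow> nat \<Rightarrow> real" where
    a [measurable]: "a \<in> M \<rightarrow>\<^sub>M count_space UNIV" and A: "\<And>x. a x < A"
    and c: "(\<integral>z. \<bar>f z - c (a (fst z)) (a (snd z))\<bar> \<partial>(M \<Otimes>\<^sub>M M)) < e / (\<bar>r\<bar> + 1)" (is "?I < _")
    unfolding grid_approximable_def by meson
  have "(\<integral>z. \<bar>r * f z - r * c (a (fst z)) (a (snd z))\<bar> \<partial>(M \<Otimes>\<^sub>M M)) = \<bar>r\<bar> * ?I"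
    by (simp flip: right_diff_distrib integral_mult_right_zero add: abs_mult)
  also have "\<dots> \<le> (\<bar>r\<bar> + 1) * ?I"
    by (intro mult_right_mono) auto
  also have "\<dots> < e" using c by (simp add: field_simps)
  finally show "\<exists>a (A::nat) (c :: nat \<Rightarrow> nat \<Rightarrow> real).
     a \<in> M \<rightarrow>\<^sub>M count_space UNIV \<and> (\<forall>x. a x < A) \<and>
     (\<integral>z. \<bar>r * f z - c (a (fst z)) (a (snd z))\<bar> \<partial>(M \<Otimes>\<^sub>M M)) < e"
    using a A by (intro exI[of _ a] exI[of _ A] exI[of _ "\<lambda>i j. r * c i j"]) auto
qed

text \<open>Dynkin's argument: the good sets contain the rectangles and are closed under complements
  and disjoint countable unions, the latter because finite partial unions are close in
  measure.\<close>

lemma grid_approximable_indicator: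
  assumes "S \<in> sets (M \<Otimes>\<^sub>M M)"
  shows "grid_approximable M (indicator S)"
proof -
  interpret pair: pair_prob_space M M ..
  have const: "grid_approximable M (\<lambda>_. r)" for r
    unfolding grid_approximable_def
    by (intro allI impI exI[of _ "\<lambda>_. 0"] exI[of _ 1] exI[of _ "\<lambda>_ _. r"]) auto
  have int: "integrable (M \<Otimes>\<^sub>M M) (indicator S :: _ \<Rightarrow> real)" if "S \<in> sets (M \<Otimes>\<^sub>M M)" for S
    using that by (intro integrable_real_indicator) (auto simp: pair.P.emeasure_eq_measure)
  have "S \<in> sigma_sets (space M \<times> space M) {A \<times> B |A B. A \<in> sets M \<and> B \<in> sets M}"
    using assms by (simp add: sets_pair_measure)
  with Int_stable_pair_measure_generator pair_measure_closed show ?thesis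
  proof (induction S rule: sigma_sets_induct_disjoint)
    case (basic S)
    then obtain A B where [measurable]: "A \<in> sets M" "B \<in> sets M" and S: "S = A \<times> B" by auto
    \<comment> \<open>Two bits record membership in \<open>A\<close> and in \<open>B\<close>, so the
      same label can be used on both sides of the rectangle.\<close>
    define a where "a x = (if x \<in> A then 2 else 0) + (if x \<in> B then 1 else 0 :: nat)" for x
    have "a \<in> M \<rightarrow>\<^sub>M count_space UNIV" unfolding a_def by measurable
    moreover have "a x < 4" for x by (simp add: a_def)
    moreover have "(indicator S z :: real) = (if a (fst z) \<ge> 2 \<and> odd (a (snd z)) then 1 else 0)" for z
      by (cases z) (auto simp: S a_def split: split_indicator)
    ultimately show ?case
      unfolding grid_approximable_def
      by (intro allI impI exI[of _ a] exI[of _ 4] exI[of _ "\<lambda>i j. if i \<ge> 2 \<and> odd j then 1 else 0"]) auto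
  next
    case empty
    then show ?case using const[of 0] by (simp add: indicator_def)
  next
    case (compl S)
    then have S: "S \<in> sets (M \<Otimes>\<^sub>M M)" by (simp add: sets_pair_measure)
    have "grid_approximable M (\<lambda>z. 1 + (-1) * indicator S z)"
      using compl(2) S int by (intro grid_approximable_add grid_approximable_cmult const) auto
    moreover have "(\<integral>z. \<bar>indicator (space M \<times> space M - S) z - (1 + (-1) * indicator S z)\<bar> \<partial>(M \<Otimes>\<^sub>M M)) =
        (\<integral>z. (0::real) \<partial>(M \<Otimes>\<^sub>M M))"
      by (intro Bochner_Integration.integral_cong) (auto simp: space_pair_measure split: split_indicator)
    moreover have "integrable (M \<Otimes>\<^sub>M M) (\<lambda>z. 1 + (-1) * indicator S z :: real)"
      using int[OF S] by auto
    moreover have "space M \<times> space M - S \<in> sets (M \<Otimes>\<^sub>M M)"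
      using S by (simp flip: space_pair_measure)
    ultimately show ?case
      by (intro grid_approximable_limit int) (auto intro!: exI[of _ "\<lambda>z. 1 + (-1) * indicator S z"])
  next
    case (union F)
    have F: "F i \<in> sets (M \<Otimes>\<^sub>M M)" for i using union(2) by (auto simp: sets_pair_measure)
    have sums: "(\<lambda>i. measure (M \<Otimes>\<^sub>M M) (F i)) sums measure (M \<Otimes>\<^sub>M M) (\<Union>i. F i)"
      using F union(1) by (intro pair.P.finite_measure_UNION) auto
    show ?case
    proof (rule grid_approximable_limit)
      show "integrable (M \<Otimes>\<^sub>M M) (indicator (\<Union>i. F i) :: _ \<Rightarrow> real)"
        using F by (intro int) auto
      fix e :: real assume "e > 0"
      with sums obtain n where n: "\<bar>(\<Sum>i<n. measure (M \<Otimes>\<^sub>M M) (F i)) - measure (M \<Otimes>\<^sub>M M) (\<Union>i. F i)\<bar> < e"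
        unfolding sums_def by (metis LIMSEQ_D order_refl real_norm_def)
      define g :: "_ \<Rightarrow> real" where "g z = (\<Sum>i<n. indicator (F i) z)" for z
      have ga: "grid_approximable M g"
      proof -
        have "grid_approximable M (\<lambda>z. \<Sum>i<m. indicator (F i) z)" for m
          by (induction m) (use const union(3) F int in \<open>auto intro!: grid_approximable_add\<close>)
        then show ?thesis by (simp add: g_def[abs_def])
      qed
      have ig: "integrable (M \<Otimes>\<^sub>M M) g" unfolding g_def using int F by auto
      have le: "g z \<le> indicator (\<Union>i. F i) z" for z
      proof -
        have "g z = indicator (\<Union>i<n. F i) z"
          unfolding g_def using union(1) by (intro indicator_UN_disjoint[symmetric])
            (auto simp: disjoint_family_on_def)
        then show ?thesis by (auto split: split_indicator)
      qed
      have "(\<integral>z. \<bar>indicator (\<Union>i. F i) z - g z\<bar> \<partial>(M \<Otimes>\<^sub>M M)) =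
          (\<integral>z. indicator (\<Union>i. F i) z - g z \<partial>(M \<Otimes>\<^sub>M M))"
        by (intro Bochner_Integration.integral_cong refl abs_of_nonneg) (simp only: diff_ge_0_iff_ge le)
      also have "\<dots> = measure (M \<Otimes>\<^sub>M M) (\<Union>i. F i) - (\<Sum>i<n. measure (M \<Otimes>\<^sub>M M) (F i))"
        using ig int F unfolding g_def by (subst Bochner_Integration.integral_diff) auto
      also have "\<dots> < e" using n by linarith
      finally show "\<exists>g. grid_approximable M g \<and> integrable (M \<Otimes>\<^sub>M M) g \<and>
          (\<integral>z. \<bar>indicator (\<Union>i. F i) z - g z\<bar> \<partial>(M \<Otimes>\<^sub>M M)) < e"
        using ga ig by blast
    qed
  qed
qed

lemma integrable_grid_approximable:
  assumes "integrable (M \<Otimes>\<^sub>M M) f"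
  shows "grid_approximable M f"
  using assms
proof (induction f rule: integrable_induct)
  case (base S r)
  then show ?case using grid_approximable_cmult[OF grid_approximable_indicator, of S r]
    by (simp add: mult.commute)
next
  case (add f g)
  then show ?case by (intro grid_approximable_add) auto
next
  case (lim f s)
  show ?case
  proof (rule grid_approximable_limit[OF lim.hyps(4)])
    fix e :: real assume "e > 0"
    have fm [measurable]: "f \<in> borel_measurable (M \<Otimes>\<^sub>M M)" "\<And>i. s i \<in> borel_measurable (M \<Otimes>\<^sub>M M)"
      using lim.hyps(1,4) by auto
    have "(\<lambda>i. \<integral>z. \<bar>f z - s i z\<bar> \<partial>(M \<Otimes>\<^sub>M M)) \<longlonglongrightarrow> (\<integral>z. 0 \<partial>(M \<Otimes>\<^sub>M M))"
    proof (rule integral_dominated_convergence[where w="\<lambda>z. 3 * \<bar>f z\<bar>"])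
      show "AE z in M \<Otimes>\<^sub>M M. (\<lambda>i. \<bar>f z - s i z\<bar>) \<longlonglongrightarrow> 0"
      proof (rule AE_I2)
        fix z assume "z \<in> space (M \<Otimes>\<^sub>M M)"
        then have "(\<lambda>i. f z - s i z) \<longlonglongrightarrow> f z - f z" by (intro tendsto_intros lim.hyps(2))
        then show "(\<lambda>i. \<bar>f z - s i z\<bar>) \<longlonglongrightarrow> 0" by (intro tendsto_rabs_zero) simp
      qed
      show "AE z in M \<Otimes>\<^sub>M M. norm \<bar>f z - s i z\<bar> \<le> 3 * \<bar>f z\<bar>" for i
      proof (rule AE_I2)
        fix z assume "z \<in> space (M \<Otimes>\<^sub>M M)"
        then have "\<bar>s i z\<bar> \<le> 2 * \<bar>f z\<bar>" using lim.hyps(3)[of z i] by simp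
        then show "norm \<bar>f z - s i z\<bar> \<le> 3 * \<bar>f z\<bar>" by simp
      qed
      show "integrable (M \<Otimes>\<^sub>M M) (\<lambda>z. 3 * \<bar>f z\<bar>)"
        by (intro integrable_mult_right integrable_abs lim.hyps(4))
    qed measurable
    then have "\<forall>\<^sub>F i in sequentially. (\<integral>z. \<bar>f z - s i z\<bar> \<partial>(M \<Otimes>\<^sub>M M)) < e"
      using \<open>e > 0\<close> by (intro order_tendstoD) auto
    then obtain i where "(\<integral>z. \<bar>f z - s i z\<bar> \<partial>(M \<Otimes>\<^sub>M M)) < e"
      by (auto simp: eventually_sequentially)
    then show "\<exists>g. grid_approximable M g \<and> integrable (M \<Otimes>\<^sub>M M) g \<and> (\<integral>z. \<bar>f z - g z\<bar> \<partial>(M \<Otimes>\<^sub>M M)) < e"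
      using lim.hyps(1) lim.IH by blast
  qed
qed

end

text \<open>Labels of null cells are merged into that of a cell of positive measure, and the coefficients
  are replaced by the cell averages of \<open>f\<close>, i.e. by its conditional expectation, which at most
  doubles the error. Thus densities that are constant on cells cannot distinguish \<open>f\<close> from \<open>c\<close>.\<close>

lemma (in prob_space) grid_conditional_expectation:
  fixes f :: "'a \<Rightarrow> 'a \<Rightarrow> real"
  assumes fm [measurable]: "(\<lambda>(x, y). f x y) \<in> borel_measurable (M \<Otimes>\<^sub>M M)"
    and f: "\<And>x y. 0 \<le> f x y" "\<And>x y. f x y \<le> C" and "0 < \<eta>"
  obtains a :: "'a \<Rightarrow> nat" and A :: nat and c :: "nat \<Rightarrow> nat \<Rightarrow> real"
  where "a \<in> M \<rightarrow>\<^sub>M count_space UNIV" "\<And>x. a x < A" "\<And>x. 0 < prob {y \<in> space M. a y = a x}"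
    "\<And>k l. (\<integral>z. f (fst z) (snd z) * indicator {k} (a (fst z)) * indicator {l} (a (snd z)) \<partial>(M \<Otimes>\<^sub>M M))
        = c k l * prob {y \<in> space M. a y = k} * prob {y \<in> space M. a y = l}"
    "\<And>k l. 0 \<le> c k l" "\<And>k l. c k l \<le> C"
    "(\<integral>z. \<bar>f (fst z) (snd z) - c (a (fst z)) (a (snd z))\<bar> \<partial>(M \<Otimes>\<^sub>M M)) \<le> \<eta>"
proof -
  interpret pair: pair_prob_space M M ..
  let ?MM = "M \<Otimes>\<^sub>M M"
  define g where "g z = f (fst z) (snd z)" for z
  have [measurable]: "g \<in> borel_measurable ?MM" using fm by (simp add: g_def[abs_def] case_prod_beta')
  have g: "0 \<le> g z" "g z \<le> C" for z using f by (auto simp: g_def)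
  have C0: "0 \<le> C" using g order_trans by blast
  have int_g: "integrable ?MM g" using g by (intro pair.P.integrable_const_bound[where B=C]) auto
  then have "grid_approximable M g" by (rule integrable_grid_approximable)
  then obtain a' and A :: nat and c' :: "nat \<Rightarrow> nat \<Rightarrow> real" where
    a' [measurable]: "a' \<in> M \<rightarrow>\<^sub>M count_space UNIV" and A': "\<And>x. a' x < A"
    and c': "(\<integral>z. \<bar>g z - c' (a' (fst z)) (a' (snd z))\<bar> \<partial>?MM) < \<eta> / 2"
    unfolding grid_approximable_def using \<open>0 < \<eta>\<close> by (meson half_gt_zero)
  define p' where "p' k = prob {y \<in> space M. a' y = k}" for k
  have "\<exists>k. p' k > 0"
  proof (rule ccontr)
    assume "\<not> ?thesis"
    then have p0: "p' k = 0" for k using measure_nonneg[of M] by (auto simp: p'_def not_less intro: antisym)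
    have "prob (\<Union>k<A. {y \<in> space M. a' y = k}) \<le> (\<Sum>k<A. prob {y \<in> space M. a' y = k})"
      by (intro finite_measure_subadditive_finite) auto
    also have "\<dots> = 0" using p0 by (simp add: p'_def)
    also have "(\<Union>k<A. {y \<in> space M. a' y = k}) = space M" using A' by auto
    finally show False by (simp add: prob_space)
  qed
  then obtain k0 where k0: "p' k0 > 0" ..
  define a where "a x = (if p' (a' x) > 0 then a' x else k0)" for x
  have a [measurable]: "a \<in> M \<rightarrow>\<^sub>M count_space UNIV"
    unfolding a_def using measurable_compose[OF a' measurable_count_space] by simp
  have A: "a x < Suc (max A k0)" for x using A'[of x] by (auto simp: a_def)
  have AE_a: "AE x in M. a x = a' x"
  proof -
    have "AE x in M. p' (a' x) \<noteq> 0"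
    proof -
      have "AE x in M. a' x \<noteq> k" if "p' k = 0" for k
        using that by (subst AE_iff_measurable[OF _ refl]) (auto simp: p'_def emeasure_eq_measure)
      then have "AE x in M. \<forall>k\<in>{k. p' k = 0}. a' x \<noteq> k"
        by (subst AE_ball_countable) auto
      then show ?thesis by eventually_elim auto
    qed
    then show ?thesis by eventually_elim (auto simp: a_def p'_def zero_less_measure_iff)
  qed
  define p where "p k = prob {y \<in> space M. a y = k}" for k
  have p_eq: "p k = p' k" for k
    unfolding p_def p'_def using AE_a by (intro finite_measure_eq_AE) auto
  have p_pos: "p (a x) > 0" for x using k0 by (simp add: p_eq a_def)
  define I where "I k l z = indicator {k} (a (fst z)) * (indicator {l} (a (snd z)) :: real)" for k l and z :: "'a \<times> 'a"
  have Im [measurable]: "I k l \<in> borel_measurable ?MM" for k l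
    unfolding I_def by measurable
  have I01: "0 \<le> I k l z" "I k l z \<le> 1" for k l z by (auto simp: I_def split: split_indicator)
  have int_I: "integrable ?MM (\<lambda>z. u z * I k l z)" if "integrable ?MM u" for u k l
  proof (rule Bochner_Integration.integrable_bound[OF that])
    show "(\<lambda>z. u z * I k l z) \<in> borel_measurable ?MM"
      by (intro borel_measurable_times borel_measurable_integrable[OF that] Im)
    show "AE z in ?MM. norm (u z * I k l z) \<le> norm (u z)"
      using I01 by (intro AE_I2) (simp add: abs_mult mult_left_le)
  qed
  have I_int: "(\<integral>z. I k l z \<partial>?MM) = p k * p l" for k l
  proof -
    let ?E = "\<lambda>k. {y \<in> space M. a y = k}"
    have E: "?E k \<in> sets M" for k by measurable
    have "I k l z = indicator (?E k \<times> ?E l) z" if "z \<in> space ?MM" for z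
      using that by (cases z) (simp add: I_def indicator_def space_pair_measure)
    then have "(\<integral>z. I k l z \<partial>?MM) = (\<integral>z. indicator (?E k \<times> ?E l) z \<partial>?MM)"
      by (rule Bochner_Integration.integral_cong[OF refl])
    also have "\<dots> = measure ?MM (?E k \<times> ?E l)"
      using sets.sets_into_space[OF pair_measureI[OF E[of k] E[of l]]] by (simp add: Int_absorb2)
    also have "\<dots> = p k * p l"
      unfolding p_def measure_def emeasure_pair_measure_Times[OF E E] by (rule enn2real_mult)
    finally show ?thesis .
  qed
  \<comment> \<open>On null cells the quotient is \<open>0\<close> by the convention for division,
    which respects both bounds and the integral identity.\<close>
  define c where "c k l = (\<integral>z. g z * I k l z \<partial>?MM) / (p k * p l)" for k l
  have p0: "0 \<le> p k" for k by (simp add: p_def)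
  have gI: "0 \<le> (\<integral>z. g z * I k l z \<partial>?MM)" "(\<integral>z. g z * I k l z \<partial>?MM) \<le> C * (p k * p l)" for k l
  proof -
    show "0 \<le> (\<integral>z. g z * I k l z \<partial>?MM)" using g I01 by (intro integral_nonneg_AE) auto
    have "(\<integral>z. g z * I k l z \<partial>?MM) \<le> (\<integral>z. C * I k l z \<partial>?MM)"
      using g I01 by (intro integral_mono int_I int_g mult_right_mono) auto
    then show "(\<integral>z. g z * I k l z \<partial>?MM) \<le> C * (p k * p l)" by (simp add: I_int)
  qed
  have c_eq: "(\<integral>z. g z * I k l z \<partial>?MM) = c k l * (p k * p l)" for k l
  proof (cases "p k * p l = 0")
    case True
    then show ?thesis using gI[of k l] by (simp only: mult_zero_right)
  qed (simp add: c_def)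
  have c0: "0 \<le> c k l" for k l using gI p0 by (simp add: c_def)
  have cC: "c k l \<le> C" for k l
  proof (cases "p k * p l = 0")
    case True
    then show ?thesis unfolding c_def using C0 by (simp only: div_by_0)
  next
    case False
    then have "0 < p k * p l" using mult_nonneg_nonneg[OF p0 p0, of k l] by linarith
    then show ?thesis unfolding c_def using gI(2)[of k l] by (simp only: pos_divide_le_eq)
  qed
  define B where "B = Suc (max A k0)"
  define v where "v z = c' (a (fst z)) (a (snd z))" for z
  have AE_aa: "AE z in ?MM. a (fst z) = a' (fst z) \<and> a (snd z) = a' (snd z)"
  proof -
    define E where "E = {x \<in> space M. real (a x) = real (a' x)}"
    have E: "E \<in> sets M"
      unfolding E_def by (intro borel_measurable_eq measurable_compose[OF a] measurable_compose[OF a']) auto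
    have "AE x in M. AE y in M. (x, y) \<in> E \<times> E"
      using AE_a AE_space
    proof eventually_elim
      case (elim x)
      show ?case using AE_a AE_space by eventually_elim (simp add: E_def elim)
    qed
    moreover have "{z \<in> space ?MM. z \<in> E \<times> E} = space ?MM \<inter> (E \<times> E)" by auto
    ultimately have "AE z in ?MM. z \<in> E \<times> E"
      using sets.Int[OF sets.top pair_measureI[OF E E]] by (intro pair.AE_pair_measure) auto
    then show ?thesis by eventually_elim (auto simp: E_def)
  qed
  have gv: "(\<integral>z. \<bar>g z - v z\<bar> \<partial>?MM) < \<eta> / 2"
  proof -
    have "(\<integral>z. \<bar>g z - v z\<bar> \<partial>?MM) = (\<integral>z. \<bar>g z - c' (a' (fst z)) (a' (snd z))\<bar> \<partial>?MM)"
      unfolding v_def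
    proof (rule integral_cong_AE)
      show "AE z in ?MM. \<bar>g z - c' (a (fst z)) (a (snd z))\<bar> = \<bar>g z - c' (a' (fst z)) (a' (snd z))\<bar>"
        using AE_aa by eventually_elim simp
    qed measurable
    then show ?thesis using c' by simp
  qed
  have int_v: "integrable ?MM v" unfolding v_def using a A by (rule integrable_grid)
  have int_c: "integrable ?MM (\<lambda>z. u (a (fst z)) (a (snd z)))" for u :: "nat \<Rightarrow> nat \<Rightarrow> real"
    using a A by (rule integrable_grid)
  have sumI: "u (a (fst z)) (a (snd z)) = (\<Sum>k<B. \<Sum>l<B. u k l * I k l z)" for u :: "nat \<Rightarrow> nat \<Rightarrow> real" and z
  proof -
    have "(\<Sum>k<B. \<Sum>l<B. u k l * I k l z) = (\<Sum>k<B. \<Sum>l<B. if a (snd z) = l then (if a (fst z) = k then u k l else 0) else 0)"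
      by (intro sum.cong refl) (auto simp: I_def split: split_indicator)
    also have "\<dots> = u (a (fst z)) (a (snd z))"
      using A[of "fst z"] A[of "snd z"] by (simp add: B_def)
    finally show ?thesis by simp
  qed
  have sum1: "(\<Sum>k<B. \<Sum>l<B. I k l z) = 1" for z using sumI[of "\<lambda>_ _. 1" z] by simp
  \<comment> \<open>Conditional expectation contracts the distance in mean: \<open>v\<close> is
    constant on each product cell, and there \<open>c\<close> is the average of \<open>g\<close>, so
    the integral of \<open>\<bar>v - c\<bar>\<close> is the absolute value of the integral of
    \<open>v - g\<close>.\<close>
  have vc: "(\<integral>z. \<bar>v z - c (a (fst z)) (a (snd z))\<bar> \<partial>?MM) \<le> (\<integral>z. \<bar>g z - v z\<bar> \<partial>?MM)"
  proof -
    have "(\<integral>z. \<bar>v z - c (a (fst z)) (a (snd z))\<bar> \<partial>?MM) = (\<integral>z. (\<Sum>k<B. \<Sum>l<B. \<bar>c' k l - c k l\<bar> * I k l z) \<partial>?MM)"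
      unfolding v_def by (simp flip: sumI[of "\<lambda>k l. \<bar>c' k l - c k l\<bar>"])
    also have "\<dots> = (\<Sum>k<B. \<Sum>l<B. \<bar>c' k l - c k l\<bar> * (p k * p l))"
      using int_I[of "\<lambda>_. 1"] by (simp add: integral_sum I_int)
    also have "\<dots> \<le> (\<Sum>k<B. \<Sum>l<B. (\<integral>z. \<bar>g z - v z\<bar> * I k l z \<partial>?MM))"
    proof (intro sum_mono)
      fix k l
      have "\<bar>c' k l - c k l\<bar> * (p k * p l) = \<bar>(c' k l - c k l) * (p k * p l)\<bar>"
        using p0 by (simp add: abs_mult)
      also have "(c' k l - c k l) * (p k * p l) = (\<integral>z. c' k l * I k l z \<partial>?MM) - (\<integral>z. g z * I k l z \<partial>?MM)"
        by (simp add: I_int c_eq left_diff_distrib)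
      also have "\<dots> = (\<integral>z. c' k l * I k l z - g z * I k l z \<partial>?MM)"
        using int_I[of "\<lambda>_. c' k l"] int_I[OF int_g] by simp
      also have "\<dots> = (\<integral>z. (v z - g z) * I k l z \<partial>?MM)"
        by (intro Bochner_Integration.integral_cong refl) (auto simp: v_def I_def split: split_indicator)
      also have "\<bar>\<dots>\<bar> \<le> (\<integral>z. \<bar>(v z - g z) * I k l z\<bar> \<partial>?MM)"
        by (rule integral_abs_bound)
      also have "\<dots> = (\<integral>z. \<bar>g z - v z\<bar> * I k l z \<partial>?MM)"
        using I01 by (simp add: abs_mult abs_minus_commute)
      finally show "\<bar>c' k l - c k l\<bar> * (p k * p l) \<le> (\<integral>z. \<bar>g z - v z\<bar> * I k l z \<partial>?MM)" .
    qed
    also have "\<dots> = (\<integral>z. (\<Sum>k<B. \<Sum>l<B. \<bar>g z - v z\<bar> * I k l z) \<partial>?MM)"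
      using int_g int_v by (simp add: integral_sum int_I)
    also have "\<dots> = (\<integral>z. \<bar>g z - v z\<bar> \<partial>?MM)"
      by (simp add: sum1 flip: sum_distrib_left)
    finally show ?thesis .
  qed
  have "(\<integral>z. \<bar>g z - c (a (fst z)) (a (snd z))\<bar> \<partial>?MM)
      \<le> (\<integral>z. \<bar>g z - v z\<bar> + \<bar>v z - c (a (fst z)) (a (snd z))\<bar> \<partial>?MM)"
    using int_g int_v int_c by (intro integral_mono) auto
  also have "\<dots> = (\<integral>z. \<bar>g z - v z\<bar> \<partial>?MM) + (\<integral>z. \<bar>v z - c (a (fst z)) (a (snd z))\<bar> \<partial>?MM)"
    using int_g int_v int_c by simp
  also have "\<dots> \<le> \<eta>" using gv vc by simp
  finally have L1: "(\<integral>z. \<bar>f (fst z) (snd z) - c (a (fst z)) (a (snd z))\<bar> \<partial>?MM) \<le> \<eta>" by (simp add: g_def)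
  show thesis
    by (rule that[OF a A _ _ c0 cC L1])
      (use p_pos c_eq in \<open>auto simp: p_def I_def g_def mult.assoc\<close>)
qed

section \<open>Product measures and the Gibbs variational principle\<close>

lemma distr_PiM_pair:
  assumes M: "\<And>i. prob_space (M i)" and I: "finite I" "i \<in> I" "j \<in> I" "i \<noteq> j"
  shows "distr (Pi\<^sub>M I M) (M i \<Otimes>\<^sub>M M j) (\<lambda>\<sigma>. (\<sigma> i, \<sigma> j)) = M i \<Otimes>\<^sub>M M j"
proof -
  interpret product_prob_space M
    using M by (intro product_prob_spaceI)
  have m: "(\<lambda>\<sigma>. (\<sigma> i, \<sigma> j)) \<in> Pi\<^sub>M I M \<rightarrow>\<^sub>M M i \<Otimes>\<^sub>M M j"
    using I by measurable
  have "M i \<Otimes>\<^sub>M M j = distr (Pi\<^sub>M I M) (M i \<Otimes>\<^sub>M M j) (\<lambda>\<sigma>. (\<sigma> i, \<sigma> j))"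
  proof (rule pair_measure_eqI)
    fix A B assume A: "A \<in> sets (M i)" and B: "B \<in> sets (M j)"
    define X where "X k = (if k = i then A else B)" for k
    have "(\<lambda>\<sigma>. (\<sigma> i, \<sigma> j)) -` (A \<times> B) \<inter> space (Pi\<^sub>M I M) = emb I {i, j} (Pi\<^sub>E {i, j} X)"
      using I by (auto simp: prod_emb_def space_PiM X_def PiE_iff split: if_splits)
    moreover have "emeasure (Pi\<^sub>M I M) (emb I {i, j} (Pi\<^sub>E {i, j} X)) = (\<Prod>k\<in>{i, j}. emeasure (M k) (X k))"
      using I A B by (intro emeasure_PiM_emb) (auto simp: X_def)
    moreover have "\<dots> = emeasure (M i) A * emeasure (M j) B"
      using I(4) by (simp add: X_def)
    ultimately show "emeasure (M i) A * emeasure (M j) B =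
        emeasure (distr (Pi\<^sub>M I M) (M i \<Otimes>\<^sub>M M j) (\<lambda>\<sigma>. (\<sigma> i, \<sigma> j))) (A \<times> B)"
      using A B by (simp add: emeasure_distr[OF m])
  qed (auto simp: M prob_space_imp_sigma_finite)
  then show ?thesis by simp
qed

lemma (in prob_space) density_PiM_prod:
  fixes h :: "'i \<Rightarrow> 'a \<Rightarrow> real"
  assumes I: "finite I" and h [measurable]: "\<And>i. h i \<in> borel_measurable M"
    and h0: "\<And>i x. 0 \<le> h i x" and h1: "\<And>i. prob_space (density M (h i))"
  shows "density (\<Pi>\<^sub>M i\<in>I. M) (\<lambda>\<sigma>. \<Prod>i\<in>I. h i (\<sigma> i)) = (\<Pi>\<^sub>M i\<in>I. density M (h i))"
proof -
  interpret D: product_prob_space "\<lambda>i. density M (h i)" using h1 by (intro product_prob_spaceI)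
  interpret PS: product_sigma_finite "\<lambda>_. M"
    by (simp add: product_sigma_finite_def sigma_finite_measure_axioms)
  have [measurable]: "(\<lambda>\<sigma>. ennreal (\<Prod>i\<in>I. h i (\<sigma> i))) \<in> borel_measurable (\<Pi>\<^sub>M i\<in>I. M)"
    by measurable
  show ?thesis
  proof (rule D.PiM_eqI[OF I])
    show "sets (density (\<Pi>\<^sub>M i\<in>I. M) (\<lambda>\<sigma>. \<Prod>i\<in>I. h i (\<sigma> i))) = sets (\<Pi>\<^sub>M i\<in>I. density M (h i))"
      by (simp cong: sets_PiM_cong)
    fix A assume A: "\<And>i. i \<in> I \<Longrightarrow> A i \<in> sets (density M (h i))"
    then have [measurable]: "\<And>i. i \<in> I \<Longrightarrow> A i \<in> sets M" by simp
    have "Pi\<^sub>E I A \<in> sets (\<Pi>\<^sub>M i\<in>I. M)" using I A by (intro sets_PiM_I_finite) auto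
    then have "emeasure (density (\<Pi>\<^sub>M i\<in>I. M) (\<lambda>\<sigma>. \<Prod>i\<in>I. h i (\<sigma> i))) (Pi\<^sub>E I A) =
        (\<integral>\<^sup>+\<sigma>. ennreal (\<Prod>i\<in>I. h i (\<sigma> i)) * indicator (Pi\<^sub>E I A) \<sigma> \<partial>(\<Pi>\<^sub>M i\<in>I. M))"
      by (intro emeasure_density) auto
    also have "\<dots> = (\<integral>\<^sup>+\<sigma>. (\<Prod>i\<in>I. ennreal (h i (\<sigma> i)) * indicator (A i) (\<sigma> i)) \<partial>(\<Pi>\<^sub>M i\<in>I. M))"
    proof (rule nn_integral_cong)
      fix \<sigma> assume "\<sigma> \<in> space (\<Pi>\<^sub>M i\<in>I. M)"
      then have "indicator (Pi\<^sub>E I A) \<sigma> = (\<Prod>i\<in>I. indicator (A i) (\<sigma> i) :: ennreal)"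
        using I by (auto simp: space_PiM PiE_iff indicator_def prod_zero_iff intro!: prod.neutral[symmetric])
      then show "ennreal (\<Prod>i\<in>I. h i (\<sigma> i)) * indicator (Pi\<^sub>E I A) \<sigma> =
          (\<Prod>i\<in>I. ennreal (h i (\<sigma> i)) * indicator (A i) (\<sigma> i))"
        by (simp add: prod.distrib prod_ennreal h0)
    qed
    also have "\<dots> = (\<Prod>i\<in>I. \<integral>\<^sup>+x. ennreal (h i x) * indicator (A i) x \<partial>M)"
      using I by (intro PS.product_nn_integral_prod) auto
    also have "\<dots> = (\<Prod>i\<in>I. emeasure (density M (h i)) (A i))"
      by (intro prod.cong refl) (simp add: emeasure_density)
    finally show "emeasure (density (\<Pi>\<^sub>M i\<in>I. M) (\<lambda>\<sigma>. \<Prod>i\<in>I. h i (\<sigma> i))) (Pi\<^sub>E I A) =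
        (\<Prod>i\<in>I. emeasure (density M (h i)) (A i))" .
  qed
qed

text \<open>With \<open>\<rho> = \<Prod>i. h i (\<sigma> i)\<close> and \<open>a = \<integral> (F - ln \<rho>) d\<mu>\<close>, integrate the tangent line bound
  \<open>exp x \<ge> y (1 + x - ln y)\<close> at \<open>x = F\<close>, \<open>y = \<rho> exp a\<close>.\<close>

lemma (in prob_space) gibbs_lower_bound:
  fixes h :: "'i \<Rightarrow> 'a \<Rightarrow> real" and F :: "('i \<Rightarrow> 'a) \<Rightarrow> real"
  assumes I: "finite I" and hm [measurable]: "\<And>i. h i \<in> borel_measurable M"
    and lo: "0 < lo" "\<And>i x. lo \<le> h i x" and hi: "\<And>i x. h i x \<le> hi" and h1: "\<And>i. (\<integral>x. h i x \<partial>M) = 1"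
    and Fm [measurable]: "F \<in> borel_measurable (\<Pi>\<^sub>M i\<in>I. M)" and FC: "\<And>\<sigma>. \<bar>F \<sigma>\<bar> \<le> C"
  shows "(\<integral>\<sigma>. F \<sigma> \<partial>(\<Pi>\<^sub>M i\<in>I. density M (h i))) - (\<Sum>i\<in>I. \<integral>x. h i x * ln (h i x) \<partial>M)
    \<le> ln (\<integral>\<sigma>. exp (F \<sigma>) \<partial>(\<Pi>\<^sub>M i\<in>I. M))"
proof -
  let ?PM = "\<Pi>\<^sub>M i\<in>I. M"
  define \<mu> where "\<mu> = (\<Pi>\<^sub>M i\<in>I. density M (h i))"
  interpret PM: prob_space ?PM by (rule prob_space_PiM) (rule prob_space_axioms)
  have h0: "0 < h i x" for i x using lo(1) lo(2)[of i x] by linarith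
  have int_h: "integrable M (h i)" for i
    by (rule integrable_const_bound[where B=hi]) (use h0 hi in \<open>auto simp: abs_of_pos\<close>)
  have ph: "prob_space (density M (h i))" for i
  proof
    have "emeasure (density M (h i)) (space (density M (h i))) = (\<integral>\<^sup>+x. h i x \<partial>M)"
      by (simp add: emeasure_density cong: nn_integral_cong)
    also have "\<dots> = ennreal (\<integral>x. h i x \<partial>M)"
      using h0 by (intro nn_integral_eq_integral int_h) (auto intro: less_imp_le)
    finally show "emeasure (density M (h i)) (space (density M (h i))) = 1" by (simp add: h1)
  qed
  interpret \<mu>: prob_space \<mu> unfolding \<mu>_def by (rule prob_space_PiM) (rule ph)
  define \<rho> where "\<rho> \<sigma> = (\<Prod>i\<in>I. h i (\<sigma> i))" for \<sigma>
  have \<rho>0: "0 < \<rho> \<sigma>" for \<sigma> using h0 by (simp add: \<rho>_def prod_pos)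
  have \<rho>m [measurable]: "\<rho> \<in> borel_measurable ?PM" unfolding \<rho>_def by measurable
  have \<mu>_eq: "\<mu> = density ?PM \<rho>"
    unfolding \<mu>_def \<rho>_def using I h0 ph by (intro density_PiM_prod[symmetric]) (auto intro: less_imp_le)
  have [measurable_cong]: "sets \<mu> = sets ?PM" by (simp add: \<mu>_eq)
  have bln: "\<bar>ln (h i x)\<bar> \<le> \<bar>ln lo\<bar> + \<bar>ln hi\<bar>" for i x
  proof -
    have "ln lo \<le> ln (h i x)" "ln (h i x) \<le> ln hi"
      using lo hi[of i x] h0[of i x] by (auto intro!: ln_mono)
    then show ?thesis by auto
  qed
  define L where "L \<sigma> = (\<Sum>i\<in>I. ln (h i (\<sigma> i)))" for \<sigma>
  have hne: "h i x \<noteq> 0" for i x using h0[of i x] by simp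
  have ln\<rho>: "ln (\<rho> \<sigma>) = L \<sigma>" for \<sigma>
    using I hne unfolding \<rho>_def L_def by (intro ln_prod) auto
  have Lm [measurable]: "L \<in> borel_measurable ?PM" unfolding L_def by measurable
  have Lb: "\<bar>L \<sigma>\<bar> \<le> real (card I) * (\<bar>ln lo\<bar> + \<bar>ln hi\<bar>)" for \<sigma>
    unfolding L_def using bln by (intro order_trans[OF sum_abs sum_bounded_above])
  have int\<mu>F: "integrable \<mu> F"
    using FC by (intro \<mu>.integrable_const_bound[where B=C]) auto
  have int\<mu>L: "integrable \<mu> L"
    using Lb by (intro \<mu>.integrable_const_bound[where B="real (card I) * (\<bar>ln lo\<bar> + \<bar>ln hi\<bar>)"]) auto
  define a where "a = (\<integral>\<sigma>. F \<sigma> \<partial>\<mu>) - (\<integral>\<sigma>. L \<sigma> \<partial>\<mu>)"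
  have int_exp: "integrable ?PM (\<lambda>\<sigma>. exp (F \<sigma>))"
  proof (rule PM.integrable_const_bound[where B="exp C"])
    have "F \<sigma> \<le> C" for \<sigma> using FC[of \<sigma>] by linarith
    then show "AE \<sigma> in ?PM. norm (exp (F \<sigma>)) \<le> exp C" by simp
  qed measurable
  have pw: "exp a * (\<rho> \<sigma> * (1 + (F \<sigma> - L \<sigma>) - a)) \<le> exp (F \<sigma>)" for \<sigma>
  proof -
    have "1 + (F \<sigma> - L \<sigma> - a) \<le> exp (F \<sigma> - L \<sigma> - a)" by (rule exp_ge_add_one_self)
    then have "exp a * \<rho> \<sigma> * (1 + (F \<sigma> - L \<sigma> - a)) \<le> exp a * \<rho> \<sigma> * exp (F \<sigma> - L \<sigma> - a)"
      using \<rho>0[of \<sigma>] by (intro mult_left_mono) auto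
    also have "\<rho> \<sigma> = exp (L \<sigma>)" using \<rho>0[of \<sigma>] by (simp flip: ln\<rho>)
    also have "exp a * exp (L \<sigma>) * exp (F \<sigma> - L \<sigma> - a) = exp (F \<sigma>)"
      by (simp flip: exp_add)
    finally show ?thesis using \<rho>0[of \<sigma>] by (simp add: algebra_simps flip: ln\<rho>)
  qed
  have int\<mu>: "integrable \<mu> (\<lambda>\<sigma>. 1 + (F \<sigma> - L \<sigma>) - a)" using int\<mu>F int\<mu>L by auto
  have int\<rho>: "integrable ?PM (\<lambda>\<sigma>. \<rho> \<sigma> * (1 + (F \<sigma> - L \<sigma>) - a))"
    using int\<mu> \<rho>0 by (subst (asm) \<mu>_eq, subst (asm) integrable_real_density) (auto intro: less_imp_le)
  \<comment> \<open>The choice of \<open>a\<close> makes the affine factor integrate to 1 under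
    \<open>\<mu>\<close>.\<close>
  have "exp a = exp a * (\<integral>\<sigma>. 1 + (F \<sigma> - L \<sigma>) - a \<partial>\<mu>)"
    using int\<mu>F int\<mu>L by (simp add: \<mu>.prob_space a_def)
  also have "(\<integral>\<sigma>. 1 + (F \<sigma> - L \<sigma>) - a \<partial>\<mu>) = (\<integral>\<sigma>. \<rho> \<sigma> * (1 + (F \<sigma> - L \<sigma>) - a) \<partial>?PM)"
    using \<rho>0 by (subst \<mu>_eq, subst integral_real_density) (auto intro: less_imp_le)
  also have "exp a * \<dots> = (\<integral>\<sigma>. exp a * (\<rho> \<sigma> * (1 + (F \<sigma> - L \<sigma>) - a)) \<partial>?PM)" by simp
  also have "\<dots> \<le> (\<integral>\<sigma>. exp (F \<sigma>) \<partial>?PM)"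
    using int\<rho> int_exp pw by (intro integral_mono) auto
  finally have le: "exp a \<le> (\<integral>\<sigma>. exp (F \<sigma>) \<partial>?PM)" .
  then have "a \<le> ln (\<integral>\<sigma>. exp (F \<sigma>) \<partial>?PM)"
    using less_le_trans[OF exp_gt_zero le] by (simp add: ln_ge_iff)
  moreover have "(\<integral>\<sigma>. L \<sigma> \<partial>\<mu>) = (\<Sum>i\<in>I. \<integral>x. h i x * ln (h i x) \<partial>M)"
  proof -
    have comp: "(\<lambda>\<sigma>. \<sigma> i) \<in> \<mu> \<rightarrow>\<^sub>M M" if "i \<in> I" for i
      using measurable_component_singleton[OF that, of "\<lambda>_. M"] by measurable
    have marg: "(\<integral>\<sigma>. ln (h i (\<sigma> i)) \<partial>\<mu>) = (\<integral>x. h i x * ln (h i x) \<partial>M)" if "i \<in> I" for i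
    proof -
      have "distr \<mu> (density M (h i)) (\<lambda>\<sigma>. \<sigma> i) = density M (h i)"
        unfolding \<mu>_def using that ph by (intro distr_PiM_component) auto
      then have "(\<integral>x. ln (h i x) \<partial>density M (h i)) = (\<integral>x. ln (h i x) \<partial>distr \<mu> (density M (h i)) (\<lambda>\<sigma>. \<sigma> i))"
        by simp
      also have "\<dots> = (\<integral>\<sigma>. ln (h i (\<sigma> i)) \<partial>\<mu>)"
        using comp[OF that] by (intro integral_distr) auto
      finally show ?thesis
        using h0 by (subst (asm) integral_real_density) (auto intro: less_imp_le)
    qed
    have int: "integrable \<mu> (\<lambda>\<sigma>. ln (h i (\<sigma> i)))" if "i \<in> I" for i
      using bln measurable_compose[OF comp[OF that], of "\<lambda>x. ln (h i x)" borel]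
      by (intro \<mu>.integrable_const_bound[where B="\<bar>ln lo\<bar> + \<bar>ln hi\<bar>"]) auto
    show ?thesis
      unfolding L_def using int by (simp add: integral_sum marg)
  qed
  ultimately show ?thesis by (simp add: a_def \<mu>_def)
qed

section \<open>Energy and entropy of admissible measures\<close>

text \<open>\<open>G\<close> is the spin part of the interaction with the normalisation
  \<open>1 / (2 * E[W])\<close> absorbed, so that the weights enter only through their
  product.\<close>

locale spin_system = weight_sequence w P for w P +
  fixes \<alpha> :: "'a::polish_space measure" and G :: "'a \<Rightarrow> 'a \<Rightarrow> real" and b :: real
  assumes alpha_prob: "prob_space \<alpha>" and sets_alpha [measurable_cong, simp]: "sets \<alpha> = sets borel"
    and G_meas [measurable]: "(\<lambda>(x, y). G x y) \<in> borel_measurable (borel \<Otimes>\<^sub>M borel)"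
    and G_nonneg: "\<And>x y. 0 \<le> G x y" and G_le: "\<And>x y. G x y \<le> b"
begin

sublocale alpha: prob_space \<alpha> by (rule alpha_prob)

lemma space_alpha [simp]: "space \<alpha> = UNIV"
  using sets_eq_imp_space_eq[OF sets_alpha] by simp

lemma b_nonneg: "0 \<le> b"
  using G_nonneg G_le order_trans by blast

definition U :: "'a \<Rightarrow> 'a \<Rightarrow> real \<Rightarrow> real \<Rightarrow> real" where
  "U x y v v' = v * v' * G x y"

definition admissible :: "('a \<times> real) measure set" where
  "admissible = {\<nu> \<in> space (prob_algebra (borel \<Otimes>\<^sub>M weight_space)). distr \<nu> weight_space snd = P}"

definition mean :: real where "mean = (\<integral>x. x \<partial>P)"

lemma mean_nonneg: "0 \<le> mean"
  unfolding mean_def by (intro integral_nonneg_AE AE_I2) auto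

lemma G_section [measurable]: "G x \<in> borel_measurable borel" "(\<lambda>x. G x y) \<in> borel_measurable borel"
  using measurable_compose[OF measurable_Pair1' G_meas, of x]
    measurable_compose[OF measurable_Pair2' G_meas, of y] by simp_all

lemma admissibleD:
  assumes "\<nu> \<in> admissible"
  shows "prob_space \<nu>" "sets \<nu> = sets (borel \<Otimes>\<^sub>M weight_space)" "distr \<nu> weight_space snd = P"
    "space \<nu> = UNIV \<times> {0<..}"
proof -
  show *: "prob_space \<nu>" "sets \<nu> = sets (borel \<Otimes>\<^sub>M weight_space)" "distr \<nu> weight_space snd = P"
    using assms by (auto simp: admissible_def space_prob_algebra)
  show "space \<nu> = UNIV \<times> {0<..}"
    using sets_eq_imp_space_eq[OF *(2)] by (simp add: space_pair_measure)
qed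

lemma
  fixes f :: "real \<Rightarrow> real"
  assumes \<nu>: "\<nu> \<in> admissible" and f: "f \<in> borel_measurable weight_space"
  shows integral_weight: "(\<integral>z. f (snd z) \<partial>\<nu>) = (\<integral>x. f x \<partial>P)"
    and integrable_weight_iff: "integrable \<nu> (\<lambda>z. f (snd z)) \<longleftrightarrow> integrable P f"
proof -
  have [measurable_cong]: "sets \<nu> = sets (borel \<Otimes>\<^sub>M weight_space)" by (rule admissibleD[OF \<nu>])
  have m: "snd \<in> \<nu> \<rightarrow>\<^sub>M weight_space" by measurable
  show "(\<integral>z. f (snd z) \<partial>\<nu>) = (\<integral>x. f x \<partial>P)"
    unfolding admissibleD(3)[OF \<nu>, symmetric] by (rule integral_distr[OF m f, symmetric])
  show "integrable \<nu> (\<lambda>z. f (snd z)) \<longleftrightarrow> integrable P f"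
    unfolding admissibleD(3)[OF \<nu>, symmetric] by (rule integrable_distr_eq[OF m f, symmetric])
qed

text \<open>The mean field that \<open>\<nu>\<close> exerts on a spin \<open>x\<close> when a weight
  \<open>v\<close> is counted as \<open>u v\<close>. The function \<open>u\<close> ranges over the
  identity, its rounding and their difference.\<close>

definition field :: "('a \<times> real) measure \<Rightarrow> (real \<Rightarrow> real) \<Rightarrow> 'a \<Rightarrow> real" where
  "field \<nu> u x = (\<integral>z. u (snd z) * G x (fst z) \<partial>\<nu>)"

definition energy :: "('a \<times> real) measure \<Rightarrow> (real \<Rightarrow> real) \<Rightarrow> real" where
  "energy \<nu> u = (\<integral>z. u (snd z) * field \<nu> u (fst z) \<partial>\<nu>)"

lemma pair_functional_eq_energy: "pair_functional \<nu> U = energy \<nu> (\<lambda>x. x)"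
  by (simp add: pair_functional_def U_def energy_def field_def mult.assoc)

context
  fixes \<nu> :: "('a \<times> real) measure" assumes \<nu>: "\<nu> \<in> admissible"
begin

interpretation \<nu>: prob_space \<nu> by (rule admissibleD[OF \<nu>])

lemma sets_admissible [measurable_cong]: "sets \<nu> = sets (borel \<Otimes>\<^sub>M weight_space)"
  by (rule admissibleD[OF \<nu>])

lemma measurable_weight [measurable (raw)]:
  assumes "u \<in> borel_measurable borel"
  shows "(\<lambda>z. u (snd z)) \<in> borel_measurable \<nu>"
proof -
  have "snd \<in> \<nu> \<rightarrow>\<^sub>M weight_space" by measurable
  from measurable_compose[OF this measurable_weight_spaceI[OF assms]] show ?thesis .
qed

lemma measurable_spin [measurable (raw)]:
  assumes "f \<in> borel_measurable borel"
  shows "(\<lambda>z. f (fst z)) \<in> borel_measurable \<nu>"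
proof -
  have "fst \<in> \<nu> \<rightarrow>\<^sub>M borel" by measurable
  from measurable_compose[OF this assms] show ?thesis .
qed

lemma measurable_field [measurable]:
  assumes [measurable]: "u \<in> borel_measurable borel"
  shows "field \<nu> u \<in> borel_measurable borel"
proof -
  have "(\<lambda>(x, z). u (snd z) * G x (fst z)) \<in> borel_measurable (borel \<Otimes>\<^sub>M \<nu>)"
  proof -
    have "(\<lambda>p. (fst p, fst (snd p))) \<in> borel \<Otimes>\<^sub>M \<nu> \<rightarrow>\<^sub>M borel \<Otimes>\<^sub>M (borel :: 'a measure)" by measurable
    from measurable_compose[OF this G_meas]
    have "(\<lambda>p. G (fst p) (fst (snd p))) \<in> borel_measurable (borel \<Otimes>\<^sub>M \<nu>)" by simp
    moreover have "(\<lambda>p. u (snd (snd p))) \<in> borel_measurable (borel \<Otimes>\<^sub>M \<nu>)"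
    proof -
      have "(\<lambda>p. snd (snd p)) \<in> borel \<Otimes>\<^sub>M \<nu> \<rightarrow>\<^sub>M weight_space" by measurable
      from measurable_compose[OF this measurable_weight_spaceI[OF assms]] show ?thesis .
    qed
    ultimately show ?thesis unfolding case_prod_beta' by (intro borel_measurable_times)
  qed
  then show ?thesis
    unfolding field_def[abs_def] by (rule \<nu>.borel_measurable_lebesgue_integral)
qed

lemma integrable_weight_mult:
  fixes u :: "real \<Rightarrow> real" and f :: "'a \<Rightarrow> real"
  assumes u [measurable]: "u \<in> borel_measurable borel" and "integrable P u"
    and f [measurable]: "f \<in> borel_measurable borel" and C: "\<And>x. \<bar>f x\<bar> \<le> C"
  shows "integrable \<nu> (\<lambda>z. u (snd z) * f (fst z))"
proof (rule Bochner_Integration.integrable_bound)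
  have "integrable \<nu> (\<lambda>z. u (snd z))" using assms(2) by (subst integrable_weight_iff[OF \<nu>]) auto
  then show "integrable \<nu> (\<lambda>z. C * u (snd z))" by simp
  show "AE z in \<nu>. norm (u (snd z) * f (fst z)) \<le> norm (C * u (snd z))"
  proof (rule AE_I2)
    fix z :: "'a \<times> real"
    have "\<bar>f (fst z)\<bar> \<le> \<bar>C\<bar>" using C[of "fst z"] by linarith
    then show "norm (u (snd z) * f (fst z)) \<le> norm (C * u (snd z))"
      by (simp add: abs_mult mult.commute mult_right_mono)
  qed
qed (intro borel_measurable_times measurable_weight measurable_spin u f)

lemma
  fixes u :: "real \<Rightarrow> real" and f :: "'a \<Rightarrow> real"
  assumes u [measurable]: "u \<in> borel_measurable borel" and int: "integrable P u" and u0: "\<And>x. 0 < x \<Longrightarrow> 0 \<le> u x"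
    and f [measurable]: "f \<in> borel_measurable borel" and f0: "\<And>x. 0 \<le> f x" and C: "\<And>x. f x \<le> C"
  shows weight_mult_nonneg: "0 \<le> (\<integral>z. u (snd z) * f (fst z) \<partial>\<nu>)"
    and weight_mult_le: "(\<integral>z. u (snd z) * f (fst z) \<partial>\<nu>) \<le> C * (\<integral>x. u x \<partial>P)"
proof -
  have snd0: "0 < snd z" if "z \<in> space \<nu>" for z using that by (auto simp: admissibleD(4)[OF \<nu>])
  show "0 \<le> (\<integral>z. u (snd z) * f (fst z) \<partial>\<nu>)"
    using u0 f0 snd0 by (intro integral_nonneg_AE AE_I2) auto
  have "(\<integral>z. u (snd z) * f (fst z) \<partial>\<nu>) \<le> (\<integral>z. C * u (snd z) \<partial>\<nu>)"
  proof (rule integral_mono)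
    show "integrable \<nu> (\<lambda>z. u (snd z) * f (fst z))"
      using f0 C by (intro integrable_weight_mult[OF u int f, of C]) auto
    show "integrable \<nu> (\<lambda>z. C * u (snd z))" using int by (intro integrable_mult_right) (subst integrable_weight_iff[OF \<nu>], auto)
    show "u (snd z) * f (fst z) \<le> C * u (snd z)" if "z \<in> space \<nu>" for z
      using u0[OF snd0[OF that]] C[of "fst z"] by (simp add: mult.commute mult_right_mono)
  qed
  also have "\<dots> = C * (\<integral>x. u x \<partial>P)" using integral_weight[OF \<nu>, of u] by simp
  finally show "(\<integral>z. u (snd z) * f (fst z) \<partial>\<nu>) \<le> C * (\<integral>x. u x \<partial>P)" .
qed

lemma
  assumes u [measurable]: "u \<in> borel_measurable borel" and int: "integrable P u" and u0: "\<And>x. 0 < x \<Longrightarrow> 0 \<le> u x"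
  shows field_nonneg: "0 \<le> field \<nu> u x" and field_le: "field \<nu> u x \<le> b * (\<integral>x. u x \<partial>P)"
  unfolding field_def
  using weight_mult_nonneg[OF u int u0 G_section(1) G_nonneg G_le]
    weight_mult_le[OF u int u0 G_section(1) G_nonneg G_le] by auto

text \<open>Both bounds come from \<open>v v' - \<rho>(v) \<rho>(v') = v (v' - \<rho>(v')) + (v - \<rho>(v)) \<rho>(v')\<close>.\<close>

lemma
  assumes \<rho> [measurable]: "\<rho> \<in> borel_measurable borel" and \<rho>0: "\<And>x. 0 < x \<Longrightarrow> 0 \<le> \<rho> x"
    and le: "\<And>x. 0 < x \<Longrightarrow> \<rho> x \<le> x" and \<eta>: "(\<integral>x. x - \<rho> x \<partial>P) \<le> \<eta>"
  shows energy_le_energy_id: "energy \<nu> \<rho> \<le> energy \<nu> (\<lambda>x. x)"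
    and energy_id_le: "energy \<nu> (\<lambda>x. x) \<le> energy \<nu> \<rho> + 2 * b * mean * \<eta>"
    and energy_id_bound: "energy \<nu> (\<lambda>x. x) \<le> b * mean\<^sup>2"
proof -
  have idm: "(\<lambda>x::real. x) \<in> borel_measurable borel" by simp
  have id0: "0 < x \<Longrightarrow> 0 \<le> x" for x :: real by simp
  have int\<rho>: "integrable P \<rho>"
    by (rule Bochner_Integration.integrable_bound[OF integrable_weight]) (use \<rho>0 le in \<open>auto intro!: AE_I2\<close>)
  define d where "d x = x - \<rho> x" for x
  have dm: "d \<in> borel_measurable borel" unfolding d_def by measurable
  have intd: "integrable P d" unfolding d_def using integrable_weight int\<rho> by auto
  have d0: "0 \<le> d x" if "0 < x" for x using le[OF that] by (simp add: d_def)
  have d\<eta>: "0 \<le> (\<integral>x. d x \<partial>P)" "(\<integral>x. d x \<partial>P) \<le> \<eta>"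
    using \<eta> d0 by (auto simp: d_def intro!: integral_nonneg_AE AE_I2)
  have \<rho>_mean: "(\<integral>x. \<rho> x \<partial>P) \<le> mean"
    unfolding mean_def using int\<rho> integrable_weight le by (intro integral_mono) auto
  have split_field: "field \<nu> (\<lambda>x. x) x = field \<nu> \<rho> x + field \<nu> d x" for x
  proof -
    have i1: "integrable \<nu> (\<lambda>z. u (snd z) * G x (fst z))"
      if "u \<in> borel_measurable borel" "integrable P u" for u
      using G_nonneg G_le by (intro integrable_weight_mult[OF that, of _ b]) auto
    have "field \<nu> \<rho> x + field \<nu> d x = (\<integral>z. \<rho> (snd z) * G x (fst z) + d (snd z) * G x (fst z) \<partial>\<nu>)"
      unfolding field_def using i1[OF \<rho> int\<rho>] i1[OF dm intd] by simp
    also have "\<dots> = field \<nu> (\<lambda>x. x) x" unfolding field_def d_def by (simp add: algebra_simps)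
    finally show ?thesis by simp
  qed
  have fm: "field \<nu> u \<in> borel_measurable borel" if "u \<in> borel_measurable borel" for u
    using that by (rule measurable_field)
  have i2: "integrable \<nu> (\<lambda>z. u (snd z) * field \<nu> v (fst z))"
    if "u \<in> borel_measurable borel" "integrable P u" "v \<in> borel_measurable borel" "integrable P v" "\<And>x. 0 < x \<Longrightarrow> 0 \<le> v x" for u v
    using field_nonneg[OF that(3-5)] field_le[OF that(3-5)]
    by (intro integrable_weight_mult[OF that(1,2) fm[OF that(3)], of "b * (\<integral>x. v x \<partial>P)"]) auto
  have e1: "energy \<nu> (\<lambda>x. x) = energy \<nu> \<rho> + (\<integral>z. d (snd z) * field \<nu> \<rho> (fst z) \<partial>\<nu>) + (\<integral>z. snd z * field \<nu> d (fst z) \<partial>\<nu>)"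
  proof -
    have "energy \<nu> \<rho> + (\<integral>z. d (snd z) * field \<nu> \<rho> (fst z) \<partial>\<nu>) + (\<integral>z. snd z * field \<nu> d (fst z) \<partial>\<nu>)
        = (\<integral>z. \<rho> (snd z) * field \<nu> \<rho> (fst z) + d (snd z) * field \<nu> \<rho> (fst z) + snd z * field \<nu> d (fst z) \<partial>\<nu>)"
      unfolding energy_def
      using i2[OF \<rho> int\<rho> \<rho> int\<rho> \<rho>0] i2[OF dm intd \<rho> int\<rho> \<rho>0] i2[OF idm integrable_weight dm intd d0] by simp
    also have "\<dots> = energy \<nu> (\<lambda>x. x)"
      unfolding energy_def split_field by (simp add: d_def algebra_simps)
    finally show ?thesis by simp
  qed
  note f\<rho> = fm[OF \<rho>] field_nonneg[OF \<rho> int\<rho> \<rho>0] field_le[OF \<rho> int\<rho> \<rho>0]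
    and fd = fm[OF dm] field_nonneg[OF dm intd d0] field_le[OF dm intd d0]
    and fid = fm[OF idm] field_nonneg[OF idm integrable_weight id0] field_le[OF idm integrable_weight id0]
  note p1 = weight_mult_nonneg[OF dm intd d0 f\<rho>] weight_mult_le[OF dm intd d0 f\<rho>]
  note p2 = weight_mult_nonneg[OF idm integrable_weight id0 fd]
    weight_mult_le[OF idm integrable_weight id0 fd, folded mean_def]
  show "energy \<nu> \<rho> \<le> energy \<nu> (\<lambda>x. x)" using e1 p1 p2 by linarith
  have q1: "b * (\<integral>x. \<rho> x \<partial>P) * (\<integral>x. d x \<partial>P) \<le> b * mean * \<eta>"
    using \<rho>_mean d\<eta> b_nonneg mean_nonneg by (intro mult_mono mult_left_mono) auto
  have q2: "b * (\<integral>x. d x \<partial>P) * mean \<le> b * \<eta> * mean"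
    using d\<eta> b_nonneg mean_nonneg by (intro mult_right_mono mult_left_mono) auto
  have "2 * b * mean * \<eta> = b * mean * \<eta> + b * \<eta> * mean" by simp
  then show "energy \<nu> (\<lambda>x. x) \<le> energy \<nu> \<rho> + 2 * b * mean * \<eta>" using e1 p1 p2 q1 q2 by linarith
  have "energy \<nu> (\<lambda>x. x) \<le> b * (\<integral>x. x \<partial>P) * (\<integral>x. x \<partial>P)"
    unfolding energy_def
    by (rule weight_mult_le[OF idm integrable_weight id0 fid])
  then show "energy \<nu> (\<lambda>x. x) \<le> b * mean\<^sup>2" by (simp add: mean_def power2_eq_square mult.assoc)
qed

text \<open>Rectangles identify \<open>\<nu>\<close> with the mixture over \<open>P\<close> of the
  laws of \<open>(x, v)\<close> with \<open>x\<close> drawn from \<open>K v\<close>; the integral of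
  a bounded function against a mixture iterates.\<close>

lemma kernel_integral:
  fixes f :: "'a \<Rightarrow> real \<Rightarrow> real"
  assumes K: "is_cond_spin \<nu> K" and fm: "(\<lambda>(x, v). f x v) \<in> borel_measurable (borel \<Otimes>\<^sub>M weight_space)"
    and C: "\<And>x v. \<bar>f x v\<bar> \<le> C"
  shows "(\<integral>z. f (fst z) (snd z) \<partial>\<nu>) = (\<integral>v. (\<integral>x. f x v \<partial>K v) \<partial>P)"
proof -
  let ?S = "borel \<Otimes>\<^sub>M weight_space :: ('a \<times> real) measure"
  have Km [measurable]: "K \<in> weight_space \<rightarrow>\<^sub>M prob_algebra borel" using K by (simp add: is_cond_spin_def)
  have Kp: "prob_space (K v)" "sets (K v) = sets borel" "space (K v) = UNIV" if "0 < v" for v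
  proof -
    show "prob_space (K v)" "sets (K v) = sets borel"
      using measurable_space[OF Km, of v] that by (auto simp: space_prob_algebra)
    then show "space (K v) = UNIV" using sets_eq_imp_space_eq by fastforce
  qed
  define L where "L v = distr (K v) ?S (\<lambda>x. (x, v))" for v
  have L: "L \<in> weight_space \<rightarrow>\<^sub>M prob_algebra ?S"
    unfolding L_def by (rule measurable_distr_prob_space2[OF Km]) (simp add: case_prod_beta')
  then have L': "L \<in> P \<rightarrow>\<^sub>M subprob_algebra ?S"
    using measurable_prob_algebraD[OF L] by (simp add: measurable_cong_sets[OF sets_P refl])
  have pairm: "(\<lambda>x. (x, v)) \<in> K v \<rightarrow>\<^sub>M ?S" if "0 < v" for v
    using that by (simp add: measurable_cong_sets[OF Kp(2)[OF that] refl] measurable_Pair2')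
  have "\<nu> = P \<bind> L"
  proof (rule measure_eqI_generator_eq[OF Int_stable_pair_measure_generator[of borel weight_space],
        where \<Omega>="UNIV \<times> {0<..}" and A="\<lambda>_. UNIV \<times> {0<..}"])
    show "{A \<times> B |A B. A \<in> sets (borel :: 'a measure) \<and> B \<in> sets weight_space} \<subseteq> Pow (UNIV \<times> {0<..})"
      using sets.sets_into_space[of _ weight_space] by auto
    show "sets \<nu> = sigma_sets (UNIV \<times> {0<..}) {A \<times> B |A B. A \<in> sets (borel :: 'a measure) \<and> B \<in> sets weight_space}"
      unfolding sets_admissible sets_pair_measure by simp
    have "sets (P \<bind> L) = sets ?S"
      by (rule sets_bind) (simp_all add: L_def)
    then show "sets (P \<bind> L) = sigma_sets (UNIV \<times> {0<..}) {A \<times> B |A B. A \<in> sets (borel :: 'a measure) \<and> B \<in> sets weight_space}"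
      unfolding sets_pair_measure by simp
    fix X assume "X \<in> {A \<times> B |A B. A \<in> sets (borel :: 'a measure) \<and> B \<in> sets weight_space}"
    then obtain A B where X: "X = A \<times> B" and A [measurable]: "A \<in> sets borel" and B [measurable]: "B \<in> sets weight_space" by auto
    have "emeasure (P \<bind> L) X = (\<integral>\<^sup>+v. emeasure (L v) X \<partial>P)"
      using L' by (intro emeasure_bind[where N="?S"]) (auto simp: X)
    also have "\<dots> = (\<integral>\<^sup>+v\<in>B. emeasure (K v) A \<partial>P)"
    proof (rule nn_integral_cong)
      fix v assume "v \<in> space P"
      then have v: "0 < v" by simp
      have "emeasure (L v) X = emeasure (K v) ((\<lambda>x. (x, v)) -` X \<inter> space (K v))"
        unfolding L_def by (rule emeasure_distr[OF pairm[OF v]]) (simp add: X)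
      also have "(\<lambda>x. (x, v)) -` X \<inter> space (K v) = (if v \<in> B then A else {})"
        using v by (auto simp: X Kp(3))
      finally show "emeasure (L v) X = emeasure (K v) A * indicator B v" by simp
    qed
    also have "\<dots> = emeasure \<nu> X"
      using K A B unfolding is_cond_spin_def X admissibleD(3)[OF \<nu>] by simp
    finally show "emeasure \<nu> X = emeasure (P \<bind> L) X" by simp
  next
    show "range (\<lambda>_::nat. UNIV \<times> {0<..}) \<subseteq> {A \<times> B |A B. A \<in> sets (borel :: 'a measure) \<and> B \<in> sets weight_space}"
      using sets.top[of weight_space] by (auto intro!: exI[of _ UNIV] exI[of _ "{0<..}"])
  qed auto
  then have "(\<integral>z. f (fst z) (snd z) \<partial>\<nu>) = (\<integral>z. f (fst z) (snd z) \<partial>(P \<bind> L))" by simp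
  also have "\<dots> = (\<integral>v. (\<integral>z. f (fst z) (snd z) \<partial>L v) \<partial>P)"
  proof (rule integral_bind[where K="?S" and B=C and B'=1])
    show "(\<lambda>z. f (fst z) (snd z)) \<in> borel_measurable ?S" using fm by (simp add: case_prod_beta')
    show "AE v in P. emeasure (L v) (space (L v)) \<le> ennreal 1"
    proof (rule AE_I2)
      fix v assume "v \<in> space P"
      then interpret Lv: prob_space "L v"
        unfolding L_def using Kp(1) pairm by (intro prob_space.prob_space_distr) auto
      show "emeasure (L v) (space (L v)) \<le> ennreal 1" by (simp add: Lv.emeasure_space_1)
    qed
  qed (use C L' in \<open>auto simp: P.finite_measure_axioms\<close>)
  also have "\<dots> = (\<integral>v. (\<integral>x. f x v \<partial>K v) \<partial>P)"
  proof (rule Bochner_Integration.integral_cong[OF refl])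
    fix v assume "v \<in> space P"
    then have v: "0 < v" by simp
    show "(\<integral>z. f (fst z) (snd z) \<partial>L v) = (\<integral>x. f x v \<partial>K v)"
      unfolding L_def using fm by (subst integral_distr[OF pairm[OF v]]) (auto simp: case_prod_beta')
  qed
  finally show ?thesis .
qed

end

end

lemma sum_by_label:
  fixes q :: "nat \<Rightarrow> real" and k :: "nat \<Rightarrow> nat"
  assumes "\<And>i. k i < K"
  shows "(\<Sum>i=1..N. q (k i)) = (\<Sum>j<K. q j * (\<Sum>i=1..N. indicator {j} (k i)))"
proof -
  have "q (k i) = (\<Sum>j<K. q j * indicator {j} (k i))" for i
  proof -
    have "(\<Sum>j<K. q j * indicator {j} (k i)) = (\<Sum>j<K. if k i = j then q j else 0)"
      by (intro sum.cong refl) (auto split: split_indicator)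
    then show ?thesis using assms[of i] by simp
  qed
  then have "(\<Sum>i=1..N. q (k i)) = (\<Sum>i=1..N. \<Sum>j<K. q j * indicator {j} (k i))" by simp
  also have "\<dots> = (\<Sum>j<K. \<Sum>i=1..N. q j * indicator {j} (k i))" by (rule sum.swap)
  finally show ?thesis by (simp only: sum_distrib_left)
qed

text \<open>Turns vertex averages of label functions into polynomials in the label frequencies, so
  that their limits follow from the convergence of finitely many frequencies.\<close>

lemma average_by_label:
  fixes q :: "nat \<Rightarrow> real" and q2 :: "nat \<Rightarrow> nat \<Rightarrow> real" and k :: "nat \<Rightarrow> nat"
  assumes k: "\<And>i. k i < K" and f_def: "\<And>j. f j = (\<Sum>i=1..N. indicator {j} (k i)) / real N"
  shows "(\<Sum>i=1..N. q (k i)) / real N = (\<Sum>j<K. q j * f j)"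
    and "(\<Sum>i=1..N. \<Sum>l=1..N. q2 (k i) (k l)) / (real N)\<^sup>2 = (\<Sum>j<K. \<Sum>l<K. q2 j l * f j * f l)"
proof -
  have 1: "(\<Sum>i=1..N. q (k i)) / real N = (\<Sum>j<K. q j * f j)" for q
    unfolding sum_by_label[OF k, of q] f_def times_divide_eq_right by (rule sum_divide_distrib)
  then show "(\<Sum>i=1..N. q (k i)) / real N = (\<Sum>j<K. q j * f j)" .
  have "(\<Sum>i=1..N. \<Sum>l=1..N. q2 (k i) (k l)) / (real N)\<^sup>2 = (\<Sum>i=1..N. (\<Sum>l=1..N. q2 (k i) (k l)) / real N) / real N"
    unfolding sum_divide_distrib[symmetric] by (simp add: power2_eq_square)
  also have "\<dots> = (\<Sum>i=1..N. (\<Sum>l<K. q2 (k i) l * f l)) / real N" by (simp only: 1)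
  also have "\<dots> = (\<Sum>j<K. (\<Sum>l<K. q2 j l * f l) * f j)" by (rule 1[of "\<lambda>j. \<Sum>l<K. q2 j l * f l"])
  also have "\<dots> = (\<Sum>j<K. \<Sum>l<K. q2 j l * f j * f l)"
    by (simp add: sum_distrib_left mult_ac)
  finally show "(\<Sum>i=1..N. \<Sum>l=1..N. q2 (k i) (k l)) / (real N)\<^sup>2 = (\<Sum>j<K. \<Sum>l<K. q2 j l * f j * f l)" .
qed

section \<open>Hamiltonian, partition function and entropy functional\<close>

context spin_system
begin

definition hamiltonian :: "nat \<Rightarrow> (nat \<Rightarrow> 'a) \<Rightarrow> real" where
  "hamiltonian N \<sigma> = (\<Sum>i=1..N. \<Sum>j=1..N. w i * w j * G (\<sigma> i) (\<sigma> j)) / real N"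

definition Z :: "nat \<Rightarrow> real" where
  "Z N = (\<integral>\<sigma>. exp (real N * pair_functional (empirical_pair N \<sigma> w) U) \<partial>(\<Pi>\<^sub>M i\<in>{1..N}. \<alpha>))"

lemma Z_eq:
  assumes "N \<ge> 1"
  shows "Z N = (\<integral>\<sigma>. exp (hamiltonian N \<sigma>) \<partial>(\<Pi>\<^sub>M i\<in>{1..N}. \<alpha>))"
proof -
  let ?S = "borel \<Otimes>\<^sub>M weight_space :: ('a \<times> real) measure"
  have "(\<lambda>p. (fst (fst p), fst (snd p))) \<in> ?S \<Otimes>\<^sub>M ?S \<rightarrow>\<^sub>M borel \<Otimes>\<^sub>M borel" by measurable
  from measurable_compose[OF this G_meas]
  have g: "(\<lambda>p. G (fst (fst p)) (fst (snd p))) \<in> borel_measurable (?S \<Otimes>\<^sub>M ?S)" by simp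
  have "(\<lambda>p. snd (fst p)) \<in> ?S \<Otimes>\<^sub>M ?S \<rightarrow>\<^sub>M weight_space" "(\<lambda>p. snd (snd p)) \<in> ?S \<Otimes>\<^sub>M ?S \<rightarrow>\<^sub>M weight_space"
    by measurable
  from measurable_compose[OF this(1), of "\<lambda>x. x" borel] measurable_compose[OF this(2), of "\<lambda>x. x" borel]
  have "(\<lambda>p. snd (fst p)) \<in> borel_measurable (?S \<Otimes>\<^sub>M ?S)" "(\<lambda>p. snd (snd p)) \<in> borel_measurable (?S \<Otimes>\<^sub>M ?S)"
    by (auto intro: measurable_weight_spaceI)
  then have "(\<lambda>((s, w), (s', w')). U s s' w w') \<in> borel_measurable (?S \<Otimes>\<^sub>M ?S)"
    unfolding U_def case_prod_beta' by (intro borel_measurable_times g)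
  from pair_functional_empirical_pair[where w=w and U=U, OF w_pos this]
  have "real N * pair_functional (empirical_pair N \<sigma> w) U = hamiltonian N \<sigma>" for \<sigma>
    using assms by (simp add: hamiltonian_def U_def power2_eq_square)
  then show ?thesis by (simp add: Z_def)
qed

lemma measurable_pair_interaction:
  assumes "i \<in> I" "j \<in> I" and M: "\<And>i. sets (M i) = sets borel"
  shows "(\<lambda>\<sigma>. G (\<sigma> i) (\<sigma> j)) \<in> borel_measurable (\<Pi>\<^sub>M i\<in>I. M i)"
proof -
  have c: "(\<lambda>\<sigma>. \<sigma> i) \<in> (\<Pi>\<^sub>M i\<in>I. M i) \<rightarrow>\<^sub>M borel" if "i \<in> I" for i
    using measurable_component_singleton[OF that, of M] by (simp add: measurable_cong_sets[OF refl M])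
  show ?thesis
    using measurable_compose[OF measurable_Pair[OF c c] G_meas] assms(1,2) by simp
qed

lemma measurable_hamiltonian:
  assumes "\<And>i. sets (M i) = sets borel"
  shows "hamiltonian N \<in> borel_measurable (\<Pi>\<^sub>M i\<in>{1..N}. M i)"
  unfolding hamiltonian_def[abs_def]
proof (rule borel_measurable_divide[OF borel_measurable_sum[OF borel_measurable_sum] borel_measurable_const])
  show "(\<lambda>\<sigma>. w i * w j * G (\<sigma> i) (\<sigma> j)) \<in> borel_measurable (\<Pi>\<^sub>M i\<in>{1..N}. M i)"
    if "i \<in> {1..N}" "j \<in> {1..N}" for i j
    by (rule borel_measurable_times[OF borel_measurable_const measurable_pair_interaction[OF that assms]])
qed

lemma hamiltonian_bound:
  assumes "N \<ge> 1"
  shows "0 \<le> hamiltonian N \<sigma>" "hamiltonian N \<sigma> \<le> b * (\<Sum>i=1..N. w i)\<^sup>2 / real N"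
proof -
  show "0 \<le> hamiltonian N \<sigma>"
    unfolding hamiltonian_def using w_pos G_nonneg
    by (intro divide_nonneg_nonneg sum_nonneg mult_nonneg_nonneg) (auto simp: less_imp_le)
  have "(\<Sum>i=1..N. \<Sum>j=1..N. w i * w j * G (\<sigma> i) (\<sigma> j)) \<le> (\<Sum>i=1..N. \<Sum>j=1..N. w i * w j * b)"
    using w_pos G_le by (intro sum_mono mult_left_mono) (auto simp: less_imp_le)
  also have "\<dots> = b * (\<Sum>i=1..N. w i)\<^sup>2"
    by (simp add: power2_eq_square sum_distrib_left sum_distrib_right mult_ac)
  finally show "hamiltonian N \<sigma> \<le> b * (\<Sum>i=1..N. w i)\<^sup>2 / real N"
    unfolding hamiltonian_def by (rule divide_right_mono) simp
qed

text \<open>The integrand is not shown to be measurable; the integral is handled only through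
  monotonicity and almost everywhere equality.\<close>

definition entropy :: "('a \<times> real) measure \<Rightarrow> ennreal" where
  "entropy \<nu> = (\<integral>\<^sup>+v. e2ennreal (relative_entropy (cond_spin \<nu> v) \<alpha>) \<partial>P)"

lemma rate_value_eq: "rate_value \<alpha> P U \<nu> = ereal (energy \<nu> (\<lambda>x. x)) - enn2ereal (entropy \<nu>)"
  unfolding rate_value_def entropy_def pair_functional_eq_energy ..

text \<open>The Donsker--Varadhan bound in each fibre, with a test density chosen by the bin of the
  weight, integrated over the weights. Bounds on \<open>h\<close> uniform in the bin make the left
  side a bounded integral against \<open>\<nu>\<close>.\<close>

lemma entropy_ge:
  fixes h :: "nat \<Rightarrow> 'a \<Rightarrow> real"
  assumes \<nu>: "\<nu> \<in> admissible" and fin: "entropy \<nu> < \<infinity>"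
    and k: "k \<in> borel \<rightarrow>\<^sub>M count_space UNIV" and h: "\<And>j. h j \<in> borel_measurable borel"
    and lo: "0 < lo" "\<And>j x. lo \<le> h j x" and hi: "\<And>j x. h j x \<le> hi" and h1: "\<And>j. (\<integral>x. h j x \<partial>\<alpha>) = 1"
  shows "(\<integral>z. ln (h (k (snd z)) (fst z)) \<partial>\<nu>) \<le> enn2real (entropy \<nu>)"
proof -
  have \<nu>': "\<nu> \<in> space (prob_algebra (borel \<Otimes>\<^sub>M weight_space))" using \<nu> by (simp add: admissible_def)
  have K: "is_cond_spin \<nu> (cond_spin \<nu>)" by (rule is_cond_spin_cond_spin[OF \<nu>'])
  then have Km: "cond_spin \<nu> \<in> weight_space \<rightarrow>\<^sub>M prob_algebra borel" by (simp add: is_cond_spin_def)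
  have hm: "h j \<in> borel_measurable \<alpha>" for j using h[of j] by simp
  define \<phi> where "\<phi> v = (\<integral>x. ln (h (k v) x) \<partial>cond_spin \<nu> v)" for v
  have le: "ennreal (\<phi> v) \<le> e2ennreal (relative_entropy (cond_spin \<nu> v) \<alpha>)" if "0 < v" for v
    unfolding \<phi>_def using measurable_space[OF Km, of v] that
    by (intro alpha.relative_entropy_ge[OF hm lo(2) hi lo(1) h1]) (auto simp: space_prob_algebra)
  have bln: "\<bar>ln (h j x)\<bar> \<le> \<bar>ln lo\<bar> + \<bar>ln hi\<bar>" for j x
  proof -
    have "ln lo \<le> ln (h j x)" "ln (h j x) \<le> ln hi"
      using lo(1) lo(2)[of j x] hi[of j x] by (auto intro!: ln_mono)
    then show ?thesis by auto
  qed
  have km: "k \<in> weight_space \<rightarrow>\<^sub>M count_space UNIV" by (rule measurable_weight_spaceI[OF k])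
  have "(\<lambda>p. ln (h (k (snd p)) (fst p))) \<in> borel_measurable (borel \<Otimes>\<^sub>M weight_space)"
    by (rule measurable_compose_countable'[where g="\<lambda>p. k (snd p)" and I=UNIV])
      (use measurable_compose[OF measurable_fst borel_measurable_ln[OF h]] measurable_compose[OF measurable_snd km] in auto)
  then have m: "(\<lambda>(x, v). ln (h (k v) x)) \<in> borel_measurable (borel \<Otimes>\<^sub>M weight_space)"
    by (simp add: case_prod_beta')
  have "(\<integral>z. ln (h (k (snd z)) (fst z)) \<partial>\<nu>) = (\<integral>v. \<phi> v \<partial>P)"
    unfolding \<phi>_def by (rule kernel_integral[OF \<nu> K m bln])
  \<comment> \<open>The coercion to \<open>ennreal\<close> discards the negative part of
    \<open>\<phi>\<close>, which can only increase the integral.\<close>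
  also have "\<dots> \<le> enn2real (\<integral>\<^sup>+v. ennreal (\<phi> v) \<partial>P)"
    by (cases "integrable P \<phi>") (simp_all add: real_lebesgue_integral_def not_integrable_integral_eq)
  also have "\<dots> \<le> enn2real (entropy \<nu>)"
    unfolding entropy_def
  proof (rule enn2real_mono)
    show "(\<integral>\<^sup>+v. ennreal (\<phi> v) \<partial>P) \<le> (\<integral>\<^sup>+v. e2ennreal (relative_entropy (cond_spin \<nu> v) \<alpha>) \<partial>P)"
      using le by (intro nn_integral_mono) auto
    show "(\<integral>\<^sup>+v. e2ennreal (relative_entropy (cond_spin \<nu> v) \<alpha>) \<partial>P) < \<top>"
      using fin by (simp add: entropy_def)
  qed
  finally show ?thesis .
qed

text \<open>For an \<open>\<alpha>\<close>-null set \<open>A\<close>, the test functions \<open>exp (n 1\<^sub>A)\<close> give \<open>n \<nu>(A \<times> E') \<le> I(\<nu>)\<close> for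
  all \<open>n\<close>. This avoids the question whether the entropy of the kernel is a measurable function.\<close>

lemma finite_entropy_null:
  assumes \<nu>: "\<nu> \<in> admissible" and fin: "entropy \<nu> < \<infinity>" and A: "A \<in> sets borel" and A0: "emeasure \<alpha> A = 0"
  shows "emeasure \<nu> (A \<times> {0<..}) = 0"
proof -
  interpret \<nu>: prob_space \<nu> by (rule admissibleD[OF \<nu>])
  have At: "A \<times> {0<..} \<in> sets \<nu>"
    using A sets.top[of weight_space] by (simp add: admissibleD(2)[OF \<nu>])
  have le: "real n * measure \<nu> (A \<times> {0<..}) \<le> enn2real (entropy \<nu>)" for n :: nat
  proof -
    define h where "h x = exp (real n * indicator A x)" for x
    have hm: "h \<in> borel_measurable borel" unfolding h_def using A by measurable
    have "AE x in \<alpha>. x \<notin> A" using A A0 by (intro AE_not_in) auto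
    then have "(\<integral>x. h x \<partial>\<alpha>) = (\<integral>x. 1 \<partial>\<alpha>)"
    proof (intro integral_cong_AE)
      assume "AE x in \<alpha>. x \<notin> A"
      then show "AE x in \<alpha>. h x = 1" by eventually_elim (simp add: h_def)
    qed (use hm in simp_all)
    then have h1: "(\<integral>x. h x \<partial>\<alpha>) = 1" using alpha.prob_space by simp
    have "(\<integral>z. ln (h (fst z)) \<partial>\<nu>) \<le> enn2real (entropy \<nu>)"
      using entropy_ge[OF \<nu> fin, of "\<lambda>_. 0" "\<lambda>_. h" 1 "exp (real n)"] hm h1
      by (auto simp: h_def split: split_indicator)
    also have "(\<integral>z. ln (h (fst z)) \<partial>\<nu>) = (\<integral>z. real n * indicator (A \<times> {0<..}) z \<partial>\<nu>)"
      by (intro Bochner_Integration.integral_cong)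
        (auto simp: h_def admissibleD(4)[OF \<nu>] split: split_indicator)
    also have "\<dots> = real n * measure \<nu> (A \<times> {0<..})"
      using sets.sets_into_space[OF At] by (simp add: Int_absorb2)
    finally show ?thesis .
  qed
  have "measure \<nu> (A \<times> {0<..}) \<le> 0"
  proof (rule ccontr)
    assume "\<not> ?thesis"
    then obtain n :: nat where "enn2real (entropy \<nu>) < real n * measure \<nu> (A \<times> {0<..})"
      using reals_Archimedean3[of "measure \<nu> (A \<times> {0<..})"] by auto
    then show False using le[of n] by linarith
  qed
  then show ?thesis by (simp add: \<nu>.emeasure_eq_measure measure_le_0_iff)
qed

text \<open>Finite entropy makes the spin law inside a bin absolutely continuous, and its normalised
  density is replaced by a bounded one. The entropy of \<open>h\<close> is compared with the
  integral of \<open>ln h\<close> over the bin and not with an entropy of that bin: the sum of these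
  integrals over the bins is exactly what \<open>entropy_ge\<close> bounds.\<close>

lemma bin_trial:
  assumes \<nu>: "\<nu> \<in> admissible" and fin: "entropy \<nu> < \<infinity>" and k: "k \<in> borel \<rightarrow>\<^sub>M count_space UNIV"
    and \<delta>: "0 < \<delta>" and \<pi>: "\<pi> = measure P {v \<in> space P. k v = j}"
  obtains h :: "'a \<Rightarrow> real" and lo hi :: real where "h \<in> borel_measurable borel" "0 < lo" "\<And>x. lo \<le> h x" "\<And>x. h x \<le> hi"
    "(\<integral>x. h x \<partial>\<alpha>) = 1"
    "\<pi> * (\<integral>x. h x * ln (h x) \<partial>\<alpha>) \<le> (\<integral>z. ln (h (fst z)) * indicator {j} (k (snd z)) \<partial>\<nu>)"
    "\<And>u C. u \<in> borel_measurable borel \<Longrightarrow> (\<And>x. \<bar>u x\<bar> \<le> C) \<Longrightarrow>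
      \<bar>(\<integral>z. u (fst z) * indicator {j} (k (snd z)) \<partial>\<nu>) - \<pi> * (\<integral>x. u x * h x \<partial>\<alpha>)\<bar> \<le> \<pi> * \<delta> * C"
proof -
  interpret \<nu>: prob_space \<nu> by (rule admissibleD[OF \<nu>])
  define J where "J z = (indicator {j} (k (snd z)) :: real)" for z :: "'a \<times> real"
  have jm: "(\<lambda>v. indicator {j} (k v) :: real) \<in> borel_measurable borel"
    by (rule measurable_compose[OF k]) simp
  have Jm: "J \<in> borel_measurable \<nu>" unfolding J_def using measurable_weight[OF \<nu> jm] .
  have J01: "0 \<le> J z" "J z \<le> 1" for z by (auto simp: J_def split: split_indicator)
  have intJ: "integrable \<nu> J" using J01 Jm by (intro \<nu>.integrable_const_bound[where B=1]) auto
  have \<pi>J: "(\<integral>z. J z \<partial>\<nu>) = \<pi>"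
  proof -
    have "(\<integral>z. J z \<partial>\<nu>) = (\<integral>v. indicator {j} (k v) \<partial>P)"
      unfolding J_def using integral_weight[OF \<nu> measurable_weight_spaceI[OF jm]] .
    also have "\<dots> = (\<integral>v. indicator {v \<in> space P. k v = j} v \<partial>P)"
      by (intro Bochner_Integration.integral_cong) (auto split: split_indicator)
    also have "\<dots> = \<pi>" using sets.sets_into_space by (simp add: \<pi> Int_def conj_ac)
    finally show ?thesis .
  qed
  have \<pi>0: "0 \<le> \<pi>" by (simp add: \<pi>)
  \<comment> \<open>The unnormalised spin law inside bin \<open>j\<close>, of total mass
    \<open>\<pi>\<close>.\<close>
  define \<nu>j where "\<nu>j = distr (density \<nu> J) borel fst"
  have fst\<nu>: "fst \<in> \<nu> \<rightarrow>\<^sub>M borel"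
    by (simp add: measurable_cong_sets[OF admissibleD(2)[OF \<nu>] refl])
  then have fstm: "fst \<in> density \<nu> J \<rightarrow>\<^sub>M borel" by (simp add: measurable_cong_sets[OF sets_density refl])
  have ac: "absolutely_continuous \<alpha> \<nu>j"
    unfolding absolutely_continuous_def
  proof
    fix A assume "A \<in> null_sets \<alpha>"
    then have A: "A \<in> sets borel" "emeasure \<alpha> A = 0" by auto
    have Am: "fst -` A \<inter> space \<nu> \<in> sets \<nu>" using A(1) by (rule measurable_sets[OF fst\<nu>])
    have "fst -` A \<inter> space \<nu> = A \<times> {0<..}" by (auto simp: admissibleD(4)[OF \<nu>])
    then have "emeasure \<nu> (fst -` A \<inter> space \<nu>) = 0" using finite_entropy_null[OF \<nu> fin A] by simp
    then have "fst -` A \<inter> space \<nu> \<in> null_sets \<nu>" using Am by auto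
    then have "fst -` A \<inter> space \<nu> \<in> null_sets (density \<nu> J)"
      using Jm absolutely_continuousI_density[of J \<nu>] by (auto simp: absolutely_continuous_def)
    then have "emeasure \<nu>j A = 0"
      unfolding \<nu>j_def using A(1) fstm by (subst emeasure_distr) (auto simp: null_sets_def)
    then show "A \<in> null_sets \<nu>j" using A by (auto simp: null_sets_def \<nu>j_def)
  qed
  have sets_\<nu>j: "sets \<nu>j = sets \<alpha>" by (simp add: \<nu>j_def)
  have fin\<nu>j: "finite_measure \<nu>j"
    unfolding \<nu>j_def
  proof (rule finite_measure.finite_measure_distr[OF _ fstm])
    show "finite_measure (density \<nu> J)"
    proof
      have "emeasure (density \<nu> J) (space (density \<nu> J)) = (\<integral>\<^sup>+z. J z \<partial>\<nu>)"
        using Jm by (simp add: emeasure_density cong: nn_integral_cong)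
      also have "\<dots> = ennreal \<pi>"
        using J01 intJ \<pi>J by (subst nn_integral_eq_integral) auto
      finally show "emeasure (density \<nu> J) (space (density \<nu> J)) \<noteq> \<infinity>" by simp
    qed
  qed
  define f where "f x = enn2real (RN_deriv \<alpha> \<nu>j x)" for x
  have fm: "f \<in> borel_measurable \<alpha>" unfolding f_def by measurable
  have f0: "0 \<le> f x" for x by (simp add: f_def)
  have \<nu>j_f: "\<nu>j = density \<alpha> f"
  proof -
    have "AE x in \<alpha>. RN_deriv \<alpha> \<nu>j x \<noteq> \<infinity>"
      using ac sets_\<nu>j fin\<nu>j
      by (intro alpha.RN_deriv_finite) (auto simp: finite_measure_def)
    then have "AE x in \<alpha>. RN_deriv \<alpha> \<nu>j x = ennreal (f x)"
      by eventually_elim (auto simp: f_def top.not_eq_extremum)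
    then have "density \<alpha> (RN_deriv \<alpha> \<nu>j) = density \<alpha> f"
      using fm by (intro density_cong) auto
    then show ?thesis using alpha.density_RN_deriv[OF ac sets_\<nu>j] by simp
  qed
  have key: "(\<integral>z. u (fst z) * J z \<partial>\<nu>) = (\<integral>x. f x * u x \<partial>\<alpha>)"
    if um: "u \<in> borel_measurable borel" for u :: "'a \<Rightarrow> real"
  proof -
    have "(\<integral>x. u x \<partial>\<nu>j) = (\<integral>z. u (fst z) \<partial>density \<nu> J)"
      unfolding \<nu>j_def by (rule integral_distr[OF fstm um])
    also have "\<dots> = (\<integral>z. J z * u (fst z) \<partial>\<nu>)"
      using J01 by (intro integral_real_density Jm AE_I2 measurable_spin[OF \<nu> um])
    finally have "(\<integral>z. u (fst z) * J z \<partial>\<nu>) = (\<integral>x. u x \<partial>\<nu>j)" by (simp add: mult.commute)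
    also have "\<dots> = (\<integral>x. f x * u x \<partial>\<alpha>)"
      unfolding \<nu>j_f using um by (intro integral_real_density fm AE_I2 f0) simp
    finally show ?thesis .
  qed
  have intf: "integrable \<alpha> f"
  proof -
    interpret nuj: finite_measure \<nu>j by fact
    have "integrable \<nu>j (\<lambda>_. 1::real)" by simp
    then show ?thesis
      unfolding \<nu>j_f using fm f0 by (subst (asm) integrable_real_density) auto
  qed
  have f\<pi>: "(\<integral>x. f x \<partial>\<alpha>) = \<pi>" using key[of "\<lambda>_. 1"] \<pi>J by simp
  show thesis
  proof (cases "\<pi> = 0")
    \<comment> \<open>For a bin of measure zero the constant density 1 is as good as any, since
      every term vanishes.\<close>
    case True
    show thesis
    proof (rule that[of "\<lambda>_. 1" 1 1])
      fix u :: "'a \<Rightarrow> real" and C assume um: "u \<in> borel_measurable borel" and C: "\<And>x. \<bar>u x\<bar> \<le> C"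
      have "AE x in \<alpha>. f x = 0"
        using integral_nonneg_eq_0_iff_AE[OF intf] f0 f\<pi> True by simp
      then have "(\<integral>x. f x * u x \<partial>\<alpha>) = (\<integral>x. 0 \<partial>\<alpha>)"
        using um fm by (intro integral_cong_AE) auto
      then show "\<bar>(\<integral>z. u (fst z) * indicator {j} (k (snd z)) \<partial>\<nu>) - \<pi> * (\<integral>x. u x * 1 \<partial>\<alpha>)\<bar> \<le> \<pi> * \<delta> * C"
        using key[OF um] True by (simp add: J_def)
    qed (use alpha.prob_space True in auto)
  next
    case False
    then have \<pi>p: "0 < \<pi>" using \<pi>0 by simp
    define g where "g x = f x / \<pi>" for x
    have intg: "integrable \<alpha> g" unfolding g_def using intf by simp
    have g0: "0 \<le> g x" for x using f0 \<pi>p by (simp add: g_def)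
    have g1: "(\<integral>x. g x \<partial>\<alpha>) = 1" unfolding g_def using f\<pi> \<pi>p by simp
    obtain h lo hi where h: "h \<in> borel_measurable \<alpha>" "0 < lo" "\<And>x. lo \<le> h x" "\<And>x. h x \<le> hi"
      "(\<integral>x. h x \<partial>\<alpha>) = 1" "(\<integral>x. \<bar>h x - g x\<bar> \<partial>\<alpha>) \<le> \<delta>"
      "(\<integral>x. h x * ln (h x) \<partial>\<alpha>) \<le> (\<integral>x. g x * ln (h x) \<partial>\<alpha>)"
      using alpha.bounded_density_approx[OF intg g0 g1 \<delta>] by blast
    have hb: "h \<in> borel_measurable borel" using h(1) by simp
    have fg: "f x = \<pi> * g x" for x using \<pi>p by (simp add: g_def)
    show thesis
    proof (rule that[OF hb h(2-5)])
      have "(\<integral>z. ln (h (fst z)) * indicator {j} (k (snd z)) \<partial>\<nu>) = (\<integral>x. f x * ln (h x) \<partial>\<alpha>)"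
        using key[of "\<lambda>x. ln (h x)"] hb by (simp add: J_def)
      also have "\<dots> = \<pi> * (\<integral>x. g x * ln (h x) \<partial>\<alpha>)" by (simp add: fg mult.assoc)
      finally show "\<pi> * (\<integral>x. h x * ln (h x) \<partial>\<alpha>) \<le> (\<integral>z. ln (h (fst z)) * indicator {j} (k (snd z)) \<partial>\<nu>)"
        using h(7) \<pi>p by simp
    next
      fix u :: "'a \<Rightarrow> real" and C assume um: "u \<in> borel_measurable borel" and C: "\<And>x. \<bar>u x\<bar> \<le> C"
      have C0: "0 \<le> C" using C abs_ge_zero order_trans by blast
      have inth: "integrable \<alpha> h"
      proof (rule alpha.integrable_const_bound[where B=hi])
        have "\<bar>h x\<bar> \<le> hi" for x using h(2) h(3,4)[of x] by auto
        then show "AE x in \<alpha>. norm (h x) \<le> hi" by simp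
      qed (rule h(1))
      have intu: "integrable \<alpha> (\<lambda>x. u x * v x)" if "integrable \<alpha> v" for v
      proof (rule Bochner_Integration.integrable_bound)
        show "integrable \<alpha> (\<lambda>x. C * v x)" using that by simp
        show "AE x in \<alpha>. norm (u x * v x) \<le> norm (C * v x)"
          using C C0 by (auto simp: abs_mult intro!: AE_I2 mult_right_mono)
        show "(\<lambda>x. u x * v x) \<in> borel_measurable \<alpha>"
          using um that by (intro borel_measurable_times) auto
      qed
      have "(\<integral>z. u (fst z) * indicator {j} (k (snd z)) \<partial>\<nu>) = \<pi> * (\<integral>x. u x * g x \<partial>\<alpha>)"
        using key[OF um] by (simp add: J_def fg mult_ac)
      then have "(\<integral>z. u (fst z) * indicator {j} (k (snd z)) \<partial>\<nu>) - \<pi> * (\<integral>x. u x * h x \<partial>\<alpha>)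
          = \<pi> * ((\<integral>x. u x * g x \<partial>\<alpha>) - (\<integral>x. u x * h x \<partial>\<alpha>))"
        by (simp add: right_diff_distrib)
      also have "(\<integral>x. u x * g x \<partial>\<alpha>) - (\<integral>x. u x * h x \<partial>\<alpha>) = (\<integral>x. u x * g x - u x * h x \<partial>\<alpha>)"
        using intu[OF intg] intu[OF inth] by simp
      finally have eq: "(\<integral>z. u (fst z) * indicator {j} (k (snd z)) \<partial>\<nu>) - \<pi> * (\<integral>x. u x * h x \<partial>\<alpha>)
          = \<pi> * (\<integral>x. u x * g x - u x * h x \<partial>\<alpha>)" .
      have "\<bar>\<integral>x. u x * g x - u x * h x \<partial>\<alpha>\<bar> \<le> (\<integral>x. \<bar>u x * g x - u x * h x\<bar> \<partial>\<alpha>)"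
        by (rule integral_abs_bound)
      also have "\<dots> \<le> (\<integral>x. C * \<bar>h x - g x\<bar> \<partial>\<alpha>)"
      proof (rule integral_mono)
        show "integrable \<alpha> (\<lambda>x. \<bar>u x * g x - u x * h x\<bar>)" using intu[OF intg] intu[OF inth] by simp
        show "integrable \<alpha> (\<lambda>x. C * \<bar>h x - g x\<bar>)" using inth intg by simp
        fix x
        have "\<bar>u x * g x - u x * h x\<bar> = \<bar>u x\<bar> * \<bar>h x - g x\<bar>"
          by (metis abs_minus_commute abs_mult right_diff_distrib)
        also have "\<dots> \<le> C * \<bar>h x - g x\<bar>" by (rule mult_right_mono[OF C]) simp
        finally show "\<bar>u x * g x - u x * h x\<bar> \<le> C * \<bar>h x - g x\<bar>" .
      qed
      also have "\<dots> = C * (\<integral>x. \<bar>h x - g x\<bar> \<partial>\<alpha>)" by simp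
      also have "\<dots> \<le> C * \<delta>" using h(6) C0 by (rule mult_left_mono)
      finally have "\<bar>\<integral>x. u x * g x - u x * h x \<partial>\<alpha>\<bar> \<le> C * \<delta>" .
      then have "\<pi> * \<bar>\<integral>x. u x * g x - u x * h x \<partial>\<alpha>\<bar> \<le> \<pi> * (C * \<delta>)" using \<pi>0 by (rule mult_left_mono)
      then show "\<bar>(\<integral>z. u (fst z) * indicator {j} (k (snd z)) \<partial>\<nu>) - \<pi> * (\<integral>x. u x * h x \<partial>\<alpha>)\<bar> \<le> \<pi> * \<delta> * C"
        unfolding eq using \<pi>0 by (simp add: abs_mult mult_ac)
    qed
  qed
qed

end

section \<open>The lower bound\<close>

text \<open>The data produced by \<open>weight_bins\<close>, fixed as parameters so that both bounds
  can work with one rounding of accuracy \<open>\<eta>\<close>.\<close>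

locale binned_system = spin_system w P \<alpha> G b
  for w P and \<alpha> :: "'a::polish_space measure" and G b +
  fixes k :: "real \<Rightarrow> nat" and r :: "nat \<Rightarrow> real" and K :: nat and \<eta> :: real
  assumes k_meas: "k \<in> borel \<rightarrow>\<^sub>M count_space UNIV" and k_less: "\<And>x. k x < K"
    and r_nonneg: "\<And>j. 0 \<le> r j" and r_le: "\<And>x. x > 0 \<Longrightarrow> r (k x) \<le> x"
    and r_close_P: "(\<integral>x. x - r (k x) \<partial>P) \<le> \<eta>"
    and r_close_w: "\<And>N. N \<ge> 1 \<Longrightarrow> (\<Sum>i=1..N. w i - r (k (w i))) / real N \<le> \<eta>"
    and bin_frequency: "\<And>j. (\<lambda>N. (\<Sum>i=1..N. indicator {j} (k (w i))) / real N :: real)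
          \<longlonglongrightarrow> measure P {x \<in> space P. k x = j}"
begin

definition p :: "nat \<Rightarrow> real" where "p j = measure P {x \<in> space P. k x = j}"

definition freq :: "nat \<Rightarrow> nat \<Rightarrow> real" where
  "freq N j = (\<Sum>i=1..N. indicator {j} (k (w i))) / real N"

definition R :: real where "R = Max (r ` {..<K})"

lemma p_nonneg: "0 \<le> p j"
  by (simp add: p_def)

lemma freq_tendsto: "(\<lambda>N. freq N j) \<longlonglongrightarrow> p j"
  unfolding freq_def p_def by (rule bin_frequency)

lemma r_le_R: "r (k x) \<le> R"
  unfolding R_def using k_less by (intro Max_ge) auto

lemma R_nonneg: "0 \<le> R"
  by (rule order_trans[OF r_nonneg r_le_R[of 0]])

lemma measurable_r_k: "(\<lambda>x. r (k x)) \<in> borel_measurable borel"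
  by (rule measurable_compose[OF k_meas]) (simp only: measurable_count_space_eq1 space_borel UNIV_I Pi_UNIV)

lemma integrable_r_k: "integrable P (\<lambda>x. r (k x))"
proof (rule Bochner_Integration.integrable_bound[OF integrable_weight])
  show "AE x in P. norm (r (k x)) \<le> norm x" using r_nonneg r_le by (intro AE_I2) auto
  show "(\<lambda>x. r (k x)) \<in> borel_measurable P"
    unfolding measurable_cong_sets[OF sets_P refl] by (rule measurable_weight_spaceI[OF measurable_r_k])
qed

lemma measurable_bin: "(\<lambda>v. indicator {j} (k v) :: real) \<in> borel_measurable borel"
  by (rule measurable_compose[OF k_meas]) (simp only: measurable_count_space_eq1 space_borel UNIV_I Pi_UNIV)

lemma integral_bin: "(\<integral>v. indicator {j} (k v) \<partial>P) = p j"
proof -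
  have "(\<integral>v. indicator {j} (k v) \<partial>P) = (\<integral>v. indicator {v \<in> space P. k v = j} v \<partial>P)"
    by (intro Bochner_Integration.integral_cong) (auto split: split_indicator)
  also have "\<dots> = p j" using sets.sets_into_space by (simp add: p_def Int_def conj_ac)
  finally show ?thesis .
qed

lemma integrable_bin: "integrable P (\<lambda>v. indicator {j} (k v) :: real)"
proof (rule P.integrable_const_bound[where B=1])
  show "(\<lambda>v. indicator {j} (k v) :: real) \<in> borel_measurable P"
    unfolding measurable_cong_sets[OF sets_P refl] by (rule measurable_weight_spaceI[OF measurable_bin])
qed (simp add: indicator_def)

lemma label_decomposition:
  fixes q :: "nat \<Rightarrow> real"
  shows "q (k v) = (\<Sum>j<K. q j * indicator {j} (k v))"
proof -
  have "(\<Sum>j<K. q j * indicator {j} (k v)) = (\<Sum>j<K. if k v = j then q j else 0)"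
    by (intro sum.cong refl) (auto split: split_indicator)
  then show ?thesis using k_less[of v] by simp
qed

lemma integrable_bin_mult:
  assumes \<nu>: "\<nu> \<in> admissible" and u: "u \<in> borel_measurable borel" and C: "\<And>x. \<bar>u x\<bar> \<le> C"
  shows "integrable \<nu> (\<lambda>z. u (fst z) * indicator {j} (k (snd z)) :: real)"
proof -
  interpret \<nu>: prob_space \<nu> by (rule admissibleD[OF \<nu>])
  show ?thesis
  proof (rule \<nu>.integrable_const_bound[where B=C])
    have "norm (u (fst z) * indicator {j} (k (snd z))) \<le> C" for z
      using C[of "fst z"] by (auto split: split_indicator)
    then show "AE z in \<nu>. norm (u (fst z) * indicator {j} (k (snd z))) \<le> C" by simp
  qed (intro borel_measurable_times measurable_spin[OF \<nu> u] measurable_weight[OF \<nu> measurable_bin])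
qed

lemma integral_label_mult:
  fixes q :: "nat \<Rightarrow> real" and u :: "nat \<Rightarrow> 'a \<Rightarrow> real"
  assumes \<nu>: "\<nu> \<in> admissible" and u: "\<And>j. u j \<in> borel_measurable borel" and C: "\<And>j x. \<bar>u j x\<bar> \<le> C"
  shows "(\<integral>z. u (k (snd z)) (fst z) \<partial>\<nu>) = (\<Sum>j<K. \<integral>z. u j (fst z) * indicator {j} (k (snd z)) \<partial>\<nu>)"
proof -
  have "(\<integral>z. u (k (snd z)) (fst z) \<partial>\<nu>) = (\<integral>z. (\<Sum>j<K. u j (fst z) * indicator {j} (k (snd z))) \<partial>\<nu>)"
    by (intro Bochner_Integration.integral_cong refl) (rule label_decomposition)
  also have "\<dots> = (\<Sum>j<K. \<integral>z. u j (fst z) * indicator {j} (k (snd z)) \<partial>\<nu>)"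
    by (intro Bochner_Integration.integral_sum integrable_bin_mult[OF \<nu> u C])
  finally show ?thesis .
qed

lemma integral_label: "(\<integral>v. q (k v) \<partial>P) = (\<Sum>j<K. q j * p j)"
proof -
  have "(\<integral>v. q (k v) \<partial>P) = (\<integral>v. (\<Sum>j<K. q j * indicator {j} (k v)) \<partial>P)"
    by (intro Bochner_Integration.integral_cong refl) (rule label_decomposition)
  also have "\<dots> = (\<Sum>j<K. \<integral>v. q j * indicator {j} (k v) \<partial>P)"
    by (rule Bochner_Integration.integral_sum) (intro integrable_mult_right integrable_bin)
  also have "\<dots> = (\<Sum>j<K. q j * p j)"
    by (intro sum.cong refl) (simp only: integral_mult_right_zero integral_bin)
  finally show ?thesis .
qed

lemma sum_r_p: "(\<Sum>j<K. r j * p j) \<le> mean"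
proof -
  have "(\<integral>v. r (k v) \<partial>P) \<le> (\<integral>v. v \<partial>P)"
    using r_le by (intro integral_mono integrable_r_k integrable_weight) auto
  then show ?thesis unfolding integral_label[of r] mean_def .
qed

definition mean_field :: "(nat \<Rightarrow> 'a \<Rightarrow> real) \<Rightarrow> nat \<Rightarrow> 'a \<Rightarrow> real" where
  "mean_field h l x = (\<integral>y. G x y * h l y \<partial>\<alpha>)"

text \<open>The mean interaction of two independent spins, the first with density \<open>h j\<close>
  and the second with density \<open>h l\<close>.\<close>

definition coupling :: "(nat \<Rightarrow> 'a \<Rightarrow> real) \<Rightarrow> nat \<Rightarrow> nat \<Rightarrow> real" where
  "coupling h j l = (\<integral>x. mean_field h l x * h j x \<partial>\<alpha>)"

text \<open>The conditions range over all labels, also those of no bin, which avoids side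
  conditions; the upper bound common to all labels keeps the entropies finite.\<close>

definition trial :: "(nat \<Rightarrow> 'a \<Rightarrow> real) \<Rightarrow> bool" where
  "trial h \<longleftrightarrow> (\<forall>j. h j \<in> borel_measurable borel) \<and> (\<forall>j. (\<integral>x. h j x \<partial>\<alpha>) = 1) \<and>
     (\<exists>hi. \<forall>j x. 0 \<le> h j x \<and> h j x \<le> hi)"

lemma trialD:
  assumes "trial h"
  shows "h j \<in> borel_measurable borel" "(\<integral>x. h j x \<partial>\<alpha>) = 1" "0 \<le> h j x" "integrable \<alpha> (h j)"
proof -
  note c = assms[unfolded trial_def, THEN conjunct2]
  show "h j \<in> borel_measurable borel"
    by (rule assms[unfolded trial_def, THEN conjunct1, THEN spec])
  show 1: "(\<integral>x. h j x \<partial>\<alpha>) = 1" by (rule c[THEN conjunct1, THEN spec])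
  obtain hi where "\<forall>j x. 0 \<le> h j x \<and> h j x \<le> hi" using c[THEN conjunct2] ..
  then show "0 \<le> h j x" by simp
  show "integrable \<alpha> (h j)"
  proof (rule ccontr)
    assume "\<not> ?thesis"
    then show False using 1 by (simp add: not_integrable_integral_eq)
  qed
qed

lemma
  assumes h: "trial h" and um: "u \<in> borel_measurable borel" and u: "\<And>x. 0 \<le> u x" "\<And>x. u x \<le> C"
  shows trial_integrable: "integrable \<alpha> (\<lambda>x. u x * h j x)"
    and trial_integral_nonneg: "0 \<le> (\<integral>x. u x * h j x \<partial>\<alpha>)"
    and trial_integral_le: "(\<integral>x. u x * h j x \<partial>\<alpha>) \<le> C"
proof -
  note hj = trialD[OF h]
  show int: "integrable \<alpha> (\<lambda>x. u x * h j x)"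
  proof (rule Bochner_Integration.integrable_bound)
    show "integrable \<alpha> (\<lambda>x. C * h j x)" using hj(4) by simp
    have "norm (u x * h j x) \<le> norm (C * h j x)" for x
    proof -
      have "u x * h j x \<le> C * h j x" using u(2) hj(3) by (rule mult_right_mono)
      moreover have "0 \<le> u x * h j x" using u(1) hj(3) by (rule mult_nonneg_nonneg)
      ultimately show ?thesis by simp
    qed
    then show "AE x in \<alpha>. norm (u x * h j x) \<le> norm (C * h j x)" by simp
    show "(\<lambda>x. u x * h j x) \<in> borel_measurable \<alpha>" using um hj(1)[of j] by simp
  qed
  show "0 \<le> (\<integral>x. u x * h j x \<partial>\<alpha>)"
    using u(1) hj(3) by (intro integral_nonneg_AE AE_I2 mult_nonneg_nonneg) auto
  have "(\<integral>x. u x * h j x \<partial>\<alpha>) \<le> (\<integral>x. C * h j x \<partial>\<alpha>)"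
    using int hj(4) u hj(3) by (intro integral_mono mult_right_mono) auto
  then show "(\<integral>x. u x * h j x \<partial>\<alpha>) \<le> C" using hj(2) by simp
qed

lemma measurable_mean_field:
  assumes h: "trial h"
  shows "mean_field h l \<in> borel_measurable borel"
proof -
  have "(\<lambda>q. G (fst q) (snd q) * h l (snd q)) \<in> borel_measurable (borel \<Otimes>\<^sub>M borel)"
  proof (rule borel_measurable_times)
    show "(\<lambda>q. G (fst q) (snd q)) \<in> borel_measurable (borel \<Otimes>\<^sub>M borel)"
      using G_meas unfolding case_prod_beta' .
    show "(\<lambda>q. h l (snd q)) \<in> borel_measurable ((borel :: 'a measure) \<Otimes>\<^sub>M borel)"
      by (rule measurable_compose[OF measurable_snd trialD(1)[OF h]])
  qed
  then have "(\<lambda>(x, y). G x y * h l y) \<in> borel_measurable (borel \<Otimes>\<^sub>M \<alpha>)"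
    unfolding case_prod_beta' measurable_cong_sets[OF sets_pair_measure_cong[OF refl sets_alpha] refl] .
  then show ?thesis
    unfolding mean_field_def[abs_def] by (rule alpha.borel_measurable_lebesgue_integral)
qed

lemma mean_field_bounds:
  assumes h: "trial h"
  shows "0 \<le> mean_field h l x" "mean_field h l x \<le> b"
  unfolding mean_field_def
  by (rule trial_integral_nonneg[OF h G_section(1) G_nonneg G_le] trial_integral_le[OF h G_section(1) G_nonneg G_le])+

lemma coupling_bounds:
  assumes h: "trial h"
  shows "0 \<le> coupling h j l" "coupling h j l \<le> b"
  unfolding coupling_def
  by (rule trial_integral_nonneg[OF h measurable_mean_field[OF h] mean_field_bounds[OF h]]
      trial_integral_le[OF h measurable_mean_field[OF h] mean_field_bounds[OF h]])+

text \<open>If the kernels \<open>h j\<close> represent the bins of \<open>\<nu>\<close> up to \<open>\<delta>\<close> in total variation, then the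
  energy changes by at most \<open>b mean\<^sup>2 \<delta>\<close> for each of its two arguments.\<close>

lemma energy_le_coupling:
  assumes \<nu>: "\<nu> \<in> admissible" and h: "trial h" and \<delta>: "0 \<le> \<delta>"
    and close: "\<And>j u C. j < K \<Longrightarrow> u \<in> borel_measurable borel \<Longrightarrow> (\<And>x. \<bar>u x\<bar> \<le> C) \<Longrightarrow>
      \<bar>(\<integral>z. u (fst z) * indicator {j} (k (snd z)) \<partial>\<nu>) - p j * (\<integral>x. u x * h j x \<partial>\<alpha>)\<bar> \<le> p j * \<delta> * C"
  shows "energy \<nu> (\<lambda>x. r (k x)) \<le> (\<Sum>j<K. \<Sum>l<K. r j * r l * coupling h j l * p j * p l) + 2 * b * mean\<^sup>2 * \<delta>"
proof -
  let ?\<rho> = "\<lambda>x. r (k x)"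
  have close': "(\<integral>z. u (fst z) * indicator {j} (k (snd z)) \<partial>\<nu>) \<le> p j * (\<integral>x. u x * h j x \<partial>\<alpha>) + p j * \<delta> * C"
    if "j < K" "u \<in> borel_measurable borel" "\<And>x. \<bar>u x\<bar> \<le> C" for j u C
    using close[OF that] by linarith
  have dec: "(\<integral>z. ?\<rho> (snd z) * u (fst z) \<partial>\<nu>) = (\<Sum>j<K. r j * (\<integral>z. u (fst z) * indicator {j} (k (snd z)) \<partial>\<nu>))"
    if um: "u \<in> borel_measurable borel" and u: "\<And>x. \<bar>u x\<bar> \<le> C" for u C
  proof -
    have "(\<integral>z. ?\<rho> (snd z) * u (fst z) \<partial>\<nu>) = (\<integral>z. (\<Sum>j<K. r j * (u (fst z) * indicator {j} (k (snd z)))) \<partial>\<nu>)"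
    proof (rule Bochner_Integration.integral_cong[OF refl])
      fix z
      show "?\<rho> (snd z) * u (fst z) = (\<Sum>j<K. r j * (u (fst z) * indicator {j} (k (snd z))))"
        unfolding label_decomposition[of r "snd z"] sum_distrib_right by (intro sum.cong refl) (simp only: mult_ac)
    qed
    also have "\<dots> = (\<Sum>j<K. \<integral>z. r j * (u (fst z) * indicator {j} (k (snd z))) \<partial>\<nu>)"
      by (intro Bochner_Integration.integral_sum integrable_mult_right integrable_bin_mult[OF \<nu> um u])
    finally show ?thesis by simp
  qed
  \<comment> \<open>The field produced by the trial densities. Closeness is used twice, for
    \<open>G x\<close> in the inner integral and for \<open>\<psi>\<close> in the outer one, and
    each use costs \<open>b * mean\<^sup>2 * \<delta>\<close>.\<close>
  define \<psi> where "\<psi> x = (\<Sum>l<K. r l * p l * mean_field h l x)" for x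
  have \<psi>m: "\<psi> \<in> borel_measurable borel"
    unfolding \<psi>_def[abs_def] by (intro borel_measurable_sum borel_measurable_times borel_measurable_const measurable_mean_field[OF h])
  have \<psi>0: "0 \<le> \<psi> x" for x
    unfolding \<psi>_def using r_nonneg p_nonneg mean_field_bounds[OF h] by (intro sum_nonneg mult_nonneg_nonneg)
  have \<psi>b: "\<psi> x \<le> b * mean" for x
  proof -
    have "\<psi> x \<le> (\<Sum>l<K. r l * p l * b)"
      unfolding \<psi>_def using r_nonneg p_nonneg mean_field_bounds[OF h] by (intro sum_mono mult_left_mono) auto
    also have "\<dots> = b * (\<Sum>l<K. r l * p l)" by (simp add: sum_distrib_left mult_ac)
    also have "\<dots> \<le> b * mean" using sum_r_p b_nonneg by (rule mult_left_mono)
    finally show ?thesis .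
  qed
  have field_approx: "field \<nu> ?\<rho> x \<le> \<psi> x + mean * \<delta> * b" for x
  proof -
    have Gb: "\<bar>G x y\<bar> \<le> b" for y using G_nonneg G_le by simp
    have "field \<nu> ?\<rho> x = (\<Sum>l<K. r l * (\<integral>z. G x (fst z) * indicator {l} (k (snd z)) \<partial>\<nu>))"
      unfolding field_def by (rule dec[OF G_section(1) Gb])
    also have "\<dots> \<le> (\<Sum>l<K. r l * (p l * (\<integral>y. G x y * h l y \<partial>\<alpha>) + p l * \<delta> * b))"
      using close'[OF _ G_section(1) Gb] r_nonneg by (intro sum_mono mult_left_mono) auto
    also have "\<dots> = \<psi> x + (\<Sum>l<K. r l * p l) * (\<delta> * b)"
      by (simp add: \<psi>_def mean_field_def sum.distrib sum_distrib_left sum_distrib_right algebra_simps)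
    also have "\<dots> \<le> \<psi> x + mean * (\<delta> * b)"
      using mult_right_mono[OF sum_r_p, of "\<delta> * b"] \<delta> b_nonneg by simp
    finally show ?thesis by (simp add: mult.assoc)
  qed
  have \<rho>0: "0 \<le> ?\<rho> x" for x by (rule r_nonneg)
  have \<rho>m: "?\<rho> \<in> borel_measurable borel" by (rule measurable_r_k)
  have \<rho>int: "(\<integral>z. ?\<rho> (snd z) \<partial>\<nu>) \<le> mean" "0 \<le> (\<integral>z. ?\<rho> (snd z) \<partial>\<nu>)" "integrable \<nu> (\<lambda>z. ?\<rho> (snd z))"
  proof -
    have "(\<integral>z. ?\<rho> (snd z) \<partial>\<nu>) = (\<integral>v. ?\<rho> v \<partial>P)"
      by (rule integral_weight[OF \<nu> measurable_weight_spaceI[OF \<rho>m]])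
    also have "\<dots> \<le> mean"
      unfolding mean_def using integrable_r_k integrable_weight r_le by (intro integral_mono) auto
    finally show "(\<integral>z. ?\<rho> (snd z) \<partial>\<nu>) \<le> mean" .
    show "0 \<le> (\<integral>z. ?\<rho> (snd z) \<partial>\<nu>)" using \<rho>0 by (intro integral_nonneg_AE AE_I2)
    show "integrable \<nu> (\<lambda>z. ?\<rho> (snd z))"
      using integrable_r_k integrable_weight_iff[OF \<nu> measurable_weight_spaceI[OF \<rho>m]] by simp
  qed
  note field_props = field_nonneg[OF \<nu> \<rho>m integrable_r_k \<rho>0] field_le[OF \<nu> \<rho>m integrable_r_k \<rho>0]
  have int1: "integrable \<nu> (\<lambda>z. ?\<rho> (snd z) * field \<nu> ?\<rho> (fst z))"
    using field_props by (intro integrable_weight_mult[OF \<nu> \<rho>m integrable_r_k measurable_field[OF \<nu> \<rho>m], of "b * (\<integral>x. ?\<rho> x \<partial>P)"]) auto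
  have int2: "integrable \<nu> (\<lambda>z. ?\<rho> (snd z) * \<psi> (fst z))"
    using \<psi>0 \<psi>b by (intro integrable_weight_mult[OF \<nu> \<rho>m integrable_r_k \<psi>m, of "b * mean"]) auto
  have "energy \<nu> ?\<rho> \<le> (\<integral>z. ?\<rho> (snd z) * \<psi> (fst z) + mean * \<delta> * b * ?\<rho> (snd z) \<partial>\<nu>)"
    unfolding energy_def
  proof (rule integral_mono[OF int1])
    show "integrable \<nu> (\<lambda>z. ?\<rho> (snd z) * \<psi> (fst z) + mean * \<delta> * b * ?\<rho> (snd z))"
      using int2 \<rho>int(3) by simp
    show "?\<rho> (snd z) * field \<nu> ?\<rho> (fst z) \<le> ?\<rho> (snd z) * \<psi> (fst z) + mean * \<delta> * b * ?\<rho> (snd z)" for z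
      using mult_left_mono[OF field_approx[of "fst z"] \<rho>0[of "snd z"]]
      by (simp add: algebra_simps)
  qed
  also have "\<dots> = (\<integral>z. ?\<rho> (snd z) * \<psi> (fst z) \<partial>\<nu>) + mean * \<delta> * b * (\<integral>z. ?\<rho> (snd z) \<partial>\<nu>)"
    using int2 \<rho>int(3) by simp
  also have "mean * \<delta> * b * (\<integral>z. ?\<rho> (snd z) \<partial>\<nu>) \<le> mean * \<delta> * b * mean"
    using \<rho>int(1) mean_nonneg \<delta> b_nonneg by (intro mult_left_mono) auto
  also have "(\<integral>z. ?\<rho> (snd z) * \<psi> (fst z) \<partial>\<nu>) \<le> (\<Sum>j<K. \<Sum>l<K. r j * r l * coupling h j l * p j * p l) + b * mean * \<delta> * mean"
  proof -
    have \<psi>abs: "\<bar>\<psi> x\<bar> \<le> b * mean" for x using \<psi>0 \<psi>b by simp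
    have \<psi>h: "(\<integral>x. \<psi> x * h j x \<partial>\<alpha>) = (\<Sum>l<K. r l * p l * coupling h j l)" for j
    proof -
      have "(\<integral>x. \<psi> x * h j x \<partial>\<alpha>) = (\<integral>x. (\<Sum>l<K. r l * p l * (mean_field h l x * h j x)) \<partial>\<alpha>)"
        unfolding \<psi>_def by (simp add: sum_distrib_right mult.assoc)
      also have "\<dots> = (\<Sum>l<K. \<integral>x. r l * p l * (mean_field h l x * h j x) \<partial>\<alpha>)"
        by (intro Bochner_Integration.integral_sum integrable_mult_right
            trial_integrable[OF h measurable_mean_field[OF h] mean_field_bounds[OF h]])
      finally show ?thesis by (simp add: coupling_def)
    qed
    have "(\<integral>z. ?\<rho> (snd z) * \<psi> (fst z) \<partial>\<nu>) = (\<Sum>j<K. r j * (\<integral>z. \<psi> (fst z) * indicator {j} (k (snd z)) \<partial>\<nu>))"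
      by (rule dec[OF \<psi>m \<psi>abs])
    also have "\<dots> \<le> (\<Sum>j<K. r j * (p j * (\<integral>x. \<psi> x * h j x \<partial>\<alpha>) + p j * \<delta> * (b * mean)))"
      using close'[OF _ \<psi>m \<psi>abs] r_nonneg by (intro sum_mono mult_left_mono) auto
    also have "\<dots> = (\<Sum>j<K. \<Sum>l<K. r j * r l * coupling h j l * p j * p l) + (\<Sum>j<K. r j * p j) * (\<delta> * (b * mean))"
      unfolding \<psi>h by (simp add: sum.distrib sum_distrib_left sum_distrib_right algebra_simps)
    also have "(\<Sum>j<K. r j * p j) * (\<delta> * (b * mean)) \<le> mean * (\<delta> * (b * mean))"
      using sum_r_p \<delta> b_nonneg mean_nonneg by (intro mult_right_mono) auto
    finally show ?thesis by (simp add: mult_ac)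
  qed
  finally show ?thesis by (simp add: power2_eq_square mult_ac)
qed

end

context spin_system
begin

lemma density_trial:
  fixes h u :: "'a \<Rightarrow> real"
  assumes m: "h \<in> borel_measurable borel" and h0: "\<And>x. 0 \<le> h x" and h1: "(\<integral>x. h x \<partial>\<alpha>) = 1"
  shows "prob_space (density \<alpha> h)"
    and "sets (density \<alpha> h) = sets borel"
    and "u \<in> borel_measurable borel \<Longrightarrow> (\<integral>x. u x \<partial>density \<alpha> h) = (\<integral>x. u x * h x \<partial>\<alpha>)"
proof -
  have hm: "h \<in> borel_measurable \<alpha>" using m by simp
  have int: "integrable \<alpha> h" using h1 not_integrable_integral_eq[of \<alpha> h] by (metis zero_neq_one)
  show "prob_space (density \<alpha> h)"
  proof
    have "emeasure (density \<alpha> h) (space (density \<alpha> h)) = (\<integral>\<^sup>+x. h x \<partial>\<alpha>)"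
      using hm by (simp add: emeasure_density cong: nn_integral_cong)
    also have "\<dots> = ennreal (\<integral>x. h x \<partial>\<alpha>)" using h0 by (intro nn_integral_eq_integral int) auto
    finally show "emeasure (density \<alpha> h) (space (density \<alpha> h)) = 1" by (simp add: h1)
  qed
  show "sets (density \<alpha> h) = sets borel" by simp
  show "(\<integral>x. u x \<partial>density \<alpha> h) = (\<integral>x. u x * h x \<partial>\<alpha>)" if "u \<in> borel_measurable borel"
  proof -
    have "u \<in> borel_measurable \<alpha>" using that by simp
    from integral_real_density[OF hm AE_I2[OF h0] this] show ?thesis by (simp add: mult.commute)
  qed
qed

end

context binned_system
begin

definition ent :: "('a \<Rightarrow> real) \<Rightarrow> real" where
  "ent g = (\<integral>x. g x * ln (g x) \<partial>\<alpha>)"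

text \<open>The Gibbs bound for independent spins, the one at \<open>i\<close> having the density of
  the bin of \<open>w i\<close>. Off the diagonal the mean interaction is a coupling. The diagonal
  is dropped on the side of the Hamiltonian; adding it back among the couplings costs at most
  \<open>R\<^sup>2 * b\<close> per vertex, hence \<open>R\<^sup>2 * b\<close> in total after
  division by \<open>N\<close>.\<close>

lemma log_Z_ge:
  assumes h: "trial h" and lo: "0 < lo" "\<And>j x. lo \<le> h j x" and hi: "\<And>j x. h j x \<le> hi" and N: "N \<ge> 1"
  shows "(\<Sum>i=1..N. \<Sum>l=1..N. r (k (w i)) * r (k (w l)) * coupling h (k (w i)) (k (w l))) / real N - R\<^sup>2 * b
      - (\<Sum>i=1..N. ent (h (k (w i)))) \<le> ln (Z N)"
proof -
  define \<kappa> where "\<kappa> i = k (w i)" for i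
  define D where "D i = density \<alpha> (h (\<kappa> i))" for i
  define \<mu> where "\<mu> = (\<Pi>\<^sub>M i\<in>{1..N}. D i)"
  note hm = trialD(1)[OF h] and hI = trialD(2)[OF h] and h0 = trialD(3)[OF h]
  note dens = density_trial[OF hm h0 hI]
  have Dp: "prob_space (D i)" for i unfolding D_def by (rule dens(1))
  have Ds: "sets (D i) = sets borel" for i unfolding D_def by (rule dens(2))
  interpret \<mu>: prob_space \<mu> unfolding \<mu>_def by (rule prob_space_PiM) (rule Dp)
  have pm: "(\<lambda>\<sigma>. G (\<sigma> i) (\<sigma> l)) \<in> borel_measurable \<mu>" if "i \<in> {1..N}" "l \<in> {1..N}" for i l
    unfolding \<mu>_def by (rule measurable_pair_interaction[OF that Ds])
  have pint: "integrable \<mu> (\<lambda>\<sigma>. G (\<sigma> i) (\<sigma> l))" if "i \<in> {1..N}" "l \<in> {1..N}" for i l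
    by (rule \<mu>.integrable_const_bound[where B=b, OF _ pm[OF that]]) (intro AE_I2, simp only: real_norm_def abs_of_nonneg G_nonneg G_le)
  have pair: "(\<integral>\<sigma>. G (\<sigma> i) (\<sigma> l) \<partial>\<mu>) = coupling h (\<kappa> i) (\<kappa> l)"
    if il: "i \<in> {1..N}" "l \<in> {1..N}" "i \<noteq> l" for i l
  proof -
    interpret Di: prob_space "D i" by (rule Dp)
    interpret Dl: prob_space "D l" by (rule Dp)
    interpret pair: pair_prob_space "D i" "D l" ..
    have c: "(\<lambda>\<sigma>. \<sigma> i) \<in> \<mu> \<rightarrow>\<^sub>M D i" "(\<lambda>\<sigma>. \<sigma> l) \<in> \<mu> \<rightarrow>\<^sub>M D l"
      unfolding \<mu>_def by (rule measurable_component_singleton[OF il(1)] measurable_component_singleton[OF il(2)])+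
    have gm: "(\<lambda>q. G (fst q) (snd q)) \<in> borel_measurable (D i \<Otimes>\<^sub>M D l)"
      using G_meas unfolding case_prod_beta' measurable_cong_sets[OF sets_pair_measure_cong[OF Ds Ds] refl] .
    have gi: "integrable (D i \<Otimes>\<^sub>M D l) (\<lambda>q. G (fst q) (snd q))"
      by (rule pair.P.integrable_const_bound[where B=b, OF _ gm]) (intro AE_I2, simp only: real_norm_def abs_of_nonneg G_nonneg G_le)
    have "(\<integral>\<sigma>. G (\<sigma> i) (\<sigma> l) \<partial>\<mu>) = (\<integral>q. G (fst q) (snd q) \<partial>distr \<mu> (D i \<Otimes>\<^sub>M D l) (\<lambda>\<sigma>. (\<sigma> i, \<sigma> l)))"
      by (subst integral_distr[OF measurable_Pair[OF c] gm]) (simp only: fst_conv snd_conv)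
    also have "distr \<mu> (D i \<Otimes>\<^sub>M D l) (\<lambda>\<sigma>. (\<sigma> i, \<sigma> l)) = D i \<Otimes>\<^sub>M D l"
      unfolding \<mu>_def by (rule distr_PiM_pair[OF Dp _ il]) simp
    also have "(\<integral>q. G (fst q) (snd q) \<partial>(D i \<Otimes>\<^sub>M D l)) = (\<integral>x. (\<integral>y. G x y \<partial>D l) \<partial>D i)"
      using pair.integral_fst'[OF gi] by simp
    also have "\<dots> = (\<integral>x. mean_field h (\<kappa> l) x \<partial>D i)"
      unfolding D_def mean_field_def by (simp only: dens(3)[OF G_section(1)])
    also have "\<dots> = coupling h (\<kappa> i) (\<kappa> l)"
      unfolding D_def coupling_def by (rule dens(3)[OF measurable_mean_field[OF h]])
    finally show ?thesis .
  qed
  \<comment> \<open>Zero on the diagonal, where a spin is paired with itself and the pair law is not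
    a product. Since all terms are nonnegative, this only lowers the energy.\<close>
  define q where "q i l \<sigma> = (if i = l then 0 else r (\<kappa> i) * r (\<kappa> l) * G (\<sigma> i) (\<sigma> l))" for i l \<sigma>
  have q_int: "integrable \<mu> (q i l)" if "i \<in> {1..N}" "l \<in> {1..N}" for i l
    unfolding q_def using pint[OF that] by (cases "i = l") auto
  have q_eq: "(\<integral>\<sigma>. q i l \<sigma> \<partial>\<mu>) = (if i = l then 0 else r (\<kappa> i) * r (\<kappa> l) * coupling h (\<kappa> i) (\<kappa> l))"
    if "i \<in> {1..N}" "l \<in> {1..N}" for i l
    unfolding q_def using pair[OF that] by (cases "i = l") auto
  have wi: "0 < w i" "r (\<kappa> i) \<le> w i" if "i \<in> {1..N}" for i
    using w_pos[of i] r_le[of "w i"] that by (auto simp: \<kappa>_def)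
  have ham: "(\<Sum>i=1..N. \<Sum>l=1..N. q i l \<sigma>) / real N \<le> hamiltonian N \<sigma>" for \<sigma>
    unfolding hamiltonian_def
  proof (intro divide_right_mono sum_mono)
    fix i l assume il: "i \<in> {1..N}" "l \<in> {1..N}"
    have "r (\<kappa> i) * r (\<kappa> l) \<le> w i * w l"
      by (rule mult_mono[OF wi(2)[OF il(1)] wi(2)[OF il(2)]]) (use wi(1)[OF il(1)] r_nonneg in auto)
    then have "r (\<kappa> i) * r (\<kappa> l) * G (\<sigma> i) (\<sigma> l) \<le> w i * w l * G (\<sigma> i) (\<sigma> l)"
      using G_nonneg by (rule mult_right_mono)
    moreover have "0 \<le> w i * w l * G (\<sigma> i) (\<sigma> l)"
      using wi(1)[OF il(1)] wi(1)[OF il(2)] G_nonneg[of "\<sigma> i" "\<sigma> l"] by simp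
    ultimately show "q i l \<sigma> \<le> w i * w l * G (\<sigma> i) (\<sigma> l)"
      unfolding q_def by presburger
  qed simp
  define C where "C = b * (\<Sum>i=1..N. w i)\<^sup>2 / real N"
  have HC: "\<bar>hamiltonian N \<sigma>\<bar> \<le> C" for \<sigma> 
    unfolding C_def abs_of_nonneg[OF hamiltonian_bound(1)[OF N]] by (rule hamiltonian_bound(2)[OF N])
  have "(\<integral>\<sigma>. hamiltonian N \<sigma> \<partial>\<mu>) - (\<Sum>i\<in>{1..N}. \<integral>x. h (\<kappa> i) x * ln (h (\<kappa> i) x) \<partial>\<alpha>)
      \<le> ln (\<integral>\<sigma>. exp (hamiltonian N \<sigma>) \<partial>(\<Pi>\<^sub>M i\<in>{1..N}. \<alpha>))"
    unfolding \<mu>_def D_def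
  proof (rule alpha.gibbs_lower_bound[where lo=lo and hi=hi and C=C])
    show "h (\<kappa> i) \<in> borel_measurable \<alpha>" for i
      unfolding measurable_cong_sets[OF sets_alpha refl] by (rule hm)
    show "hamiltonian N \<in> borel_measurable (\<Pi>\<^sub>M i\<in>{1..N}. \<alpha>)"
      by (rule measurable_hamiltonian) (rule sets_alpha)
  qed (use lo hi hI HC in simp_all)
  then have gibbs: "(\<integral>\<sigma>. hamiltonian N \<sigma> \<partial>\<mu>) - (\<Sum>i=1..N. ent (h (\<kappa> i))) \<le> ln (Z N)"
    unfolding Z_eq[OF N] ent_def .
  have hmint: "integrable \<mu> (hamiltonian N)"
  proof (rule \<mu>.integrable_const_bound[where B=C])
    show "hamiltonian N \<in> borel_measurable \<mu>" unfolding \<mu>_def by (rule measurable_hamiltonian[OF Ds])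
  qed (simp add: HC)
  have S_int: "integrable \<mu> (\<lambda>\<sigma>. \<Sum>i=1..N. \<Sum>l=1..N. q i l \<sigma>)"
    by (intro Bochner_Integration.integrable_sum q_int)
  have "(\<Sum>i=1..N. \<Sum>l=1..N. r (\<kappa> i) * r (\<kappa> l) * coupling h (\<kappa> i) (\<kappa> l)) - real N * (R\<^sup>2 * b)
      \<le> (\<Sum>i=1..N. \<Sum>l=1..N. (\<integral>\<sigma>. q i l \<sigma> \<partial>\<mu>))"
  proof -
    define B where "B i l = r (\<kappa> i) * r (\<kappa> l) * coupling h (\<kappa> i) (\<kappa> l)" for i l
    have B: "B i l \<le> R\<^sup>2 * b" for i l
    proof -
      have "r (\<kappa> i) * r (\<kappa> l) \<le> R * R"
        unfolding \<kappa>_def by (rule mult_mono[OF r_le_R r_le_R R_nonneg r_nonneg])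
      then have "B i l \<le> R * R * b"
        unfolding B_def by (rule mult_mono) (use coupling_bounds[OF h] R_nonneg in auto)
      then show ?thesis by (simp add: power2_eq_square)
    qed
    have "(\<Sum>i=1..N. (\<Sum>l=1..N. B i l) - R\<^sup>2 * b) \<le> (\<Sum>i=1..N. \<Sum>l=1..N. if i = l then 0 else B i l)"
    proof (rule sum_mono)
      fix i assume i: "i \<in> {1..N}"
      have "(\<Sum>l=1..N. B i l) = (\<Sum>l=1..N. (if i = l then 0 else B i l) + (if i = l then B i l else 0))"
        by (intro sum.cong) auto
      also have "\<dots> = (\<Sum>l=1..N. if i = l then 0 else B i l) + B i i" using i by (simp add: sum.distrib)
      finally show "(\<Sum>l=1..N. B i l) - R\<^sup>2 * b \<le> (\<Sum>l=1..N. if i = l then 0 else B i l)"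
        using B[of i i] by linarith
    qed
    moreover have "(\<Sum>i=1..N. \<Sum>l=1..N. (\<integral>\<sigma>. q i l \<sigma> \<partial>\<mu>)) = (\<Sum>i=1..N. \<Sum>l=1..N. if i = l then 0 else B i l)"
      by (intro sum.cong refl) (simp add: q_eq B_def)
    ultimately show ?thesis by (simp add: sum_subtractf B_def)
  qed
  also have "\<dots> = (\<integral>\<sigma>. (\<Sum>i=1..N. \<Sum>l=1..N. q i l \<sigma>) \<partial>\<mu>)"
  proof -
    have "(\<integral>\<sigma>. (\<Sum>i=1..N. \<Sum>l=1..N. q i l \<sigma>) \<partial>\<mu>) = (\<Sum>i=1..N. \<integral>\<sigma>. (\<Sum>l=1..N. q i l \<sigma>) \<partial>\<mu>)"
      by (intro Bochner_Integration.integral_sum Bochner_Integration.integrable_sum q_int)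
    also have "\<dots> = (\<Sum>i=1..N. \<Sum>l=1..N. (\<integral>\<sigma>. q i l \<sigma> \<partial>\<mu>))"
      by (intro sum.cong refl Bochner_Integration.integral_sum q_int)
    finally show ?thesis by (rule sym)
  qed
  finally have "((\<Sum>i=1..N. \<Sum>l=1..N. r (\<kappa> i) * r (\<kappa> l) * coupling h (\<kappa> i) (\<kappa> l)) - real N * (R\<^sup>2 * b)) / real N
      \<le> (\<integral>\<sigma>. (\<Sum>i=1..N. \<Sum>l=1..N. q i l \<sigma>) \<partial>\<mu>) / real N"
    by (rule divide_right_mono) simp
  also have "\<dots> = (\<integral>\<sigma>. (\<Sum>i=1..N. \<Sum>l=1..N. q i l \<sigma>) / real N \<partial>\<mu>)" by simp
  also have "\<dots> \<le> (\<integral>\<sigma>. hamiltonian N \<sigma> \<partial>\<mu>)"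
    using ham hmint S_int by (intro integral_mono) auto
  finally show ?thesis
    using gibbs N by (simp add: diff_divide_distrib \<kappa>_def)
qed

text \<open>For fixed densities the bound of \<open>log_Z_ge\<close> is a polynomial in the bin
  frequencies, up to \<open>1 / N\<close>. Its limit \<open>T\<close> differs from the value of
  \<open>\<nu>\<close> by the rounding error and the total variation error; the last
  \<open>\<delta>\<close> pays for the convergence.\<close>

lemma lower_bound_binned:
  assumes \<nu>: "\<nu> \<in> admissible" and fin: "entropy \<nu> < \<infinity>" and \<delta>: "0 < \<delta>"
  shows "\<forall>\<^sub>F N in sequentially. energy \<nu> (\<lambda>x. x) - enn2real (entropy \<nu>)
      - (2 * b * mean * \<eta> + 2 * b * mean\<^sup>2 * \<delta> + \<delta>) \<le> ln (Z N) / real N"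
proof -
  interpret \<nu>: prob_space \<nu> by (rule admissibleD[OF \<nu>])
  \<comment> \<open>Collects everything \<open>bin_trial\<close> provides, so that one choice over
    \<open>j\<close> yields the densities together with their bounds.\<close>
  define good where "good j h lo hi \<longleftrightarrow> h \<in> borel_measurable borel \<and> 0 < (lo::real) \<and> (\<forall>x. lo \<le> h x) \<and>
      (\<forall>x. h x \<le> (hi::real)) \<and> (\<integral>x. h x \<partial>\<alpha>) = 1 \<and>
      p j * ent h \<le> (\<integral>z. ln (h (fst z)) * indicator {j} (k (snd z)) \<partial>\<nu>) \<and>
      (\<forall>u C. u \<in> borel_measurable borel \<longrightarrow> (\<forall>x. \<bar>u x\<bar> \<le> C) \<longrightarrow>
        \<bar>(\<integral>z. u (fst z) * indicator {j} (k (snd z)) \<partial>\<nu>) - p j * (\<integral>x. u x * h x \<partial>\<alpha>)\<bar> \<le> p j * \<delta> * C)"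
    for j h lo hi
  have "\<exists>h lo hi. good j h lo hi" for j
    unfolding good_def ent_def by (rule bin_trial[OF \<nu> fin k_meas \<delta> p_def[of j]]) blast
  then obtain h lo hi where good: "\<And>j. good j (h j) (lo j) (hi j)" by metis
  note good' = good[unfolded good_def]
  note hm = good'[THEN conjunct1]
  note g2 = good'[THEN conjunct2]
  note lo = g2[THEN conjunct1]
  note g3 = g2[THEN conjunct2]
  note hlo = g3[THEN conjunct1, THEN spec]
  note g4 = g3[THEN conjunct2]
  note hhi = g4[THEN conjunct1, THEN spec]
  note g5 = g4[THEN conjunct2]
  note h1 = g5[THEN conjunct1]
  note hent = g5[THEN conjunct2, THEN conjunct1]
  have hclose: "\<bar>(\<integral>z. u (fst z) * indicator {j} (k (snd z)) \<partial>\<nu>) - p j * (\<integral>x. u x * h j x \<partial>\<alpha>)\<bar> \<le> p j * \<delta> * C"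
    if "u \<in> borel_measurable borel" "\<And>x. \<bar>u x\<bar> \<le> C" for j u C
    using g5[of j, THEN conjunct2, THEN conjunct2] that by blast
  \<comment> \<open>Labels beyond the last bin repeat it, so that the finite minimum
    \<open>LO\<close> and maximum \<open>HI\<close> are bounds for every label.\<close>
  define g where "g j = h (min j (K - 1))" for j
  define LO where "LO = Min (lo ` {..<K})"
  define HI where "HI = Max (hi ` {..<K})"
  have K0: "0 < K" using k_less[of 0] by linarith
  then have m: "min j (K - 1) < K" for j by auto
  have gj: "g j = h j" if "j < K" for j
  proof -
    have "min j (K - 1) = j" using that by linarith
    then show ?thesis unfolding g_def by (rule arg_cong)
  qed
  have LO: "0 < LO" unfolding LO_def using lo K0 by (subst Min_gr_iff) auto
  have glo: "LO \<le> g j x" for j x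
  proof -
    have "LO \<le> lo (min j (K - 1))" unfolding LO_def using m by (intro Min_le) auto
    also have "\<dots> \<le> g j x" unfolding g_def by (rule hlo)
    finally show ?thesis .
  qed
  have ghi: "g j x \<le> HI" for j x
  proof -
    have "g j x \<le> hi (min j (K - 1))" unfolding g_def by (rule hhi)
    also have "\<dots> \<le> HI" unfolding HI_def using m by (intro Max_ge) auto
    finally show ?thesis .
  qed
  have gm: "g j \<in> borel_measurable borel" and g1: "(\<integral>x. g j x \<partial>\<alpha>) = 1" for j
    unfolding g_def by (rule hm, rule h1)
  have g0: "0 \<le> g j x" for j x using LO glo[of j x] by linarith
  have gt: "trial g" unfolding trial_def using gm g1 g0 ghi by blast
  have close: "\<bar>(\<integral>z. u (fst z) * indicator {j} (k (snd z)) \<partial>\<nu>) - p j * (\<integral>x. u x * g j x \<partial>\<alpha>)\<bar> \<le> p j * \<delta> * C"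
    if "j < K" "u \<in> borel_measurable borel" "\<And>x. \<bar>u x\<bar> \<le> C" for j u C
    unfolding gj[OF that(1)] by (rule hclose[OF that(2,3)])
  have bln: "\<bar>ln (g j x)\<bar> \<le> \<bar>ln LO\<bar> + \<bar>ln HI\<bar>" for j x
  proof -
    have "0 < g j x" using LO glo[of j x] by linarith
    then have "ln LO \<le> ln (g j x)" "ln (g j x) \<le> ln HI"
      using LO glo[of j x] ghi[of j x] by (auto intro!: ln_mono)
    then show ?thesis by linarith
  qed
  \<comment> \<open>The bin inequalities are added up, and \<open>entropy_ge\<close> is applied with
    the trial densities themselves as test densities.\<close>
  have ent_le: "(\<Sum>j<K. ent (g j) * p j) \<le> enn2real (entropy \<nu>)"
  proof -
    have "(\<Sum>j<K. ent (g j) * p j) \<le> (\<Sum>j<K. \<integral>z. ln (g j (fst z)) * indicator {j} (k (snd z)) \<partial>\<nu>)"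
    proof (rule sum_mono)
      fix j assume "j \<in> {..<K}"
      then have "g j = h j" using gj by blast
      then show "ent (g j) * p j \<le> (\<integral>z. ln (g j (fst z)) * indicator {j} (k (snd z)) \<partial>\<nu>)"
        using hent[of j] by (simp only: mult.commute)
    qed
    also have "\<dots> = (\<integral>z. ln (g (k (snd z)) (fst z)) \<partial>\<nu>)"
      by (rule integral_label_mult[OF \<nu> borel_measurable_ln[OF gm] bln, symmetric])
    also have "\<dots> \<le> enn2real (entropy \<nu>)"
      by (rule entropy_ge[OF \<nu> fin k_meas gm LO glo ghi g1])
    finally show ?thesis .
  qed
  define T where "T = (\<Sum>j<K. \<Sum>l<K. r j * r l * coupling g j l * p j * p l) - (\<Sum>j<K. ent (g j) * p j)"
  have en1: "energy \<nu> (\<lambda>x. r (k x)) \<le> (\<Sum>j<K. \<Sum>l<K. r j * r l * coupling g j l * p j * p l) + 2 * b * mean\<^sup>2 * \<delta>"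
    by (rule energy_le_coupling[OF \<nu> gt _ close]) (use \<delta> in auto)
  have en2: "energy \<nu> (\<lambda>x. x) \<le> energy \<nu> (\<lambda>x. r (k x)) + 2 * b * mean * \<eta>"
    by (rule energy_id_le[OF \<nu> measurable_r_k r_nonneg r_le r_close_P])
  have T_ge: "energy \<nu> (\<lambda>x. x) - enn2real (entropy \<nu>) - (2 * b * mean * \<eta> + 2 * b * mean\<^sup>2 * \<delta>) \<le> T"
    using en1 en2 ent_le unfolding T_def by linarith
  define S where "S N = (\<Sum>j<K. \<Sum>l<K. r j * r l * coupling g j l * freq N j * freq N l) - R\<^sup>2 * b * (1 / real N) - (\<Sum>j<K. ent (g j) * freq N j)" for N
  have "S \<longlonglongrightarrow> (\<Sum>j<K. \<Sum>l<K. r j * r l * coupling g j l * p j * p l) - R\<^sup>2 * b * 0 - (\<Sum>j<K. ent (g j) * p j)"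
    unfolding S_def by (intro tendsto_intros freq_tendsto lim_1_over_n)
  then have "S \<longlonglongrightarrow> T" by (simp add: T_def)
  then have "\<forall>\<^sub>F N in sequentially. T - \<delta> < S N" using \<delta> by (intro order_tendstoD) auto
  with eventually_ge_at_top[of 1] show ?thesis
  proof eventually_elim
    case (elim N)
    have N: "N \<ge> 1" by (rule elim(1))
    have "((\<Sum>i=1..N. \<Sum>l=1..N. r (k (w i)) * r (k (w l)) * coupling g (k (w i)) (k (w l))) / real N - R\<^sup>2 * b
        - (\<Sum>i=1..N. ent (g (k (w i))))) / real N \<le> ln (Z N) / real N"
      by (intro divide_right_mono log_Z_ge[OF gt LO glo ghi N]) simp
    also have "((\<Sum>i=1..N. \<Sum>l=1..N. r (k (w i)) * r (k (w l)) * coupling g (k (w i)) (k (w l))) / real N - R\<^sup>2 * b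
        - (\<Sum>i=1..N. ent (g (k (w i))))) / real N =
        (\<Sum>i=1..N. \<Sum>l=1..N. r (k (w i)) * r (k (w l)) * coupling g (k (w i)) (k (w l))) / (real N)\<^sup>2 - R\<^sup>2 * b * (1 / real N)
        - (\<Sum>i=1..N. ent (g (k (w i)))) / real N"
      by (simp add: diff_divide_distrib power2_eq_square)
    also have "\<dots> = S N"
      unfolding S_def
      using average_by_label(2)[of "\<lambda>i. k (w i)" K "freq N" N "\<lambda>j l. r j * r l * coupling g j l", OF k_less freq_def]
        average_by_label(1)[of "\<lambda>i. k (w i)" K "freq N" N "\<lambda>j. ent (g j)", OF k_less freq_def]
      by (simp only:)
    finally show ?case using T_ge elim(2) by linarith
  qed
qed

end

section \<open>Admissible measures built from trial densities\<close>

context binned_system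
begin

lemma trial_bound:
  assumes "trial h"
  obtains hi where "\<And>j x. h j x \<le> hi"
  using assms unfolding trial_def by blast

text \<open>From \<open>t * ln t \<ge> t - 1\<close>, where \<open>h j - 1\<close> integrates to
  zero.\<close>

lemma ent_nonneg:
  assumes h: "trial h"
  shows "0 \<le> ent (h j)"
proof -
  obtain hi where hi: "\<And>j x. h j x \<le> hi" using trial_bound[OF h] by blast
  have hm: "h j \<in> borel_measurable \<alpha>"
    unfolding measurable_cong_sets[OF sets_alpha refl] by (rule trialD(1)[OF h])
  have "(\<integral>x. h j x - 1 \<partial>\<alpha>) \<le> (\<integral>x. h j x * ln (h j x) \<partial>\<alpha>)"
  proof (rule integral_mono)
    show "integrable \<alpha> (\<lambda>x. h j x - 1)" using trialD(4)[OF h] by (intro Bochner_Integration.integrable_diff) auto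
    show "integrable \<alpha> (\<lambda>x. h j x * ln (h j x))"
      by (rule alpha.relative_entropy_density_bounded(2)[OF hm trialD(3)[OF h] hi])
    show "h j x - 1 \<le> h j x * ln (h j x)" for x
    proof (cases "h j x = 0")
      case False
      then have p: "0 < h j x" using trialD(3)[OF h, of j x] by linarith
      have "ln (1 / h j x) \<le> 1 / h j x - 1" using p by (intro ln_le_minus_one) auto
      then have "h j x * ln (1 / h j x) \<le> h j x * (1 / h j x - 1)" using p by (intro mult_left_mono) auto
      then show ?thesis using p by (simp add: ln_div algebra_simps)
    qed simp
  qed
  moreover have "(\<integral>x. h j x - 1 \<partial>\<alpha>) = 0"
    using trialD(4)[OF h, of j] trialD(2)[OF h, of j] alpha.prob_space by simp
  ultimately show ?thesis by (simp add: ent_def)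
qed

text \<open>Only finitely many conditional laws occur, one for each bin, so energy and entropy
  become finite sums. The constant density 1 gives \<open>\<alpha> \<Otimes> P\<close>.\<close>

definition tilted :: "(nat \<Rightarrow> 'a \<Rightarrow> real) \<Rightarrow> ('a \<times> real) measure" where
  "tilted h = density (\<alpha> \<Otimes>\<^sub>M P) (\<lambda>z. h (k (snd z)) (fst z))"

lemma
  assumes h: "trial h"
  shows tilted_admissible: "tilted h \<in> admissible"
    and is_cond_spin_tilted: "is_cond_spin (tilted h) (\<lambda>v. density \<alpha> (h (k v)))"
proof -
  interpret aP: pair_prob_space \<alpha> P ..
  note hm = trialD(1)[OF h] and h1 = trialD(2)[OF h] and h0 = trialD(3)[OF h]
  note dens = density_trial[OF hm h0 h1]
  have km: "k \<in> weight_space \<rightarrow>\<^sub>M count_space UNIV" by (rule measurable_weight_spaceI[OF k_meas])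
  have s: "sets (\<alpha> \<Otimes>\<^sub>M P) = sets (borel \<Otimes>\<^sub>M weight_space)"
    by (rule sets_pair_measure_cong[OF sets_alpha sets_P])
  have fm: "(\<lambda>z. h (k (snd z)) (fst z)) \<in> borel_measurable (borel \<Otimes>\<^sub>M weight_space)"
    by (rule measurable_compose_countable'[where g="\<lambda>z. k (snd z)" and I=UNIV,
          OF measurable_compose[OF measurable_fst hm] measurable_compose[OF measurable_snd km]]) auto
  then have fm': "(\<lambda>z. ennreal (h (k (snd z)) (fst z))) \<in> borel_measurable (\<alpha> \<Otimes>\<^sub>M P)"
    unfolding measurable_cong_sets[OF s refl] by (rule measurable_compose[OF _ measurable_ennreal])
  have st: "sets (tilted h) = sets (borel \<Otimes>\<^sub>M weight_space)" by (simp add: tilted_def s)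
  have spt: "space (tilted h) = UNIV \<times> {0<..}"
    using sets_eq_imp_space_eq[OF st] by (simp add: space_pair_measure)
  have rect: "emeasure (tilted h) (A \<times> B) = (\<integral>\<^sup>+v\<in>B. emeasure (density \<alpha> (h (k v))) A \<partial>P)"
    if A: "A \<in> sets borel" and B: "B \<in> sets weight_space" for A B
  proof -
    have AB: "A \<times> B \<in> sets (\<alpha> \<Otimes>\<^sub>M P)" unfolding s by (rule pair_measureI[OF A B])
    have Aa: "A \<in> sets \<alpha>" unfolding sets_alpha by (rule A)
    have "emeasure (tilted h) (A \<times> B) = (\<integral>\<^sup>+z. ennreal (h (k (snd z)) (fst z)) * indicator (A \<times> B) z \<partial>(\<alpha> \<Otimes>\<^sub>M P))"
      unfolding tilted_def by (rule emeasure_density[OF fm' AB])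
    also have "\<dots> = (\<integral>\<^sup>+v. (\<integral>\<^sup>+x. ennreal (h (k v) x) * indicator (A \<times> B) (x, v) \<partial>\<alpha>) \<partial>P)"
      using aP.nn_integral_snd[OF borel_measurable_times_ennreal[OF fm' borel_measurable_indicator[OF AB]]] by simp
    also have "\<dots> = (\<integral>\<^sup>+v\<in>B. emeasure (density \<alpha> (h (k v))) A \<partial>P)"
    proof (rule nn_integral_cong)
      fix v
      have hmv: "(\<lambda>x. ennreal (h (k v) x)) \<in> borel_measurable \<alpha>"
        unfolding measurable_cong_sets[OF sets_alpha refl] by (rule measurable_compose[OF hm measurable_ennreal])
      show "(\<integral>\<^sup>+x. ennreal (h (k v) x) * indicator (A \<times> B) (x, v) \<partial>\<alpha>) = emeasure (density \<alpha> (h (k v))) A * indicator B v"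
        by (cases "v \<in> B") (simp_all add: emeasure_density[OF hmv Aa] indicator_times)
    qed
    finally show ?thesis .
  qed
  have marg: "distr (tilted h) weight_space snd = P"
  proof (rule measure_eqI)
    fix B assume "B \<in> sets (distr (tilted h) weight_space snd)"
    then have B: "B \<in> sets weight_space" by simp
    have sndm: "snd \<in> tilted h \<rightarrow>\<^sub>M weight_space" unfolding measurable_cong_sets[OF st refl] by (rule measurable_snd)
    have "B \<subseteq> {0<..}" using sets.sets_into_space[OF B] by simp
    then have "snd -` B \<inter> space (tilted h) = UNIV \<times> B" by (auto simp: spt)
    then have "emeasure (distr (tilted h) weight_space snd) B = emeasure (tilted h) (UNIV \<times> B)"
      using emeasure_distr[OF sndm B] by simp
    also have "\<dots> = (\<integral>\<^sup>+v\<in>B. emeasure (density \<alpha> (h (k v))) UNIV \<partial>P)" by (rule rect[OF _ B]) simp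
    also have "\<dots> = (\<integral>\<^sup>+v. indicator B v \<partial>P)"
    proof (rule nn_integral_cong)
      fix v
      have "space (density \<alpha> (h (k v))) = UNIV" by simp
      then have "emeasure (density \<alpha> (h (k v))) UNIV = 1"
        using prob_space.emeasure_space_1[OF dens(1)[of "k v"]] by simp
      then show "emeasure (density \<alpha> (h (k v))) UNIV * indicator B v = indicator B v" by simp
    qed
    also have "\<dots> = emeasure P B" using B by simp
    finally show "emeasure (distr (tilted h) weight_space snd) B = emeasure P B" .
  qed simp
  have prob: "prob_space (tilted h)"
  proof
    have sp: "{0<..} \<in> sets weight_space" using sets.top[of weight_space] by simp
    have "emeasure (tilted h) (UNIV \<times> {0<..}) = emeasure (distr (tilted h) weight_space snd) {0<..}"
    proof -
      have sndm: "snd \<in> tilted h \<rightarrow>\<^sub>M weight_space" unfolding measurable_cong_sets[OF st refl] by (rule measurable_snd)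
      have "snd -` {0<..} \<inter> space (tilted h) = UNIV \<times> {0<..}" by (auto simp: spt)
      then show ?thesis using emeasure_distr[OF sndm sp] by simp
    qed
    also have "\<dots> = 1" unfolding marg using P.emeasure_space_1 by simp
    finally show "emeasure (tilted h) (space (tilted h)) = 1" unfolding spt .
  qed
  show "tilted h \<in> admissible"
    unfolding admissible_def space_prob_algebra using prob st marg by simp
  show "is_cond_spin (tilted h) (\<lambda>v. density \<alpha> (h (k v)))"
    unfolding is_cond_spin_def marg
  proof (intro conjI ballI)
    have "(\<lambda>j. density \<alpha> (h j)) \<in> count_space UNIV \<rightarrow>\<^sub>M prob_algebra borel"
      unfolding measurable_count_space_eq1 space_prob_algebra using dens(1,2) by blast
    from measurable_compose[OF km this]
    show "(\<lambda>v. density \<alpha> (h (k v))) \<in> weight_space \<rightarrow>\<^sub>M prob_algebra borel" .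
  qed (rule rect)
qed

text \<open>The functional uses the chosen version \<open>cond_spin\<close>; by uniqueness it agrees
  for almost every weight with the explicit density kernel, whose entropy is known.\<close>

lemma entropy_tilted:
  assumes h: "trial h"
  shows "entropy (tilted h) = ennreal (\<Sum>j<K. ent (h j) * p j)"
proof -
  note \<nu> = tilted_admissible[OF h]
  then have \<nu>': "tilted h \<in> space (prob_algebra (borel \<Otimes>\<^sub>M weight_space))" and m: "distr (tilted h) weight_space snd = P"
    by (auto simp: admissible_def)
  obtain hi where hi: "\<And>j x. h j x \<le> hi" using trial_bound[OF h] by blast
  have hm: "h j \<in> borel_measurable \<alpha>" for j
    unfolding measurable_cong_sets[OF sets_alpha refl] by (rule trialD(1)[OF h])
  have "AE v in P. cond_spin (tilted h) v = density \<alpha> (h (k v))"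
    using is_cond_spin_unique[OF \<nu>' is_cond_spin_cond_spin[OF \<nu>'] is_cond_spin_tilted[OF h]] unfolding m .
  then have "AE v in P. e2ennreal (relative_entropy (cond_spin (tilted h) v) \<alpha>) = ennreal (ent (h (k v)))"
  proof eventually_elim
    case (elim v)
    have "relative_entropy (density \<alpha> (h (k v))) \<alpha> = ereal (ent (h (k v)))"
      unfolding ent_def by (rule alpha.relative_entropy_density_bounded(1)[OF hm trialD(3)[OF h] hi])
    then show ?case unfolding elim by (simp add: e2ennreal_ereal)
  qed
  then have "entropy (tilted h) = (\<integral>\<^sup>+v. ennreal (ent (h (k v))) \<partial>P)"
    unfolding entropy_def by (rule nn_integral_cong_AE)
  also have "\<dots> = ennreal (\<integral>v. ent (h (k v)) \<partial>P)"
  proof (rule nn_integral_eq_integral)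
    have em: "(\<lambda>v. ent (h (k v))) \<in> borel_measurable P"
      unfolding measurable_cong_sets[OF sets_P refl]
      by (rule measurable_weight_spaceI, rule measurable_compose[OF k_meas])
        (simp only: measurable_count_space_eq1 space_borel UNIV_I Pi_UNIV)
    show "integrable P (\<lambda>v. ent (h (k v)))"
    proof (rule P.integrable_const_bound[OF _ em])
      have "ent (h (k v)) \<le> Max ((\<lambda>j. ent (h j)) ` {..<K})" for v
        using k_less by (intro Max_ge) auto
      then show "AE v in P. norm (ent (h (k v))) \<le> Max ((\<lambda>j. ent (h j)) ` {..<K})"
        using ent_nonneg[OF h] by (intro AE_I2) (simp only: real_norm_def abs_of_nonneg)
    qed
  qed (simp add: ent_nonneg[OF h])
  also have "(\<integral>v. ent (h (k v)) \<partial>P) = (\<Sum>j<K. ent (h j) * p j)"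
    by (rule integral_label)
  finally show ?thesis .
qed

lemma energy_tilted:
  assumes h: "trial h"
  shows "energy (tilted h) (\<lambda>x. r (k x)) = (\<Sum>j<K. \<Sum>l<K. r j * r l * coupling h j l * p j * p l)"
proof -
  note \<nu> = tilted_admissible[OF h] and cs = is_cond_spin_tilted[OF h]
  note dens = density_trial[OF trialD(1)[OF h] trialD(3)[OF h] trialD(2)[OF h]]
  have key: "(\<integral>z. r (k (snd z)) * u (fst z) \<partial>tilted h) = (\<Sum>j<K. r j * (\<integral>x. u x * h j x \<partial>\<alpha>) * p j)"
    if um: "u \<in> borel_measurable borel" and u: "\<And>x. 0 \<le> u x" "\<And>x. u x \<le> C" for u C
  proof -
    have rm: "(\<lambda>z. r (k (snd z)) * u (fst z)) \<in> borel_measurable (borel \<Otimes>\<^sub>M weight_space)"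
      by (rule borel_measurable_times[OF measurable_compose[OF measurable_snd measurable_weight_spaceI[OF measurable_r_k]]
            measurable_compose[OF measurable_fst um]])
    have "(\<integral>z. r (k (snd z)) * u (fst z) \<partial>tilted h) = (\<integral>v. (\<integral>x. r (k v) * u x \<partial>density \<alpha> (h (k v))) \<partial>P)"
    proof (rule kernel_integral[OF \<nu> cs])
      show "(\<lambda>(x, v). r (k v) * u x) \<in> borel_measurable (borel \<Otimes>\<^sub>M weight_space)"
        unfolding case_prod_beta' by (rule rm)
      show "\<bar>r (k v) * u x\<bar> \<le> R * C" for x v
        unfolding abs_mult abs_of_nonneg[OF r_nonneg] abs_of_nonneg[OF u(1)]
        by (rule mult_mono[OF r_le_R u(2) R_nonneg u(1)])
    qed
    also have "\<dots> = (\<integral>v. r (k v) * (\<integral>x. u x * h (k v) x \<partial>\<alpha>) \<partial>P)"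
      by (simp only: integral_mult_right_zero dens(3)[OF um])
    also have "\<dots> = (\<Sum>j<K. r j * (\<integral>x. u x * h j x \<partial>\<alpha>) * p j)" by (rule integral_label)
    finally show ?thesis .
  qed
  let ?\<rho> = "\<lambda>x. r (k x)"
  have fe: "field (tilted h) ?\<rho> x = (\<Sum>l<K. r l * mean_field h l x * p l)" for x
    unfolding field_def mean_field_def by (rule key[OF G_section(1) G_nonneg G_le])
  have "energy (tilted h) ?\<rho> = (\<Sum>j<K. r j * (\<integral>x. field (tilted h) ?\<rho> x * h j x \<partial>\<alpha>) * p j)"
    unfolding energy_def
    by (rule key[OF measurable_field[OF \<nu> measurable_r_k] field_nonneg[OF \<nu> measurable_r_k integrable_r_k r_nonneg]
          field_le[OF \<nu> measurable_r_k integrable_r_k r_nonneg]])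
  also have "\<dots> = (\<Sum>j<K. r j * (\<Sum>l<K. r l * p l * coupling h j l) * p j)"
  proof (intro sum.cong refl arg_cong2[where f="(*)"])
    fix j
    have "(\<integral>x. field (tilted h) ?\<rho> x * h j x \<partial>\<alpha>) = (\<integral>x. (\<Sum>l<K. r l * p l * (mean_field h l x * h j x)) \<partial>\<alpha>)"
      unfolding fe sum_distrib_right by (intro Bochner_Integration.integral_cong refl sum.cong) (simp only: mult_ac)
    also have "\<dots> = (\<Sum>l<K. \<integral>x. r l * p l * (mean_field h l x * h j x) \<partial>\<alpha>)"
      by (intro Bochner_Integration.integral_sum integrable_mult_right
          trial_integrable[OF h measurable_mean_field[OF h] mean_field_bounds[OF h]])
    finally show "(\<integral>x. field (tilted h) ?\<rho> x * h j x \<partial>\<alpha>) = (\<Sum>l<K. r l * p l * coupling h j l)"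
      by (simp only: integral_mult_right_zero coupling_def)
  qed
  also have "\<dots> = (\<Sum>j<K. \<Sum>l<K. r j * r l * coupling h j l * p j * p l)"
    by (simp only: sum_distrib_left sum_distrib_right) (intro sum.cong refl, simp only: mult_ac)
  finally show ?thesis .
qed

text \<open>Rounding the weights down lowers the energy, so the finite sum bounds the true value
  from below with no rounding error. This is the direction the upper bound on the partition function
  needs.\<close>

lemma rate_value_tilted:
  assumes h: "trial h"
  shows "ereal ((\<Sum>j<K. \<Sum>l<K. r j * r l * coupling h j l * p j * p l) - (\<Sum>j<K. ent (h j) * p j))
    \<le> rate_value \<alpha> P U (tilted h)"
proof -
  note \<nu> = tilted_admissible[OF h]
  have e0: "0 \<le> (\<Sum>j<K. ent (h j) * p j)"
    by (intro sum_nonneg mult_nonneg_nonneg ent_nonneg[OF h] p_nonneg)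
  have "(\<Sum>j<K. \<Sum>l<K. r j * r l * coupling h j l * p j * p l) \<le> energy (tilted h) (\<lambda>x. x)"
    unfolding energy_tilted[OF h, symmetric]
    by (rule energy_le_energy_id[OF \<nu> measurable_r_k r_nonneg r_le r_close_P])
  then show ?thesis
    unfolding rate_value_eq entropy_tilted[OF h] enn2ereal_ennreal[OF e0] by simp
qed

end

section \<open>The upper bound\<close>

text \<open>The data of \<open>grid_conditional_expectation\<close>, except for the approximation
  error, which enters only when the discrepancy is estimated.\<close>

locale grid_system = binned_system w P \<alpha> G b k r K \<eta>
  for w P and \<alpha> :: "'a::polish_space measure" and G b k r K \<eta> +
  fixes a :: "'a \<Rightarrow> nat" and A :: nat and c :: "nat \<Rightarrow> nat \<Rightarrow> real"
  assumes a_meas: "a \<in> borel \<rightarrow>\<^sub>M count_space UNIV" and a_less: "\<And>x. a x < A"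
    and cell_pos': "\<And>x. 0 < measure \<alpha> {y \<in> space \<alpha>. a y = a x}"
    and c_average: "\<And>s t. (\<integral>z. G (fst z) (snd z) * indicator {s} (a (fst z)) * indicator {t} (a (snd z)) \<partial>(\<alpha> \<Otimes>\<^sub>M \<alpha>))
        = c s t * measure \<alpha> {y \<in> space \<alpha>. a y = s} * measure \<alpha> {y \<in> space \<alpha>. a y = t}"
    and c_nonneg: "\<And>s t. 0 \<le> c s t" and c_le: "\<And>s t. c s t \<le> b"
begin

definition cell :: "nat \<Rightarrow> real" where "cell s = measure \<alpha> {y \<in> space \<alpha>. a y = s}"

lemma cell_nonneg: "0 \<le> cell s"
  by (simp add: cell_def)

lemma cell_pos: "0 < cell (a x)"
  unfolding cell_def by (rule cell_pos')

lemma measurable_label: "(\<lambda>x. f (a x) :: real) \<in> borel_measurable borel"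
  by (rule measurable_compose[OF a_meas]) (simp only: measurable_count_space_eq1 space_borel UNIV_I Pi_UNIV)

lemma cell_decomposition:
  fixes q :: "nat \<Rightarrow> real"
  shows "q (a x) = (\<Sum>s<A. q s * indicator {s} (a x))"
proof -
  have "(\<Sum>s<A. q s * indicator {s} (a x)) = (\<Sum>s<A. if a x = s then q s else 0)"
    by (intro sum.cong refl) (auto split: split_indicator)
  then show ?thesis using a_less[of x] by simp
qed

lemma integrable_cell: "integrable \<alpha> (\<lambda>x. indicator {s} (a x) :: real)"
proof (rule alpha.integrable_const_bound[where B=1])
  show "(\<lambda>x. indicator {s} (a x) :: real) \<in> borel_measurable \<alpha>"
    unfolding measurable_cong_sets[OF sets_alpha refl] by (rule measurable_label)
qed (simp add: indicator_def)

lemma integral_cell: "(\<integral>x. q (a x) \<partial>\<alpha>) = (\<Sum>s<A. q s * cell s)"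
proof -
  have 1: "(\<integral>x. indicator {s} (a x) \<partial>\<alpha>) = cell s" for s
  proof -
    have "(\<integral>x. indicator {s} (a x) \<partial>\<alpha>) = (\<integral>x. indicator {y \<in> space \<alpha>. a y = s} x \<partial>\<alpha>)"
      by (intro Bochner_Integration.integral_cong) (auto split: split_indicator)
    also have "\<dots> = measure \<alpha> ({y \<in> space \<alpha>. a y = s} \<inter> space \<alpha>)" by simp
    also have "{y \<in> space \<alpha>. a y = s} \<inter> space \<alpha> = {y \<in> space \<alpha>. a y = s}" by blast
    finally show ?thesis by (simp only: cell_def)
  qed
  have "(\<integral>x. q (a x) \<partial>\<alpha>) = (\<integral>x. (\<Sum>s<A. q s * indicator {s} (a x)) \<partial>\<alpha>)"
    by (intro Bochner_Integration.integral_cong refl) (rule cell_decomposition)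
  also have "\<dots> = (\<Sum>s<A. \<integral>x. q s * indicator {s} (a x) \<partial>\<alpha>)"
    by (rule Bochner_Integration.integral_sum) (intro integrable_mult_right integrable_cell)
  also have "\<dots> = (\<Sum>s<A. q s * cell s)" by (simp only: integral_mult_right_zero 1)
  finally show ?thesis .
qed

lemma sum_cell: "(\<Sum>s<A. cell s) = 1"
proof -
  have "(\<Sum>s<A. cell s) = (\<Sum>s<A. 1 * cell s)" by (simp only: mult_1)
  also have "\<dots> = (\<integral>x. 1 \<partial>\<alpha>)" by (rule integral_cell[symmetric])
  also have "\<dots> = 1" using alpha.prob_space by simp
  finally show ?thesis .
qed

text \<open>Taken over the labels that occur: a label outside the range of \<open>a\<close> has an
  empty cell, of measure zero.\<close>

definition cell_min :: real where "cell_min = Min (cell ` range a)"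

lemma finite_range_a: "finite (range a)"
  by (rule finite_subset[of _ "{..<A}"]) (use a_less in auto)

lemma cell_min: "0 < cell_min" "cell_min \<le> cell (a x)"
proof -
  show "0 < cell_min"
    unfolding cell_min_def using finite_range_a cell_pos by (subst Min_gr_iff) auto
  show "cell_min \<le> cell (a x)"
    unfolding cell_min_def using finite_range_a by (intro Min_le) auto
qed

text \<open>Row \<open>j\<close> is a distribution over the cells for the spins in bin
  \<open>j\<close>. Vanishing on null cells is absolute continuity; without it division by zero
  would lose mass in \<open>dens\<close>.\<close>

definition stochastic :: "(nat \<Rightarrow> nat \<Rightarrow> real) \<Rightarrow> bool" where
  "stochastic q \<longleftrightarrow> (\<forall>j s. 0 \<le> q j s) \<and> (\<forall>j. (\<Sum>s<A. q j s) = 1) \<and> (\<forall>j s. cell s = 0 \<longrightarrow> q j s = 0)"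

definition dens :: "(nat \<Rightarrow> nat \<Rightarrow> real) \<Rightarrow> nat \<Rightarrow> 'a \<Rightarrow> real" where
  "dens q j x = q j (a x) / cell (a x)"

context
  fixes q assumes q: "stochastic q"
begin

lemma stochasticD: "0 \<le> q j s" "(\<Sum>s<A. q j s) = 1" "cell s = 0 \<Longrightarrow> q j s = 0"
  using q unfolding stochastic_def by blast+

lemma q_div_cell: "q j s / cell s * cell s = q j s"
  using stochasticD(3)[of s j] by (cases "cell s = 0") simp_all

lemma dens_bounds: "0 \<le> dens q j x" "dens q j x \<le> 1 / cell_min"
proof -
  show "0 \<le> dens q j x" unfolding dens_def by (intro divide_nonneg_nonneg stochasticD cell_nonneg)
  have "q j (a x) \<le> (\<Sum>s<A. q j s)"
    using a_less[of x] stochasticD(1) by (intro member_le_sum) auto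
  then have "q j (a x) \<le> 1" by (simp only: stochasticD(2))
  then show "dens q j x \<le> 1 / cell_min"
    unfolding dens_def using cell_min(1) cell_min(2)[of x] by (intro frac_le) auto
qed

lemma trial_dens: "trial (dens q)"
proof -
  have "(\<integral>x. dens q j x \<partial>\<alpha>) = 1" for j
  proof -
    have "(\<integral>x. dens q j x \<partial>\<alpha>) = (\<Sum>s<A. q j s / cell s * cell s)"
      unfolding dens_def by (rule integral_cell)
    also have "\<dots> = 1" by (simp only: q_div_cell stochasticD(2))
    finally show ?thesis .
  qed
  moreover have "dens q j \<in> borel_measurable borel" for j
    unfolding dens_def[abs_def] by (rule measurable_label)
  ultimately show ?thesis unfolding trial_def using dens_bounds by blast
qed

lemma ent_dens: "ent (dens q j) = (\<Sum>s<A. q j s * ln (q j s / cell s))"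
proof -
  have "ent (dens q j) = (\<Sum>s<A. (q j s / cell s * ln (q j s / cell s)) * cell s)"
    unfolding ent_def dens_def by (rule integral_cell)
  also have "\<dots> = (\<Sum>s<A. q j s * ln (q j s / cell s))"
  proof (intro sum.cong refl)
    fix s
    have "(q j s / cell s * ln (q j s / cell s)) * cell s = (q j s / cell s * cell s) * ln (q j s / cell s)" by (simp only: mult_ac)
    then show "(q j s / cell s * ln (q j s / cell s)) * cell s = q j s * ln (q j s / cell s)" by (simp only: q_div_cell)
  qed
  finally show ?thesis .
qed

text \<open>The place where cell averages pay off: a density constant on cells integrates
  \<open>G\<close> over each product of cells, where \<open>c\<close> has the same integral, so no
  approximation error appears.\<close>

lemma coupling_dens: "coupling (dens q) j l = (\<Sum>s<A. \<Sum>t<A. q j s * q l t * c s t)"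
proof -
  interpret aa: pair_prob_space \<alpha> \<alpha> ..
  have s2: "sets (\<alpha> \<Otimes>\<^sub>M \<alpha>) = sets (borel \<Otimes>\<^sub>M borel)" by (rule sets_pair_measure_cong[OF sets_alpha sets_alpha])
  define J where "J s t z = G (fst z) (snd z) * indicator {s} (a (fst z)) * (indicator {t} (a (snd z)) :: real)" for s t and z :: "'a \<times> 'a"
  have Gm: "(\<lambda>z. G (fst z) (snd z)) \<in> borel_measurable (\<alpha> \<Otimes>\<^sub>M \<alpha>)"
    using G_meas unfolding case_prod_beta' measurable_cong_sets[OF s2 refl] .
  have m1: "(\<lambda>z. f (a (fst z)) :: real) \<in> borel_measurable (\<alpha> \<Otimes>\<^sub>M \<alpha>)" for f
    unfolding measurable_cong_sets[OF s2 refl] by (rule measurable_compose[OF measurable_fst measurable_label])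
  have m2: "(\<lambda>z. f (a (snd z)) :: real) \<in> borel_measurable (\<alpha> \<Otimes>\<^sub>M \<alpha>)" for f
    unfolding measurable_cong_sets[OF s2 refl] by (rule measurable_compose[OF measurable_snd measurable_label])
  have intJ: "integrable (\<alpha> \<Otimes>\<^sub>M \<alpha>) (J s t)" for s t
  proof (rule aa.P.integrable_const_bound[where B=b])
    have "norm (J s t z) \<le> b" for z
      using G_nonneg[of "fst z" "snd z"] G_le[of "fst z" "snd z"] b_nonneg by (simp add: J_def indicator_def)
    then show "AE z in \<alpha> \<Otimes>\<^sub>M \<alpha>. norm (J s t z) \<le> b" by (intro AE_I2)
    show "J s t \<in> borel_measurable (\<alpha> \<Otimes>\<^sub>M \<alpha>)"
      unfolding J_def[abs_def] by (intro borel_measurable_times Gm m1[of "indicator {s}"] m2[of "indicator {t}"])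
  qed
  define W where "W z = (\<Sum>s<A. \<Sum>t<A. (q j s / cell s) * (q l t / cell t) * J s t z)" for z
  have W: "W (x, y) = G x y * dens q l y * dens q j x" for x y
  proof -
    have "G x y * dens q l y * dens q j x = (\<Sum>s<A. q j s / cell s * indicator {s} (a x)) * ((\<Sum>t<A. q l t / cell t * indicator {t} (a y)) * G x y)"
      unfolding dens_def cell_decomposition[of "\<lambda>s. q j s / cell s" x, symmetric]
        cell_decomposition[of "\<lambda>s. q l s / cell s" y, symmetric] by (simp only: mult_ac)
    also have "\<dots> = W (x, y)"
      unfolding W_def J_def sum_distrib_right by (simp only: sum_distrib_left fst_conv snd_conv) (intro sum.cong refl, simp only: mult_ac)
    finally show ?thesis ..
  qed
  have intW: "integrable (\<alpha> \<Otimes>\<^sub>M \<alpha>) W"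
    unfolding W_def[abs_def] by (intro Bochner_Integration.integrable_sum integrable_mult_right intJ)
  have "coupling (dens q) j l = (\<integral>x. (\<integral>y. W (x, y) \<partial>\<alpha>) \<partial>\<alpha>)"
    unfolding coupling_def mean_field_def W by (simp only: integral_mult_left_zero)
  also have "\<dots> = (\<integral>z. W z \<partial>(\<alpha> \<Otimes>\<^sub>M \<alpha>))" by (rule aa.integral_fst'[OF intW])
  also have "\<dots> = (\<Sum>s<A. \<integral>z. (\<Sum>t<A. (q j s / cell s) * (q l t / cell t) * J s t z) \<partial>(\<alpha> \<Otimes>\<^sub>M \<alpha>))"
    unfolding W_def by (intro Bochner_Integration.integral_sum Bochner_Integration.integrable_sum integrable_mult_right intJ)
  also have "\<dots> = (\<Sum>s<A. \<Sum>t<A. \<integral>z. (q j s / cell s) * (q l t / cell t) * J s t z \<partial>(\<alpha> \<Otimes>\<^sub>M \<alpha>))"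
    by (intro sum.cong refl Bochner_Integration.integral_sum integrable_mult_right intJ)
  also have "\<dots> = (\<Sum>s<A. \<Sum>t<A. q j s * q l t * c s t)"
  proof (intro sum.cong refl)
    fix s t
    have "(\<integral>z. (q j s / cell s) * (q l t / cell t) * J s t z \<partial>(\<alpha> \<Otimes>\<^sub>M \<alpha>)) = (q j s / cell s) * (q l t / cell t) * (c s t * cell s * cell t)"
      unfolding integral_mult_right_zero J_def c_average cell_def ..
    also have "\<dots> = (q j s / cell s * cell s) * (q l t / cell t * cell t) * c s t" by (simp only: mult_ac)
    finally show "(\<integral>z. (q j s / cell s) * (q l t / cell t) * J s t z \<partial>(\<alpha> \<Otimes>\<^sub>M \<alpha>)) = q j s * q l t * c s t"
      by (simp only: q_div_cell)
  qed
  finally show ?thesis .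
qed

text \<open>A bound uniform in \<open>q\<close> is required because the type varies with the
  configuration and with \<open>N\<close>. It follows from \<open>ln t \<le> t\<close> and
  \<open>t \<le> 1 / cell_min\<close>.\<close>

lemma ent_dens_le: "ent (dens q j) \<le> 1 / cell_min\<^sup>2"
proof -
  have m: "dens q j \<in> borel_measurable \<alpha>"
    unfolding measurable_cong_sets[OF sets_alpha refl] by (rule trialD(1)[OF trial_dens])
  have "ent (dens q j) \<le> (\<integral>x. 1 / cell_min\<^sup>2 \<partial>\<alpha>)"
    unfolding ent_def
  proof (rule integral_mono)
    show "integrable \<alpha> (\<lambda>x. dens q j x * ln (dens q j x))"
      by (rule alpha.relative_entropy_density_bounded(2)[OF m dens_bounds])
    fix x
    let ?t = "dens q j x"
    have "?t * ln ?t \<le> ?t * ?t"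
    proof (cases "?t = 0")
      case False
      then have "0 < ?t" using dens_bounds(1)[of j x] by linarith
      then show ?thesis using ln_le_minus_one[of ?t] by (intro mult_left_mono) auto
    qed simp
    also have "\<dots> \<le> (1 / cell_min) * (1 / cell_min)"
      by (intro mult_mono dens_bounds) (use cell_min(1) in auto)
    finally show "?t * ln ?t \<le> 1 / cell_min\<^sup>2" by (simp add: power2_eq_square)
  qed simp
  then show ?thesis using alpha.prob_space by simp
qed

end

section \<open>Types of configurations\<close>

definition cnt :: "nat \<Rightarrow> (nat \<Rightarrow> 'a) \<Rightarrow> nat \<Rightarrow> nat \<Rightarrow> real" where
  "cnt N \<sigma> j s = real (card {i \<in> {1..N}. k (w i) = j \<and> a (\<sigma> i) = s})"

text \<open>An empty bin receives the cell measures, that is, the density 1, so that every row is a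
  probability distribution.\<close>

definition normalize_rows :: "(nat \<Rightarrow> nat \<Rightarrow> real) \<Rightarrow> nat \<Rightarrow> nat \<Rightarrow> real" where
  "normalize_rows m j s = (if (\<Sum>t<A. m j t) = 0 then cell s else m j s / (\<Sum>t<A. m j t))"

lemma sum_over_types:
  "(\<Sum>i=1..N. \<phi> (k (w i)) (a (\<sigma> i))) = (\<Sum>j<K. \<Sum>s<A. \<phi> j s * cnt N \<sigma> j s)" for \<phi> :: "nat \<Rightarrow> nat \<Rightarrow> real"
proof -
  have "(\<Sum>i=1..N. \<phi> (k (w i)) (a (\<sigma> i))) =
      (\<Sum>i=1..N. \<Sum>j<K. \<Sum>s<A. if k (w i) = j \<and> a (\<sigma> i) = s then \<phi> j s else 0)"
  proof (intro sum.cong refl)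
    fix i
    have "(\<Sum>j<K. \<Sum>s<A. if k (w i) = j \<and> a (\<sigma> i) = s then \<phi> j s else 0) =
        (\<Sum>j<K. if k (w i) = j then (\<Sum>s<A. if a (\<sigma> i) = s then \<phi> j s else 0) else 0)"
      by (intro sum.cong refl) auto
    then show "\<phi> (k (w i)) (a (\<sigma> i)) = (\<Sum>j<K. \<Sum>s<A. if k (w i) = j \<and> a (\<sigma> i) = s then \<phi> j s else 0)"
      using k_less[of "w i"] a_less[of "\<sigma> i"] by simp
  qed
  also have "\<dots> = (\<Sum>j<K. \<Sum>i=1..N. \<Sum>s<A. if k (w i) = j \<and> a (\<sigma> i) = s then \<phi> j s else 0)"
    by (rule sum.swap)
  also have "\<dots> = (\<Sum>j<K. \<Sum>s<A. \<Sum>i=1..N. if k (w i) = j \<and> a (\<sigma> i) = s then \<phi> j s else 0)"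
    by (intro sum.cong refl sum.swap)
  also have "\<dots> = (\<Sum>j<K. \<Sum>s<A. \<phi> j s * cnt N \<sigma> j s)"
    by (intro sum.cong refl) (simp add: cnt_def flip: sum.inter_filter)
  finally show ?thesis .
qed

lemma row_sum_cnt:
  assumes N: "N \<ge> 1"
  shows "j < K \<Longrightarrow> (\<Sum>s<A. cnt N \<sigma> j s) = real N * freq N j"
proof -
  assume j: "j < K"
  have "real N * freq N j = (\<Sum>i=1..N. indicator {j} (k (w i)))" using N by (simp add: freq_def)
  also have "\<dots> = (\<Sum>l<K. \<Sum>s<A. indicator {j} l * cnt N \<sigma> l s)"
    by (rule sum_over_types[of "\<lambda>l s. indicator {j} l"])
  also have "\<dots> = (\<Sum>l<K. if j = l then (\<Sum>s<A. cnt N \<sigma> l s) else 0)"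
    by (intro sum.cong refl) (auto simp: sum_distrib_left[symmetric] split: split_indicator)
  also have "\<dots> = (\<Sum>s<A. cnt N \<sigma> j s)" using j by simp
  finally show ?thesis ..
qed

lemma cnt_nonneg: "0 \<le> cnt N \<sigma> j s"
  by (simp add: cnt_def)

lemma normalize_cnt:
  shows stochastic_cnt: "stochastic (normalize_rows (cnt N \<sigma>))"
    and normalize_mult: "s < A \<Longrightarrow> normalize_rows (cnt N \<sigma>) j s * (\<Sum>t<A. cnt N \<sigma> j t) = cnt N \<sigma> j s"
proof -
  have z: "cnt N \<sigma> j s = 0" if "(\<Sum>t<A. cnt N \<sigma> j t) = 0" "s < A" for j s
    using that cnt_nonneg by (subst (asm) sum_nonneg_eq_0_iff) auto
  \<comment> \<open>Every label that occurs has a cell of positive measure, so this holds for all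
    configurations and not merely almost surely.\<close>
  have c0: "cnt N \<sigma> j s = 0" if "cell s = 0" for j s
  proof -
    have "{i \<in> {1..N}. k (w i) = j \<and> a (\<sigma> i) = s} = {}"
      using cell_pos that by (metis (mono_tags, lifting) Collect_empty_eq less_irrefl)
    then show ?thesis unfolding cnt_def by simp
  qed
  have s0: "0 \<le> (\<Sum>t<A. cnt N \<sigma> j t)" for j by (intro sum_nonneg cnt_nonneg)
  show "stochastic (normalize_rows (cnt N \<sigma>))"
    unfolding stochastic_def
  proof (intro conjI allI impI)
    fix j s
    show "0 \<le> normalize_rows (cnt N \<sigma>) j s"
      using s0[of j] cnt_nonneg[of N \<sigma> j s] cell_nonneg[of s] by (simp add: normalize_rows_def)
    show "(\<Sum>s<A. normalize_rows (cnt N \<sigma>) j s) = 1"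
    proof (cases "(\<Sum>t<A. cnt N \<sigma> j t) = 0")
      case True
      then show ?thesis by (simp add: normalize_rows_def sum_cell)
    next
      case False
      then show ?thesis by (simp add: normalize_rows_def flip: sum_divide_distrib)
    qed
    show "normalize_rows (cnt N \<sigma>) j s = 0" if "cell s = 0"
      using that c0[OF that] by (simp add: normalize_rows_def)
  qed
  show "normalize_rows (cnt N \<sigma>) j s * (\<Sum>t<A. cnt N \<sigma> j t) = cnt N \<sigma> j s" if "s < A"
    using z[OF _ that] by (cases "(\<Sum>t<A. cnt N \<sigma> j t) = 0") (simp_all add: normalize_rows_def)
qed

definition grid_energy :: "nat \<Rightarrow> (nat \<Rightarrow> 'a) \<Rightarrow> real" where
  "grid_energy N \<sigma> = (\<Sum>i=1..N. \<Sum>l=1..N. r (k (w i)) * r (k (w l)) * c (a (\<sigma> i)) (a (\<sigma> l)))"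

text \<open>The finite sum of \<open>rate_value_tilted\<close> with the bin frequencies at size
  \<open>N\<close> in place of their limits \<open>p\<close>.\<close>

definition type_rate :: "nat \<Rightarrow> (nat \<Rightarrow> nat \<Rightarrow> real) \<Rightarrow> real" where
  "type_rate N q = (\<Sum>j<K. \<Sum>l<K. r j * r l * coupling (dens q) j l * freq N j * freq N l)
      - (\<Sum>j<K. ent (dens q j) * freq N j)"

text \<open>On configurations with type \<open>q\<close> the product density of \<open>dens q\<close> is constant, and equal to
  the exponential of \<open>N\<close> times the entropy of \<open>q\<close>.\<close>

lemma exp_grid_energy:
  fixes N :: nat and \<sigma> :: "nat \<Rightarrow> 'a"
  assumes N: "N \<ge> 1"
  defines "q \<equiv> normalize_rows (cnt N \<sigma>)"
  shows "exp (grid_energy N \<sigma> / real N) = exp (real N * type_rate N q) * (\<Prod>i=1..N. dens q (k (w i)) (\<sigma> i))"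
proof -
  note q = stochastic_cnt[of N \<sigma>, folded q_def]
  define n where "n j = (\<Sum>t<A. cnt N \<sigma> j t)" for j
  have n: "n j = real N * freq N j" if "j < K" for j
    unfolding n_def by (rule row_sum_cnt[OF N that])
  have qn: "q j s * n j = cnt N \<sigma> j s" if "s < A" for j s
    unfolding q_def n_def by (rule normalize_mult[OF that])
  have "grid_energy N \<sigma> = (\<Sum>i=1..N. \<Sum>l<K. \<Sum>t<A. r (k (w i)) * r l * c (a (\<sigma> i)) t * cnt N \<sigma> l t)"
    unfolding grid_energy_def
  proof (rule sum.cong[OF refl])
    fix i
    show "(\<Sum>l=1..N. r (k (w i)) * r (k (w l)) * c (a (\<sigma> i)) (a (\<sigma> l))) =
        (\<Sum>l<K. \<Sum>t<A. r (k (w i)) * r l * c (a (\<sigma> i)) t * cnt N \<sigma> l t)"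
      by (rule sum_over_types[of "\<lambda>l t. r (k (w i)) * r l * c (a (\<sigma> i)) t"])
  qed
  also have "\<dots> = (\<Sum>j<K. \<Sum>s<A. (\<Sum>l<K. \<Sum>t<A. r j * r l * c s t * cnt N \<sigma> l t) * cnt N \<sigma> j s)"
    by (rule sum_over_types[of "\<lambda>j s. \<Sum>l<K. \<Sum>t<A. r j * r l * c s t * cnt N \<sigma> l t"])
  also have "\<dots> = (\<Sum>j<K. \<Sum>s<A. \<Sum>l<K. \<Sum>t<A. r j * r l * c s t * (q l t * n l) * (q j s * n j))"
    unfolding sum_distrib_right by (intro sum.cong refl) (simp add: qn)
  also have "\<dots> = (\<Sum>j<K. \<Sum>l<K. \<Sum>s<A. \<Sum>t<A. r j * r l * c s t * (q l t * n l) * (q j s * n j))"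
    by (intro sum.cong refl sum.swap)
  also have "\<dots> = (\<Sum>j<K. \<Sum>l<K. r j * r l * coupling (dens q) j l * n j * n l)"
    unfolding coupling_dens[OF q] by (intro sum.cong refl) (simp only: sum_distrib_left sum_distrib_right mult_ac)
  also have "\<dots> = (\<Sum>j<K. \<Sum>l<K. (r j * r l * coupling (dens q) j l * freq N j * freq N l) * (real N * real N))"
    by (intro sum.cong refl) (simp add: n mult_ac)
  also have "\<dots> = (\<Sum>j<K. \<Sum>l<K. r j * r l * coupling (dens q) j l * freq N j * freq N l) * (real N * real N)"
    by (simp only: sum_distrib_right)
  finally have E: "grid_energy N \<sigma> / real N = real N * (\<Sum>j<K. \<Sum>l<K. r j * r l * coupling (dens q) j l * freq N j * freq N l)"
    using N by simp
  \<comment> \<open>Each vertex is counted in its own entry of the type, so the densities are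
    positive at the configuration and logarithms are legitimate.\<close>
  have pos: "0 < dens q (k (w i)) (\<sigma> i)" if i: "i \<in> {1..N}" for i
  proof -
    have "i \<in> {i' \<in> {1..N}. k (w i') = k (w i) \<and> a (\<sigma> i') = a (\<sigma> i)}" using i by simp
    then have "0 < card {i' \<in> {1..N}. k (w i') = k (w i) \<and> a (\<sigma> i') = a (\<sigma> i)}"
      by (subst card_gt_0_iff) auto
    then have c: "0 < cnt N \<sigma> (k (w i)) (a (\<sigma> i))" unfolding cnt_def by simp
    then have "q (k (w i)) (a (\<sigma> i)) \<noteq> 0" using qn[OF a_less, of "k (w i)" "\<sigma> i"] by fastforce
    then have "0 < q (k (w i)) (a (\<sigma> i))" using stochasticD(1)[OF q, of "k (w i)" "a (\<sigma> i)"] by linarith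
    then show ?thesis unfolding dens_def using cell_pos by (rule divide_pos_pos)
  qed
  have "(\<Sum>i=1..N. ln (dens q (k (w i)) (\<sigma> i))) = (\<Sum>j<K. \<Sum>s<A. ln (q j s / cell s) * cnt N \<sigma> j s)"
    unfolding dens_def by (rule sum_over_types[of "\<lambda>j s. ln (q j s / cell s)"])
  also have "\<dots> = (\<Sum>j<K. \<Sum>s<A. q j s * ln (q j s / cell s) * n j)"
    by (intro sum.cong refl) (simp add: qn[symmetric])
  also have "\<dots> = (\<Sum>j<K. ent (dens q j) * freq N j * real N)"
    unfolding ent_dens[OF q] by (intro sum.cong refl) (simp add: n flip: sum_distrib_right)
  also have "\<dots> = real N * (\<Sum>j<K. ent (dens q j) * freq N j)" by (simp add: sum_distrib_left mult_ac)
  finally have L: "(\<Sum>i=1..N. ln (dens q (k (w i)) (\<sigma> i))) = real N * (\<Sum>j<K. ent (dens q j) * freq N j)" .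
  have "(\<Prod>i=1..N. dens q (k (w i)) (\<sigma> i)) = (\<Prod>i=1..N. exp (ln (dens q (k (w i)) (\<sigma> i))))"
    using pos by (intro prod.cong refl) (simp only: exp_ln)
  also have "\<dots> = exp (\<Sum>i=1..N. ln (dens q (k (w i)) (\<sigma> i)))" by (simp only: exp_sum finite_atLeastAtMost)
  finally have "(\<Prod>i=1..N. dens q (k (w i)) (\<sigma> i)) = exp (real N * (\<Sum>j<K. ent (dens q j) * freq N j))" unfolding L .
  then show ?thesis unfolding E type_rate_def by (simp only: mult_exp_exp right_diff_distrib diff_add_cancel)
qed

definition types :: "nat \<Rightarrow> (nat \<Rightarrow> nat \<Rightarrow> real) set" where
  "types N = range (cnt N)"

text \<open>A type is a table of \<open>K * A\<close> counts between \<open>0\<close> and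
  \<open>N\<close>; entries outside the table vanish.\<close>

lemma types_card: "finite (types N)" "card (types N) \<le> (N + 1) ^ (K * A)"
proof -
  define F where "F = ({..<K} \<times> {..<A}) \<rightarrow>\<^sub>E {..N}"
  define \<Phi> where "\<Phi> f j s = (if j < K \<and> s < A then real (f (j, s)) else 0)" for f :: "nat \<times> nat \<Rightarrow> nat" and j s
  have F: "finite F" "card F = (N + 1) ^ (K * A)"
    unfolding F_def by (auto simp: finite_PiE card_PiE)
  have sub: "types N \<subseteq> \<Phi> ` F"
    unfolding types_def
  proof safe
    fix \<sigma>
    define f where "f = (\<lambda>(j, s)\<in>{..<K} \<times> {..<A}. card {i \<in> {1..N}. k (w i) = j \<and> a (\<sigma> i) = s})"
    have "card {i \<in> {1..N}. k (w i) = j \<and> a (\<sigma> i) = s} \<le> card {1..N}" for j s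
      by (intro card_mono) auto
    then have "card {i \<in> {1..N}. k (w i) = j \<and> a (\<sigma> i) = s} \<le> N" for j s by simp
    then have "f \<in> F" unfolding F_def f_def by auto
    moreover have "cnt N \<sigma> = \<Phi> f"
    proof (intro ext)
      fix j s
      show "cnt N \<sigma> j s = \<Phi> f j s"
      proof (cases "j < K \<and> s < A")
        case False
        then have "{i \<in> {1..N}. k (w i) = j \<and> a (\<sigma> i) = s} = {}" using k_less a_less by blast
        then show ?thesis unfolding cnt_def \<Phi>_def if_not_P[OF False] by simp
      qed (simp add: cnt_def \<Phi>_def f_def)
    qed
    ultimately show "cnt N \<sigma> \<in> \<Phi> ` F" by blast
  qed
  then show "finite (types N)" using F(1) finite_surj by blast
  have "card (types N) \<le> card (\<Phi> ` F)" using sub F(1) by (intro card_mono) auto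
  also have "\<dots> \<le> card F" using F(1) by (rule card_image_le)
  finally show "card (types N) \<le> (N + 1) ^ (K * A)" using F(2) by simp
qed

text \<open>At each configuration the product density of its own type is bounded by the sum over all
  types. Each product density integrates to one, so only the number of types remains as a
  prefactor.\<close>

lemma nn_integral_grid_energy:
  assumes N: "N \<ge> 1" and B: "\<And>q. stochastic q \<Longrightarrow> type_rate N q \<le> B"
  shows "(\<integral>\<^sup>+\<sigma>. exp (grid_energy N \<sigma> / real N) \<partial>(\<Pi>\<^sub>M i\<in>{1..N}. \<alpha>)) \<le> ennreal (exp (real N * B) * real (N + 1) ^ (K * A))"
proof -
  let ?PM = "\<Pi>\<^sub>M i\<in>{1..N}. \<alpha>"
  interpret PS: product_sigma_finite "\<lambda>_. \<alpha>"
    by (simp add: product_sigma_finite_def alpha.sigma_finite_measure_axioms)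
  define D where "D m \<sigma> = (\<Prod>i=1..N. ennreal (dens (normalize_rows m) (k (w i)) (\<sigma> i)))" for m and \<sigma> :: "nat \<Rightarrow> 'a"
  have st: "stochastic (normalize_rows m)" if "m \<in> types N" for m
    using that stochastic_cnt unfolding types_def by blast
  have dm: "(\<lambda>x. ennreal (dens q j x)) \<in> borel_measurable \<alpha>" for q j
    unfolding measurable_cong_sets[OF sets_alpha refl] dens_def by (rule measurable_compose[OF measurable_label measurable_ennreal])
  have Dm: "D m \<in> borel_measurable ?PM" for m
    unfolding D_def[abs_def]
    by (rule borel_measurable_prod_ennreal)
      (rule measurable_compose[OF measurable_component_singleton[where M="\<lambda>_. \<alpha>"] dm])
  have D1: "(\<integral>\<^sup>+\<sigma>. D m \<sigma> \<partial>?PM) = 1" if m: "m \<in> types N" for m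
  proof -
    note t = trial_dens[OF st[OF m]]
    have "(\<integral>\<^sup>+\<sigma>. D m \<sigma> \<partial>?PM) = (\<Prod>i=1..N. \<integral>\<^sup>+x. ennreal (dens (normalize_rows m) (k (w i)) x) \<partial>\<alpha>)"
      unfolding D_def by (rule PS.product_nn_integral_prod[OF finite_atLeastAtMost dm])
    also have "\<dots> = (\<Prod>i=1..N. 1)"
    proof (rule prod.cong[OF refl])
      fix i
      have "(\<integral>\<^sup>+x. ennreal (dens (normalize_rows m) (k (w i)) x) \<partial>\<alpha>) = ennreal (\<integral>x. dens (normalize_rows m) (k (w i)) x \<partial>\<alpha>)"
        by (rule nn_integral_eq_integral[OF trialD(4)[OF t] AE_I2[OF trialD(3)[OF t]]])
      then show "(\<integral>\<^sup>+x. ennreal (dens (normalize_rows m) (k (w i)) x) \<partial>\<alpha>) = 1"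
        by (simp only: trialD(2)[OF t] ennreal_1)
    qed
    finally show ?thesis by (simp only: prod.neutral_const)
  qed
  have pw: "ennreal (exp (grid_energy N \<sigma> / real N)) \<le> ennreal (exp (real N * B)) * (\<Sum>m\<in>types N. D m \<sigma>)" for \<sigma>
  proof -
    define m where "m = cnt N \<sigma>"
    have m: "m \<in> types N" by (simp add: m_def types_def)
    have "exp (real N * type_rate N (normalize_rows m)) \<le> exp (real N * B)"
      using B[OF st[OF m]] by (simp add: mult_left_mono)
    then have "exp (grid_energy N \<sigma> / real N) \<le> exp (real N * B) * (\<Prod>i=1..N. dens (normalize_rows m) (k (w i)) (\<sigma> i))"
      unfolding exp_grid_energy[OF N, of \<sigma>] m_def[symmetric]
      by (intro mult_right_mono prod_nonneg dens_bounds(1)[OF st[OF m]])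
    then have "ennreal (exp (grid_energy N \<sigma> / real N)) \<le> ennreal (exp (real N * B) * (\<Prod>i=1..N. dens (normalize_rows m) (k (w i)) (\<sigma> i)))"
      by (rule ennreal_leI)
    also have "\<dots> = ennreal (exp (real N * B)) * D m \<sigma>"
      unfolding D_def prod_ennreal[OF dens_bounds(1)[OF st[OF m]]] by (rule ennreal_mult') simp
    also have "\<dots> \<le> ennreal (exp (real N * B)) * (\<Sum>m\<in>types N. D m \<sigma>)"
      by (intro mult_left_mono member_le_sum m types_card) auto
    finally show ?thesis .
  qed
  have "(\<integral>\<^sup>+\<sigma>. exp (grid_energy N \<sigma> / real N) \<partial>?PM) \<le> (\<integral>\<^sup>+\<sigma>. ennreal (exp (real N * B)) * (\<Sum>m\<in>types N. D m \<sigma>) \<partial>?PM)"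
    by (intro nn_integral_mono pw)
  also have "\<dots> = ennreal (exp (real N * B)) * (\<Sum>m\<in>types N. \<integral>\<^sup>+\<sigma>. D m \<sigma> \<partial>?PM)"
    by (simp only: nn_integral_cmult[OF borel_measurable_sum[OF Dm]] nn_integral_sum[OF Dm])
  also have "\<dots> = ennreal (exp (real N * B) * real (card (types N)))"
  proof -
    have "(\<Sum>m\<in>types N. \<integral>\<^sup>+\<sigma>. D m \<sigma> \<partial>?PM) = (\<Sum>m\<in>types N. 1)"
      by (intro sum.cong refl D1)
    also have "\<dots> = ennreal (real (card (types N)))" by (simp add: ennreal_of_nat_eq_real_of_nat)
    finally show ?thesis by (simp only: ennreal_mult'[OF of_nat_0_le_iff] ennreal_mult''[OF of_nat_0_le_iff])
  qed
  also have "\<dots> \<le> ennreal (exp (real N * B) * real (N + 1) ^ (K * A))"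
  proof (intro ennreal_leI mult_left_mono)
    have "real (card (types N)) \<le> real ((N + 1) ^ (K * A))" using types_card(2)[of N] by (simp only: of_nat_le_iff)
    then show "real (card (types N)) \<le> real (N + 1) ^ (K * A)" by (simp only: of_nat_power)
  qed simp
  finally show ?thesis .
qed

end

context spin_system
begin

lemma Z_ge_1:
  assumes N: "N \<ge> 1"
  shows "1 \<le> Z N"
proof -
  interpret PM: prob_space "\<Pi>\<^sub>M i\<in>{1..N}. \<alpha>" by (rule prob_space_PiM) (rule alpha_prob)
  have m: "hamiltonian N \<in> borel_measurable (\<Pi>\<^sub>M i\<in>{1..N}. \<alpha>)"
    by (rule measurable_hamiltonian) (rule sets_alpha)
  have "(\<integral>\<sigma>. 1 \<partial>(\<Pi>\<^sub>M i\<in>{1..N}. \<alpha>)) \<le> (\<integral>\<sigma>. exp (hamiltonian N \<sigma>) \<partial>(\<Pi>\<^sub>M i\<in>{1..N}. \<alpha>))"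
  proof (rule integral_mono)
    show "integrable (\<Pi>\<^sub>M i\<in>{1..N}. \<alpha>) (\<lambda>\<sigma>. exp (hamiltonian N \<sigma>))"
    proof (rule PM.integrable_const_bound[where B="exp (b * (\<Sum>i=1..N. w i)\<^sup>2 / real N)"])
      show "AE \<sigma> in \<Pi>\<^sub>M i\<in>{1..N}. \<alpha>. norm (exp (hamiltonian N \<sigma>)) \<le> exp (b * (\<Sum>i=1..N. w i)\<^sup>2 / real N)"
        using hamiltonian_bound(2)[OF N] by (intro AE_I2) simp
      show "(\<lambda>\<sigma>. exp (hamiltonian N \<sigma>)) \<in> borel_measurable (\<Pi>\<^sub>M i\<in>{1..N}. \<alpha>)"
        by (rule measurable_compose[OF m borel_measurable_exp])
    qed
    show "integrable (\<Pi>\<^sub>M i\<in>{1..N}. \<alpha>) (\<lambda>\<sigma>. 1 :: real)" by (rule PM.integrable_const)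
    show "1 \<le> exp (hamiltonian N \<sigma>)" for \<sigma> using hamiltonian_bound(1)[OF N] by simp
  qed
  then show ?thesis unfolding Z_eq[OF N] using PM.prob_space by simp
qed

end

section \<open>From the Hamiltonian to the grid energy\<close>

context grid_system
begin

text \<open>The prefactors bound \<open>r j * r l * coupling (dens q) j l\<close> and the entropies
  uniformly in \<open>q\<close>, so the error does not depend on the type.\<close>

definition type_error :: "nat \<Rightarrow> real" where
  "type_error N = R\<^sup>2 * b * (\<Sum>j<K. \<Sum>l<K. \<bar>freq N j * freq N l - p j * p l\<bar>) + 1 / cell_min\<^sup>2 * (\<Sum>j<K. \<bar>freq N j - p j\<bar>)"

lemma type_error_tendsto: "type_error \<longlonglongrightarrow> 0"
proof -
  have "type_error \<longlonglongrightarrow> R\<^sup>2 * b * (\<Sum>j<K. \<Sum>l<K. \<bar>p j * p l - p j * p l\<bar>) + 1 / cell_min\<^sup>2 * (\<Sum>j<K. \<bar>p j - p j\<bar>)"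
    unfolding type_error_def[abs_def] by (intro tendsto_intros freq_tendsto)
  then show ?thesis by simp
qed

lemma type_error_nonneg: "0 \<le> type_error N"
  unfolding type_error_def using b_nonneg
  by (intro add_nonneg_nonneg mult_nonneg_nonneg sum_nonneg) auto

text \<open>The density of a type defines an admissible measure, whose value is at most
  \<open>V\<close>; \<open>type_error\<close> is the price for replacing the limiting frequencies by
  those at \<open>N\<close>.\<close>

lemma type_rate_le:
  assumes V: "\<And>\<nu>. \<nu> \<in> admissible \<Longrightarrow> rate_value \<alpha> P U \<nu> \<le> ereal V" and q: "stochastic q"
  shows "type_rate N q \<le> V + type_error N"
proof -
  note h = trial_dens[OF q]
  define B where "B j l = r j * r l * coupling (dens q) j l" for j l
  define e where "e j = ent (dens q j)" for j
  have rR: "r j \<le> R" if "j < K" for j unfolding R_def using that by (intro Max_ge) auto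
  have B: "0 \<le> B j l" "B j l \<le> R\<^sup>2 * b" if "j < K" "l < K" for j l
  proof -
    show "0 \<le> B j l" unfolding B_def by (intro mult_nonneg_nonneg r_nonneg coupling_bounds[OF h])
    have "r j * r l \<le> R * R" by (rule mult_mono[OF rR[OF that(1)] rR[OF that(2)] R_nonneg r_nonneg])
    then have "B j l \<le> R * R * b"
      unfolding B_def by (rule mult_mono[OF _ coupling_bounds(2)[OF h]]) (use coupling_bounds(1)[OF h] R_nonneg in simp_all)
    then show "B j l \<le> R\<^sup>2 * b" by (simp only: power2_eq_square)
  qed
  have "ereal ((\<Sum>j<K. \<Sum>l<K. r j * r l * coupling (dens q) j l * p j * p l) - (\<Sum>j<K. ent (dens q j) * p j)) \<le> ereal V"
    by (rule order_trans[OF rate_value_tilted[OF h] V[OF tilted_admissible[OF h]]])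
  then have 1: "(\<Sum>j<K. \<Sum>l<K. B j l * (p j * p l)) - (\<Sum>j<K. e j * p j) \<le> V"
    unfolding B_def e_def by (simp only: ereal_less_eq mult.assoc)
  have 2: "type_rate N q = (\<Sum>j<K. \<Sum>l<K. B j l * (freq N j * freq N l)) - (\<Sum>j<K. e j * freq N j)"
    unfolding type_rate_def B_def e_def by (simp only: mult.assoc)
  have 3: "(\<Sum>j<K. \<Sum>l<K. B j l * (freq N j * freq N l)) \<le> (\<Sum>j<K. \<Sum>l<K. B j l * (p j * p l)) + R\<^sup>2 * b * (\<Sum>j<K. \<Sum>l<K. \<bar>freq N j * freq N l - p j * p l\<bar>)"
  proof -
    have "(\<Sum>j<K. \<Sum>l<K. B j l * (freq N j * freq N l)) \<le> (\<Sum>j<K. \<Sum>l<K. B j l * (p j * p l) + R\<^sup>2 * b * \<bar>freq N j * freq N l - p j * p l\<bar>)"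
    proof (intro sum_mono)
      fix j l assume jl: "j \<in> {..<K}" "l \<in> {..<K}"
      define d where "d = freq N j * freq N l - p j * p l"
      have "B j l * d \<le> B j l * \<bar>d\<bar>" using B(1)[of j l] jl by (intro mult_left_mono) auto
      also have "\<dots> \<le> R\<^sup>2 * b * \<bar>d\<bar>" using B(2)[of j l] jl by (intro mult_right_mono) auto
      finally have "B j l * d \<le> R\<^sup>2 * b * \<bar>d\<bar>" .
      then show "B j l * (freq N j * freq N l) \<le> B j l * (p j * p l) + R\<^sup>2 * b * \<bar>freq N j * freq N l - p j * p l\<bar>"
        unfolding d_def right_diff_distrib by linarith
    qed
    then show ?thesis by (simp only: sum.distrib sum_distrib_left)
  qed
  have 4: "- (\<Sum>j<K. e j * freq N j) \<le> - (\<Sum>j<K. e j * p j) + 1 / cell_min\<^sup>2 * (\<Sum>j<K. \<bar>freq N j - p j\<bar>)"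
  proof -
    have "(\<Sum>j<K. e j * p j) \<le> (\<Sum>j<K. e j * freq N j + 1 / cell_min\<^sup>2 * \<bar>freq N j - p j\<bar>)"
    proof (intro sum_mono)
      fix j
      have "e j * (p j - freq N j) \<le> e j * \<bar>freq N j - p j\<bar>"
        unfolding e_def by (intro mult_left_mono ent_nonneg[OF h]) auto
      also have "\<dots> \<le> 1 / cell_min\<^sup>2 * \<bar>freq N j - p j\<bar>"
        unfolding e_def by (intro mult_right_mono ent_dens_le[OF q]) auto
      finally show "e j * p j \<le> e j * freq N j + 1 / cell_min\<^sup>2 * \<bar>freq N j - p j\<bar>"
        unfolding right_diff_distrib by linarith
    qed
    then have "(\<Sum>j<K. e j * p j) \<le> (\<Sum>j<K. e j * freq N j) + 1 / cell_min\<^sup>2 * (\<Sum>j<K. \<bar>freq N j - p j\<bar>)"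
      by (simp only: sum.distrib sum_distrib_left)
    then show ?thesis by linarith
  qed
  show ?thesis unfolding 2 type_error_def using 1 3 4 by linarith
qed

definition discrepancy :: "'a \<Rightarrow> 'a \<Rightarrow> real" where
  "discrepancy x y = \<bar>G x y - c (a x) (a y)\<bar>"

lemma discrepancy_bounds: "0 \<le> discrepancy x y" "discrepancy x y \<le> b"
  unfolding discrepancy_def using G_nonneg[of x y] G_le[of x y] c_nonneg[of "a x" "a y"] c_le[of "a x" "a y"] by auto

text \<open>With \<open>X\<close> and \<open>Y\<close> the sums of the weights and of the rounded
  weights, rounding changes the sum of pair products by \<open>(X - Y) * (X + Y)\<close>, at most
  \<open>N \<eta>\<close> times \<open>2 N B1\<close>. Once the weights are rounded,
  \<open>G\<close> is exchanged for \<open>c\<close>, and the rounded products are at most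
  \<open>R\<^sup>2\<close>.\<close>

lemma hamiltonian_le:
  assumes N: "N \<ge> 1" and B1: "(\<Sum>i=1..N. w i) / real N \<le> B1"
  shows "hamiltonian N \<sigma> \<le> real N * (2 * b * B1 * \<eta>) + grid_energy N \<sigma> / real N
    + R\<^sup>2 / real N * (\<Sum>i=1..N. \<Sum>l=1..N. discrepancy (\<sigma> i) (\<sigma> l))"
proof -
  define \<rho> where "\<rho> i = r (k (w i))" for i
  have wi: "0 < w i" "\<rho> i \<le> w i" "0 \<le> \<rho> i" if "i \<in> {1..N}" for i
    using w_pos[of i] r_le[of "w i"] r_nonneg that by (auto simp: \<rho>_def)
  define X where "X = (\<Sum>i=1..N. w i)"
  define Y where "Y = (\<Sum>i=1..N. \<rho> i)"
  have YX: "Y \<le> X" unfolding X_def Y_def using wi by (intro sum_mono) auto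
  have Y0: "0 \<le> Y" unfolding Y_def using wi by (intro sum_nonneg) auto
  have XB: "X \<le> real N * B1" using B1 N by (simp add: X_def field_simps)
  have XY: "X - Y \<le> real N * \<eta>"
    using r_close_w[OF N] N by (simp add: X_def Y_def \<rho>_def sum_subtractf field_simps)
  have "(X - Y) * (X + Y) \<le> (real N * \<eta>) * (2 * (real N * B1))"
    using XY XB YX Y0 by (intro mult_mono) linarith+
  moreover have "(\<Sum>i=1..N. \<Sum>l=1..N. w i * w l - \<rho> i * \<rho> l) = (X - Y) * (X + Y)"
    unfolding sum_subtractf X_def Y_def by (simp add: sum_product algebra_simps)
  ultimately have 1: "(\<Sum>i=1..N. \<Sum>l=1..N. w i * w l - \<rho> i * \<rho> l) \<le> real N * real N * (2 * B1 * \<eta>)"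
    by (simp add: mult_ac)
  have "(\<Sum>i=1..N. \<Sum>l=1..N. w i * w l * G (\<sigma> i) (\<sigma> l)) \<le>
      (\<Sum>i=1..N. \<Sum>l=1..N. b * (w i * w l - \<rho> i * \<rho> l) + \<rho> i * \<rho> l * c (a (\<sigma> i)) (a (\<sigma> l)) + R\<^sup>2 * discrepancy (\<sigma> i) (\<sigma> l))"
  proof (intro sum_mono)
    fix i l assume il: "i \<in> {1..N}" "l \<in> {1..N}"
    define g where "g = G (\<sigma> i) (\<sigma> l)"
    have le: "\<rho> i * \<rho> l \<le> w i * w l"
      using wi[OF il(1)] wi[OF il(2)] by (intro mult_mono) auto
    have "\<rho> i * \<rho> l \<le> R * R"
      unfolding \<rho>_def by (rule mult_mono[OF r_le_R r_le_R R_nonneg r_nonneg])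
    then have R2: "\<rho> i * \<rho> l \<le> R\<^sup>2" by (simp only: power2_eq_square)
    have \<rho>0: "0 \<le> \<rho> i * \<rho> l" using wi[OF il(1)] wi[OF il(2)] by simp
    have "(w i * w l - \<rho> i * \<rho> l) * g \<le> (w i * w l - \<rho> i * \<rho> l) * b"
      using le G_le[of "\<sigma> i" "\<sigma> l"] by (intro mult_left_mono) (auto simp: g_def)
    moreover have "\<rho> i * \<rho> l * g \<le> \<rho> i * \<rho> l * c (a (\<sigma> i)) (a (\<sigma> l)) + R\<^sup>2 * discrepancy (\<sigma> i) (\<sigma> l)"
    proof -
      have "g \<le> c (a (\<sigma> i)) (a (\<sigma> l)) + discrepancy (\<sigma> i) (\<sigma> l)" unfolding g_def discrepancy_def by linarith
      from mult_left_mono[OF this \<rho>0]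
      have "\<rho> i * \<rho> l * g \<le> \<rho> i * \<rho> l * c (a (\<sigma> i)) (a (\<sigma> l)) + \<rho> i * \<rho> l * discrepancy (\<sigma> i) (\<sigma> l)"
        by (simp only: distrib_left)
      moreover have "\<rho> i * \<rho> l * discrepancy (\<sigma> i) (\<sigma> l) \<le> R\<^sup>2 * discrepancy (\<sigma> i) (\<sigma> l)"
        by (rule mult_right_mono[OF R2 discrepancy_bounds(1)])
      ultimately show ?thesis by linarith
    qed
    moreover have "w i * w l * g = (w i * w l - \<rho> i * \<rho> l) * g + \<rho> i * \<rho> l * g" by (simp add: algebra_simps)
    ultimately show "w i * w l * G (\<sigma> i) (\<sigma> l) \<le> b * (w i * w l - \<rho> i * \<rho> l) + \<rho> i * \<rho> l * c (a (\<sigma> i)) (a (\<sigma> l)) + R\<^sup>2 * discrepancy (\<sigma> i) (\<sigma> l)"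
      unfolding g_def[symmetric] mult.commute[of b] by linarith
  qed
  also have "\<dots> = b * (\<Sum>i=1..N. \<Sum>l=1..N. w i * w l - \<rho> i * \<rho> l) + grid_energy N \<sigma>
      + R\<^sup>2 * (\<Sum>i=1..N. \<Sum>l=1..N. discrepancy (\<sigma> i) (\<sigma> l))"
    unfolding grid_energy_def \<rho>_def by (simp only: sum.distrib sum_distrib_left)
  also have "\<dots> \<le> b * (real N * real N * (2 * B1 * \<eta>)) + grid_energy N \<sigma>
      + R\<^sup>2 * (\<Sum>i=1..N. \<Sum>l=1..N. discrepancy (\<sigma> i) (\<sigma> l))"
    using mult_left_mono[OF 1 b_nonneg] by linarith
  finally have "hamiltonian N \<sigma> \<le> (b * (real N * real N * (2 * B1 * \<eta>)) + grid_energy N \<sigma>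
      + R\<^sup>2 * (\<Sum>i=1..N. \<Sum>l=1..N. discrepancy (\<sigma> i) (\<sigma> l))) / real N"
    unfolding hamiltonian_def by (rule divide_right_mono) simp
  also have "\<dots> = real N * (2 * b * B1 * \<eta>) + grid_energy N \<sigma> / real N
    + R\<^sup>2 / real N * (\<Sum>i=1..N. \<Sum>l=1..N. discrepancy (\<sigma> i) (\<sigma> l))"
    using N by (simp add: add_divide_distrib)
  finally show ?thesis .
qed

lemma grid_energy_le: 
  assumes N: "N \<ge> 1"
  shows "grid_energy N \<sigma> / real N \<le> real N * (R\<^sup>2 * b)"
proof -
  have "grid_energy N \<sigma> \<le> (\<Sum>i=1..N. \<Sum>l=1..N. R * R * b)"
    unfolding grid_energy_def
    by (intro sum_mono mult_mono r_le_R c_le mult_nonneg_nonneg R_nonneg r_nonneg c_nonneg)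
  also have "\<dots> = real N * real N * (R\<^sup>2 * b)" by (simp add: power2_eq_square)
  finally have "grid_energy N \<sigma> / real N \<le> real N * real N * (R\<^sup>2 * b) / real N" by (rule divide_right_mono) simp
  then show ?thesis using N by simp
qed

text \<open>The discrepancy contributes more than \<open>\<delta> N\<close> to the exponent only with a probability that is
  exponentially small at any prescribed rate, which beats the trivial bound \<open>R\<^sup>2 b N\<close>.\<close>

lemma Z_le:
  assumes V: "\<And>\<nu>. \<nu> \<in> admissible \<Longrightarrow> rate_value \<alpha> P U \<nu> \<le> ereal V" and V0: "0 \<le> V" and \<delta>: "0 < \<delta>"
    and B1: "\<And>N. N \<ge> 1 \<Longrightarrow> (\<Sum>i=1..N. w i) / real N \<le> B1"
    and \<theta>: "0 < \<theta>" and t_def: "t = (1 + (R\<^sup>2 * b + 1) / \<delta>) * R\<^sup>2" and \<theta>t: "\<theta> * (1 + 2 * t) * exp (2 * t * b) \<le> 1"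
    and small: "(\<integral>z. \<bar>G (fst z) (snd z) - c (a (fst z)) (a (snd z))\<bar> \<partial>(\<alpha> \<Otimes>\<^sub>M \<alpha>)) \<le> \<theta>\<^sup>2"
    and N: "N \<ge> 1"
  shows "Z N \<le> exp (real N * (2 * b * B1 * \<eta> + \<delta> + V + type_error N)) * (1 + exp (2 * t * b)) * real (N + 1) ^ (K * A)"
proof -
  let ?PM = "\<Pi>\<^sub>M i\<in>{1..N}. \<alpha>"
  interpret aa: pair_prob_space \<alpha> \<alpha> ..
  define \<zeta> where "\<zeta> = 2 * b * B1 * \<eta>"
  \<comment> \<open>The slope of an exponential Chebyshev bound:
    \<open>\<Lambda> * \<delta> * N\<close> exceeds the trivial bound
    \<open>R\<^sup>2 * b * N\<close> by \<open>N\<close>. As the discrepancy term \<open>y\<close>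
    also stands in the exponent itself, its total coefficient is \<open>1 + \<Lambda>\<close>, which
    is the origin of \<open>t\<close>.\<close>
  define \<Lambda> where "\<Lambda> = (R\<^sup>2 * b + 1) / \<delta>"
  have \<Lambda>0: "0 \<le> \<Lambda>" unfolding \<Lambda>_def using b_nonneg \<delta> by simp
  have t0: "0 \<le> t" unfolding t_def \<Lambda>_def[symmetric] using \<Lambda>0 by simp
  have s2: "sets (\<alpha> \<Otimes>\<^sub>M \<alpha>) = sets (borel \<Otimes>\<^sub>M borel)" by (rule sets_pair_measure_cong[OF sets_alpha sets_alpha])
  have Gm: "(\<lambda>z. G (fst z) (snd z)) \<in> borel_measurable (\<alpha> \<Otimes>\<^sub>M \<alpha>)"
    using G_meas unfolding case_prod_beta' measurable_cong_sets[OF s2 refl] .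
  have am: "a \<in> \<alpha> \<rightarrow>\<^sub>M count_space UNIV" unfolding measurable_cong_sets[OF sets_alpha refl] by (rule a_meas)
  have cm: "(\<lambda>z. c (a (fst z)) (a (snd z))) \<in> borel_measurable (\<alpha> \<Otimes>\<^sub>M \<alpha>)"
    by (rule measurable_grid[OF measurable_compose[OF measurable_fst am] measurable_compose[OF measurable_snd am]])
  have Dm': "(\<lambda>z. discrepancy (fst z) (snd z)) \<in> borel_measurable (\<alpha> \<Otimes>\<^sub>M \<alpha>)"
    unfolding discrepancy_def by (intro borel_measurable_abs borel_measurable_diff Gm cm)
  then have Dm: "(\<lambda>(x, y). discrepancy x y) \<in> borel_measurable (\<alpha> \<Otimes>\<^sub>M \<alpha>)" by (simp only: case_prod_beta')
  have Di: "integrable (\<alpha> \<Otimes>\<^sub>M \<alpha>) (\<lambda>(x, y). discrepancy x y)"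
  proof (rule aa.P.integrable_const_bound[where B=b])
    show "AE z in \<alpha> \<Otimes>\<^sub>M \<alpha>. norm (case z of (x, y) \<Rightarrow> discrepancy x y) \<le> b"
      by (intro AE_I2) (simp only: case_prod_beta' real_norm_def abs_of_nonneg discrepancy_bounds)
  qed (rule Dm)
  have sm: "(\<integral>y. (\<integral>x. discrepancy x y \<partial>\<alpha>) \<partial>\<alpha>) \<le> \<theta>\<^sup>2"
    unfolding aa.integral_snd[OF Di] using small by (simp only: case_prod_beta' discrepancy_def)
  define Y where "Y \<sigma> = (\<Sum>i=1..N. \<Sum>l=1..N. discrepancy (\<sigma> i) (\<sigma> l))" for \<sigma> :: "nat \<Rightarrow> 'a"
  define X where "X \<sigma> = grid_energy N \<sigma> / real N" for \<sigma>
  define E0 where "E0 = exp (real N * \<zeta>) * exp (real N * \<delta>)"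
  define E1 where "E1 = exp (real N * \<zeta>) * exp (real N * (R\<^sup>2 * b) - \<Lambda> * (\<delta> * real N))"
  \<comment> \<open>If \<open>y \<le> \<delta> N\<close>, the discrepancy is absorbed into
    \<open>E0\<close>. Otherwise the factor \<open>exp (\<Lambda> * (y - \<delta> * N))\<close> is
    at least 1 and may be inserted, while the grid energy is bounded trivially.\<close>
  have pw: "exp (hamiltonian N \<sigma>) \<le> E0 * exp (X \<sigma>) + E1 * exp (t / real N * Y \<sigma>)" for \<sigma>
  proof -
    define y where "y = R\<^sup>2 / real N * Y \<sigma>"
    have ty: "t / real N * Y \<sigma> = (1 + \<Lambda>) * y" by (simp add: t_def \<Lambda>_def y_def)
    have "hamiltonian N \<sigma> \<le> real N * \<zeta> + X \<sigma> + y"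
      unfolding y_def Y_def X_def \<zeta>_def by (rule hamiltonian_le[OF N B1[OF N]])
    then have le: "exp (hamiltonian N \<sigma>) \<le> exp (real N * \<zeta> + X \<sigma> + y)" by simp
    show ?thesis
    proof (cases "y \<le> \<delta> * real N")
      case True
      then have "exp (real N * \<zeta> + X \<sigma> + y) \<le> exp (real N * \<zeta> + real N * \<delta> + X \<sigma>)" by (simp add: mult.commute)
      also have "\<dots> = E0 * exp (X \<sigma>)" by (simp only: E0_def exp_add)
      finally have "exp (hamiltonian N \<sigma>) \<le> E0 * exp (X \<sigma>)" using le by linarith
      moreover have "0 \<le> E1 * exp (t / real N * Y \<sigma>)" by (simp add: E1_def)
      ultimately show ?thesis by linarith
    next
      case False
      then have "0 \<le> \<Lambda> * (y - \<delta> * real N)" using \<Lambda>0 by simp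
      moreover have "X \<sigma> \<le> real N * (R\<^sup>2 * b)" unfolding X_def by (rule grid_energy_le[OF N])
      moreover have "\<Lambda> * (y - \<delta> * real N) + y = (1 + \<Lambda>) * y - \<Lambda> * (\<delta> * real N)" by (simp add: algebra_simps)
      ultimately have "exp (real N * \<zeta> + X \<sigma> + y) \<le> exp (real N * \<zeta> + (real N * (R\<^sup>2 * b) - \<Lambda> * (\<delta> * real N)) + (1 + \<Lambda>) * y)"
        by simp
      also have "\<dots> = E1 * exp (t / real N * Y \<sigma>)" by (simp only: E1_def ty exp_add)
      finally have "exp (hamiltonian N \<sigma>) \<le> E1 * exp (t / real N * Y \<sigma>)" using le by linarith
      moreover have "0 \<le> E0 * exp (X \<sigma>)" by (simp add: E0_def)
      ultimately show ?thesis by linarith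
    qed
  qed
  have comp: "(\<lambda>\<sigma>. \<sigma> i) \<in> ?PM \<rightarrow>\<^sub>M \<alpha>" if "i \<in> {1..N}" for i
    by (rule measurable_component_singleton[where M="\<lambda>_. \<alpha>", OF that])
  have Ym: "Y \<in> borel_measurable ?PM"
    unfolding Y_def[abs_def]
  proof (intro borel_measurable_sum)
    fix i l assume il: "i \<in> {1..N}" "l \<in> {1..N}"
    from measurable_compose[OF measurable_Pair[OF comp[OF il(1)] comp[OF il(2)]] Dm']
    show "(\<lambda>\<sigma>. discrepancy (\<sigma> i) (\<sigma> l)) \<in> borel_measurable ?PM" by (simp only: fst_conv snd_conv)
  qed
  have Xm: "X \<in> borel_measurable ?PM"
    unfolding X_def[abs_def] grid_energy_def
  proof (intro borel_measurable_divide borel_measurable_sum borel_measurable_const)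
    fix i l assume il: "i \<in> {1..N}" "l \<in> {1..N}"
    from measurable_compose[OF measurable_Pair[OF comp[OF il(1)] comp[OF il(2)]] cm]
    have "(\<lambda>\<sigma>. c (a (\<sigma> i)) (a (\<sigma> l))) \<in> borel_measurable ?PM" by (simp only: fst_conv snd_conv)
    then show "(\<lambda>\<sigma>. r (k (w i)) * r (k (w l)) * c (a (\<sigma> i)) (a (\<sigma> l))) \<in> borel_measurable ?PM"
      by (rule borel_measurable_times[OF borel_measurable_const])
  qed
  have eXm: "(\<lambda>\<sigma>. ennreal (exp (X \<sigma>))) \<in> borel_measurable ?PM"
    by (rule measurable_compose[OF measurable_compose[OF Xm borel_measurable_exp] measurable_ennreal])
  have eYm: "(\<lambda>\<sigma>. ennreal (exp (t / real N * Y \<sigma>))) \<in> borel_measurable ?PM"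
    by (rule measurable_compose[OF measurable_compose[OF borel_measurable_times[OF borel_measurable_const Ym] borel_measurable_exp] measurable_ennreal])
  define B where "B = exp (real N * (V + type_error N)) * real (N + 1) ^ (K * A)"
  define B' where "B' = exp (2 * t * b) * exp (real N * \<theta> * (1 + 2 * t) * exp (2 * t * b))"
  have IX: "(\<integral>\<^sup>+\<sigma>. exp (X \<sigma>) \<partial>?PM) \<le> ennreal B"
    unfolding X_def B_def by (rule nn_integral_grid_energy[OF N type_rate_le[OF V]])
  have IY: "(\<integral>\<^sup>+\<sigma>. exp (t / real N * Y \<sigma>) \<partial>?PM) \<le> ennreal B'"
    unfolding Y_def B'_def by (rule alpha.exp_pair_sum_bound[OF Dm discrepancy_bounds sm \<theta> t0 N])
  have nn: "0 \<le> E0" "0 \<le> E1" "0 \<le> B" "0 \<le> B'" unfolding E0_def E1_def B_def B'_def by simp_all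
  have "(\<integral>\<^sup>+\<sigma>. exp (hamiltonian N \<sigma>) \<partial>?PM) \<le> (\<integral>\<^sup>+\<sigma>. ennreal E0 * ennreal (exp (X \<sigma>)) + ennreal E1 * ennreal (exp (t / real N * Y \<sigma>)) \<partial>?PM)"
  proof (rule nn_integral_mono)
    fix \<sigma>
    have "ennreal (exp (hamiltonian N \<sigma>)) \<le> ennreal (E0 * exp (X \<sigma>) + E1 * exp (t / real N * Y \<sigma>))"
      by (rule ennreal_leI[OF pw])
    also have "\<dots> = ennreal E0 * ennreal (exp (X \<sigma>)) + ennreal E1 * ennreal (exp (t / real N * Y \<sigma>))"
      using nn by (subst ennreal_plus) (auto simp: ennreal_mult)
    finally show "ennreal (exp (hamiltonian N \<sigma>)) \<le> ennreal E0 * ennreal (exp (X \<sigma>)) + ennreal E1 * ennreal (exp (t / real N * Y \<sigma>))" .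
  qed
  also have "\<dots> = ennreal E0 * (\<integral>\<^sup>+\<sigma>. exp (X \<sigma>) \<partial>?PM) + ennreal E1 * (\<integral>\<^sup>+\<sigma>. exp (t / real N * Y \<sigma>) \<partial>?PM)"
    unfolding nn_integral_cmult[OF eXm, symmetric] nn_integral_cmult[OF eYm, symmetric]
    by (intro nn_integral_add borel_measurable_times_ennreal borel_measurable_const eXm eYm)
  also have "\<dots> \<le> ennreal E0 * ennreal B + ennreal E1 * ennreal B'"
    by (intro add_mono mult_left_mono IX IY) simp_all
  also have "\<dots> = ennreal (E0 * B + E1 * B')"
    using nn by (simp add: ennreal_mult)
  finally have "(\<integral>\<sigma>. exp (hamiltonian N \<sigma>) \<partial>?PM) \<le> E0 * B + E1 * B'"
    using nn by (intro integral_real_bounded) simp_all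
  then have Z: "Z N \<le> E0 * B + E1 * B'" unfolding Z_eq[OF N] .
  have T: "exp (real N * (\<zeta> + \<delta> + V + type_error N)) = E0 * exp (real N * (V + type_error N))"
    by (simp add: E0_def distrib_left flip: exp_add)
  have pow1: "1 \<le> real (N + 1) ^ (K * A)" by (intro one_le_power) simp
  \<comment> \<open>The factor \<open>exp (- N)\<close> gained in \<open>E1\<close> cancels the
    growth allowed in \<open>B'\<close>, because \<open>\<theta>\<close> was chosen so that this
    growth is at most \<open>exp N\<close>.\<close>
  have "E1 * B' \<le> exp (real N * \<zeta>) * exp (2 * t * b)"
  proof -
    have "real N * \<theta> * (1 + 2 * t) * exp (2 * t * b) = real N * (\<theta> * (1 + 2 * t) * exp (2 * t * b))" by (simp only: mult_ac)
    also have "\<dots> \<le> real N * 1" by (rule mult_left_mono[OF \<theta>t]) simp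
    finally have *: "real N * \<theta> * (1 + 2 * t) * exp (2 * t * b) \<le> real N" by simp
    have "\<Lambda> * (\<delta> * real N) = (R\<^sup>2 * b + 1) * real N" using \<delta> by (simp add: \<Lambda>_def)
    then have eq: "real N * (R\<^sup>2 * b) - \<Lambda> * (\<delta> * real N) = - real N" by (simp add: algebra_simps)
    define q where "q = real N * \<theta> * (1 + 2 * t) * exp (2 * t * b)"
    have d: "exp (q - real N) = exp q * exp (- real N)" by (simp add: exp_diff exp_minus divide_inverse)
    have "E1 * B' = exp (real N * \<zeta>) * exp (2 * t * b) * exp (q - real N)"
      unfolding E1_def eq B'_def q_def[symmetric] d by (simp only: mult_ac)
    also have "\<dots> \<le> exp (real N * \<zeta>) * exp (2 * t * b) * 1"
      using * unfolding q_def by (intro mult_left_mono) simp_all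
    finally show ?thesis by simp
  qed
  also have "\<dots> \<le> exp (real N * (\<zeta> + \<delta> + V + type_error N)) * exp (2 * t * b)"
  proof (rule mult_right_mono)
    \<comment> \<open>Here \<open>V \<ge> 0\<close> enters: the exceptional configurations grow at
      rate \<open>\<zeta>\<close> only, which must not exceed the main rate.\<close>
    have "real N * \<zeta> \<le> real N * (\<zeta> + \<delta> + V + type_error N)"
      using \<delta> V0 type_error_nonneg[of N] by (intro mult_left_mono) auto
    then show "exp (real N * \<zeta>) \<le> exp (real N * (\<zeta> + \<delta> + V + type_error N))" by simp
  qed simp
  also have "\<dots> \<le> exp (real N * (\<zeta> + \<delta> + V + type_error N)) * exp (2 * t * b) * real (N + 1) ^ (K * A)"
    using mult_left_mono[OF pow1, of "exp (real N * (\<zeta> + \<delta> + V + type_error N)) * exp (2 * t * b)"] by simp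
  finally have "E0 * B + E1 * B' \<le> exp (real N * (\<zeta> + \<delta> + V + type_error N)) * real (N + 1) ^ (K * A)
      + exp (real N * (\<zeta> + \<delta> + V + type_error N)) * exp (2 * t * b) * real (N + 1) ^ (K * A)"
    unfolding B_def T by simp
  then show ?thesis using Z unfolding \<zeta>_def by (simp add: algebra_simps)
qed

lemma upper_bound_grid:
  assumes V: "\<And>\<nu>. \<nu> \<in> admissible \<Longrightarrow> rate_value \<alpha> P U \<nu> \<le> ereal V" and V0: "0 \<le> V" and \<delta>: "0 < \<delta>"
    and B1: "\<And>N. N \<ge> 1 \<Longrightarrow> (\<Sum>i=1..N. w i) / real N \<le> B1"
    and \<theta>: "0 < \<theta>" and t_def: "t = (1 + (R\<^sup>2 * b + 1) / \<delta>) * R\<^sup>2" and \<theta>t: "\<theta> * (1 + 2 * t) * exp (2 * t * b) \<le> 1"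
    and small: "(\<integral>z. \<bar>G (fst z) (snd z) - c (a (fst z)) (a (snd z))\<bar> \<partial>(\<alpha> \<Otimes>\<^sub>M \<alpha>)) \<le> \<theta>\<^sup>2"
  shows "\<forall>\<^sub>F N in sequentially. ln (Z N) / real N \<le> V + 2 * b * B1 * \<eta> + 2 * \<delta>"
proof -
  \<comment> \<open>All terms of \<open>Z_le\<close> that vanish after division by \<open>N\<close>,
    with \<open>ln (N + 1) \<le> ln 2 + ln N\<close>. Their smallness accounts for the second
    \<open>\<delta>\<close> in the claim, the first being already in the exponent.\<close>
  define S where "S N = type_error N + (ln (1 + exp (2 * t * b)) + real (K * A) * ln 2) * (1 / real N)
      + real (K * A) * (ln (real N) / real N)" for N
  have "S \<longlonglongrightarrow> 0 + (ln (1 + exp (2 * t * b)) + real (K * A) * ln 2) * 0 + real (K * A) * 0"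
    unfolding S_def[abs_def] by (intro tendsto_intros type_error_tendsto lim_1_over_n lim_ln_over_n)
  then have "\<forall>\<^sub>F N in sequentially. S N < \<delta>" using \<delta> by (intro order_tendstoD(2)) auto
  with eventually_ge_at_top[of 1] show ?thesis
  proof eventually_elim
    case (elim N)
    note N = elim(1)
    define C where "C = 1 + exp (2 * t * b)"
    have C: "0 < C" unfolding C_def by (simp add: add_pos_pos)
    define x where "x = 2 * b * B1 * \<eta> + \<delta> + V + type_error N"
    have "ln (Z N) \<le> ln (exp (real N * x) * C * real (N + 1) ^ (K * A))"
      using Z_le[OF assms N] Z_ge_1[OF N] unfolding x_def C_def by (intro ln_mono) linarith+
    also have "\<dots> = real N * x + ln C + real (K * A) * ln (real (N + 1))"
      using C by (simp add: ln_mult ln_realpow)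
    also have "\<dots> \<le> real N * x + ln C + real (K * A) * (ln 2 + ln (real N))"
    proof -
      have "ln (real (N + 1)) \<le> ln (2 * real N)" using N by (intro ln_mono) auto
      also have "\<dots> = ln 2 + ln (real N)" using N by (intro ln_mult_pos) auto
      finally have "real (K * A) * ln (real (N + 1)) \<le> real (K * A) * (ln 2 + ln (real N))" by (rule mult_left_mono) simp
      then show ?thesis by linarith
    qed
    finally have "ln (Z N) / real N \<le> (real N * x + ln C + real (K * A) * (ln 2 + ln (real N))) / real N"
      by (rule divide_right_mono) simp
    also have "\<dots> = x - type_error N + S N"
      using N by (simp add: S_def C_def field_simps)
    finally show ?case using elim(2) unfolding x_def by linarith
  qed
qed

end

section \<open>Finiteness of the supremum and convergence\<close>

context spin_system
begin

lemma rate_value_bound: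
  assumes \<nu>: "\<nu> \<in> admissible"
  shows "rate_value \<alpha> P U \<nu> \<le> ereal (b * mean\<^sup>2)"
proof -
  \<comment> \<open>Rounding every weight to zero satisfies the hypotheses with error
    \<open>mean\<close>; the energy bound itself does not involve the rounding.\<close>
  have "energy \<nu> (\<lambda>x. x) \<le> b * mean\<^sup>2"
    by (rule energy_id_bound[OF \<nu>, where \<rho>="\<lambda>_. 0" and \<eta>=mean]) (simp_all add: mean_def)
  then have "ereal (energy \<nu> (\<lambda>x. x)) - enn2ereal (entropy \<nu>) \<le> ereal (b * mean\<^sup>2) - 0"
    by (intro ereal_minus_mono) simp_all
  then show ?thesis unfolding rate_value_eq by simp
qed

text \<open>The product measure \<open>\<alpha> \<Otimes> P\<close> has entropy zero and nonnegative
  energy, so the supremum is at least zero; the energy bound keeps it finite. The rounding accuracy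
  1 is arbitrary and only makes \<open>tilted\<close> available.\<close>

lemma rate_value_sup:
  obtains V where "(SUP \<nu>\<in>admissible. rate_value \<alpha> P U \<nu>) = ereal V" "0 \<le> V"
proof -
  have ub: "(SUP \<nu>\<in>admissible. rate_value \<alpha> P U \<nu>) \<le> ereal (b * mean\<^sup>2)"
    by (intro SUP_least rate_value_bound)
  obtain k :: "real \<Rightarrow> nat" and r :: "nat \<Rightarrow> real" and K :: nat where bins: "k \<in> borel \<rightarrow>\<^sub>M count_space UNIV" "\<And>x. k x < K" "\<And>j. 0 \<le> r j" "\<And>x. x > 0 \<Longrightarrow> r (k x) \<le> x"
    "(\<integral>x. x - r (k x) \<partial>P) \<le> 1"
    "\<And>N. N \<ge> 1 \<Longrightarrow> (\<Sum>i=1..N. w i - r (k (w i))) / real N \<le> 1"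
    "\<And>j. (\<lambda>N. (\<Sum>i=1..N. indicator {j} (k (w i))) / real N :: real) \<longlonglongrightarrow> measure P {x \<in> space P. k x = j}"
    by (rule weight_bins[OF zero_less_one]) (rule that; assumption)
  interpret binned_system w P \<alpha> G b k r K 1
    by (intro binned_system.intro spin_system_axioms binned_system_axioms.intro bins)
  have h: "trial (\<lambda>_ _. 1)" unfolding trial_def using alpha.prob_space by auto
  have "0 \<le> (\<Sum>j<K. \<Sum>l<K. r j * r l * coupling (\<lambda>_ _. 1) j l * p j * p l)"
    by (intro sum_nonneg mult_nonneg_nonneg r_nonneg p_nonneg coupling_bounds(1)[OF h])
  moreover have "ent (\<lambda>_. 1) = 0" unfolding ent_def by simp
  ultimately have "ereal 0 \<le> rate_value \<alpha> P U (tilted (\<lambda>_ _. 1))"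
    using order_trans[OF _ rate_value_tilted[OF h], of "ereal 0"] by simp
  also have "\<dots> \<le> (SUP \<nu>\<in>admissible. rate_value \<alpha> P U \<nu>)"
    by (rule SUP_upper[OF tilted_admissible[OF h]])
  finally have lb: "ereal 0 \<le> (SUP \<nu>\<in>admissible. rate_value \<alpha> P U \<nu>)" .
  show thesis
  proof (cases "SUP \<nu>\<in>admissible. rate_value \<alpha> P U \<nu>")
    case (real V)
    then show thesis using that[of V] lb by simp
  qed (use ub lb in auto)
qed

lemma eventually_ge:
  assumes \<nu>: "\<nu> \<in> admissible" and fin: "entropy \<nu> < \<infinity>" and e: "0 < e"
  shows "\<forall>\<^sub>F N in sequentially. energy \<nu> (\<lambda>x. x) - enn2real (entropy \<nu>) - e \<le> ln (Z N) / real N"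
proof -
  \<comment> \<open>Each parameter spends half of \<open>e\<close>. The added 1 keeps the
    denominators positive, and for \<open>\<delta>\<close> it also pays for the separate summand
    \<open>\<delta>\<close>.\<close>
  define \<eta> where "\<eta> = e / (2 * (2 * b * mean + 1))"
  define \<delta> where "\<delta> = e / (2 * (2 * b * mean\<^sup>2 + 1))"
  have p1: "0 < 2 * b * mean + 1" using mult_nonneg_nonneg[OF b_nonneg mean_nonneg] by linarith
  have p2: "0 < 2 * b * mean\<^sup>2 + 1" using mult_nonneg_nonneg[OF b_nonneg zero_le_power2[of mean]] by linarith
  have \<eta>: "0 < \<eta>" and \<delta>: "0 < \<delta>" unfolding \<eta>_def \<delta>_def using e p1 p2 by simp_all
  have half: "x * (e / (2 * x)) = e / 2" if "0 < x" for x :: real using that by simp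
  have "(2 * b * mean + 1) * \<eta> = e / 2" "(2 * b * mean\<^sup>2 + 1) * \<delta> = e / 2"
    unfolding \<eta>_def \<delta>_def by (rule half[OF p1], rule half[OF p2])
  then have le: "2 * b * mean * \<eta> + 2 * b * mean\<^sup>2 * \<delta> + \<delta> \<le> e"
    using \<eta> by (simp add: distrib_right)
  obtain k :: "real \<Rightarrow> nat" and r :: "nat \<Rightarrow> real" and K :: nat where bins: "k \<in> borel \<rightarrow>\<^sub>M count_space UNIV" "\<And>x. k x < K" "\<And>j. 0 \<le> r j" "\<And>x. x > 0 \<Longrightarrow> r (k x) \<le> x"
    "(\<integral>x. x - r (k x) \<partial>P) \<le> \<eta>"
    "\<And>N. N \<ge> 1 \<Longrightarrow> (\<Sum>i=1..N. w i - r (k (w i))) / real N \<le> \<eta>"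
    "\<And>j. (\<lambda>N. (\<Sum>i=1..N. indicator {j} (k (w i))) / real N :: real) \<longlonglongrightarrow> measure P {x \<in> space P. k x = j}"
    by (rule weight_bins[OF \<eta>]) (rule that; assumption)
  interpret binned_system w P \<alpha> G b k r K \<eta>
    by (intro binned_system.intro spin_system_axioms binned_system_axioms.intro bins)
  from lower_bound_binned[OF \<nu> fin \<delta>] show ?thesis
    by eventually_elim (use le in linarith)
qed

lemma eventually_le:
  assumes V: "\<And>\<nu>. \<nu> \<in> admissible \<Longrightarrow> rate_value \<alpha> P U \<nu> \<le> ereal V" and V0: "0 \<le> V" and e: "0 < e"
  shows "\<forall>\<^sub>F N in sequentially. ln (Z N) / real N \<le> V + e"
proof -
  obtain B where B: "\<And>N. N \<ge> 1 \<Longrightarrow> (\<Sum>i=1..N. w i) / real N \<le> B" by (rule uniform_tails) blast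
  define B1 where "B1 = max B 0"
  have B1: "(\<Sum>i=1..N. w i) / real N \<le> B1" if "N \<ge> 1" for N using B[OF that] by (simp add: B1_def)
  have B10: "0 \<le> B1" by (simp add: B1_def)
  define \<eta> where "\<eta> = e / (2 * (2 * b * B1 + 1))"
  have p1: "0 < 2 * b * B1 + 1" using mult_nonneg_nonneg[OF b_nonneg B10] by linarith
  have \<eta>: "0 < \<eta>" unfolding \<eta>_def using e p1 by simp
  have half: "x * (e / (2 * x)) = e / 2" if "0 < x" for x :: real using that by simp
  have "(2 * b * B1 + 1) * \<eta> = e / 2" unfolding \<eta>_def by (rule half[OF p1])
  then have le: "2 * b * B1 * \<eta> + 2 * (e / 4) \<le> e" using \<eta> by (simp add: distrib_right)
  have \<delta>: "0 < e / 4" using e by simp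
  obtain k :: "real \<Rightarrow> nat" and r :: "nat \<Rightarrow> real" and K :: nat where bins: "k \<in> borel \<rightarrow>\<^sub>M count_space UNIV" "\<And>x. k x < K" "\<And>j. 0 \<le> r j" "\<And>x. x > 0 \<Longrightarrow> r (k x) \<le> x"
    "(\<integral>x. x - r (k x) \<partial>P) \<le> \<eta>"
    "\<And>N. N \<ge> 1 \<Longrightarrow> (\<Sum>i=1..N. w i - r (k (w i))) / real N \<le> \<eta>"
    "\<And>j. (\<lambda>N. (\<Sum>i=1..N. indicator {j} (k (w i))) / real N :: real) \<longlonglongrightarrow> measure P {x \<in> space P. k x = j}"
    by (rule weight_bins[OF \<eta>]) (rule that; assumption)
  interpret bs: binned_system w P \<alpha> G b k r K \<eta>
    by (intro binned_system.intro spin_system_axioms binned_system_axioms.intro bins)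
  \<comment> \<open>The order of choices matters: \<open>e\<close> fixes \<open>\<eta>\<close> and
    \<open>\<delta> = e / 4\<close>, the bins then fix \<open>R\<close> and thereby \<open>t\<close>
    and \<open>\<theta>\<close>, and only afterwards is the grid chosen, with mean error at most
    \<open>\<theta>\<^sup>2\<close>. The number of cells affects only the polynomial prefactor and
    errors that vanish as \<open>N\<close> grows.\<close>
  define t where "t = (1 + (bs.R\<^sup>2 * b + 1) / (e / 4)) * bs.R\<^sup>2"
  have t0: "0 \<le> t" unfolding t_def using b_nonneg e by (intro mult_nonneg_nonneg add_nonneg_nonneg divide_nonneg_nonneg) auto
  define \<theta> where "\<theta> = 1 / ((1 + 2 * t) * exp (2 * t * b))"
  have \<theta>: "0 < \<theta>" unfolding \<theta>_def using t0 by (intro divide_pos_pos mult_pos_pos) auto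
  have \<theta>t: "\<theta> * (1 + 2 * t) * exp (2 * t * b) \<le> 1" unfolding \<theta>_def using t0 by simp
  have s2: "sets (\<alpha> \<Otimes>\<^sub>M \<alpha>) = sets (borel \<Otimes>\<^sub>M borel)" by (rule sets_pair_measure_cong[OF sets_alpha sets_alpha])
  have Gm: "(\<lambda>(x, y). G x y) \<in> borel_measurable (\<alpha> \<Otimes>\<^sub>M \<alpha>)"
    using G_meas unfolding measurable_cong_sets[OF s2 refl] .
  obtain a :: "'a \<Rightarrow> nat" and A :: nat and c :: "nat \<Rightarrow> nat \<Rightarrow> real" where grid: "a \<in> \<alpha> \<rightarrow>\<^sub>M count_space UNIV" "\<And>x. a x < A" "\<And>x. 0 < measure \<alpha> {y \<in> space \<alpha>. a y = a x}"
    "\<And>s t. (\<integral>z. G (fst z) (snd z) * indicator {s} (a (fst z)) * indicator {t} (a (snd z)) \<partial>(\<alpha> \<Otimes>\<^sub>M \<alpha>))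
        = c s t * measure \<alpha> {y \<in> space \<alpha>. a y = s} * measure \<alpha> {y \<in> space \<alpha>. a y = t}"
    "\<And>s t. 0 \<le> c s t" "\<And>s t. c s t \<le> b"
    "(\<integral>z. \<bar>G (fst z) (snd z) - c (a (fst z)) (a (snd z))\<bar> \<partial>(\<alpha> \<Otimes>\<^sub>M \<alpha>)) \<le> \<theta>\<^sup>2"
    by (rule alpha.grid_conditional_expectation[OF Gm G_nonneg G_le zero_less_power[OF \<theta>, of 2]]) (rule that; assumption)
  have am: "a \<in> borel \<rightarrow>\<^sub>M count_space UNIV"
    using grid(1) unfolding measurable_cong_sets[OF sets_alpha refl] .
  interpret gs: grid_system w P \<alpha> G b k r K \<eta> a A c
    by (intro grid_system.intro bs.binned_system_axioms grid_system_axioms.intro am grid(2-6))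
  have "\<forall>\<^sub>F N in sequentially. ln (Z N) / real N \<le> V + 2 * b * B1 * \<eta> + 2 * (e / 4)"
    by (rule gs.upper_bound_grid[OF V V0 \<delta> B1 \<theta> t_def \<theta>t grid(7)])
  then show ?thesis
    by eventually_elim (use le in linarith)
qed

theorem free_energy:
  "(\<lambda>N. ereal (1 / real N * ln (Z N))) \<longlonglongrightarrow> (SUP \<nu>\<in>admissible. rate_value \<alpha> P U \<nu>)"
  "(SUP \<nu>\<in>admissible. rate_value \<alpha> P U \<nu>) < \<infinity>"
proof -
  obtain V where V: "(SUP \<nu>\<in>admissible. rate_value \<alpha> P U \<nu>) = ereal V" "0 \<le> V" by (rule rate_value_sup)
  have VU: "rate_value \<alpha> P U \<nu> \<le> ereal V" if "\<nu> \<in> admissible" for \<nu>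
    unfolding V(1)[symmetric] by (rule SUP_upper[OF that])
  show "(SUP \<nu>\<in>admissible. rate_value \<alpha> P U \<nu>) < \<infinity>" unfolding V(1) by simp
  have "(\<lambda>N. ln (Z N) / real N) \<longlonglongrightarrow> V"
  proof (rule tendstoI)
    fix e :: real assume e: "0 < e"
    have "ereal (V - e / 4) < (SUP \<nu>\<in>admissible. rate_value \<alpha> P U \<nu>)" unfolding V(1) using e by simp
    then obtain \<nu> where \<nu>: "\<nu> \<in> admissible" and gt: "ereal (V - e / 4) < rate_value \<alpha> P U \<nu>"
      unfolding less_SUP_iff by blast
    \<comment> \<open>An infinite entropy would give the value minus infinity, which is not above a
      real number.\<close>
    have fin: "entropy \<nu> < \<infinity>"
    proof (rule ccontr)
      assume "\<not> ?thesis"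
      then have "entropy \<nu> = \<infinity>" using top.not_eq_extremum[of "entropy \<nu>"] by auto
      then show False using gt unfolding rate_value_eq by simp
    qed
    then have "enn2ereal (entropy \<nu>) = ereal (enn2real (entropy \<nu>))"
      by (cases "entropy \<nu>") (auto simp: enn2ereal_ennreal)
    then have "V - e / 4 < energy \<nu> (\<lambda>x. x) - enn2real (entropy \<nu>)"
      using gt unfolding rate_value_eq by simp
    moreover have "\<forall>\<^sub>F N in sequentially. energy \<nu> (\<lambda>x. x) - enn2real (entropy \<nu>) - e / 4 \<le> ln (Z N) / real N"
      using e by (intro eventually_ge[OF \<nu> fin]) simp
    moreover have "\<forall>\<^sub>F N in sequentially. ln (Z N) / real N \<le> V + e / 4"
      using e by (intro eventually_le[OF VU V(2)]) simp_all
    ultimately show "\<forall>\<^sub>F N in sequentially. dist (ln (Z N) / real N) V < e"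
    proof -
      assume a: "V - e / 4 < energy \<nu> (\<lambda>x. x) - enn2real (entropy \<nu>)"
        "\<forall>\<^sub>F N in sequentially. energy \<nu> (\<lambda>x. x) - enn2real (entropy \<nu>) - e / 4 \<le> ln (Z N) / real N"
        "\<forall>\<^sub>F N in sequentially. ln (Z N) / real N \<le> V + e / 4"
      from a(2,3) show ?thesis
      proof eventually_elim
        case (elim N)
        then show ?case using a(1) e unfolding dist_real_def by linarith
      qed
    qed
  qed
  then show "(\<lambda>N. ereal (1 / real N * ln (Z N))) \<longlonglongrightarrow> (SUP \<nu>\<in>admissible. rate_value \<alpha> P U \<nu>)"
    unfolding V(1) by simp
qed

end

theorem theorem3p3:
  fixes \<alpha> :: "'a::polish_space measure"
    and \<Phi> :: "'a \<Rightarrow> 'a \<Rightarrow> real"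
    and w :: "nat \<Rightarrow> real"
    and M :: "'b measure"
    and W :: "'b \<Rightarrow> real"
    and P :: "real measure"
    and U :: "'a \<Rightarrow> 'a \<Rightarrow> real \<Rightarrow> real \<Rightarrow> real"
  assumes E_compact: "compact (UNIV :: 'a set)"
    and alpha: "\<alpha> \<in> space (prob_algebra borel)"
    and Phi_measurable: "(\<lambda>(\<sigma>, \<sigma>'). \<Phi> \<sigma> \<sigma>') \<in> borel_measurable (borel \<Otimes>\<^sub>M borel)"
    and Phi_bounded: "bounded (range (\<lambda>(\<sigma>, \<sigma>'). \<Phi> \<sigma> \<sigma>'))"
    and w_pos: "\<And>i. i \<ge> 1 \<Longrightarrow> w i > 0"
    and M_prob: "prob_space M"
    and W_rv: "W \<in> M \<rightarrow>\<^sub>M weight_space"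
    and W_law: "P = distr M weight_space W"
    and w_conv: "weakly_converges_on {0<..} (\<lambda>N. empirical weight_space N w) P"
    and w_moment: "\<exists>\<epsilon>>0. bdd_above ((\<lambda>N::nat. (\<Sum>i=1..N. w i powr (1 + \<epsilon>)) / real N) ` {1..})"
    and U_def: "U = interaction \<Phi> (prob_space.expectation M W)"
  shows "((\<lambda>N. ereal (1 / real N *
            ln (\<integral>\<sigma>. exp (real N * pair_functional (empirical_pair N \<sigma> w) U)
                  \<partial>(\<Pi>\<^sub>M i\<in>{1..N}. \<alpha>))))
          \<longlonglongrightarrow> (SUP \<nu> \<in> {\<nu> \<in> space (prob_algebra (borel \<Otimes>\<^sub>M weight_space)). distr \<nu> weight_space snd = P}.
                  rate_value \<alpha> P U \<nu>))
       \<and> (SUP \<nu> \<in> {\<nu> \<in> space (prob_algebra (borel \<Otimes>\<^sub>M weight_space)). distr \<nu> weight_space snd = P}.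
            rate_value \<alpha> P U \<nu>) < \<infinity>"
proof -
  define m where "m = prob_space.expectation M W"
  \<comment> \<open>The normalising factor moves from the weights to the spin part, which turns
    \<open>U\<close> into the product form of the locale.\<close>
  define G where "G x y = exp (\<Phi> x y) / (2 * m)" for x y
  obtain C where C: "\<And>x y. \<bar>\<Phi> x y\<bar> \<le> C"
    using Phi_bounded unfolding bounded_iff by auto
  \<comment> \<open>Nonnegativity yields both bounds on \<open>G\<close>, also under the convention
    for division by zero.\<close>
  have m0: "0 \<le> m"
    unfolding m_def using measurable_space[OF W_rv] by (intro integral_nonneg_AE AE_I2) force
  interpret sys: spin_system w P \<alpha> G "exp C / (2 * m)"
  proof (intro spin_system.intro weight_sequence.intro spin_system_axioms.intro)
    show "0 < w i" if "1 \<le> i" for i by (rule w_pos[OF that])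
    show "prob_space P" unfolding W_law by (rule prob_space.prob_space_distr[OF M_prob W_rv])
    show "sets P = sets weight_space" unfolding W_law by simp
    show "weakly_converges_on {0<..} (\<lambda>N. empirical weight_space N w) P" by (rule w_conv)
    show "\<exists>\<epsilon>>0. bdd_above ((\<lambda>N::nat. (\<Sum>i=1..N. w i powr (1 + \<epsilon>)) / real N) ` {1..})" by (rule w_moment)
    show "prob_space \<alpha>" and "sets \<alpha> = sets borel" using alpha by (auto simp: space_prob_algebra)
    have "(\<lambda>z. \<Phi> (fst z) (snd z)) \<in> borel_measurable (borel \<Otimes>\<^sub>M borel)"
      using Phi_measurable by (simp add: case_prod_beta')
    then show "(\<lambda>(x, y). G x y) \<in> borel_measurable (borel \<Otimes>\<^sub>M borel)"
      unfolding G_def case_prod_beta'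
      by (intro borel_measurable_divide borel_measurable_const measurable_compose[OF _ borel_measurable_exp])
    show "0 \<le> G x y" for x y unfolding G_def using m0 by simp
    have "exp (\<Phi> x y) \<le> exp C" for x y using C[of x y] by simp
    then show "G x y \<le> exp C / (2 * m)" for x y unfolding G_def using m0 by (intro divide_right_mono) simp_all
  qed
  have "interaction \<Phi> m x y v v' = sys.U x y v v'" for x y v v'
    unfolding interaction_def sys.U_def G_def by simp
  then have U_eq: "U = sys.U" unfolding U_def m_def[symmetric] by (intro ext)
  show ?thesis
    using sys.free_energy unfolding sys.Z_def sys.admissible_def U_eq[symmetric] by blast
qed

end
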